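(* Let $\mathcal{P}$ be a circle closed path polyomino and let $\omega_{K[\mathcal{P}]}$ be the canonical module of $K[\mathcal{P}]$. Then $$\omega_{K[\mathcal{P}]}\cong \big(J(\mathcal{P})+K(\mathcal{P})\big)/J(\mathcal{P}),$$ where $J(\mathcal{P})$ and $K(\mathcal{P})$ are the binomial and the monomial ideal of $S_{\mathcal{P}}$ defined in the context.
   Context: Intervals and cells: for $a=(i,j)\le b=(k,l)$ in $\mathbb{Z}^2$ (componentwise order), $[a,b]=\{(p,q)\in\mathbb{Z}^2: i\le p\le k,\ j\le q\le l\}$; it is proper if $i<k$ and $j<l$. The diagonal corners of a proper interval are $a,b$ and its anti-diagonal corners are $(i,l)$, $(k,j)$. A cell is an interval $[a,a+(1,1)]$. For a proper interval $I$, $\mathcal{P}_I$ denotes the set of cells contained in $I$. For a finite set of cells $\mathcal{P}$, $V(\mathcal{P})$ is the set of all corners of its cells, and a proper interval is an inner interval of $\mathcal{P}$ if all cells contained in it belong to $\mathcal{P}$. Polyomino ideal: $K$ is a field and $S_{\mathcal{P}}=K[x_v: v\in V(\mathcal{P})]$. To an inner interval $[a,b]$ with anti-diagonal corners $c,d$ one attaches the inner $2$-minor $x_ax_b-x_cx_d$. $I_{\mathcal{P}}$ is the ideal generated by all inner $2$-minors of $\mathcal{P}$ and $K[\mathcal{P}]=S_{\mathcal{P}}/I_{\mathcal{P}}$ (a Cohen–Macaulay ring for the polyominoes considered here). Circle: let $m,n\ge 4$ with $(m,n)\ne(4,4)$, $I_1=[(1,1),(m,n)]$, $I_2=[(2,2),(m-1,n-1)]$.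 A circle closed path is $\mathcal{P}=\mathcal{P}_{I_1}\setminus\mathcal{P}_{I_2}$. The ideal $J(\mathcal{P})$: it is generated by the $|\mathcal{P}|$ inner $2$-minors attached to the following inner intervals: all cells of $\mathcal{P}$ except the four cells $[(2,1),(3,2)]$, $[(m-1,2),(m,3)]$, $[(m-2,n-1),(m-1,n)]$, $[(1,n-2),(2,n-1)]$, together with the four intervals $[(1,1),(3,2)]$, $[(m-1,1),(m,3)]$, $[(m-2,n-1),(m,n)]$, $[(1,n-2),(2,n)]$ (each consisting of two cells). The ideal $K(\mathcal{P})$: put $L_{j-2}=\{(1,j),(2,j)\}$ and $R_{j-2}=\{(m-1,j),(m,j)\}$ for $3\le j\le n-2$, and $U_{k-2}=\{(k,n),(k,n-1)\}$ and $D_{k-2}=\{(k,1),(k,2)\}$ for $3\le k\le m-2$. Let $C$ be the Cartesian product of all these sets, i.e. $C=\prod_{i=1}^{n-4}L_i\times\prod_{i=1}^{n-4}R_i\times\prod_{i=1}^{m-4}U_i\times\prod_{i=1}^{m-4}D_i$ (if $n=4$ the factors $L_i,R_i$ are absent; if $m=4$ the factors $U_i,D_i$ are absent), and let $t=2(m+n-8)$ be the number of factors. Let $\mathcal{V}$ be the set of $\mathbf{v}=(v_1,\dots,v_t)\in C$ such that for all $i,j\in\{1,\dots,t\}$, $v_i,v_j$ are not the diagonal corners of an inner interval of $\mathcal{P}$. For $\mathbf{v}\in\mathcal{V}$ let $$\mathbf{x}_{\mathbf{v}}=x_{v_1}x_{v_2}\cdots x_{v_t}\,x_{(2,2)}\,x_{(1,n)}\,x_{(m,1)}\,x_{(m-1,n-1)}.$$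 Then $K(\mathcal{P})$ is the monomial ideal of $S_{\mathcal{P}}$ generated by all $\mathbf{x}_{\mathbf{v}}$, $\mathbf{v}\in\mathcal{V}$. *)

theory Defs
  imports
    "HOL-Algebra.QuotRing"
    "HOL-Algebra.Module"
    "HOL-Library.FuncSet"
    "HOL-Library.Poly_Mapping"
    "HOL-Library.Extended_Nat"
begin

section \<open>Modules over a commutative ring\<close>

text \<open>A module record extends a ring record; its fields \<open>mult\<close> and \<open>one\<close> play no role in the
  locale \<^locale>\<open>module\<close> and are left undefined below.\<close>

definition ring_module :: "('a, 'c) ring_scheme \<Rightarrow> ('a, 'a) module" where
  "ring_module R = \<lparr>carrier = carrier R, mult = undefined, one = undefined,
     zero = \<zero>\<^bsub>R\<^esub>, add = (\<lambda>x y. x \<oplus>\<^bsub>R\<^esub> y), smult = (\<lambda>r x. r \<otimes>\<^bsub>R\<^esub> x)\<rparr>"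

definition free_module :: "('a, 'c) ring_scheme \<Rightarrow> nat \<Rightarrow> ('a, nat \<Rightarrow> 'a) module" where
  "free_module R k = \<lparr>carrier = {..<k} \<rightarrow>\<^sub>E carrier R, mult = undefined, one = undefined,
     zero = (\<lambda>i\<in>{..<k}. \<zero>\<^bsub>R\<^esub>), add = (\<lambda>x y. \<lambda>i\<in>{..<k}. x i \<oplus>\<^bsub>R\<^esub> y i),
     smult = (\<lambda>r x. \<lambda>i\<in>{..<k}. r \<otimes>\<^bsub>R\<^esub> x i)\<rparr>"

text \<open>The quotient of \<open>M\<close> by a submodule \<open>H\<close>, with the cosets of \<open>H\<close> as elements. As for
  \<^const>\<open>rcoset_mult\<close>, the scalar multiple of a coset is the union over its representatives.\<close>

definition quotient_module :: "('a, 'b) module \<Rightarrow> 'b set \<Rightarrow> ('a, 'b set) module" where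
  "quotient_module M H = \<lparr>carrier = a_rcosets\<^bsub>M\<^esub> H, mult = undefined, one = undefined,
     zero = H, add = (\<lambda>X Y. X <+>\<^bsub>M\<^esub> Y), smult = (\<lambda>r X. \<Union>x\<in>X. H +>\<^bsub>M\<^esub> (r \<odot>\<^bsub>M\<^esub> x))\<rparr>"

definition linear_maps :: "('a, 'c) ring_scheme \<Rightarrow> ('a, 'b) module \<Rightarrow> ('a, 'd) module \<Rightarrow> ('b \<Rightarrow> 'd) set"
  where
  "linear_maps R M N = {f \<in> carrier M \<rightarrow>\<^sub>E carrier N.
     (\<forall>x\<in>carrier M. \<forall>y\<in>carrier M. f (x \<oplus>\<^bsub>M\<^esub> y) = f x \<oplus>\<^bsub>N\<^esub> f y) \<and>
     (\<forall>r\<in>carrier R. \<forall>x\<in>carrier M. f (r \<odot>\<^bsub>M\<^esub> x) = r \<odot>\<^bsub>N\<^esub> f x)}"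

definition isomorphic_modules ::
  "('a, 'c) ring_scheme \<Rightarrow> ('a, 'b) module \<Rightarrow> ('a, 'd) module \<Rightarrow> bool" where
  "isomorphic_modules R M N \<longleftrightarrow> (\<exists>f\<in>linear_maps R M N. bij_betw f (carrier M) (carrier N))"

definition hom_module ::
  "('a, 'c) ring_scheme \<Rightarrow> ('a, 'b) module \<Rightarrow> ('a, 'd) module \<Rightarrow> ('a, 'b \<Rightarrow> 'd) module" where
  "hom_module R M N = \<lparr>carrier = linear_maps R M N, mult = undefined, one = undefined,
     zero = (\<lambda>x\<in>carrier M. \<zero>\<^bsub>N\<^esub>), add = (\<lambda>f g. \<lambda>x\<in>carrier M. f x \<oplus>\<^bsub>N\<^esub> g x),
     smult = (\<lambda>r f. \<lambda>x\<in>carrier M. r \<odot>\<^bsub>N\<^esub> f x)\<rparr>"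


section \<open>Ext\<close>

definition linear_kernel :: "('a, 'b) module \<Rightarrow> ('a, 'd) module \<Rightarrow> ('b \<Rightarrow> 'd) \<Rightarrow> 'b set" where
  "linear_kernel M N f = {x \<in> carrier M. f x = \<zero>\<^bsub>N\<^esub>}"

text \<open>An exact sequence
  \<open>\<dots> \<rightarrow> R\<^bsup>k 2\<^esup> \<rightarrow> R\<^bsup>k 1\<^esup> \<rightarrow> R\<^bsup>k 0\<^esup> \<rightarrow> M \<rightarrow> 0\<close>, where
  \<open>d i\<close> maps \<open>R\<^bsup>k (i + 1)\<^esup>\<close> to \<open>R\<^bsup>k i\<^esup>\<close> and \<open>e\<close> is the augmentation.\<close>

definition free_resolution :: "('a, 'c) ring_scheme \<Rightarrow> ('a, 'b) module \<Rightarrow>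
    (nat \<Rightarrow> nat) \<Rightarrow> (nat \<Rightarrow> (nat \<Rightarrow> 'a) \<Rightarrow> (nat \<Rightarrow> 'a)) \<Rightarrow> ((nat \<Rightarrow> 'a) \<Rightarrow> 'b) \<Rightarrow> bool" where
  "free_resolution R M k d e \<longleftrightarrow>
     (let F = (\<lambda>i. free_module R (k i)) in
      e \<in> linear_maps R (F 0) M \<and>
      (\<forall>i. d i \<in> linear_maps R (F (Suc i)) (F i)) \<and>
      e ` carrier (F 0) = carrier M \<and>
      d 0 ` carrier (F 1) = linear_kernel (F 0) M e \<and>
      (\<forall>i. d (Suc i) ` carrier (F (Suc (Suc i))) = linear_kernel (F (Suc i)) (F i) (d i)))"

text \<open>The \<open>i\<close>-th cohomology module of the complex \<open>Hom (R\<^bsup>k i\<^esup>, N)\<close>, whose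
  differential from degree \<open>i\<close> to degree \<open>i + 1\<close> is composition with \<open>d i\<close>.\<close>

definition hom_differential :: "('a, 'c) ring_scheme \<Rightarrow> (nat \<Rightarrow> nat) \<Rightarrow>
    (nat \<Rightarrow> (nat \<Rightarrow> 'a) \<Rightarrow> (nat \<Rightarrow> 'a)) \<Rightarrow> nat \<Rightarrow> ((nat \<Rightarrow> 'a) \<Rightarrow> 'd) \<Rightarrow> ((nat \<Rightarrow> 'a) \<Rightarrow> 'd)" where
  "hom_differential R k d i f = compose (carrier (free_module R (k (Suc i)))) f (d i)"

definition hom_cohomology :: "('a, 'c) ring_scheme \<Rightarrow> (nat \<Rightarrow> nat) \<Rightarrow>
    (nat \<Rightarrow> (nat \<Rightarrow> 'a) \<Rightarrow> (nat \<Rightarrow> 'a)) \<Rightarrow> ('a, 'd) module \<Rightarrow> nat \<Rightarrow>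
    ('a, ((nat \<Rightarrow> 'a) \<Rightarrow> 'd) set) module" where
  "hom_cohomology R k d N i =
     (let C = (\<lambda>j. hom_module R (free_module R (k j)) N);
          Z = linear_kernel (C i) (C (Suc i)) (hom_differential R k d i);
          B = (case i of 0 \<Rightarrow> {\<zero>\<^bsub>C 0\<^esub>} | Suc j \<Rightarrow> hom_differential R k d j ` carrier (C j))
      in quotient_module ((C i)\<lparr>carrier := Z\<rparr>) B)"

text \<open>\<open>Ext\<^bsup>i\<^esup> (M, N)\<close>, computed from a chosen resolution of \<open>M\<close> by free modules of finite rank. Such
  resolutions exist for finitely generated \<open>M\<close> over noetherian \<open>R\<close>, and another choice
  gives an isomorphic module. The definition is meaningful only for such \<open>R\<close> and \<open>M\<close>.\<close>

definition Ext :: "('a, 'c) ring_scheme \<Rightarrow> nat \<Rightarrow> ('a, 'b) module \<Rightarrow> ('a, 'd) module \<Rightarrow>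
    ('a, ((nat \<Rightarrow> 'a) \<Rightarrow> 'd) set) module" where
  "Ext R i M N = (let (k, d) = (SOME (k, d). \<exists>e. free_resolution R M k d e)
                  in hom_cohomology R k d N i)"


section \<open>Polynomial rings and canonical modules\<close>

text \<open>Polynomials over \<open>'k\<close> in variables indexed by \<open>'v\<close>: a finitely supported
  assignment of coefficients to exponent vectors.\<close>

type_synonym ('v, 'k) mpoly = "('v \<Rightarrow>\<^sub>0 nat) \<Rightarrow>\<^sub>0 'k"

definition var :: "'v \<Rightarrow> ('v, 'k::comm_ring_1) mpoly" where
  "var v = Poly_Mapping.single (Poly_Mapping.single v 1) 1"

definition poly_ring :: "'v set \<Rightarrow> ('v, 'k::comm_ring_1) mpoly ring" where
  "poly_ring V = \<lparr>carrier = {p. \<forall>t\<in>Poly_Mapping.keys p. Poly_Mapping.keys t \<subseteq> V},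
     mult = (*), one = 1, zero = 0, add = (+)\<rparr>"

lemma poly_ring_closed:
  fixes x y :: "('v, 'k::comm_ring_1) mpoly"
  assumes x: "x \<in> carrier (poly_ring V)" and y: "y \<in> carrier (poly_ring V)"
  shows "x + y \<in> carrier (poly_ring V)" "x * y \<in> carrier (poly_ring V)"
    "- x \<in> carrier (poly_ring V)"
proof -
  have x': "Poly_Mapping.keys t \<subseteq> V" if "t \<in> Poly_Mapping.keys x" for t
    using x that by (simp add: poly_ring_def)
  have y': "Poly_Mapping.keys t \<subseteq> V" if "t \<in> Poly_Mapping.keys y" for t
    using y that by (simp add: poly_ring_def)
  have "Poly_Mapping.keys t \<subseteq> V" if "t \<in> Poly_Mapping.keys (x + y)" for t
    using that Poly_Mapping.keys_add[of x y] x' y' by blast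
  then show "x + y \<in> carrier (poly_ring V)"
    by (simp add: poly_ring_def)
  have "Poly_Mapping.keys t \<subseteq> V" if t: "t \<in> Poly_Mapping.keys (x * y)" for t
  proof -
    obtain a b where ab: "t = a + b" "a \<in> Poly_Mapping.keys x" "b \<in> Poly_Mapping.keys y"
      using subsetD[OF keys_mult t] by blast
    show ?thesis
      using Poly_Mapping.keys_add[of a b] x'[OF ab(2)] y'[OF ab(3)] unfolding ab(1) by blast
  qed
  then show "x * y \<in> carrier (poly_ring V)"
    by (simp add: poly_ring_def)
  show "- x \<in> carrier (poly_ring V)"
    using x' by (simp add: poly_ring_def)
qed

lemma poly_ring_simps [simp]:
  "x \<oplus>\<^bsub>poly_ring V\<^esub> y = x + y" "x \<otimes>\<^bsub>poly_ring V\<^esub> y = x * y"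
  "\<zero>\<^bsub>poly_ring V\<^esub> = 0" "\<one>\<^bsub>poly_ring V\<^esub> = 1"
  "0 \<in> carrier (poly_ring V)" "1 \<in> carrier (poly_ring V)"
  by (simp_all add: poly_ring_def)

lemma cring_poly_ring: "cring (poly_ring V)"
proof (rule cringI)
  show "abelian_group (poly_ring V)"
  proof (rule abelian_groupI)
    fix x
    assume "x \<in> carrier (poly_ring V)"
    then show "\<exists>y\<in>carrier (poly_ring V). y \<oplus>\<^bsub>poly_ring V\<^esub> x = \<zero>\<^bsub>poly_ring V\<^esub>"
      by (intro bexI[of _ "- x"]) (simp_all add: poly_ring_closed)
  qed (simp_all add: poly_ring_closed add_ac)
  show "Group.comm_monoid (poly_ring V)"
    by (rule comm_monoidI) (simp_all add: poly_ring_closed mult_ac)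
qed (simp add: algebra_simps)

definition krull_dim :: "('a, 'c) ring_scheme \<Rightarrow> enat" where
  "krull_dim R = Sup {enat l | l. \<exists>p :: nat \<Rightarrow> 'a set.
     (\<forall>i\<le>l. primeideal (p i) R) \<and> (\<forall>i<l. p i \<subset> p (Suc i))}"

text \<open>For an ideal \<open>I\<close> of \<open>S = K[x\<^sub>v : v \<in> V]\<close> with \<open>S/I\<close> Cohen--Macaulay of dimension
  \<open>\<delta>\<close> and \<open>V\<close> finite, the canonical module of \<open>S/I\<close> is \<open>Ext\<^bsup>|V| - \<delta>\<^esup> (S/I, S)\<close>, taken over
  \<open>S\<close>. It is regarded as an \<open>S\<close>-module annihilated by \<open>I\<close>, and its grading is forgotten.\<close>

definition canonical_module :: "'v set \<Rightarrow> ('v, 'k::field) mpoly set \<Rightarrow>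
    (('v, 'k) mpoly, ((nat \<Rightarrow> ('v, 'k) mpoly) \<Rightarrow> ('v, 'k) mpoly) set) module" where
  "canonical_module V I =
     (let S = poly_ring V in
      Ext S (card V - the_enat (krull_dim (S Quot I)))
        (quotient_module (ring_module S) I) (ring_module S))"


section \<open>Collections of cells and their ideals\<close>

type_synonym point = "int \<times> int"

definition interval :: "point \<Rightarrow> point \<Rightarrow> point set" where
  "interval a b = {fst a..fst b} \<times> {snd a..snd b}"

definition proper :: "point \<Rightarrow> point \<Rightarrow> bool" where
  "proper a b \<longleftrightarrow> fst a < fst b \<and> snd a < snd b"

definition corners :: "point \<Rightarrow> point \<Rightarrow> point set" where
  "corners a b = {a, b, (fst a, snd b), (fst b, snd a)}"

definition up :: "point \<Rightarrow> point" where
  "up a = (fst a + 1, snd a + 1)"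

definition cell :: "point \<Rightarrow> point set" where
  "cell a = interval a (up a)"

definition cells_in :: "point set \<Rightarrow> point set set" where
  "cells_in I = {cell a | a. cell a \<subseteq> I}"

definition vertices :: "point set set \<Rightarrow> point set" where
  "vertices P = \<Union> {corners a (up a) | a. cell a \<in> P}"

definition inner_interval :: "point set set \<Rightarrow> point \<Rightarrow> point \<Rightarrow> bool" where
  "inner_interval P a b \<longleftrightarrow> proper a b \<and> cells_in (interval a b) \<subseteq> P"

definition minor :: "point \<Rightarrow> point \<Rightarrow> (point, 'k::comm_ring_1) mpoly" where
  "minor a b = var a * var b - var (fst a, snd b) * var (fst b, snd a)"

definition polyomino_ideal :: "point set set \<Rightarrow> (point, 'k::field) mpoly set" where
  "polyomino_ideal P = Idl\<^bsub>poly_ring (vertices P)\<^esub> {minor a b | a b. inner_interval P a b}"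


section \<open>The circle\<close>

definition circle :: "int \<Rightarrow> int \<Rightarrow> point set set" where
  "circle m n = cells_in (interval (1, 1) (m, n)) - cells_in (interval (2, 2) (m - 1, n - 1))"

definition J_intervals :: "int \<Rightarrow> int \<Rightarrow> (point \<times> point) set" where
  "J_intervals m n =
     {(a, up a) | a. cell a \<in> circle m n \<and>
        a \<notin> {(2, 1), (m - 1, 2), (m - 2, n - 1), (1, n - 2)}} \<union>
     {((1, 1), (3, 2)), ((m - 1, 1), (m, 3)), ((m - 2, n - 1), (m, n)), ((1, n - 2), (2, n))}"

definition J_ideal :: "int \<Rightarrow> int \<Rightarrow> (point, 'k::field) mpoly set" where
  "J_ideal m n =
     Idl\<^bsub>poly_ring (vertices (circle m n))\<^esub> {minor a b | a b. (a, b) \<in> J_intervals m n}"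

text \<open>The factors of the Cartesian product, in the order \<open>L, R, U, D\<close>; an element of
  \<open>listset (factors m n)\<close> is a tuple \<open>(v\<^sub>1, \<dots>, v\<^sub>t)\<close>.\<close>

definition factors :: "int \<Rightarrow> int \<Rightarrow> point set list" where
  "factors m n =
     map (\<lambda>j. {(1, j), (2, j)}) [3..n - 2] @
     map (\<lambda>j. {(m - 1, j), (m, j)}) [3..n - 2] @
     map (\<lambda>k. {(k, n), (k, n - 1)}) [3..m - 2] @
     map (\<lambda>k. {(k, 1), (k, 2)}) [3..m - 2]"

definition admissible :: "int \<Rightarrow> int \<Rightarrow> point list set" where
  "admissible m n = {v \<in> listset (factors m n).
     \<forall>i<length v. \<forall>j<length v. \<not> inner_interval (circle m n) (v ! i) (v ! j)}"

definition x_monomial :: "int \<Rightarrow> int \<Rightarrow> point list \<Rightarrow> (point, 'k::comm_ring_1) mpoly" where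
  "x_monomial m n v = prod_list (map var v) * var (2, 2) * var (1, n) * var (m, 1) * var (m - 1, n - 1)"

definition K_ideal :: "int \<Rightarrow> int \<Rightarrow> (point, 'k::field) mpoly set" where
  "K_ideal m n = Idl\<^bsub>poly_ring (vertices (circle m n))\<^esub> (x_monomial m n ` admissible m n)"

end

theory Submission
  imports Defs "HOL-Library.Product_Lexorder"
begin

text \<open>
  For a suitable weight, the leading monomials of the \<open>|\<P>|\<close> generators of \<open>J\<close> are squarefree and pairwise
  coprime. Hence \<open>J\<close> is radical and generated by a regular sequence. Its length is \<open>|V(\<P>)| - dim K[\<P>]\<close>,
  since \<open>I\<close> is the toric ideal of an explicit monomial parametrization. Shifting dimensions
  along the regular sequence in an arbitrary free resolution of \<open>K[\<P>]\<close> gives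
  \<open>Ext\<^sup>c(S/I, S) \<cong> (J : I) / J\<close>, and it remains to see that \<open>J : I = J + K\<close>.

  Modulo \<open>J\<close>, a minor of two columns of a strip is a telescoping combination of minors of consecutive
  columns once it is multiplied by a variable from each column in between; each
  \<open>x\<^sub>v\<close> contains such variables, where at the corners of the circle the relations in \<open>J\<close> are used to exchange
  vertices. So \<open>K \<subseteq> J : I\<close>.
  Conversely, for each facet of the cone of the toric ring there is a monomial map
  that vanishes on \<open>J\<close> but not on \<open>I\<close>, hence kills \<open>J : I\<close>. Therefore the image of an element of
  \<open>J : I\<close> in \<open>K[\<P>]\<close> is supported in the interior of the cone, and every interior degree is the degree of a
  multiple of some \<open>x\<^sub>v\<close>. Subtracting these multiples leaves an element of
  \<open>I \<inter> (J : I)\<close>, which is \<open>J\<close> because \<open>J\<close> is radical.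
\<close>

text \<open>\<open>Ext\<close> picks its resolution by choice, so nothing may be assumed about its
  shape and the Koszul complex of the generators of J does not help. What is used instead is that
  multiplication by an element of I is null-homotopic on every free resolution of S/I.

  The form of J is dictated by the corners. Minors of consecutive columns of each strip would be the
  natural generators, but then the inner vertex of a corner square would occur in leading monomials
  of both strips through it. Exchanging columns 1 and 2 of every strip separates these, and turns
  the minor of columns 2 and 3 into that of columns 1 and 3: this is where the four two-cell
  intervals come from. The supports of the leading monomials then partition V(P), which has twice as
  many elements as P.

  A degree of the toric ring records how many factors lie in each corner square or remaining column,
  and how many factors are inner in each strip. The cone is cut out by the evident inequalities; its
  interior is where they are strict. Each facet kills vertices in such a way that a strip falls
  apart for J, whose generators only join neighbouring columns, but not for I.\<close>

abbreviation keys where "keys \<equiv> Poly_Mapping.keys"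
abbreviation lookup where "lookup \<equiv> Poly_Mapping.lookup"
abbreviation single where "single \<equiv> Poly_Mapping.single"

abbreviation polys :: "'v set \<Rightarrow> ('v, 'k::comm_ring_1) mpoly set" where
  "polys V \<equiv> carrier (poly_ring V)"

section \<open>Monomials, constants and coefficients\<close>

definition xpow :: "('v \<Rightarrow>\<^sub>0 nat) \<Rightarrow> ('v, 'k::comm_ring_1) mpoly" where
  "xpow t = single t 1"

abbreviation const :: "'k \<Rightarrow> ('v, 'k::comm_ring_1) mpoly" where
  "const c \<equiv> single 0 c"

lemma polys_iff: "p \<in> polys V \<longleftrightarrow> (\<forall>t\<in>keys p. keys t \<subseteq> V)"
  by (simp add: poly_ring_def)

lemma keys_add_nat: "keys (s + t) = keys s \<union> keys (t :: 'v \<Rightarrow>\<^sub>0 nat)"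
  by (auto simp: in_keys_iff lookup_add)

lemma xpow_0: "xpow 0 = 1"
  by (simp add: xpow_def)

lemma xpow_add: "xpow (s + t) = xpow s * xpow t"
  by (simp add: xpow_def mult_single)

lemma keys_xpow [simp]: "keys (xpow t :: ('v, 'k::comm_ring_1) mpoly) = {t}"
  by (simp add: xpow_def)

lemma xpow_neq_0 [simp]: "xpow t \<noteq> 0"
  by (metis keys_xpow keys_zero insert_not_empty)

lemma lookup_xpow: "lookup (xpow t) s = (if s = t then 1 else 0)"
  by (simp add: xpow_def lookup_single when_def)

lemma const_mult_xpow: "const c * xpow t = single t c"
  by (simp add: xpow_def mult_single)

lemma lookup_const_mult: "lookup (const c * p) t = c * lookup p t"
proof -
  have "const c * p = Poly_Mapping.map ((*) c) p"
    by (simp add: mult_map_scale_conv_mult)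
  then show ?thesis
    by (simp add: map.rep_eq when_def)
qed

lemma const_mult_const: "const (a * b) = const a * const b"
  by (simp add: mult_single)

lemma poly_as_sum:
  assumes "finite T" and "keys p \<subseteq> T"
  shows "p = (\<Sum>t\<in>T. single t (lookup p t))"
proof (rule poly_mapping_eqI)
  fix s
  have "lookup (\<Sum>t\<in>T. single t (lookup p t)) s = (\<Sum>t\<in>T. if t = s then lookup p t else 0)"
    by (simp add: lookup_sum lookup_single when_def)
  also have "\<dots> = lookup p s"
    using assms by (auto simp: in_keys_iff)
  finally show "lookup p s = lookup (\<Sum>t\<in>T. single t (lookup p t)) s" by simp
qed

lemma single_in_polys [intro]: "keys t \<subseteq> V \<Longrightarrow> single t c \<in> polys V"
  by (simp add: polys_iff)

lemma xpow_in_polys [simp]: "(xpow t :: ('v, 'k::comm_ring_1) mpoly) \<in> polys V \<longleftrightarrow> keys t \<subseteq> V"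
  by (simp add: polys_iff)

lemma const_in_polys [simp]: "const c \<in> polys V"
  by (rule single_in_polys) simp

lemma polys_diff: "x \<in> polys V \<Longrightarrow> y \<in> polys V \<Longrightarrow> x - y \<in> polys V"
  using poly_ring_closed(1)[of x V "- y"] poly_ring_closed(3)[of y V y] by simp

lemma polys_sum: "(\<And>i. i \<in> A \<Longrightarrow> f i \<in> polys V) \<Longrightarrow> sum f A \<in> polys V"
  by (induction A rule: infinite_finite_induct) (auto simp: poly_ring_closed)

lemma polys_prod: "(\<And>i. i \<in> A \<Longrightarrow> f i \<in> polys V) \<Longrightarrow> prod f A \<in> polys V"
  by (induction A rule: infinite_finite_induct) (auto simp: poly_ring_closed)

lemma polys_power: "x \<in> polys V \<Longrightarrow> x ^ n \<in> polys V"
  by (induction n) (auto simp: poly_ring_closed)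

lemma polys_uminus: "x \<in> polys V \<Longrightarrow> - x \<in> polys V"
  by (rule poly_ring_closed(3)[of x V x])

lemma polys_minus_one: "- 1 \<in> polys V"
  by (rule polys_uminus) simp

lemmas polys_closed = poly_ring_closed(1,2) polys_uminus polys_diff polys_sum polys_prod polys_power

lemma poly_lin_induct [consumes 1, case_names single add]:
  assumes "keys p \<subseteq> T"
    and single: "\<And>t c. t \<in> T \<Longrightarrow> P (single t c)"
    and add: "\<And>p q. P p \<Longrightarrow> P q \<Longrightarrow> P (p + q)"
    and zero: "P 0"
  shows "P (p :: 'a \<Rightarrow>\<^sub>0 'b::comm_monoid_add)"
proof -
  have "finite U \<Longrightarrow> U \<subseteq> T \<Longrightarrow> P (\<Sum>t\<in>U. single t (lookup p t))" for U
    by (induction U rule: finite_induct) (auto simp: zero intro!: add single)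
  moreover have "p = (\<Sum>t\<in>keys p. single t (lookup p t))"
  proof (rule poly_mapping_eqI)
    fix s
    have "lookup (\<Sum>t\<in>keys p. single t (lookup p t)) s
        = (\<Sum>t\<in>keys p. if t = s then lookup p t else 0)"
      by (simp add: lookup_sum lookup_single when_def)
    also have "\<dots> = lookup p s"
      by (auto simp: in_keys_iff)
    finally show "lookup p s = lookup (\<Sum>t\<in>keys p. single t (lookup p t)) s" by simp
  qed
  ultimately show ?thesis
    using assms(1) by (metis finite_keys)
qed


subsection \<open>Linear extensions of maps on monomials\<close>

definition lin_ext :: "('a \<Rightarrow> ('w, 'k) mpoly) \<Rightarrow> ('a \<Rightarrow>\<^sub>0 'k) \<Rightarrow> ('w, 'k::comm_ring_1) mpoly" where
  "lin_ext F p = (\<Sum>t\<in>keys p. const (lookup p t) * F t)"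

lemma lin_ext_superset:
  assumes "finite T" and "keys p \<subseteq> T"
  shows "lin_ext F p = (\<Sum>t\<in>T. const (lookup p t) * F t)"
  unfolding lin_ext_def
  by (rule sum.mono_neutral_left) (use assms in \<open>auto simp: in_keys_iff\<close>)

lemma lin_ext_0 [simp]: "lin_ext F 0 = 0"
  by (simp add: lin_ext_def)

lemma lin_ext_add: "lin_ext F (p + q) = lin_ext F p + lin_ext F q"
proof -
  let ?T = "keys p \<union> keys q"
  have "keys (p + q) \<subseteq> ?T"
    by (rule Poly_Mapping.keys_add)
  then show ?thesis
    by (simp add: lin_ext_superset[of ?T] lookup_add single_add distrib_right sum.distrib)
qed

lemma lin_ext_uminus: "lin_ext F (- p) = - lin_ext F p"
  by (simp add: lin_ext_def single_uminus sum_negf)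

lemma lin_ext_diff: "lin_ext F (p - q) = lin_ext F p - lin_ext F q"
  using lin_ext_add[of F p "- q"] by (simp add: lin_ext_uminus)

lemma lin_ext_sum: "lin_ext F (sum f A) = (\<Sum>i\<in>A. lin_ext F (f i))"
  by (induction A rule: infinite_finite_induct) (auto simp: lin_ext_add)

lemma lin_ext_single: "lin_ext F (single t c) = const c * F t"
  by (cases "c = 0") (simp_all add: lin_ext_def)

lemma lin_ext_xpow: "lin_ext F (xpow t) = F t"
  by (simp add: xpow_def lin_ext_single)

lemma lin_ext_mult:
  assumes "\<And>s t. F (s + t) = F s * F t"
  shows "lin_ext F (p * q) = lin_ext F p * lin_ext F q"
proof (rule poly_lin_induct[of p UNIV])
  fix s :: 'a and c
  show "lin_ext F (single s c * q) = lin_ext F (single s c) * lin_ext F q"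
  proof (rule poly_lin_induct[of q UNIV])
    fix t :: 'a and d
    show "lin_ext F (single s c * single t d) = lin_ext F (single s c) * lin_ext F (single t d)"
      unfolding mult_single lin_ext_single assms by (simp only: const_mult_const mult_ac)
  qed (simp_all only: distrib_left lin_ext_add subset_UNIV mult_zero_right lin_ext_0)
qed (simp_all only: distrib_right lin_ext_add subset_UNIV mult_zero_left lin_ext_0)

lemma lookup_lin_ext: "lookup (lin_ext F p) u = (\<Sum>t\<in>keys p. lookup p t * lookup (F t) u)"
  by (simp add: lin_ext_def lookup_sum lookup_const_mult)


subsection \<open>Ideals of a polynomial ring\<close>

lemma poly_idealI:
  assumes "I \<subseteq> polys V" and "0 \<in> I"
    and add: "\<And>x y. x \<in> I \<Longrightarrow> y \<in> I \<Longrightarrow> x + y \<in> I"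
    and mult: "\<And>a x. a \<in> polys V \<Longrightarrow> x \<in> I \<Longrightarrow> a * x \<in> I"
  shows "ideal I (poly_ring V :: ('v, 'k::comm_ring_1) mpoly ring)"
proof (rule idealI)
  interpret cring "poly_ring V :: ('v, 'k) mpoly ring" by (rule cring_poly_ring)
  show "ring (poly_ring V :: ('v, 'k) mpoly ring)" by (rule ring_axioms)
  show "subgroup I (add_monoid (poly_ring V))"
  proof (rule add.subgroupI)
    fix a assume a: "a \<in> I"
    have ac: "a \<in> polys V" using a assms(1) by blast
    have "- 1 * a \<in> I" by (rule mult[OF polys_minus_one a])
    moreover have "\<ominus>\<^bsub>poly_ring V\<^esub> a = - a"
      by (rule minus_equality) (use ac in \<open>simp_all add: polys_closed\<close>)
    ultimately show "\<ominus>\<^bsub>poly_ring V\<^esub> a \<in> I" by simp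
  qed (use assms in \<open>auto\<close>)
next
  fix a x :: "('v, 'k) mpoly" assume "a \<in> I" and "x \<in> polys V"
  then show "x \<otimes>\<^bsub>poly_ring V\<^esub> a \<in> I" and "a \<otimes>\<^bsub>poly_ring V\<^esub> x \<in> I"
    using mult[of x a] by (simp_all add: mult.commute)
qed

context
  fixes I V
  assumes I: "ideal I (poly_ring V :: ('v, 'k::comm_ring_1) mpoly ring)"
begin

interpretation ideal I "poly_ring V" by (rule I)

lemma poly_ideal_carrier: "x \<in> I \<Longrightarrow> x \<in> polys V"
  by (rule Icarr)

lemma poly_ideal_0: "0 \<in> I"
  using additive_subgroup.zero_closed[OF is_additive_subgroup] by simp

lemma poly_ideal_add: "x \<in> I \<Longrightarrow> y \<in> I \<Longrightarrow> x + y \<in> I"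
  using additive_subgroup.a_closed[OF is_additive_subgroup, of x y] by simp

lemma poly_ideal_mult: "a \<in> polys V \<Longrightarrow> x \<in> I \<Longrightarrow> a * x \<in> I"
  using I_l_closed[of x a] by simp

lemma poly_ideal_mult2: "a \<in> polys V \<Longrightarrow> x \<in> I \<Longrightarrow> x * a \<in> I"
  using I_r_closed[of x a] by simp

lemma poly_ideal_uminus: "x \<in> I \<Longrightarrow> - x \<in> I"
  using poly_ideal_mult[OF polys_minus_one, of x] by simp

lemma poly_ideal_diff: "x \<in> I \<Longrightarrow> y \<in> I \<Longrightarrow> x - y \<in> I"
  using poly_ideal_add[of x "- y"] poly_ideal_uminus[of y] by simp

lemma poly_ideal_sum: "(\<And>i. i \<in> A \<Longrightarrow> f i \<in> I) \<Longrightarrow> sum f A \<in> I"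
  by (induction A rule: infinite_finite_induct) (auto simp: poly_ideal_0 poly_ideal_add)

lemma poly_ideal_diff_trans: "x - y \<in> I \<Longrightarrow> y - z \<in> I \<Longrightarrow> x - z \<in> I"
  using poly_ideal_add[of "x - y" "y - z"] by simp

lemma poly_ideal_diff_sym: "x - y \<in> I \<Longrightarrow> y - x \<in> I"
  using poly_ideal_uminus[of "x - y"] by simp

lemma poly_ideal_diff_mem: "x - y \<in> I \<Longrightarrow> x \<in> I \<longleftrightarrow> y \<in> I"
  using poly_ideal_diff[of x "x - y"] poly_ideal_add[of "x - y" y] by auto

end

lemmas poly_ideal_closed = poly_ideal_add poly_ideal_mult poly_ideal_mult2 poly_ideal_uminus
  poly_ideal_diff poly_ideal_sum poly_ideal_0

lemma genideal_poly_ideal: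
  "G \<subseteq> polys V \<Longrightarrow> ideal (Idl\<^bsub>poly_ring V\<^esub> G) (poly_ring V :: ('v, 'k::comm_ring_1) mpoly ring)"
  by (rule ring.genideal_ideal) (auto intro: cring.axioms(1) cring_poly_ring)

lemma genideal_poly_mem:
  "G \<subseteq> polys V \<Longrightarrow> g \<in> G \<Longrightarrow> (g :: ('v, 'k::comm_ring_1) mpoly) \<in> Idl\<^bsub>poly_ring V\<^esub> G"
  using ring.genideal_self[of "poly_ring V" G] cring.axioms(1)[OF cring_poly_ring] by blast

lemma genideal_poly_least:
  "ideal I (poly_ring V) \<Longrightarrow> G \<subseteq> I \<Longrightarrow> Idl\<^bsub>poly_ring V\<^esub> G \<subseteq> (I :: ('v, 'k::comm_ring_1) mpoly set)"
  by (rule ring.genideal_minimal) (auto intro: cring.axioms(1) cring_poly_ring)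

text \<open>One coefficient per index, so that a member can be taken apart and an initial segment of
  a sequence is just an index set \<open>{..<r}\<close>. It agrees with the generated ideal by
  \<open>genideal_eq_ideal_span\<close>.\<close>

definition ideal_span :: "'v set \<Rightarrow> ('i \<Rightarrow> ('v, 'k::comm_ring_1) mpoly) \<Rightarrow> 'i set \<Rightarrow> ('v, 'k) mpoly set" where
  "ideal_span V f A = {\<Sum>i\<in>A. a i * f i | a. \<forall>i\<in>A. a i \<in> polys V}"

lemma ideal_span_ideal:
  fixes f :: "'i \<Rightarrow> ('b, 'c::comm_ring_1) mpoly"
  assumes "\<And>i. i \<in> A \<Longrightarrow> f i \<in> polys V"
  shows "ideal (ideal_span V f A) (poly_ring V)"
proof (rule poly_idealI)
  show "ideal_span V f A \<subseteq> polys V"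
    using assms by (auto simp: ideal_span_def intro!: polys_closed)
  show "0 \<in> ideal_span V f A"
    unfolding ideal_span_def by (rule CollectI, rule exI[of _ "\<lambda>_. 0"]) simp
next
  fix x y assume "x \<in> ideal_span V f A" "y \<in> ideal_span V f A"
  then obtain a b where "x = (\<Sum>i\<in>A. a i * f i)" "\<forall>i\<in>A. a i \<in> polys V"
    "y = (\<Sum>i\<in>A. b i * f i)" "\<forall>i\<in>A. b i \<in> polys V"
    unfolding ideal_span_def by blast
  then show "x + y \<in> ideal_span V f A"
    unfolding ideal_span_def
    by (intro CollectI exI[of _ "\<lambda>i. a i + b i"]) (simp add: sum.distrib distrib_right polys_closed)
next
  fix c x :: "('b, 'c) mpoly" assume c: "c \<in> polys V" and "x \<in> ideal_span V f A"
  then obtain a where "x = (\<Sum>i\<in>A. a i * f i)" "\<forall>i\<in>A. a i \<in> polys V"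
    unfolding ideal_span_def by blast
  with c show "c * x \<in> ideal_span V f A"
    unfolding ideal_span_def
    by (intro CollectI exI[of _ "\<lambda>i. c * a i"]) (simp add: sum_distrib_left mult_ac polys_closed)
qed

lemma ideal_span_mem:
  assumes "finite A" and "i \<in> A"
  shows "f i \<in> ideal_span V f A"
proof -
  have "(\<Sum>j\<in>A. (if j = i then 1 else 0) * f j) = (\<Sum>j\<in>A. if j = i then f j else 0)"
    by (rule sum.cong) auto
  also have "\<dots> = f i" using assms by simp
  finally have "(\<Sum>j\<in>A. (if j = i then 1 else 0) * f j) = f i" .
  then show ?thesis
    unfolding ideal_span_def by (intro CollectI exI[of _ "\<lambda>j. if j = i then 1 else 0"]) auto
qed

lemma genideal_eq_ideal_span:
  assumes "finite A" and f: "\<And>i. i \<in> A \<Longrightarrow> f i \<in> polys V"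
  shows "Idl\<^bsub>poly_ring V\<^esub> (f ` A) = ideal_span V f A"
proof
  show "Idl\<^bsub>poly_ring V\<^esub> (f ` A) \<subseteq> ideal_span V f A"
    by (rule genideal_poly_least[OF ideal_span_ideal]) (use assms ideal_span_mem in auto)
  have G: "f ` A \<subseteq> polys V" using f by auto
  show "ideal_span V f A \<subseteq> Idl\<^bsub>poly_ring V\<^esub> (f ` A)"
  proof
    fix x assume "x \<in> ideal_span V f A"
    then obtain a where a: "x = (\<Sum>i\<in>A. a i * f i)" "\<forall>i\<in>A. a i \<in> polys V"
      unfolding ideal_span_def by blast
    note idl = genideal_poly_ideal[OF G]
    show "x \<in> Idl\<^bsub>poly_ring V\<^esub> (f ` A)"
      unfolding a(1)
      by (rule poly_ideal_sum[OF idl], rule poly_ideal_mult[OF idl])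
        (use a(2) genideal_poly_mem[OF G] in auto)
  qed
qed

subsection \<open>Linear maps between free modules\<close>

definition vec :: "'v set \<Rightarrow> nat \<Rightarrow> (nat \<Rightarrow> ('v, 'k::comm_ring_1) mpoly) set" where
  "vec V k = {..<k} \<rightarrow>\<^sub>E polys V"

definition vadd :: "nat \<Rightarrow> (nat \<Rightarrow> 'a::comm_ring_1) \<Rightarrow> (nat \<Rightarrow> 'a) \<Rightarrow> nat \<Rightarrow> 'a" where
  "vadd k x y = (\<lambda>i\<in>{..<k}. x i + y i)"

definition vscale :: "nat \<Rightarrow> 'a::comm_ring_1 \<Rightarrow> (nat \<Rightarrow> 'a) \<Rightarrow> nat \<Rightarrow> 'a" where
  "vscale k a x = (\<lambda>i\<in>{..<k}. a * x i)"

definition vzero :: "nat \<Rightarrow> nat \<Rightarrow> 'a::comm_ring_1" where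
  "vzero k = (\<lambda>i\<in>{..<k}. 0)"

definition vunit :: "nat \<Rightarrow> nat \<Rightarrow> nat \<Rightarrow> 'a::comm_ring_1" where
  "vunit k i = (\<lambda>j\<in>{..<k}. if j = i then 1 else 0)"

definition lin_fun :: "'v set \<Rightarrow> nat \<Rightarrow> ((nat \<Rightarrow> ('v, 'k::comm_ring_1) mpoly) \<Rightarrow> ('v, 'k) mpoly) \<Rightarrow> bool" where
  "lin_fun V k f \<longleftrightarrow> (\<forall>x\<in>vec V k. f x \<in> polys V) \<and>
     (\<forall>x\<in>vec V k. \<forall>y\<in>vec V k. f (vadd k x y) = f x + f y) \<and>
     (\<forall>a\<in>polys V. \<forall>x\<in>vec V k. f (vscale k a x) = a * f x)"

text \<open>Linearity is required coordinate by coordinate, so that facts on functionals apply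
  directly; \<open>lin_mapI\<close> recovers the usual form.\<close>

definition lin_map :: "'v set \<Rightarrow> nat \<Rightarrow> nat \<Rightarrow> ((nat \<Rightarrow> ('v, 'k::comm_ring_1) mpoly) \<Rightarrow> nat \<Rightarrow> ('v, 'k) mpoly) \<Rightarrow> bool" where
  "lin_map V k l h \<longleftrightarrow> (\<forall>x\<in>vec V k. h x \<in> vec V l) \<and> (\<forall>i<l. lin_fun V k (\<lambda>x. h x i))"

lemma vec_carrier: "carrier (free_module (poly_ring V) k) = vec V k"
  by (simp add: free_module_def vec_def)

lemma vadd_simps [simp]: "i < k \<Longrightarrow> vadd k x y i = x i + y i"
  and vscale_simps [simp]: "i < k \<Longrightarrow> vscale k a x i = a * x i"
  and vzero_simps [simp]: "i < k \<Longrightarrow> vzero k i = 0"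
  and vunit_simps [simp]: "i < k \<Longrightarrow> vunit k j i = (if i = j then 1 else 0)"
  by (simp_all add: vadd_def vscale_def vzero_def vunit_def)

lemma vec_mem: "x \<in> vec V k \<Longrightarrow> i < k \<Longrightarrow> x i \<in> polys V"
  by (auto simp: vec_def)

lemma vecI: "(\<And>i. i < k \<Longrightarrow> f i \<in> polys V) \<Longrightarrow> (\<lambda>i\<in>{..<k}. f i) \<in> vec V k"
  by (simp add: vec_def)

lemma vec_eqI: "x \<in> vec V k \<Longrightarrow> y \<in> vec V k \<Longrightarrow> (\<And>i. i < k \<Longrightarrow> x i = y i) \<Longrightarrow> x = y"
  unfolding vec_def by (rule PiE_ext) auto

lemma vadd_vec [simp]: "x \<in> vec V k \<Longrightarrow> y \<in> vec V k \<Longrightarrow> vadd k x y \<in> vec V k"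
  unfolding vadd_def by (rule vecI) (simp add: polys_closed vec_mem)

lemma vscale_vec [simp]: "a \<in> polys V \<Longrightarrow> x \<in> vec V k \<Longrightarrow> vscale k a x \<in> vec V k"
  unfolding vscale_def by (rule vecI) (simp add: polys_closed vec_mem)

lemma vzero_vec [simp]: "vzero k \<in> vec V k"
  unfolding vzero_def by (rule vecI) simp

lemma vunit_vec [simp]: "vunit k i \<in> vec V k"
  unfolding vunit_def by (rule vecI) simp

text \<open>Induction over the truncations of \<open>x\<close> to its first \<open>n\<close>
  coordinates. The number \<open>n\<close> is passed to \<open>P\<close> so that \<open>P\<close>
  can speak of a partial sum.\<close>

lemma vec_induct:
  assumes x: "x \<in> vec V k"
    and zero: "P 0 (vzero k)"
    and step: "\<And>n y. n < k \<Longrightarrow> y \<in> vec V k \<Longrightarrow> P n y \<Longrightarrow> P (Suc n) (vadd k y (vscale k (x n) (vunit k n)))"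
  shows "P k x"
proof -
  define tr where "tr n = (\<lambda>i\<in>{..<k}. if i < n then x i else 0)" for n
  have tr_vec: "tr n \<in> vec V k" for n
    unfolding tr_def by (rule vecI) (simp add: vec_mem[OF x])
  have "P n (tr n)" if "n \<le> k" for n
    using that
  proof (induction n)
    case 0
    have "tr 0 = vzero k" by (simp add: tr_def vzero_def)
    with zero show ?case by simp
  next
    case (Suc n)
    have "tr (Suc n) = vadd k (tr n) (vscale k (x n) (vunit k n))"
      by (rule vec_eqI[OF tr_vec]) (use Suc.prems x in
          \<open>auto simp: tr_def vec_mem less_Suc_eq intro!: vadd_vec tr_vec[unfolded tr_def]\<close>)
    with Suc step[OF _ tr_vec] show ?case by simp
  qed
  from this[of k] have "P k (tr k)" by simp
  moreover have "tr k = x"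
    by (rule vec_eqI[OF tr_vec x]) (simp add: tr_def)
  ultimately show ?thesis by simp
qed

context
  fixes V :: "'v set" and k :: nat and f :: "(nat \<Rightarrow> ('v, 'k::comm_ring_1) mpoly) \<Rightarrow> ('v, 'k) mpoly"
  assumes f: "lin_fun V k f"
begin

lemma lin_fun_closed: "x \<in> vec V k \<Longrightarrow> f x \<in> polys V"
  using f by (simp add: lin_fun_def)

lemma lin_fun_add: "x \<in> vec V k \<Longrightarrow> y \<in> vec V k \<Longrightarrow> f (vadd k x y) = f x + f y"
  using f by (simp add: lin_fun_def)

lemma lin_fun_scale: "a \<in> polys V \<Longrightarrow> x \<in> vec V k \<Longrightarrow> f (vscale k a x) = a * f x"
  using f by (simp add: lin_fun_def)

lemma lin_fun_zero: "f (vzero k) = 0"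
proof -
  have "vscale k 0 (vzero k) = (vzero k :: nat \<Rightarrow> ('v, 'k) mpoly)"
    by (auto simp: vscale_def vzero_def)
  then show ?thesis
    using lin_fun_scale[of 0 "vzero k"] by simp
qed

lemma lin_fun_expand:
  assumes x: "x \<in> vec V k"
  shows "f x = (\<Sum>i<k. x i * f (vunit k i))"
proof (rule vec_induct[OF x, where P = "\<lambda>n y. f y = (\<Sum>i<n. x i * f (vunit k i))"])
  show "f (vzero k) = (\<Sum>i<0. x i * f (vunit k i))" by (simp add: lin_fun_zero)
next
  fix n y assume "n < k" "y \<in> vec V k" "f y = (\<Sum>i<n. x i * f (vunit k i))"
  then show "f (vadd k y (vscale k (x n) (vunit k n))) = (\<Sum>i<Suc n. x i * f (vunit k i))"
    using x by (simp add: lin_fun_add lin_fun_scale vec_mem)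
qed

end

lemma lin_fun_coord: "i < k \<Longrightarrow> lin_fun V k (\<lambda>x. x i)"
  by (auto simp: lin_fun_def vec_mem)

lemma lin_fun_plus: "lin_fun V k f \<Longrightarrow> lin_fun V k g \<Longrightarrow> lin_fun V k (\<lambda>x. f x + g x)"
  by (simp add: lin_fun_def polys_closed algebra_simps)

lemma lin_fun_times: "a \<in> polys V \<Longrightarrow> lin_fun V k f \<Longrightarrow> lin_fun V k (\<lambda>x. a * f x)"
  by (simp add: lin_fun_def polys_closed algebra_simps)

lemma lin_fun_uminus: "lin_fun V k f \<Longrightarrow> lin_fun V k (\<lambda>x. - f x)"
  using lin_fun_times[OF polys_minus_one] by fastforce

lemma lin_fun_minus: "lin_fun V k f \<Longrightarrow> lin_fun V k g \<Longrightarrow> lin_fun V k (\<lambda>x. f x - g x)"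
  using lin_fun_plus[OF _ lin_fun_uminus] by fastforce

lemma lin_fun_0: "lin_fun V k (\<lambda>x. 0)"
  by (simp add: lin_fun_def)

lemma lin_fun_sum: "(\<And>i. i \<in> A \<Longrightarrow> lin_fun V k (f i)) \<Longrightarrow> lin_fun V k (\<lambda>x. \<Sum>i\<in>A. f i x)"
  by (induction A rule: infinite_finite_induct) (auto simp: lin_fun_0 lin_fun_plus)

lemma lin_fun_of_coeffs:
  assumes "\<And>i. i < k \<Longrightarrow> c i \<in> polys V"
  shows "lin_fun V k (\<lambda>x. \<Sum>i<k. x i * c i)"
proof (rule lin_fun_sum)
  fix i assume "i \<in> {..<k}"
  then show "lin_fun V k (\<lambda>x. x i * c i)"
    using lin_fun_times[OF assms lin_fun_coord, of i i] by (simp add: mult.commute)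
qed

lemma lin_fun_eq_on_units:
  assumes "lin_fun V k f" "lin_fun V k g" "\<And>i. i < k \<Longrightarrow> f (vunit k i) = g (vunit k i)" "x \<in> vec V k"
  shows "f x = g x"
  using assms by (simp add: lin_fun_expand[of V k f x] lin_fun_expand[of V k g x])

context
  fixes V :: "'v set" and k l :: nat
    and h :: "(nat \<Rightarrow> ('v, 'k::comm_ring_1) mpoly) \<Rightarrow> nat \<Rightarrow> ('v, 'k) mpoly"
  assumes h: "lin_map V k l h"
begin

lemma lin_map_vec: "x \<in> vec V k \<Longrightarrow> h x \<in> vec V l"
  using h by (simp add: lin_map_def)

lemma lin_map_coord: "i < l \<Longrightarrow> lin_fun V k (\<lambda>x. h x i)"
  using h by (simp add: lin_map_def)

lemma lin_map_add: "x \<in> vec V k \<Longrightarrow> y \<in> vec V k \<Longrightarrow> h (vadd k x y) = vadd l (h x) (h y)"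
  by (rule vec_eqI[of _ V l]) (auto simp: lin_map_vec lin_fun_add[OF lin_map_coord])

lemma lin_map_scale: "a \<in> polys V \<Longrightarrow> x \<in> vec V k \<Longrightarrow> h (vscale k a x) = vscale l a (h x)"
  by (rule vec_eqI[of _ V l]) (auto simp: lin_map_vec lin_fun_scale[OF lin_map_coord])

lemma lin_map_zero: "h (vzero k) = vzero l"
  by (rule vec_eqI[of _ V l]) (simp_all add: lin_map_vec lin_fun_zero[OF lin_map_coord])

lemma lin_fun_compose: "lin_fun V l f \<Longrightarrow> lin_fun V k (\<lambda>x. f (h x))"
  by (simp add: lin_fun_def lin_map_vec lin_map_add lin_map_scale)

end

lemma lin_mapI:
  assumes "\<And>x. x \<in> vec V k \<Longrightarrow> h x \<in> vec V l"
    and "\<And>x y. x \<in> vec V k \<Longrightarrow> y \<in> vec V k \<Longrightarrow> h (vadd k x y) = vadd l (h x) (h y)"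
    and "\<And>a x. a \<in> polys V \<Longrightarrow> x \<in> vec V k \<Longrightarrow> h (vscale k a x) = vscale l a (h x)"
  shows "lin_map V k l h"
  using assms by (auto simp: lin_map_def lin_fun_def dest!: vec_mem[OF assms(1)])

text \<open>The universal property of a free module.\<close>

lemma lin_map_of_units:
  assumes w: "\<And>i. i < k \<Longrightarrow> w i \<in> vec V l"
  obtains h where "lin_map V k l h" "\<And>i. i < k \<Longrightarrow> h (vunit k i) = w i"
proof
  let ?h = "\<lambda>x. \<lambda>j\<in>{..<l}. \<Sum>i<k. x i * w i j"
  have w': "w i j \<in> polys V" if "i < k" "j < l" for i j
    using vec_mem[OF w] that by blast
  show lin: "lin_map V k l ?h"
    unfolding lin_map_def
  proof (intro conjI ballI allI impI)
    fix j assume "j < l"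
    then show "lin_fun V k (\<lambda>x. (\<lambda>j\<in>{..<l}. \<Sum>i<k. x i * w i j) j)"
      using lin_fun_of_coeffs[of k "\<lambda>i. w i j" V] w' by simp
  qed (auto simp: vec_mem intro!: vecI polys_closed w')
  show "?h (vunit k i) = w i" if i: "i < k" for i
  proof (rule vec_eqI[of _ V l])
    show "?h (vunit k i) \<in> vec V l" by (rule lin_map_vec[OF lin vunit_vec])
    fix j assume j: "j < l"
    have "(\<Sum>a<k. vunit k i a * w a j) = (\<Sum>a<k. if a = i then w a j else 0)"
      by (rule sum.cong) auto
    also have "\<dots> = w i j" using i by simp
    finally show "?h (vunit k i) j = w i j" using j by simp
  qed (rule w[OF i])
qed

lemma lin_map_eq_on_units:
  assumes "lin_map V k l g" "lin_map V k l h" "\<And>i. i < k \<Longrightarrow> g (vunit k i) = h (vunit k i)" "x \<in> vec V k"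
  shows "g x = h x"
proof (rule vec_eqI[of _ V l])
  fix i assume "i < l"
  then show "g x i = h x i"
    using lin_fun_eq_on_units[OF lin_map_coord[OF assms(1)] lin_map_coord[OF assms(2)], of i i x]
      assms(3,4) by simp
qed (use assms lin_map_vec in blast)+

lemma lin_map_compose: "lin_map V k l g \<Longrightarrow> lin_map V l m h \<Longrightarrow> lin_map V k m (\<lambda>x. h (g x))"
  by (rule lin_mapI) (simp_all add: lin_map_vec lin_map_add lin_map_scale)

lemma linear_maps_free_iff:
  "h \<in> linear_maps (poly_ring V) (free_module (poly_ring V) k) (free_module (poly_ring V) l) \<longleftrightarrow>
   h \<in> extensional (vec V k) \<and> lin_map V k l h"
proof -
  have "lin_map V k l h \<longleftrightarrow> (\<forall>x\<in>vec V k. h x \<in> vec V l) \<and>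
     (\<forall>x\<in>vec V k. \<forall>y\<in>vec V k. h (vadd k x y) = vadd l (h x) (h y)) \<and>
     (\<forall>a\<in>polys V. \<forall>x\<in>vec V k. h (vscale k a x) = vscale l a (h x))"
    by (auto simp: lin_map_vec lin_map_add lin_map_scale intro!: lin_mapI)
  then show ?thesis
    by (auto simp: linear_maps_def free_module_def vadd_def[symmetric] vscale_def[symmetric]
        vec_def[symmetric] PiE_iff)
qed

lemma linear_maps_ring_iff:
  "f \<in> linear_maps (poly_ring V) (free_module (poly_ring V) k) (ring_module (poly_ring V)) \<longleftrightarrow>
   f \<in> extensional (vec V k) \<and> lin_fun V k f"
  by (auto simp: linear_maps_def lin_fun_def free_module_def ring_module_def vadd_def[symmetric]
      vscale_def[symmetric] vec_def[symmetric] PiE_iff)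

subsection \<open>The connecting isomorphisms of a regular sequence\<close>

text \<open>A free resolution of S/I in which the augmentation has been lifted to a functional
  \<open>ev\<close> into S. Exactness at the end then speaks of membership in I instead of cosets,
  and \<open>u\<close> is a vector that is sent to 1 modulo I.\<close>

locale poly_resolution =
  fixes V :: "'v set" and I :: "('v, 'k::field) mpoly set"
    and k :: "nat \<Rightarrow> nat" and d :: "nat \<Rightarrow> (nat \<Rightarrow> ('v, 'k) mpoly) \<Rightarrow> nat \<Rightarrow> ('v, 'k) mpoly"
    and ev :: "(nat \<Rightarrow> ('v, 'k) mpoly) \<Rightarrow> ('v, 'k) mpoly" and u :: "nat \<Rightarrow> ('v, 'k) mpoly"
  assumes I: "ideal I (poly_ring V)"
    and d_lin: "\<And>i. lin_map V (k (Suc i)) (k i) (d i)"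
    and ev_lin: "lin_fun V (k 0) ev"
    and exact_0: "\<And>x. x \<in> vec V (k 0) \<Longrightarrow> ev x \<in> I \<longleftrightarrow> x \<in> d 0 ` vec V (k (Suc 0))"
    and exact_Suc: "\<And>i x. x \<in> vec V (k (Suc i)) \<Longrightarrow>
      d i x = vzero (k i) \<longleftrightarrow> x \<in> d (Suc i) ` vec V (k (Suc (Suc i)))"
    and u_vec: "u \<in> vec V (k 0)" and ev_u: "ev u - 1 \<in> I"
begin

lemma dd: "x \<in> vec V (k (Suc (Suc i))) \<Longrightarrow> d i (d (Suc i) x) = vzero (k i)"
  using exact_Suc[of "d (Suc i) x" i] lin_map_vec[OF d_lin] by blast

text \<open>Free modules are projective: preimages are chosen for the unit vectors only and extended
  linearly.\<close>

lemma lift_through: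
  assumes g: "lin_map V l (k n) g" and im: "\<And>x. x \<in> vec V l \<Longrightarrow> g x \<in> d n ` vec V (k (Suc n))"
  obtains h where "lin_map V l (k (Suc n)) h" "\<And>x. x \<in> vec V l \<Longrightarrow> d n (h x) = g x"
proof -
  have "\<forall>i. \<exists>w. w \<in> vec V (k (Suc n)) \<and> d n w = g (vunit l i)"
    using im[OF vunit_vec] by (metis imageE)
  then obtain w where w: "\<And>i. w i \<in> vec V (k (Suc n))" "\<And>i. d n (w i) = g (vunit l i)"
    by metis
  obtain h where h: "lin_map V l (k (Suc n)) h" "\<And>i. i < l \<Longrightarrow> h (vunit l i) = w i"
    using lin_map_of_units[of l w V "k (Suc n)"] w(1) by blast
  have "d n (h x) = g x" if "x \<in> vec V l" for x
    by (rule lin_map_eq_on_units[OF lin_map_compose[OF h(1) d_lin] g _ that]) (simp add: h(2) w(2))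
  with h(1) show thesis by (rule that)
qed

lemma lin_map_vscale: "a \<in> polys V \<Longrightarrow> lin_map V l l (vscale l a)"
  by (rule lin_mapI) (simp_all, auto simp: vadd_def vscale_def algebra_simps)

text \<open>Multiplication by an element \<open>s\<close> of \<open>I\<close> is null-homotopic; \<open>homotopic_at\<close> is the part of the
  homotopy equation in degree \<open>j\<close> that is needed to extend the homotopy to degree \<open>j + 1\<close>.\<close>

definition homotopic_at where
  "homotopic_at s j h \<longleftrightarrow> lin_map V (k j) (k (Suc j)) h \<and>
     (\<forall>x\<in>vec V (k (Suc j)). d j (h (d j x)) = vscale (k j) s (d j x))"

text \<open>\<open>ev\<close> takes \<open>s * x\<close> into I, so exactness puts multiplication by
  \<open>s\<close> into the image of \<open>d 0\<close>.\<close>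

lemma homotopy_0:
  assumes s: "s \<in> I"
  obtains h where "lin_map V (k 0) (k (Suc 0)) h" "homotopic_at s 0 h"
    "\<And>x. x \<in> vec V (k 0) \<Longrightarrow> d 0 (h x) = vscale (k 0) s x"
proof -
  note sp = poly_ideal_carrier[OF I s]
  have "vscale (k 0) s x \<in> d 0 ` vec V (k (Suc 0))" if x: "x \<in> vec V (k 0)" for x
  proof -
    have "ev (vscale (k 0) s x) \<in> I"
      unfolding lin_fun_scale[OF ev_lin sp x]
      by (rule poly_ideal_mult2[OF I lin_fun_closed[OF ev_lin x] s])
    then show ?thesis using exact_0[of "vscale (k 0) s x"] x sp by simp
  qed
  then obtain h where h: "lin_map V (k 0) (k (Suc 0)) h"
    "\<And>x. x \<in> vec V (k 0) \<Longrightarrow> d 0 (h x) = vscale (k 0) s x"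
    using lift_through[OF lin_map_vscale[OF sp]] by metis
  have "homotopic_at s 0 h"
    unfolding homotopic_at_def using h lin_map_vec[OF d_lin] by blast
  with h show thesis using that by blast
qed

text \<open>The map \<open>x \<mapsto> s * x - h (d j x)\<close> has values in the kernel of
  \<open>d j\<close>, which is what \<open>homotopic_at\<close> expresses. By exactness it lifts
  through \<open>d (Suc j)\<close>, and the lift is the next homotopy.\<close>

lemma homotopy_Suc:
  assumes s: "s \<in> I" and h: "homotopic_at s j h"
  obtains h' where "homotopic_at s (Suc j) h'"
    "\<And>x i. x \<in> vec V (k (Suc j)) \<Longrightarrow> i < k (Suc j) \<Longrightarrow> d (Suc j) (h' x) i + h (d j x) i = s * x i"
proof -
  note sp = poly_ideal_carrier[OF I s]
  note hl = conjunct1[OF h[unfolded homotopic_at_def]]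
  let ?g = "\<lambda>x. vadd (k (Suc j)) (vscale (k (Suc j)) s x) (vscale (k (Suc j)) (- 1) (h (d j x)))"
  have hd: "lin_map V (k (Suc j)) (k (Suc j)) (\<lambda>x. h (d j x))"
    by (rule lin_map_compose[OF d_lin hl])
  have g_lin: "lin_map V (k (Suc j)) (k (Suc j)) ?g"
    unfolding lin_map_def
  proof (intro conjI ballI allI impI)
    fix x :: "nat \<Rightarrow> ('v, 'k) mpoly" assume "x \<in> vec V (k (Suc j))"
    then show "?g x \<in> vec V (k (Suc j))"
      by (intro vadd_vec vscale_vec lin_map_vec[OF hd] sp polys_minus_one)
  next
    fix i assume i: "i < k (Suc j)"
    have "lin_fun V (k (Suc j)) (\<lambda>x. s * x i + - 1 * h (d j x) i)"
      by (intro lin_fun_plus lin_fun_times lin_fun_coord lin_map_coord[OF hd] i sp polys_minus_one)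
    then show "lin_fun V (k (Suc j)) (\<lambda>x. ?g x i)" using i by simp
  qed
  have "?g x \<in> d (Suc j) ` vec V (k (Suc (Suc j)))" if x: "x \<in> vec V (k (Suc j))" for x
  proof -
    have v: "vscale (k (Suc j)) s x \<in> vec V (k (Suc j))"
      "vscale (k (Suc j)) (- 1) (h (d j x)) \<in> vec V (k (Suc j))"
      using x by (intro vscale_vec lin_map_vec[OF hd] sp polys_minus_one; assumption)+
    have "d j (?g x) = vadd (k j) (vscale (k j) s (d j x)) (vscale (k j) (- 1) (d j (h (d j x))))"
      using x v by (simp add: lin_map_add[OF d_lin] lin_map_scale[OF d_lin] sp polys_minus_one
          lin_map_vec[OF hd])
    also have "\<dots> = vzero (k j)"
      using h x by (auto simp: homotopic_at_def vadd_def vscale_def vzero_def)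
    finally show ?thesis
      using exact_Suc[of "?g x" j] lin_map_vec[OF g_lin x] by simp
  qed
  then obtain h' where h': "lin_map V (k (Suc j)) (k (Suc (Suc j))) h'"
    "\<And>x. x \<in> vec V (k (Suc j)) \<Longrightarrow> d (Suc j) (h' x) = ?g x"
    using lift_through[OF g_lin] by metis
  have "d (Suc j) (h' (d (Suc j) x)) = vscale (k (Suc j)) s (d (Suc j) x)"
    if x: "x \<in> vec V (k (Suc (Suc j)))" for x
  proof -
    note dx = lin_map_vec[OF d_lin x]
    show ?thesis
      unfolding h'(2)[OF dx] dd[OF x] lin_map_zero[OF hl]
      by (auto simp: vadd_def vscale_def vzero_def)
  qed
  with h'(1) have "homotopic_at s (Suc j) h'" by (simp add: homotopic_at_def)
  moreover have "d (Suc j) (h' x) i + h (d j x) i = s * x i"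
    if "x \<in> vec V (k (Suc j))" "i < k (Suc j)" for x i
    using that by (simp add: h'(2))
  ultimately show thesis using that by blast
qed

lemma homotopy:
  assumes s: "s \<in> I"
  obtains h where "homotopic_at s j h"
proof -
  have "\<exists>h. homotopic_at s j h"
  proof (induction j)
    case 0
    then show ?case using homotopy_0[OF s] by metis
  next
    case (Suc j)
    then show ?case using homotopy_Suc[OF s] by metis
  qed
  then show thesis using that by blast
qed

end

section \<open>Ext modulo initial segments of a regular sequence\<close>

locale regular_resolution = poly_resolution V I k d ev u
  for V :: "'v set" and I :: "('v, 'k::field) mpoly set" and k d ev u +
  fixes f :: "nat \<Rightarrow> ('v, 'k) mpoly" and c :: nat
  assumes f_in: "\<And>i. i < c \<Longrightarrow> f i \<in> I"
    and regular: "\<And>r g. r < c \<Longrightarrow> g \<in> polys V \<Longrightarrow> f r * g \<in> ideal_span V f {..<r} \<Longrightarrow>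
      g \<in> ideal_span V f {..<r}"
begin

abbreviation J where "J r \<equiv> ideal_span V f {..<r}"

lemma f_polys: "i < c \<Longrightarrow> f i \<in> polys V"
  using f_in poly_ideal_carrier[OF I] by blast

lemma J_ideal: "r \<le> c \<Longrightarrow> ideal (J r) (poly_ring V)"
  by (rule ideal_span_ideal) (use f_polys in auto)

lemma J_0: "J 0 = {0}"
  by (auto simp: ideal_span_def)

lemmas J_0' = J_0 J_0[simplified]

lemma J_Suc: "p \<in> J (Suc r) \<longleftrightarrow> (\<exists>a\<in>J r. \<exists>b\<in>polys V. p = f r * b + a)"
proof
  assume "p \<in> J (Suc r)"
  then obtain b where b: "p = (\<Sum>i<Suc r. b i * f i)" "\<forall>i<Suc r. b i \<in> polys V"
    by (auto simp: ideal_span_def)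
  then have "(\<Sum>i<r. b i * f i) \<in> J r" "b r \<in> polys V" by (auto simp: ideal_span_def)
  with b(1) show "\<exists>a\<in>J r. \<exists>b\<in>polys V. p = f r * b + a"
    by (intro bexI[of _ "\<Sum>i<r. b i * f i"] bexI[of _ "b r"]) (auto simp: algebra_simps)
next
  assume "\<exists>a\<in>J r. \<exists>b\<in>polys V. p = f r * b + a"
  then obtain a b where "p = f r * b + (\<Sum>i<r. a i * f i)" "\<forall>i<r. a i \<in> polys V" "b \<in> polys V"
    by (auto simp: ideal_span_def)
  then show "p \<in> J (Suc r)"
    unfolding ideal_span_def
    by (intro CollectI exI[of _ "a(r := b)"]) (auto simp: algebra_simps less_Suc_eq)
qed

lemma J_mono: "J r \<subseteq> J (Suc r)"
proof
  fix p assume "p \<in> J r"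
  then show "p \<in> J (Suc r)" unfolding J_Suc by (intro bexI[of _ p] bexI[of _ 0]) auto
qed

lemma f_J_Suc: "b \<in> polys V \<Longrightarrow> r < c \<Longrightarrow> f r * b \<in> J (Suc r)"
  unfolding J_Suc by (intro bexI[of _ 0] bexI[of _ b] poly_ideal_0[OF J_ideal]) auto

text \<open>Cocycles of the complex Hom(F, S/J r), represented by functionals into S: since the
  modules of the resolution are free, every functional into the quotient lifts. This avoids cosets
  until the very end.\<close>

definition cocycle where
  "cocycle r j \<phi> \<longleftrightarrow> lin_fun V (k j) \<phi> \<and> (\<forall>x\<in>vec V (k (Suc j)). \<phi> (d j x) \<in> J r)"

text \<open>In degree 0 the only coboundary is zero modulo \<open>J r\<close>.\<close>

fun boundary_of where
  "boundary_of r 0 \<phi> \<longleftrightarrow> (\<forall>x\<in>vec V (k 0). \<phi> x \<in> J r)"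
| "boundary_of r (Suc i) \<phi> \<longleftrightarrow> (\<exists>\<chi>. lin_fun V (k i) \<chi> \<and> (\<forall>x\<in>vec V (k (Suc i)). \<phi> x - \<chi> (d i x) \<in> J r))"

text \<open>The quotient by \<open>f r\<close> is chosen on the unit vectors and extended linearly;
  choosing it pointwise would not give a functional.\<close>

lemma lin_fun_J_Suc:
  assumes r: "r < c" and g: "lin_fun V l g" and gJ: "\<And>x. x \<in> vec V l \<Longrightarrow> g x \<in> J (Suc r)"
  obtains a where "lin_fun V l a" "\<And>x. x \<in> vec V l \<Longrightarrow> g x - f r * a x \<in> J r"
proof -
  note Jr = J_ideal[OF less_imp_le[OF r]]
  have "\<forall>i. \<exists>b. b \<in> polys V \<and> g (vunit l i) - f r * b \<in> J r"
    using gJ[OF vunit_vec] unfolding J_Suc by (metis add_diff_cancel_left')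
  then obtain b where b: "\<And>i. b i \<in> polys V" "\<And>i. g (vunit l i) - f r * b i \<in> J r" by metis
  let ?a = "\<lambda>x. \<Sum>i<l. x i * b i"
  have a: "lin_fun V l ?a" by (rule lin_fun_of_coeffs) (rule b(1))
  have "g x - f r * ?a x \<in> J r" if x: "x \<in> vec V l" for x
  proof -
    have "g x - f r * ?a x = (\<Sum>i<l. x i * (g (vunit l i) - f r * b i))"
      unfolding lin_fun_expand[OF g x]
      by (simp add: sum_distrib_left sum_subtractf[symmetric] algebra_simps)
    also have "\<dots> \<in> J r"
      by (rule poly_ideal_sum[OF Jr], rule poly_ideal_mult[OF Jr]) (use vec_mem[OF x] b(2) in auto)
    finally show ?thesis .
  qed
  with a show thesis by (rule that)
qed

text \<open>Since \<open>f r\<close> lies in I, multiplication by it is null-homotopic on the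
  resolution, hence zero on Ext(S/I, S/J r).\<close>

lemma annihilate:
  assumes r: "r < c" and \<phi>: "cocycle r j \<phi>"
  shows "boundary_of r j (\<lambda>x. f r * \<phi> x)"
proof (cases j)
  case 0
  obtain h where h: "lin_map V (k 0) (k (Suc 0)) h"
    "\<And>x. x \<in> vec V (k 0) \<Longrightarrow> d 0 (h x) = vscale (k 0) (f r) x"
    using homotopy_0[OF f_in[OF r]] by metis
  have "f r * \<phi> x \<in> J r" if x: "x \<in> vec V (k 0)" for x
  proof -
    have "\<phi> (d 0 (h x)) \<in> J r"
      using \<phi> 0 lin_map_vec[OF h(1) x] by (simp add: cocycle_def)
    moreover have "\<phi> (d 0 (h x)) = f r * \<phi> x"
      unfolding h(2)[OF x] by (rule lin_fun_scale) (use \<phi> 0 f_polys[OF r] x in \<open>auto simp: cocycle_def\<close>)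
    ultimately show ?thesis by simp
  qed
  with 0 show ?thesis by simp
next
  case (Suc i)
  obtain h where h: "homotopic_at (f r) i h"
    using homotopy[OF f_in[OF r]] by blast
  obtain h' where h': "homotopic_at (f r) (Suc i) h'"
    "\<And>x l. x \<in> vec V (k (Suc i)) \<Longrightarrow> l < k (Suc i) \<Longrightarrow> d (Suc i) (h' x) l + h (d i x) l = f r * x l"
    using homotopy_Suc[OF f_in[OF r] h] by blast
  have hl: "lin_map V (k i) (k (Suc i)) h" "lin_map V (k (Suc i)) (k (Suc (Suc i))) h'"
    using h h' by (simp_all add: homotopic_at_def)
  have \<phi>': "lin_fun V (k (Suc i)) \<phi>" using \<phi> Suc by (simp add: cocycle_def)
  have "f r * \<phi> x - \<phi> (h (d i x)) \<in> J r" if x: "x \<in> vec V (k (Suc i))" for x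
  proof -
    note v = lin_map_vec[OF d_lin lin_map_vec[OF hl(2) x]] lin_map_vec[OF hl(1) lin_map_vec[OF d_lin x]]
    have "vscale (k (Suc i)) (f r) x = vadd (k (Suc i)) (d (Suc i) (h' x)) (h (d i x))"
      by (rule vec_eqI[of _ V "k (Suc i)"]) (use v x h'(2) f_polys[OF r] in auto)
    then have "f r * \<phi> x = \<phi> (d (Suc i) (h' x)) + \<phi> (h (d i x))"
      using lin_fun_scale[OF \<phi>' f_polys[OF r] x] lin_fun_add[OF \<phi>' v] by simp
    moreover have "\<phi> (d (Suc i) (h' x)) \<in> J r"
      using \<phi> Suc lin_map_vec[OF hl(2) x] by (simp add: cocycle_def)
    ultimately show ?thesis by simp
  qed
  then have "boundary_of r (Suc i) (\<lambda>x. f r * \<phi> x)"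
    using lin_fun_compose[OF hl(1) \<phi>'] by (auto intro!: exI[of _ "\<lambda>x. \<phi> (h x)"])
  with Suc show ?thesis by simp
qed

lemma boundary_of_diff:
  assumes "r \<le> c" "boundary_of r j \<phi>" "boundary_of r j \<psi>"
  shows "boundary_of r j (\<lambda>x. \<phi> x - \<psi> x)"
proof (cases j)
  case 0
  with assms show ?thesis by (simp add: poly_ideal_diff[OF J_ideal])
next
  case (Suc i)
  then obtain a b where "lin_fun V (k i) a" "lin_fun V (k i) b"
    "\<And>x. x \<in> vec V (k (Suc i)) \<Longrightarrow> \<phi> x - a (d i x) \<in> J r"
    "\<And>x. x \<in> vec V (k (Suc i)) \<Longrightarrow> \<psi> x - b (d i x) \<in> J r"
    using assms by auto
  then have "lin_fun V (k i) (\<lambda>x. a x - b x)"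
    "\<And>x. x \<in> vec V (k (Suc i)) \<Longrightarrow> (\<phi> x - a (d i x)) - (\<psi> x - b (d i x)) \<in> J r"
    using poly_ideal_diff[OF J_ideal[OF assms(1)]] lin_fun_minus by blast+
  with Suc show ?thesis
    by (auto intro!: exI[of _ "\<lambda>x. a x - b x"] simp: algebra_simps)
qed

lemma boundary_of_J:
  assumes "r \<le> c" "\<And>x. x \<in> vec V (k j) \<Longrightarrow> \<phi> x \<in> J r"
  shows "boundary_of r j \<phi>"
  using assms by (cases j) (auto intro!: exI[of _ "\<lambda>x. 0"] lin_fun_0)

lemma boundary_of_mono: "boundary_of r j \<phi> \<Longrightarrow> boundary_of (Suc r) j \<phi>"
  using J_mono[of r] by (cases j) (simp_all, blast+)

text \<open>If \<open>\<psi> = \<delta>\<chi> + l\<close> modulo \<open>J (r + 1)\<close> then \<open>\<delta>\<psi>\<close> is \<open>f r\<close> times a coboundary modulo \<open>J r\<close>.\<close>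

lemma differential_of_boundary:
  assumes r: "r < c" and \<psi>: "lin_fun V (k j) \<psi>" "boundary_of (Suc r) j \<psi>"
  obtains a where "lin_fun V (k j) a" "\<And>x. x \<in> vec V (k (Suc j)) \<Longrightarrow> \<psi> (d j x) - f r * a (d j x) \<in> J r"
proof (cases j)
  case 0
  then obtain a where "lin_fun V (k 0) a" "\<And>x. x \<in> vec V (k 0) \<Longrightarrow> \<psi> x - f r * a x \<in> J r"
    using lin_fun_J_Suc[OF r, of "k 0" \<psi>] \<psi> by auto
  with 0 show thesis using that[of a] lin_map_vec[OF d_lin] by blast
next
  case (Suc i)
  then obtain \<chi> where \<chi>: "lin_fun V (k i) \<chi>" "\<And>x. x \<in> vec V (k (Suc i)) \<Longrightarrow> \<psi> x - \<chi> (d i x) \<in> J (Suc r)"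
    using \<psi> by auto
  have lin: "lin_fun V (k j) (\<lambda>x. \<psi> x - \<chi> (d i x))"
    using lin_fun_minus[OF \<psi>(1)] lin_fun_compose[OF d_lin \<chi>(1)] Suc by simp
  obtain a where a: "lin_fun V (k j) a"
    "\<And>x. x \<in> vec V (k j) \<Longrightarrow> (\<psi> x - \<chi> (d i x)) - f r * a x \<in> J r"
    by (rule lin_fun_J_Suc[OF r lin]) (use \<chi>(2) Suc in auto)
  have "\<psi> (d j x) - f r * a (d j x) \<in> J r" if x: "x \<in> vec V (k (Suc j))" for x
    using a(2)[OF lin_map_vec[OF d_lin x]] dd[of x i] x Suc lin_fun_zero[OF \<chi>(1)] by simp
  with a(1) show thesis by (rule that)
qed

text \<open>The vanishing of Ext below the grade, by following the long exact sequence of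
  multiplication by \<open>f r\<close> on S/J r: \<open>f r * \<phi>\<close> is the coboundary of
  some \<open>\<psi>\<close>, which is a cocycle modulo \<open>J (Suc r)\<close> one degree lower.
  There it is a coboundary, and \<open>f r\<close> can be cancelled.\<close>

lemma vanish: "j + r < c \<Longrightarrow> cocycle r j \<phi> \<Longrightarrow> boundary_of r j \<phi>"
proof (induction j arbitrary: r \<phi>)
  case 0
  then have r: "r < c" by simp
  have "boundary_of r 0 (\<lambda>x. f r * \<phi> x)" by (rule annihilate[OF r 0(2)])
  then show ?case
    using regular[OF r] 0(2) lin_fun_closed[of V "k 0" \<phi>] by (simp add: cocycle_def)
next
  case (Suc j)
  then have r: "r < c" and r': "j + Suc r < c" by simp_all
  have \<phi>: "lin_fun V (k (Suc j)) \<phi>" using Suc.prems by (simp add: cocycle_def)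
  obtain \<psi> where \<psi>: "lin_fun V (k j) \<psi>"
    "\<And>x. x \<in> vec V (k (Suc j)) \<Longrightarrow> f r * \<phi> x - \<psi> (d j x) \<in> J r"
    using annihilate[OF r Suc.prems(2)] by auto
  note Jr = J_ideal[OF less_imp_le[OF r]] and Jr' = J_ideal[OF Suc_leI[OF r]]
  have "\<psi> (d j x) \<in> J (Suc r)" if x: "x \<in> vec V (k (Suc j))" for x
    using poly_ideal_diff[OF Jr' f_J_Suc[OF lin_fun_closed[OF \<phi> x] r], of "f r * \<phi> x - \<psi> (d j x)"]
      \<psi>(2)[OF x] J_mono by auto
  with \<psi>(1) have "cocycle (Suc r) j \<psi>" by (simp add: cocycle_def)
  then have "boundary_of (Suc r) j \<psi>" by (rule Suc.IH[OF r'])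
  then obtain a where a: "lin_fun V (k j) a"
    "\<And>x. x \<in> vec V (k (Suc j)) \<Longrightarrow> \<psi> (d j x) - f r * a (d j x) \<in> J r"
    using differential_of_boundary[OF r \<psi>(1)] by metis
  have "\<phi> x - a (d j x) \<in> J r" if x: "x \<in> vec V (k (Suc j))" for x
  proof (rule regular[OF r])
    show "\<phi> x - a (d j x) \<in> polys V"
      using lin_fun_closed[OF \<phi> x] lin_fun_closed[OF a(1) lin_map_vec[OF d_lin x]] by (rule polys_diff)
    show "f r * (\<phi> x - a (d j x)) \<in> J r"
      using poly_ideal_add[OF Jr \<psi>(2)[OF x] a(2)[OF x]] by (simp add: algebra_simps)
  qed
  with a(1) show ?case by auto
qed

section \<open>The isomorphism with the colon ideal\<close>

definition colon where "colon = {g \<in> polys V. \<forall>a\<in>I. g * a \<in> J c}"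

text \<open>Says that \<open>\<theta>\<close> induces an isomorphism of Ext^j(S/I, S/J r) onto
  \<open>colon\<close> modulo \<open>J c\<close>. It is phrased on representatives and only up to
  \<open>J c\<close>, because the maps obtained from \<open>induces_iso_Suc\<close> depend on
  choices.\<close>

definition induces_iso where
  "induces_iso r j \<theta> \<longleftrightarrow>
     (\<forall>\<phi>. cocycle r j \<phi> \<longrightarrow> \<theta> \<phi> \<in> colon) \<and>
     (\<forall>\<phi> \<psi>. cocycle r j \<phi> \<longrightarrow> cocycle r j \<psi> \<longrightarrow> \<theta> (\<lambda>x. \<phi> x + \<psi> x) - (\<theta> \<phi> + \<theta> \<psi>) \<in> J c) \<and>
     (\<forall>a\<in>polys V. \<forall>\<phi>. cocycle r j \<phi> \<longrightarrow> \<theta> (\<lambda>x. a * \<phi> x) - a * \<theta> \<phi> \<in> J c) \<and>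
     (\<forall>\<phi>. cocycle r j \<phi> \<longrightarrow> \<theta> \<phi> \<in> J c \<longleftrightarrow> boundary_of r j \<phi>) \<and>
     (\<forall>g\<in>colon. \<exists>\<phi>. cocycle r j \<phi> \<and> \<theta> \<phi> - g \<in> J c)"

lemma cocycle_add: "r \<le> c \<Longrightarrow> cocycle r j \<phi> \<Longrightarrow> cocycle r j \<psi> \<Longrightarrow> cocycle r j (\<lambda>x. \<phi> x + \<psi> x)"
  by (simp add: cocycle_def lin_fun_plus poly_ideal_add[OF J_ideal])

lemma cocycle_diff: "r \<le> c \<Longrightarrow> cocycle r j \<phi> \<Longrightarrow> cocycle r j \<psi> \<Longrightarrow> cocycle r j (\<lambda>x. \<phi> x - \<psi> x)"
  by (simp add: cocycle_def lin_fun_minus poly_ideal_diff[OF J_ideal])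

lemma cocycle_times: "r \<le> c \<Longrightarrow> a \<in> polys V \<Longrightarrow> cocycle r j \<phi> \<Longrightarrow> cocycle r j (\<lambda>x. a * \<phi> x)"
  by (simp add: cocycle_def lin_fun_times poly_ideal_mult[OF J_ideal])

lemma induces_iso_cong:
  assumes r: "r \<le> c" and \<theta>: "induces_iso r j \<theta>" and c: "cocycle r j \<phi>" "cocycle r j \<psi>"
    and b: "boundary_of r j (\<lambda>x. \<phi> x - \<psi> x)"
  shows "\<theta> \<phi> - \<theta> \<psi> \<in> J c"
proof -
  have "cocycle r j (\<lambda>x. \<phi> x - \<psi> x)" by (rule cocycle_diff[OF r c])
  moreover from this b have "\<theta> (\<lambda>x. \<phi> x - \<psi> x) \<in> J c" using \<theta> by (simp add: induces_iso_def)
  ultimately have "\<theta> (\<lambda>x. (\<phi> x - \<psi> x) + \<psi> x) - (\<theta> (\<lambda>x. \<phi> x - \<psi> x) + \<theta> \<psi>) \<in> J c"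
    using \<theta> c(2) unfolding induces_iso_def by blast
  then show ?thesis
    using poly_ideal_add[OF J_ideal[OF order_refl] _ \<open>\<theta> (\<lambda>x. \<phi> x - \<psi> x) \<in> J c\<close>] by fastforce
qed

text \<open>A homomorphism from S/I is determined by the image of 1, which \<open>u\<close>
  represents; conversely an element \<open>g\<close> of the colon ideal gives
  \<open>g * ev\<close>.\<close>

lemma induces_iso_0: "induces_iso c 0 (\<lambda>\<phi>. \<phi> u)"
  unfolding induces_iso_def
proof (intro conjI allI impI ballI)
  note Jc = J_ideal[OF order_refl]
  have rep: "\<exists>y\<in>vec V (k (Suc 0)). \<phi> x - ev x * \<phi> u = \<phi> (d 0 y)"
    if \<phi>: "lin_fun V (k 0) \<phi>" and x: "x \<in> vec V (k 0)" for \<phi> x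
  proof -
    note ex = lin_fun_closed[OF ev_lin x]
    \<comment> \<open>Subtracting the multiple of \<open>u\<close> with the same augmentation leaves
      an element that \<open>ev\<close> maps into I, hence a boundary.\<close>
    let ?z = "vadd (k 0) x (vscale (k 0) (- ev x) u)"
    have z: "?z \<in> vec V (k 0)" by (intro vadd_vec vscale_vec x u_vec polys_uminus ex)
    have v: "vscale (k 0) (- ev x) u \<in> vec V (k 0)" by (intro vscale_vec u_vec polys_uminus ex)
    have "ev ?z = ev x - ev x * ev u"
      by (simp add: lin_fun_add[OF ev_lin x v] lin_fun_scale[OF ev_lin polys_uminus[OF ex] u_vec])
    also have "\<dots> = - ev x * (ev u - 1)" by (simp add: algebra_simps)
    also have "\<dots> \<in> I" by (rule poly_ideal_mult[OF I polys_uminus[OF ex] ev_u])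
    finally obtain y where "y \<in> vec V (k (Suc 0))" "?z = d 0 y" using exact_0[OF z] by blast
    moreover have "\<phi> ?z = \<phi> x - ev x * \<phi> u"
      by (simp add: lin_fun_add[OF \<phi> x v] lin_fun_scale[OF \<phi> polys_uminus[OF ex] u_vec])
    ultimately show ?thesis by metis
  qed
  fix \<phi> assume \<phi>: "cocycle c 0 \<phi>"
  then have \<phi>l: "lin_fun V (k 0) \<phi>" by (simp add: cocycle_def)
  note \<phi>u = lin_fun_closed[OF \<phi>l u_vec]
  show "\<phi> u \<in> colon"
    unfolding colon_def
  proof (intro CollectI conjI ballI \<phi>u)
    fix a assume a: "a \<in> I"
    note ac = poly_ideal_carrier[OF I a]
    have "ev (vscale (k 0) a u) \<in> I"
      unfolding lin_fun_scale[OF ev_lin ac u_vec]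
      by (rule poly_ideal_mult2[OF I lin_fun_closed[OF ev_lin u_vec] a])
    then obtain y where "y \<in> vec V (k (Suc 0))" "vscale (k 0) a u = d 0 y"
      using exact_0[OF vscale_vec[OF ac u_vec]] by blast
    then have "\<phi> (vscale (k 0) a u) \<in> J c" using \<phi> by (simp add: cocycle_def)
    then show "\<phi> u * a \<in> J c" by (simp add: lin_fun_scale[OF \<phi>l ac u_vec] mult.commute)
  qed
  show "\<phi> u \<in> J c \<longleftrightarrow> boundary_of c 0 \<phi>"
  proof
    assume u: "\<phi> u \<in> J c"
    have "\<phi> x \<in> J c" if x: "x \<in> vec V (k 0)" for x
    proof -
      have "\<phi> x - ev x * \<phi> u \<in> J c"
        using rep[OF \<phi>l x] \<phi> by (auto simp: cocycle_def)
      then show ?thesis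
        using poly_ideal_diff_mem[OF Jc] poly_ideal_mult[OF Jc lin_fun_closed[OF ev_lin x] u] by blast
    qed
    then show "boundary_of c 0 \<phi>" by simp
  qed (use u_vec in simp)
next
  note Jc = J_ideal[OF order_refl]
  fix g assume g: "g \<in> colon"
  then have gc: "g \<in> polys V" and gI: "\<And>a. a \<in> I \<Longrightarrow> g * a \<in> J c" by (auto simp: colon_def)
  let ?\<phi> = "\<lambda>x. g * ev x"
  have "lin_fun V (k 0) ?\<phi>" by (rule lin_fun_times[OF gc ev_lin])
  moreover have "ev (d 0 x) \<in> I" if "x \<in> vec V (k (Suc 0))" for x
    using exact_0[OF lin_map_vec[OF d_lin that]] that by blast
  ultimately have "cocycle c 0 ?\<phi>" using gI by (simp add: cocycle_def)
  moreover have "?\<phi> u - g \<in> J c" using gI[OF ev_u] by (simp add: algebra_simps)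
  ultimately show "\<exists>\<phi>. cocycle c 0 \<phi> \<and> \<phi> u - g \<in> J c" by blast
qed (use poly_ideal_0[OF J_ideal[OF order_refl]] in simp_all)

text \<open>The connecting map from Ext^j(S/I, S/J (r+1)) to Ext^(j+1)(S/I, S/J r) is bijective:
  \<open>conn \<phi> \<psi>\<close> says that it takes the class of \<open>\<psi>\<close> to that of
  \<open>\<phi>\<close>. Surjectivity is \<open>annihilate\<close>, injectivity is
  \<open>vanish\<close>, which applies because \<open>j + r < c\<close>.\<close>

lemma induces_iso_Suc:
  assumes rj: "Suc j + r = c" and \<theta>: "induces_iso (Suc r) j \<theta>"
  obtains \<theta>' where "induces_iso r (Suc j) \<theta>'"
proof -
  have r: "r < c" and r1: "r \<le> c" and r2: "Suc r \<le> c" and jr: "j + r < c" using rj by simp_all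
  note Jr = J_ideal[OF r1] and Jr' = J_ideal[OF r2] and Jc = J_ideal[OF order_refl]
  define conn where "conn \<phi> \<psi> \<longleftrightarrow> cocycle (Suc r) j \<psi> \<and>
    (\<forall>x\<in>vec V (k (Suc j)). f r * \<phi> x - \<psi> (d j x) \<in> J r)" for \<phi> \<psi>
  have conn_ex: "\<exists>\<psi>. conn \<phi> \<psi>" if c: "cocycle r (Suc j) \<phi>" for \<phi>
  proof -
    have \<phi>: "lin_fun V (k (Suc j)) \<phi>" using c by (simp add: cocycle_def)
    obtain \<psi> where \<psi>: "lin_fun V (k j) \<psi>"
      "\<And>x. x \<in> vec V (k (Suc j)) \<Longrightarrow> f r * \<phi> x - \<psi> (d j x) \<in> J r"
      using annihilate[OF r c] by auto
    have "\<psi> (d j x) \<in> J (Suc r)" if x: "x \<in> vec V (k (Suc j))" for x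
      using poly_ideal_diff[OF Jr' f_J_Suc[OF lin_fun_closed[OF \<phi> x] r], of "f r * \<phi> x - \<psi> (d j x)"]
        \<psi>(2)[OF x] J_mono by auto
    with \<psi> show ?thesis by (auto simp: conn_def cocycle_def)
  qed
  have conn_cong: "\<theta> \<psi> - \<theta> \<psi>' \<in> J c" if "conn \<phi> \<psi>" "conn \<phi> \<psi>'" for \<phi> \<psi> \<psi>'
  proof -
    have "\<psi> (d j x) - \<psi>' (d j x) \<in> J r" if x: "x \<in> vec V (k (Suc j))" for x
      using poly_ideal_diff[OF Jr, of "f r * \<phi> x - \<psi>' (d j x)" "f r * \<phi> x - \<psi> (d j x)"]
        \<open>conn \<phi> \<psi>\<close> \<open>conn \<phi> \<psi>'\<close> x by (simp add: conn_def algebra_simps)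
    then have "cocycle r j (\<lambda>x. \<psi> x - \<psi>' x)"
      using that by (simp add: conn_def cocycle_def lin_fun_minus)
    then have "boundary_of (Suc r) j (\<lambda>x. \<psi> x - \<psi>' x)"
      using vanish[OF jr] boundary_of_mono by blast
    then show ?thesis
      using induces_iso_cong[OF r2 \<theta>] that by (simp add: conn_def)
  qed
  \<comment> \<open>By \<open>conn_cong\<close> another choice of \<open>\<psi>\<close> changes the
    value only by an element of \<open>J c\<close>.\<close>
  define \<theta>' where "\<theta>' \<phi> = \<theta> (SOME \<psi>. conn \<phi> \<psi>)" for \<phi>
  have \<theta>'_eq: "\<theta>' \<phi> - \<theta> \<psi> \<in> J c" if "conn \<phi> \<psi>" for \<phi> \<psi>
    unfolding \<theta>'_def by (rule conn_cong[OF someI[of "conn \<phi>"] that]) (rule that)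
  have \<theta>c: "\<theta> \<psi> \<in> colon" if "conn \<phi> \<psi>" for \<phi> \<psi>
    using \<theta> that by (simp add: induces_iso_def conn_def)
  have "induces_iso r (Suc j) \<theta>'"
    unfolding induces_iso_def
  proof (intro conjI allI impI ballI)
    fix \<phi> assume c\<phi>: "cocycle r (Suc j) \<phi>"
    then obtain \<psi> where \<psi>: "conn \<phi> \<psi>" using conn_ex by blast
    then have \<psi>l: "lin_fun V (k j) \<psi>" by (simp add: conn_def cocycle_def)
    have \<phi>: "lin_fun V (k (Suc j)) \<phi>" using c\<phi> by (simp add: cocycle_def)
    show "\<theta>' \<phi> \<in> colon"
      unfolding \<theta>'_def by (rule \<theta>c[OF someI[of "conn \<phi>", OF \<psi>]])
    have "\<theta>' \<phi> \<in> J c \<longleftrightarrow> \<theta> \<psi> \<in> J c" by (rule poly_ideal_diff_mem[OF Jc \<theta>'_eq[OF \<psi>]])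
    also have "\<dots> \<longleftrightarrow> boundary_of (Suc r) j \<psi>"
      using \<theta> \<psi> by (simp add: induces_iso_def conn_def)
    also have "\<dots> \<longleftrightarrow> boundary_of r (Suc j) \<phi>"
    proof
      assume "boundary_of (Suc r) j \<psi>"
      then obtain a where a: "lin_fun V (k j) a"
        "\<And>x. x \<in> vec V (k (Suc j)) \<Longrightarrow> \<psi> (d j x) - f r * a (d j x) \<in> J r"
        using differential_of_boundary[OF r \<psi>l] by metis
      have "\<phi> x - a (d j x) \<in> J r" if x: "x \<in> vec V (k (Suc j))" for x
      proof (rule regular[OF r])
        show "\<phi> x - a (d j x) \<in> polys V"
          using lin_fun_closed[OF \<phi> x] lin_fun_closed[OF a(1) lin_map_vec[OF d_lin x]]
          by (rule polys_diff)
        show "f r * (\<phi> x - a (d j x)) \<in> J r"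
          using poly_ideal_add[OF Jr _ a(2)[OF x], of "f r * \<phi> x - \<psi> (d j x)"] \<psi> x
          by (simp add: algebra_simps conn_def)
      qed
      with a(1) show "boundary_of r (Suc j) \<phi>" by auto
    next
      assume "boundary_of r (Suc j) \<phi>"
      then obtain \<chi> where \<chi>: "lin_fun V (k j) \<chi>"
        "\<And>x. x \<in> vec V (k (Suc j)) \<Longrightarrow> \<phi> x - \<chi> (d j x) \<in> J r" by auto
      let ?\<chi> = "\<lambda>x. f r * \<chi> x"
      have l: "lin_fun V (k j) ?\<chi>" by (rule lin_fun_times[OF f_polys[OF r] \<chi>(1)])
      have "\<psi> (d j x) - ?\<chi> (d j x) \<in> J r" if x: "x \<in> vec V (k (Suc j))" for x
        using poly_ideal_diff[OF Jr poly_ideal_mult[OF Jr f_polys[OF r] \<chi>(2)[OF x]],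
            of "f r * \<phi> x - \<psi> (d j x)"] \<psi> x
        by (simp add: algebra_simps conn_def)
      with lin_fun_minus[OF \<psi>l l] have "cocycle r j (\<lambda>x. \<psi> x - ?\<chi> x)" by (simp add: cocycle_def)
      then have "boundary_of (Suc r) j (\<lambda>x. \<psi> x - ?\<chi> x)"
        using vanish[OF jr] boundary_of_mono by blast
      \<comment> \<open>The correction is a multiple of \<open>f r\<close> and so vanishes modulo
        \<open>J (Suc r)\<close>.\<close>
      moreover have "boundary_of (Suc r) j (\<lambda>x. - ?\<chi> x)"
        by (rule boundary_of_J[OF r2])
          (use f_J_Suc[OF lin_fun_closed[OF \<chi>(1)] r] poly_ideal_uminus[OF Jr'] in blast)
      ultimately have "boundary_of (Suc r) j (\<lambda>x. (\<psi> x - ?\<chi> x) - - ?\<chi> x)"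
        by (rule boundary_of_diff[OF r2])
      then show "boundary_of (Suc r) j \<psi>" by simp
    qed
    finally show "\<theta>' \<phi> \<in> J c \<longleftrightarrow> boundary_of r (Suc j) \<phi>" .
    {
      fix a :: "('v, 'k) mpoly" assume a: "a \<in> polys V"
      have "a * (f r * \<phi> x - \<psi> (d j x)) \<in> J r" if "x \<in> vec V (k (Suc j))" for x
        using poly_ideal_mult[OF Jr a] \<psi> that by (simp add: conn_def)
      then have "conn (\<lambda>x. a * \<phi> x) (\<lambda>x. a * \<psi> x)"
        using \<psi> cocycle_times[OF r2 a] by (simp add: conn_def algebra_simps)
      from \<theta>'_eq[OF this] have 1: "\<theta>' (\<lambda>x. a * \<phi> x) - \<theta> (\<lambda>x. a * \<psi> x) \<in> J c" .
      have 2: "\<theta> (\<lambda>x. a * \<psi> x) - a * \<theta> \<psi> \<in> J c"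
        using \<theta> \<psi> a by (simp add: induces_iso_def conn_def)
      have 3: "a * \<theta> \<psi> - a * \<theta>' \<phi> \<in> J c"
        using poly_ideal_mult[OF Jc a poly_ideal_diff_sym[OF Jc \<theta>'_eq[OF \<psi>]]] by (simp add: algebra_simps)
      show "\<theta>' (\<lambda>x. a * \<phi> x) - a * \<theta>' \<phi> \<in> J c"
        by (rule poly_ideal_diff_trans[OF Jc poly_ideal_diff_trans[OF Jc 1 2] 3])
    }
    fix \<phi>2 assume c\<phi>2: "cocycle r (Suc j) \<phi>2"
    then obtain \<psi>2 where \<psi>2: "conn \<phi>2 \<psi>2" using conn_ex by blast
    have "(f r * \<phi> x - \<psi> (d j x)) + (f r * \<phi>2 x - \<psi>2 (d j x)) \<in> J r" if "x \<in> vec V (k (Suc j))" for x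
      using poly_ideal_add[OF Jr] \<psi> \<psi>2 that by (simp add: conn_def)
    then have "conn (\<lambda>x. \<phi> x + \<phi>2 x) (\<lambda>x. \<psi> x + \<psi>2 x)"
      using \<psi> \<psi>2 cocycle_add[OF r2] by (simp add: conn_def algebra_simps)
    from \<theta>'_eq[OF this] have 1: "\<theta>' (\<lambda>x. \<phi> x + \<phi>2 x) - \<theta> (\<lambda>x. \<psi> x + \<psi>2 x) \<in> J c" .
    have 2: "\<theta> (\<lambda>x. \<psi> x + \<psi>2 x) - (\<theta> \<psi> + \<theta> \<psi>2) \<in> J c"
      using \<theta> \<psi> \<psi>2 by (simp add: induces_iso_def conn_def)
    have 3: "\<theta> \<psi> + \<theta> \<psi>2 - (\<theta>' \<phi> + \<theta>' \<phi>2) \<in> J c"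
      using poly_ideal_add[OF Jc poly_ideal_diff_sym[OF Jc \<theta>'_eq[OF \<psi>]]
          poly_ideal_diff_sym[OF Jc \<theta>'_eq[OF \<psi>2]]] by (simp add: algebra_simps)
    show "\<theta>' (\<lambda>x. \<phi> x + \<phi>2 x) - (\<theta>' \<phi> + \<theta>' \<phi>2) \<in> J c"
      by (rule poly_ideal_diff_trans[OF Jc poly_ideal_diff_trans[OF Jc 1 2] 3])
  next
    fix g assume "g \<in> colon"
    then obtain \<psi> where \<psi>: "cocycle (Suc r) j \<psi>" "\<theta> \<psi> - g \<in> J c"
      using \<theta> unfolding induces_iso_def by blast
    then have \<psi>l: "lin_fun V (k j) \<psi>" and \<psi>J: "\<And>x. x \<in> vec V (k (Suc j)) \<Longrightarrow> \<psi> (d j x) \<in> J (Suc r)"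
      by (auto simp: cocycle_def)
    obtain \<phi> where \<phi>: "lin_fun V (k (Suc j)) \<phi>"
      "\<And>x. x \<in> vec V (k (Suc j)) \<Longrightarrow> \<psi> (d j x) - f r * \<phi> x \<in> J r"
      using lin_fun_J_Suc[OF r lin_fun_compose[OF d_lin \<psi>l] \<psi>J] by metis
    have "\<phi> (d (Suc j) x) \<in> J r" if x: "x \<in> vec V (k (Suc (Suc j)))" for x
    proof (rule regular[OF r])
      note dx = lin_map_vec[OF d_lin x]
      show "\<phi> (d (Suc j) x) \<in> polys V" by (rule lin_fun_closed[OF \<phi>(1) dx])
      show "f r * \<phi> (d (Suc j) x) \<in> J r"
        using poly_ideal_uminus[OF Jr \<phi>(2)[OF dx]] by (simp add: dd[OF x] lin_fun_zero[OF \<psi>l])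
    qed
    with \<phi>(1) have c\<phi>: "cocycle r (Suc j) \<phi>" by (simp add: cocycle_def)
    have "conn \<phi> \<psi>"
      using \<psi>(1) poly_ideal_diff_sym[OF Jr \<phi>(2)] by (simp add: conn_def)
    then have "\<theta>' \<phi> - \<theta> \<psi> \<in> J c" by (rule \<theta>'_eq)
    then have "\<theta>' \<phi> - g \<in> J c" by (rule poly_ideal_diff_trans[OF Jc _ \<psi>(2)])
    with c\<phi> show "\<exists>\<phi>. cocycle r (Suc j) \<phi> \<and> \<theta>' \<phi> - g \<in> J c" by blast
  qed
  then show thesis by (rule that)
qed

text \<open>Degree and length of the initial segment always add up to \<open>c\<close>: the start is
  Hom(S/I, S/J c), and at \<open>j = c\<close> the ideal \<open>J 0\<close> is zero, which leaves
  Ext^c(S/I, S).\<close>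

lemma induces_iso_exists: "j \<le> c \<Longrightarrow> \<exists>\<theta>. induces_iso (c - j) j \<theta>"
proof (induction j)
  case 0
  then show ?case using induces_iso_0 by auto
next
  case (Suc j)
  then obtain \<theta> where "induces_iso (Suc (c - Suc j)) j \<theta>"
    by (metis Suc_diff_Suc Suc_leD Suc_le_lessD)
  then show ?case
    using induces_iso_Suc[of j "c - Suc j" \<theta>] Suc.prems by auto
qed

end

subsection \<open>Ext as a colon ideal modulo a regular sequence\<close>

text \<open>The compatibility of scalars with the subgroup that makes the operations of
  \<open>quotient_module\<close> well defined.\<close>

locale scalar_quotient = abelian_subgroup H M
  for R :: "('a, 'c) ring_scheme" and M :: "('a, 'b) module" and H +
  assumes smult_closed: "\<And>r x. r \<in> carrier R \<Longrightarrow> x \<in> carrier M \<Longrightarrow> r \<odot>\<^bsub>M\<^esub> x \<in> carrier M"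
    and smult_H: "\<And>r x. r \<in> carrier R \<Longrightarrow> x \<in> H \<Longrightarrow> r \<odot>\<^bsub>M\<^esub> x \<in> H"
    and smult_add: "\<And>r x y. r \<in> carrier R \<Longrightarrow> x \<in> carrier M \<Longrightarrow> y \<in> carrier M \<Longrightarrow>
      r \<odot>\<^bsub>M\<^esub> (x \<oplus>\<^bsub>M\<^esub> y) = r \<odot>\<^bsub>M\<^esub> x \<oplus>\<^bsub>M\<^esub> r \<odot>\<^bsub>M\<^esub> y"
begin

lemma coset_eqI: "y \<in> H +>\<^bsub>M\<^esub> x \<Longrightarrow> x \<in> carrier M \<Longrightarrow> H +>\<^bsub>M\<^esub> y = H +>\<^bsub>M\<^esub> x"
  using a_repr_independence[OF _ _ a_subgroup] by metis

text \<open>All representatives contribute the same coset to the union in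
  \<open>quotient_module\<close>.\<close>

lemma smult_coset:
  assumes "r \<in> carrier R" "x \<in> carrier M"
  shows "r \<odot>\<^bsub>quotient_module M H\<^esub> (H +>\<^bsub>M\<^esub> x) = H +>\<^bsub>M\<^esub> (r \<odot>\<^bsub>M\<^esub> x)"
proof -
  have "H +>\<^bsub>M\<^esub> (r \<odot>\<^bsub>M\<^esub> y) = H +>\<^bsub>M\<^esub> (r \<odot>\<^bsub>M\<^esub> x)" if y: "y \<in> H +>\<^bsub>M\<^esub> x" for y
  proof (rule coset_eqI)
    obtain h where "h \<in> H" "y = h \<oplus>\<^bsub>M\<^esub> x" using y by (auto simp: a_r_coset_def')
    then show "r \<odot>\<^bsub>M\<^esub> y \<in> H +>\<^bsub>M\<^esub> (r \<odot>\<^bsub>M\<^esub> x)"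
      using assms a_subset smult_H by (auto simp: smult_add a_r_coset_def')
    show "r \<odot>\<^bsub>M\<^esub> x \<in> carrier M" by (rule smult_closed[OF assms])
  qed
  then have *: "\<forall>y\<in>H +>\<^bsub>M\<^esub> x. H +>\<^bsub>M\<^esub> (r \<odot>\<^bsub>M\<^esub> y) = H +>\<^bsub>M\<^esub> (r \<odot>\<^bsub>M\<^esub> x)" by blast
  have "(\<Union>y\<in>H +>\<^bsub>M\<^esub> x. H +>\<^bsub>M\<^esub> (r \<odot>\<^bsub>M\<^esub> y)) = H +>\<^bsub>M\<^esub> (r \<odot>\<^bsub>M\<^esub> x)"
    by (rule UN_constant_eq[OF a_rcos_self[OF assms(2)] *])
  then show ?thesis by (simp add: quotient_module_def)
qed

lemma add_coset:
  "x \<in> carrier M \<Longrightarrow> y \<in> carrier M \<Longrightarrow>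
    (H +>\<^bsub>M\<^esub> x) \<oplus>\<^bsub>quotient_module M H\<^esub> (H +>\<^bsub>M\<^esub> y) = H +>\<^bsub>M\<^esub> (x \<oplus>\<^bsub>M\<^esub> y)"
  by (simp add: quotient_module_def a_rcos_sum)

lemma quotient_carrier: "carrier (quotient_module M H) = (\<lambda>x. H +>\<^bsub>M\<^esub> x) ` carrier M"
  by (auto simp: quotient_module_def A_RCOSETS_def')

end

text \<open>The homomorphism theorem for a map that is linear only modulo \<open>L\<close>.\<close>

lemma quotient_module_iso:
  assumes Q: "scalar_quotient R M H" and Q': "scalar_quotient R N L"
    and closed: "\<And>x. x \<in> carrier M \<Longrightarrow> \<theta> x \<in> carrier N"
    and add: "\<And>x y. x \<in> carrier M \<Longrightarrow> y \<in> carrier M \<Longrightarrow>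
      L +>\<^bsub>N\<^esub> \<theta> (x \<oplus>\<^bsub>M\<^esub> y) = L +>\<^bsub>N\<^esub> (\<theta> x \<oplus>\<^bsub>N\<^esub> \<theta> y)"
    and scale: "\<And>r x. r \<in> carrier R \<Longrightarrow> x \<in> carrier M \<Longrightarrow>
      L +>\<^bsub>N\<^esub> \<theta> (r \<odot>\<^bsub>M\<^esub> x) = L +>\<^bsub>N\<^esub> (r \<odot>\<^bsub>N\<^esub> \<theta> x)"
    and ker: "\<And>x. x \<in> carrier M \<Longrightarrow> \<theta> x \<in> L \<longleftrightarrow> x \<in> H"
    and surj: "\<And>y. y \<in> carrier N \<Longrightarrow> \<exists>x\<in>carrier M. L +>\<^bsub>N\<^esub> \<theta> x = L +>\<^bsub>N\<^esub> y"
  shows "isomorphic_modules R (quotient_module M H) (quotient_module N L)"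
proof -
  interpret M: scalar_quotient R M H by (rule Q)
  interpret N: scalar_quotient R N L by (rule Q')
  let ?q = "\<lambda>x. H +>\<^bsub>M\<^esub> x" and ?p = "\<lambda>y. L +>\<^bsub>N\<^esub> y"
  \<comment> \<open>Reduces equality of cosets to the kernel condition for the difference. One
    direction makes the induced map well defined, the other makes it injective.\<close>
  have eq_iff: "?p (\<theta> x) = ?p (\<theta> y) \<longleftrightarrow> ?q x = ?q y" if x: "x \<in> carrier M" and y: "y \<in> carrier M" for x y
  proof -
    define z where "z = x \<ominus>\<^bsub>M\<^esub> y"
    have z: "z \<in> carrier M" and xz: "x = z \<oplus>\<^bsub>M\<^esub> y"
      using x y by (simp_all add: z_def M.minus_eq M.a_assoc M.l_neg)
    have t: "\<theta> x \<in> carrier N" "\<theta> y \<in> carrier N" "\<theta> z \<in> carrier N" using x y z closed by auto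
    have "?q x = ?q y \<longleftrightarrow> z \<in> H"
    proof
      assume "?q x = ?q y"
      then have "x \<in> ?q y" using M.a_rcos_self[OF x] by simp
      then obtain h where h: "h \<in> H" "x = h \<oplus>\<^bsub>M\<^esub> y" by (auto simp: a_r_coset_def')
      then have "h \<in> carrier M" using M.a_subset by blast
      then have "h = z" using h(2) xz y z M.add.right_cancel[of y h z] by simp
      with h show "z \<in> H" by simp
    next
      assume "z \<in> H"
      then have "x \<in> ?q y" unfolding xz by (auto simp: a_r_coset_def')
      then show "?q x = ?q y" by (rule M.coset_eqI[OF _ y])
    qed
    also have "\<dots> \<longleftrightarrow> \<theta> z \<in> L" using ker[OF z] by simp
    also have "\<dots> \<longleftrightarrow> ?p (\<theta> z \<oplus>\<^bsub>N\<^esub> \<theta> y) = ?p (\<theta> y)"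
    proof
      assume "\<theta> z \<in> L"
      then have "\<theta> z \<oplus>\<^bsub>N\<^esub> \<theta> y \<in> ?p (\<theta> y)" by (auto simp: a_r_coset_def')
      then show "?p (\<theta> z \<oplus>\<^bsub>N\<^esub> \<theta> y) = ?p (\<theta> y)" by (rule N.coset_eqI[OF _ t(2)])
    next
      assume "?p (\<theta> z \<oplus>\<^bsub>N\<^esub> \<theta> y) = ?p (\<theta> y)"
      then have "\<theta> z \<oplus>\<^bsub>N\<^esub> \<theta> y \<in> ?p (\<theta> y)" using N.a_rcos_self[of "\<theta> z \<oplus>\<^bsub>N\<^esub> \<theta> y"] t by simp
      then obtain h where h: "h \<in> L" "\<theta> z \<oplus>\<^bsub>N\<^esub> \<theta> y = h \<oplus>\<^bsub>N\<^esub> \<theta> y" by (auto simp: a_r_coset_def')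
      then have "h \<in> carrier N" using N.a_subset by blast
      then have "\<theta> z = h" using h(2) t N.add.right_cancel[of "\<theta> y" h "\<theta> z"] by simp
      with h show "\<theta> z \<in> L" by simp
    qed
    also have "\<dots> \<longleftrightarrow> ?p (\<theta> x) = ?p (\<theta> y)" unfolding xz add[OF z y] ..
    finally show ?thesis by simp
  qed
  define f where "f = (\<lambda>X\<in>carrier (quotient_module M H). ?p (\<theta> (SOME x. x \<in> carrier M \<and> X = ?q x)))"
  have f: "f (?q x) = ?p (\<theta> x)" if x: "x \<in> carrier M" for x
  proof -
    let ?s = "SOME y. y \<in> carrier M \<and> ?q x = ?q y"
    have "?s \<in> carrier M \<and> ?q x = ?q ?s" by (rule someI[of _ x]) (simp add: x)
    then have "?p (\<theta> ?s) = ?p (\<theta> x)" using eq_iff[OF _ x] by simp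
    then show ?thesis using x by (simp add: f_def M.quotient_carrier)
  qed
  have "f \<in> linear_maps R (quotient_module M H) (quotient_module N L)"
    unfolding linear_maps_def
  proof (intro CollectI conjI ballI)
    show "f \<in> carrier (quotient_module M H) \<rightarrow>\<^sub>E carrier (quotient_module N L)"
    proof (rule PiE_I)
      fix X assume "X \<in> carrier (quotient_module M H)"
      then show "f X \<in> carrier (quotient_module N L)"
        using f closed by (auto simp: M.quotient_carrier N.quotient_carrier)
    qed (simp add: f_def)
    fix X assume "X \<in> carrier (quotient_module M H)"
    then obtain x where x: "x \<in> carrier M" "X = ?q x" by (auto simp: M.quotient_carrier)
    {
      fix Y assume "Y \<in> carrier (quotient_module M H)"
      then obtain y where y: "y \<in> carrier M" "Y = ?q y" by (auto simp: M.quotient_carrier)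
      show "f (X \<oplus>\<^bsub>quotient_module M H\<^esub> Y) = f X \<oplus>\<^bsub>quotient_module N L\<^esub> f Y"
        using x y by (simp add: M.add_coset N.add_coset f add closed)
    }
    fix r assume "r \<in> carrier R"
    then show "f (r \<odot>\<^bsub>quotient_module M H\<^esub> X) = r \<odot>\<^bsub>quotient_module N L\<^esub> f X"
      using x by (simp add: M.smult_coset N.smult_coset f scale closed M.smult_closed)
  qed
  moreover have "bij_betw f (carrier (quotient_module M H)) (carrier (quotient_module N L))"
  proof (rule bij_betw_imageI)
    show "inj_on f (carrier (quotient_module M H))"
      by (rule inj_onI) (auto simp: M.quotient_carrier f eq_iff)
    show "f ` carrier (quotient_module M H) = carrier (quotient_module N L)"
    proof
      show "f ` carrier (quotient_module M H) \<subseteq> carrier (quotient_module N L)"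
        using f closed by (auto simp: M.quotient_carrier N.quotient_carrier)
      show "carrier (quotient_module N L) \<subseteq> f ` carrier (quotient_module M H)"
      proof
        fix Y assume "Y \<in> carrier (quotient_module N L)"
        then obtain y where y: "y \<in> carrier N" "Y = ?p y" by (auto simp: N.quotient_carrier)
        then obtain x where "x \<in> carrier M" "?p (\<theta> x) = Y" using surj by metis
        then show "Y \<in> f ` carrier (quotient_module M H)"
          using f by (auto simp: M.quotient_carrier)
      qed
    qed
  qed
  ultimately show ?thesis unfolding isomorphic_modules_def by blast
qed

lemma abelian_group_poly_ideal:
  assumes "ideal Q (poly_ring V :: ('v, 'k::comm_ring_1) mpoly ring)"
  shows "abelian_group ((ring_module (poly_ring V))\<lparr>carrier := Q\<rparr>)"
proof (rule abelian_groupI)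
  fix x assume "x \<in> carrier ((ring_module (poly_ring V))\<lparr>carrier := Q\<rparr>)"
  then show "\<exists>y\<in>carrier ((ring_module (poly_ring V))\<lparr>carrier := Q\<rparr>).
      y \<oplus>\<^bsub>(ring_module (poly_ring V))\<lparr>carrier := Q\<rparr>\<^esub> x = \<zero>\<^bsub>(ring_module (poly_ring V))\<lparr>carrier := Q\<rparr>\<^esub>"
    using poly_ideal_uminus[OF assms, of x]
    by (intro bexI[of _ "- x"]) (simp_all add: ring_module_def)
qed (use assms in \<open>simp_all add: ring_module_def poly_ideal_closed add_ac\<close>)

lemma scalar_quotient_poly_ideal:
  assumes Q: "ideal Q (poly_ring V :: ('v, 'k::comm_ring_1) mpoly ring)" and J: "ideal J (poly_ring V)"
    and sub: "J \<subseteq> Q"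
  shows "scalar_quotient (poly_ring V) ((ring_module (poly_ring V))\<lparr>carrier := Q\<rparr>) J"
proof (intro scalar_quotient.intro scalar_quotient_axioms.intro)
  let ?M = "(ring_module (poly_ring V))\<lparr>carrier := Q\<rparr>"
  interpret abelian_group ?M by (rule abelian_group_poly_ideal[OF Q])
  have "subgroup J (add_monoid ?M)"
  proof (rule add.subgroupI)
    show "J \<subseteq> carrier ?M" using sub by simp
    show "J \<noteq> {}" using poly_ideal_0[OF J] by auto
    fix a assume a: "a \<in> J"
    then have "a \<in> Q" "- a \<in> Q" using sub poly_ideal_uminus[OF Q] by auto
    then have "\<ominus>\<^bsub>?M\<^esub> a = - a" by (intro minus_equality) (simp_all add: ring_module_def)
    then show "\<ominus>\<^bsub>?M\<^esub> a \<in> J" using poly_ideal_uminus[OF J a] by simp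
    fix b assume "b \<in> J"
    with a show "a \<oplus>\<^bsub>?M\<^esub> b \<in> J" by (simp add: ring_module_def poly_ideal_add[OF J])
  qed
  then show "abelian_subgroup J ?M"
    by (intro abelian_subgroupI3 additive_subgroupI abelian_group_axioms)
qed (simp_all add: ring_module_def poly_ideal_mult[OF Q] poly_ideal_mult[OF J] distrib_left)

lemma ring_module_carrier_self: "(ring_module R)\<lparr>carrier := carrier R\<rparr> = ring_module R"
  by (simp add: ring_module_def)

lemma polys_ideal: "ideal (polys V) (poly_ring V)"
  by (rule poly_idealI) (simp_all add: polys_closed)

lemma poly_coset_eq_iff:
  assumes "ideal J (poly_ring V :: ('v, 'k::comm_ring_1) mpoly ring)"
  shows "J +>\<^bsub>(ring_module (poly_ring V))\<lparr>carrier := Q\<rparr>\<^esub> a = J +>\<^bsub>(ring_module (poly_ring V))\<lparr>carrier := Q\<rparr>\<^esub> b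
     \<longleftrightarrow> a - b \<in> J"
proof -
  have c: "J +>\<^bsub>(ring_module (poly_ring V))\<lparr>carrier := Q\<rparr>\<^esub> a = {x. x - a \<in> J}" for a
  proof (rule Set.set_eqI)
    fix x
    have "x \<in> J +>\<^bsub>(ring_module (poly_ring V))\<lparr>carrier := Q\<rparr>\<^esub> a \<longleftrightarrow> (\<exists>h\<in>J. x = h + a)"
      by (simp add: a_r_coset_def' ring_module_def)
    also have "\<dots> \<longleftrightarrow> x \<in> {x. x - a \<in> J}"
    proof
      assume "x \<in> {x. x - a \<in> J}"
      then show "\<exists>h\<in>J. x = h + a" by (intro bexI[of _ "x - a"]) simp_all
    qed auto
    finally show "x \<in> J +>\<^bsub>(ring_module (poly_ring V))\<lparr>carrier := Q\<rparr>\<^esub> a \<longleftrightarrow> x \<in> {x. x - a \<in> J}" .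
  qed
  show ?thesis
    unfolding c
  proof
    assume eq: "{x. x - a \<in> J} = {x. x - b \<in> J}"
    have "a \<in> {x. x - a \<in> J}" using poly_ideal_0[OF assms] by simp
    then have "a \<in> {x. x - b \<in> J}" by (simp only: eq)
    then show "a - b \<in> J" by simp
  next
    assume ab: "a - b \<in> J"
    show "{x. x - a \<in> J} = {x. x - b \<in> J}"
      using poly_ideal_diff_trans[OF assms _ ab] poly_ideal_diff_trans[OF assms _ poly_ideal_diff_sym[OF assms ab]]
      by blast
  qed
qed

text \<open>Representatives of the cosets \<open>e (vunit (k 0) i)\<close> define the lift
  \<open>ev\<close> of the augmentation, and surjectivity of \<open>e\<close> provides
  \<open>u\<close>.\<close>

lemma free_resolution_poly_resolution:
  assumes I: "ideal I (poly_ring V :: ('v, 'k::field) mpoly ring)"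
    and res: "free_resolution (poly_ring V) (quotient_module (ring_module (poly_ring V)) I) k d e"
  obtains ev u where "poly_resolution V I k d ev u"
proof -
  let ?R = "ring_module (poly_ring V) :: (('v, 'k) mpoly, ('v, 'k) mpoly) module"
  let ?F = "\<lambda>i. free_module (poly_ring V) (k i) :: (('v, 'k) mpoly, nat \<Rightarrow> ('v, 'k) mpoly) module"
  interpret Q: scalar_quotient "poly_ring V" ?R I
    using scalar_quotient_poly_ideal[OF polys_ideal I] poly_ideal_carrier[OF I]
    by (auto simp: ring_module_carrier_self)
  have e: "e \<in> linear_maps (poly_ring V) (?F 0) (quotient_module ?R I)"
    and d: "\<And>i. d i \<in> linear_maps (poly_ring V) (?F (Suc i)) (?F i)"
    and surj: "e ` carrier (?F 0) = carrier (quotient_module ?R I)"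
    and ex0: "d 0 ` carrier (?F 1) = linear_kernel (?F 0) (quotient_module ?R I) e"
    and exS: "\<And>i. d (Suc i) ` carrier (?F (Suc (Suc i))) = linear_kernel (?F (Suc i)) (?F i) (d i)"
    using res unfolding free_resolution_def by (auto simp: Let_def)
  have Rc: "carrier ?R = polys V" by (simp add: ring_module_def)
  have "\<forall>i. \<exists>a. a \<in> polys V \<and> e (vunit (k 0) i) = I +>\<^bsub>?R\<^esub> a"
  proof
    fix i
    have "e (vunit (k 0) i) \<in> carrier (quotient_module ?R I)"
      using e vunit_vec[of "k 0" i V] by (auto simp: linear_maps_def vec_carrier)
    then show "\<exists>a. a \<in> polys V \<and> e (vunit (k 0) i) = I +>\<^bsub>?R\<^esub> a"
      by (auto simp: Q.quotient_carrier Rc)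
  qed
  then obtain a where a: "\<And>i. a i \<in> polys V" "\<And>i. e (vunit (k 0) i) = I +>\<^bsub>?R\<^esub> a i" by metis
  define ev where "ev x = (\<Sum>i<k 0. x i * a i)" for x
  have ev: "lin_fun V (k 0) ev" unfolding ev_def by (rule lin_fun_of_coeffs) (rule a(1))
  have e_add: "e (vadd (k 0) x y) = e x \<oplus>\<^bsub>quotient_module ?R I\<^esub> e y"
    if "x \<in> vec V (k 0)" "y \<in> vec V (k 0)" for x y
    using e that unfolding linear_maps_def by (auto simp: free_module_def vec_def vadd_def)
  have e_scale: "e (vscale (k 0) r x) = r \<odot>\<^bsub>quotient_module ?R I\<^esub> e x"
    if "r \<in> polys V" "x \<in> vec V (k 0)" for r x
    using e that unfolding linear_maps_def by (auto simp: free_module_def vec_def vscale_def)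
  have e_ev: "e x = I +>\<^bsub>?R\<^esub> ev x" if x: "x \<in> vec V (k 0)" for x
    unfolding ev_def
  proof (rule vec_induct[OF x, where P = "\<lambda>n y. e y = I +>\<^bsub>?R\<^esub> (\<Sum>i<n. x i * a i)"])
    \<comment> \<open>That zero is sent to zero is not part of \<open>linear_maps\<close>; it comes
      from multiplication by the scalar 0.\<close>
    have v: "vscale (k 0) 0 (vzero (k 0)) = vzero (k 0)" by (auto simp: vscale_def vzero_def)
    have "e (vzero (k 0)) \<in> carrier (quotient_module ?R I)"
      using e vzero_vec[of "k 0" V] by (auto simp: linear_maps_def vec_carrier)
    then obtain b where b: "b \<in> polys V" "e (vzero (k 0)) = I +>\<^bsub>?R\<^esub> b"
      by (auto simp: Q.quotient_carrier Rc)
    have "e (vzero (k 0)) = e (vscale (k 0) 0 (vzero (k 0)))" by (simp only: v)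
    also have "\<dots> = 0 \<odot>\<^bsub>quotient_module ?R I\<^esub> e (vzero (k 0))" by (rule e_scale) simp_all
    also have "\<dots> = I +>\<^bsub>?R\<^esub> (0 \<odot>\<^bsub>?R\<^esub> b)"
      unfolding b(2) by (rule Q.smult_coset) (simp_all add: Rc b(1))
    finally show "e (vzero (k 0)) = I +>\<^bsub>?R\<^esub> (\<Sum>i<0. x i * a i)" by (simp add: ring_module_def)
  next
    fix n y assume n: "n < k 0" and y: "y \<in> vec V (k 0)" and IH: "e y = I +>\<^bsub>?R\<^esub> (\<Sum>i<n. x i * a i)"
    have xa: "x i * a i \<in> polys V" if "i \<le> n" for i
      using vec_mem[OF x] n that a(1) by (intro polys_closed) auto
    have s: "(\<Sum>i<n. x i * a i) \<in> polys V" by (rule polys_sum) (use xa in auto)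
    have xn: "x n \<in> polys V" by (rule vec_mem[OF x n])
    have "e (vadd (k 0) y (vscale (k 0) (x n) (vunit (k 0) n)))
        = e y \<oplus>\<^bsub>quotient_module ?R I\<^esub> (x n \<odot>\<^bsub>quotient_module ?R I\<^esub> e (vunit (k 0) n))"
      by (simp add: e_add e_scale y xn)
    also have "\<dots> = I +>\<^bsub>?R\<^esub> ((\<Sum>i<n. x i * a i) \<oplus>\<^bsub>?R\<^esub> (x n \<odot>\<^bsub>?R\<^esub> a n))"
      unfolding IH a(2) using xn a(1) s xa[of n]
      by (subst Q.smult_coset, simp_all add: Rc) (rule Q.add_coset, simp_all add: ring_module_def)
    finally show "e (vadd (k 0) y (vscale (k 0) (x n) (vunit (k 0) n))) = I +>\<^bsub>?R\<^esub> (\<Sum>i<Suc n. x i * a i)"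
      by (simp add: ring_module_def)
  qed
  have coset_eq: "I +>\<^bsub>?R\<^esub> b = I +>\<^bsub>?R\<^esub> b' \<longleftrightarrow> b - b' \<in> I" for b b'
    using poly_coset_eq_iff[OF I, of "polys V" b b'] by (simp add: ring_module_carrier_self)
  have "I +>\<^bsub>?R\<^esub> 0 = I" by (auto simp: a_r_coset_def' ring_module_def)
  then have zero: "I +>\<^bsub>?R\<^esub> b = I \<longleftrightarrow> b \<in> I" for b using coset_eq[of b 0] by simp
  have "I +>\<^bsub>?R\<^esub> 1 \<in> e ` vec V (k 0)"
    using surj by (auto simp: Q.quotient_carrier Rc vec_carrier)
  then obtain u where u: "u \<in> vec V (k 0)" "I +>\<^bsub>?R\<^esub> ev u = I +>\<^bsub>?R\<^esub> 1" using e_ev by auto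
  have "poly_resolution V I k d ev u"
  proof (rule poly_resolution.intro)
    fix i
    show "lin_map V (k (Suc i)) (k i) (d i)" using d linear_maps_free_iff by blast
  next
    fix x :: "nat \<Rightarrow> ('v, 'k) mpoly" assume x: "x \<in> vec V (k 0)"
    have "x \<in> d 0 ` vec V (k (Suc 0)) \<longleftrightarrow> e x = I"
      using ex0 x by (auto simp: vec_carrier linear_kernel_def quotient_module_def set_eq_iff)
    then show "ev x \<in> I \<longleftrightarrow> x \<in> d 0 ` vec V (k (Suc 0))" by (simp add: e_ev[OF x] zero)
  next
    fix i and x :: "nat \<Rightarrow> ('v, 'k) mpoly" assume x: "x \<in> vec V (k (Suc i))"
    have "\<zero>\<^bsub>?F i\<^esub> = vzero (k i)" by (simp add: free_module_def vzero_def)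
    then show "d i x = vzero (k i) \<longleftrightarrow> x \<in> d (Suc i) ` vec V (k (Suc (Suc i)))"
      using exS[of i] x by (auto simp: vec_carrier linear_kernel_def set_eq_iff)
  qed (use I ev u coset_eq in auto)
  then show thesis by (rule that)
qed

text \<open>Carries the case \<open>r = 0\<close>, \<open>j = c\<close> over to the module records.
  There cochains are extensional, so every functional is first restricted to \<open>vec\<close>; as
  \<open>c\<close> is positive, the coboundaries are those of an actual differential.\<close>

lemma (in regular_resolution) hom_cohomology_iso:
  assumes d_ext: "\<And>i. d i \<in> extensional (vec V (k (Suc i)))" and c: "0 < c"
  shows "isomorphic_modules (poly_ring V) (hom_cohomology (poly_ring V) k d (ring_module (poly_ring V)) c)
    (quotient_module ((ring_module (poly_ring V))\<lparr>carrier := colon\<rparr>) (J c))"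
proof -
  let ?S = "poly_ring V :: ('v, 'k) mpoly ring"
  let ?R = "ring_module ?S"
  obtain b where cb: "c = Suc b" using c by (cases c) auto
  define C where "C j = hom_module ?S (free_module ?S (k j)) ?R" for j
  have C_carrier: "carrier (C j) = {\<phi> \<in> extensional (vec V (k j)). lin_fun V (k j) \<phi>}" for j
    using linear_maps_ring_iff by (auto simp: C_def hom_module_def)
  have C_add: "\<phi> \<oplus>\<^bsub>C j\<^esub> \<psi> = (\<lambda>x\<in>vec V (k j). \<phi> x + \<psi> x)" for \<phi> \<psi> j
    by (simp add: C_def hom_module_def ring_module_def vec_carrier)
  have C_zero: "\<zero>\<^bsub>C j\<^esub> = (\<lambda>x\<in>vec V (k j). 0)" for j
    by (simp add: C_def hom_module_def ring_module_def vec_carrier)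
  have C_smult: "a \<odot>\<^bsub>C j\<^esub> \<phi> = (\<lambda>x\<in>vec V (k j). a * \<phi> x)" for a \<phi> j
    by (simp add: C_def hom_module_def ring_module_def vec_carrier)
  define Z where "Z = {\<phi> \<in> extensional (vec V (k c)). cocycle 0 c \<phi>}"
  define B where "B = {\<phi> \<in> Z. boundary_of 0 c \<phi>}"
  have lin_cong: "lin_fun V l \<phi> \<longleftrightarrow> lin_fun V l \<psi>" if "\<And>x. x \<in> vec V l \<Longrightarrow> \<phi> x = \<psi> x" for l \<phi> \<psi>
    using that by (simp add: lin_fun_def)
  have cocycle_cong: "cocycle 0 c \<phi> \<longleftrightarrow> cocycle 0 c \<psi>"
    if "\<And>x. x \<in> vec V (k c) \<Longrightarrow> \<phi> x = \<psi> x" for \<phi> \<psi>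
    using that lin_map_vec[OF d_lin] lin_cong[OF that] by (simp add: cocycle_def)
  have boundary_cong: "boundary_of 0 c \<phi> \<longleftrightarrow> boundary_of 0 c \<psi>"
    if "\<And>x. x \<in> vec V (k c) \<Longrightarrow> \<phi> x = \<psi> x" for \<phi> \<psi>
    using that by (simp add: cb)
  have Z_eq: "linear_kernel (C c) (C (Suc c)) (hom_differential ?S k d c) = Z"
    by (auto simp: linear_kernel_def C_carrier Z_def cocycle_def J_0' C_zero hom_differential_def
        compose_def vec_carrier fun_eq_iff restrict_def split: if_splits)
  have B_eq: "hom_differential ?S k d b ` carrier (C b) = B"
  proof (intro equalityI subsetI)
    fix \<phi> assume "\<phi> \<in> hom_differential ?S k d b ` carrier (C b)"
    then obtain \<chi> where \<chi>: "lin_fun V (k b) \<chi>" "\<phi> = (\<lambda>x\<in>vec V (k c). \<chi> (d b x))"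
      by (auto simp: C_carrier hom_differential_def compose_def vec_carrier cb)
    have "lin_fun V (k c) \<phi>"
      using lin_fun_compose[OF d_lin \<chi>(1)] by (subst lin_cong[of _ _ "\<lambda>x. \<chi> (d b x)"]) (simp_all add: \<chi>(2) cb)
    moreover have "\<phi> (d c x) = 0" if "x \<in> vec V (k (Suc c))" for x
      using that lin_map_vec[OF d_lin that] by (simp add: \<chi>(2) cb dd lin_fun_zero[OF \<chi>(1)])
    moreover have "boundary_of 0 c \<phi>"
      using \<chi> by (auto simp: cb J_0' intro!: exI[of _ \<chi>])
    ultimately show "\<phi> \<in> B" by (simp add: B_def Z_def cocycle_def J_0' \<chi>(2))
  next
    fix \<phi> assume \<phi>: "\<phi> \<in> B"
    then obtain \<chi> where \<chi>: "lin_fun V (k b) \<chi>" "\<And>x. x \<in> vec V (k c) \<Longrightarrow> \<phi> x = \<chi> (d b x)"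
      by (auto simp: B_def cb J_0')
    let ?\<chi> = "restrict \<chi> (vec V (k b))"
    have "?\<chi> \<in> carrier (C b)"
      using \<chi>(1) lin_cong[of "k b" ?\<chi> \<chi>] by (simp add: C_carrier)
    moreover have "hom_differential ?S k d b ?\<chi> = \<phi>"
    proof (rule extensionalityI[of _ "vec V (k c)"])
      show "\<phi> \<in> extensional (vec V (k c))" using \<phi> by (simp add: B_def Z_def)
      show "hom_differential ?S k d b ?\<chi> x = \<phi> x" if "x \<in> vec V (k c)" for x
        using that \<chi>(2) lin_map_vec[OF d_lin, of x b] by (simp add: hom_differential_def compose_def vec_carrier cb)
    qed (simp add: hom_differential_def vec_carrier cb)
    ultimately show "\<phi> \<in> hom_differential ?S k d b ` carrier (C b)" by blast
  qed
  let ?M = "(C c)\<lparr>carrier := Z\<rparr>" and ?N = "?R\<lparr>carrier := colon\<rparr>"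
  have coh: "hom_cohomology ?S k d ?R c = quotient_module ?M B"
    unfolding hom_cohomology_def by (simp add: Let_def C_def[symmetric] Z_eq) (simp add: cb B_eq[unfolded cb])
  note J0 = J_ideal[OF le0] and Jc = J_ideal[OF order_refl]
  have restrict_Z: "restrict \<phi> (vec V (k c)) \<in> Z" if "cocycle 0 c \<phi>" for \<phi>
    using that cocycle_cong[of "restrict \<phi> (vec V (k c))" \<phi>] by (simp add: Z_def)
  have restrict_B: "restrict \<phi> (vec V (k c)) \<in> B" if "cocycle 0 c \<phi>" "boundary_of 0 c \<phi>" for \<phi>
    using that restrict_Z boundary_cong[of "restrict \<phi> (vec V (k c))" \<phi>] by (simp add: B_def)
  have ZD: "cocycle 0 c \<phi>" "\<phi> \<in> extensional (vec V (k c))" if "\<phi> \<in> Z" for \<phi>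
    using that by (simp_all add: Z_def)
  have zero_cocycle: "cocycle 0 c (\<lambda>x. 0)" by (simp add: cocycle_def lin_fun_0 J_0')
  have zero_boundary: "boundary_of 0 c (\<lambda>x. 0)" by (rule boundary_of_J) (simp_all add: J_0')
  have Z_add: "\<phi> \<oplus>\<^bsub>?M\<^esub> \<psi> \<in> Z" if "\<phi> \<in> Z" "\<psi> \<in> Z" for \<phi> \<psi>
    using restrict_Z[OF cocycle_add[OF le0 ZD(1)[OF that(1)] ZD(1)[OF that(2)]]] by (simp add: C_add)
  have ext: "\<phi> = \<psi>" if "\<phi> \<in> Z" "\<psi> \<in> Z" "\<And>x. x \<in> vec V (k c) \<Longrightarrow> \<phi> x = \<psi> x" for \<phi> \<psi>
    using extensionalityI[OF ZD(2)[OF that(1)] ZD(2)[OF that(2)]] that(3) by blast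
  have M: "abelian_group ?M"
  proof (rule abelian_groupI)
    show z: "\<zero>\<^bsub>?M\<^esub> \<in> carrier ?M" using restrict_Z[OF zero_cocycle] by (simp add: C_zero)
    fix \<phi> assume \<phi>: "\<phi> \<in> carrier ?M"
    then have "cocycle 0 c (\<lambda>x. - 1 * \<phi> x)" using cocycle_times[OF le0 polys_minus_one] ZD by simp
    then have m: "restrict (\<lambda>x. - 1 * \<phi> x) (vec V (k c)) \<in> Z" by (rule restrict_Z)
    show "\<exists>\<psi>\<in>carrier ?M. \<psi> \<oplus>\<^bsub>?M\<^esub> \<phi> = \<zero>\<^bsub>?M\<^esub>"
      by (rule bexI[of _ "restrict (\<lambda>x. - 1 * \<phi> x) (vec V (k c))"])
        (use m in \<open>auto simp: C_add C_zero restrict_def\<close>)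
    show "\<zero>\<^bsub>?M\<^esub> \<oplus>\<^bsub>?M\<^esub> \<phi> = \<phi>"
      by (rule ext[OF Z_add]) (use \<phi> z in \<open>simp_all add: C_add C_zero\<close>)
  next
    fix \<phi> \<psi> \<chi> assume "\<phi> \<in> carrier ?M" "\<psi> \<in> carrier ?M" "\<chi> \<in> carrier ?M"
    then show "\<phi> \<oplus>\<^bsub>?M\<^esub> \<psi> \<oplus>\<^bsub>?M\<^esub> \<chi> = \<phi> \<oplus>\<^bsub>?M\<^esub> (\<psi> \<oplus>\<^bsub>?M\<^esub> \<chi>)"
      by (auto simp: C_add restrict_def add_ac)
  qed (use Z_add in \<open>auto simp: C_add restrict_def add_ac\<close>)
  have BZ: "B \<subseteq> Z" by (auto simp: B_def)
  have BD: "boundary_of 0 c \<phi>" "cocycle 0 c \<phi>" if "\<phi> \<in> B" for \<phi>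
    using that by (simp_all add: B_def Z_def)
  have minus_B: "restrict (\<lambda>x. - \<phi> x) (vec V (k c)) \<in> B" if "\<phi> \<in> B" for \<phi>
    using restrict_B[of "\<lambda>x. 0 - \<phi> x"] cocycle_diff[OF le0 zero_cocycle BD(2)[OF that]]
      boundary_of_diff[OF le0 zero_boundary BD(1)[OF that]] by simp
  have add_B: "\<phi> \<oplus>\<^bsub>?M\<^esub> \<psi> \<in> B" if "\<phi> \<in> B" "\<psi> \<in> B" for \<phi> \<psi>
  proof -
    have "boundary_of 0 c (\<lambda>x. \<phi> x - (0 - \<psi> x))"
      by (intro boundary_of_diff le0 BD that zero_boundary)
    then have "boundary_of 0 c (\<lambda>x. \<phi> x + \<psi> x)" by simp
    then show ?thesis
      using restrict_B[OF cocycle_add[OF le0 BD(2)[OF that(1)] BD(2)[OF that(2)]]] by (simp add: C_add)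
  qed
  have scale_B: "a \<odot>\<^bsub>?M\<^esub> \<phi> \<in> B" if a: "a \<in> polys V" and \<phi>: "\<phi> \<in> B" for a \<phi>
  proof -
    obtain \<chi> where \<chi>: "lin_fun V (k b) \<chi>" "\<And>x. x \<in> vec V (k c) \<Longrightarrow> \<phi> x = \<chi> (d b x)"
      using BD(1)[OF \<phi>] by (auto simp: cb J_0')
    then have "boundary_of 0 c (\<lambda>x. a * \<phi> x)"
      using lin_fun_times[OF a \<chi>(1)] by (auto simp: cb J_0' intro!: exI[of _ "\<lambda>x. a * \<chi> x"])
    then show ?thesis
      using restrict_B[OF cocycle_times[OF le0 a BD(2)[OF \<phi>]]] by (simp add: C_smult)
  qed
  have SM: "scalar_quotient ?S ?M B"
  proof (intro scalar_quotient.intro scalar_quotient_axioms.intro)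
    interpret M: abelian_group ?M by (rule M)
    have "subgroup B (add_monoid ?M)"
    proof (rule M.add.subgroupI)
      show "B \<subseteq> carrier ?M" using BZ by simp
      show "B \<noteq> {}" using restrict_B[OF zero_cocycle zero_boundary] by blast
      fix \<phi> assume \<phi>: "\<phi> \<in> B"
      have "\<ominus>\<^bsub>?M\<^esub> \<phi> = restrict (\<lambda>x. - \<phi> x) (vec V (k c))"
        by (rule M.minus_equality) (use \<phi> BZ minus_B in \<open>auto simp: C_add C_zero restrict_def\<close>)
      then show "\<ominus>\<^bsub>?M\<^esub> \<phi> \<in> B" using minus_B[OF \<phi>] by simp
    qed (rule add_B)
    then show "abelian_subgroup B ?M"
      by (intro abelian_subgroupI3 additive_subgroupI M)
    fix a \<phi> assume a: "a \<in> carrier ?S" and \<phi>: "\<phi> \<in> carrier ?M"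
    then show "a \<odot>\<^bsub>?M\<^esub> \<phi> \<in> carrier ?M"
      using restrict_Z[OF cocycle_times[OF le0 a ZD(1)]] by (simp add: C_smult)
  next
    fix a \<phi> assume "a \<in> carrier ?S" "\<phi> \<in> B"
    then show "a \<odot>\<^bsub>?M\<^esub> \<phi> \<in> B" by (rule scale_B)
  qed (auto simp: C_smult C_add distrib_left restrict_def)
  have colon_ideal: "ideal colon ?S"
    by (rule poly_idealI)
      (auto simp: colon_def polys_closed distrib_right mult.assoc poly_ideal_closed[OF Jc])
  have J_colon: "J c \<subseteq> colon"
    using poly_ideal_carrier[OF Jc] poly_ideal_mult2[OF Jc poly_ideal_carrier[OF I]] by (auto simp: colon_def)
  have SN: "scalar_quotient ?S ?N (J c)"
    by (rule scalar_quotient_poly_ideal[OF colon_ideal Jc J_colon])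
  obtain \<theta> where \<theta>: "induces_iso 0 c \<theta>" using induces_iso_exists[of c] by auto
  \<comment> \<open>Restriction changes \<open>\<phi>\<close> only outside \<open>vec\<close>, so
    the difference is a coboundary.\<close>
  have \<theta>_res: "\<theta> (restrict \<phi> (vec V (k c))) - \<theta> \<phi> \<in> J c" if "cocycle 0 c \<phi>" for \<phi>
    by (rule induces_iso_cong[OF le0 \<theta>])
      (use that ZD(1)[OF restrict_Z] in \<open>auto intro!: boundary_of_J simp: J_0'\<close>)
  show ?thesis
    unfolding coh
  proof (rule quotient_module_iso[OF SM SN, of \<theta>])
    fix \<phi> assume \<phi>: "\<phi> \<in> carrier ?M"
    then have c\<phi>: "cocycle 0 c \<phi>" using ZD by simp
    show "\<theta> \<phi> \<in> carrier ?N" using \<theta> c\<phi> by (simp add: induces_iso_def)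
    show "\<theta> \<phi> \<in> J c \<longleftrightarrow> \<phi> \<in> B" using \<theta> c\<phi> \<phi> by (simp add: induces_iso_def B_def)
    {
      fix \<psi> assume "\<psi> \<in> carrier ?M"
      then have c\<psi>: "cocycle 0 c \<psi>" using ZD by simp
      have "\<theta> (\<lambda>x. \<phi> x + \<psi> x) - (\<theta> \<phi> + \<theta> \<psi>) \<in> J c"
        using \<theta> c\<phi> c\<psi> by (simp add: induces_iso_def)
      then have "\<theta> (\<phi> \<oplus>\<^bsub>?M\<^esub> \<psi>) - (\<theta> \<phi> + \<theta> \<psi>) \<in> J c"
        using poly_ideal_diff_trans[OF Jc \<theta>_res[OF cocycle_add[OF le0 c\<phi> c\<psi>]]] by (simp add: C_add)
      then show "J c +>\<^bsub>?N\<^esub> \<theta> (\<phi> \<oplus>\<^bsub>?M\<^esub> \<psi>) = J c +>\<^bsub>?N\<^esub> (\<theta> \<phi> \<oplus>\<^bsub>?N\<^esub> \<theta> \<psi>)"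
        unfolding poly_coset_eq_iff[OF Jc] by (simp add: ring_module_def)
    }
    fix a assume a: "a \<in> carrier ?S"
    have "\<theta> (\<lambda>x. a * \<phi> x) - a * \<theta> \<phi> \<in> J c"
      using \<theta> c\<phi> a by (simp add: induces_iso_def)
    then have "\<theta> (a \<odot>\<^bsub>?M\<^esub> \<phi>) - a * \<theta> \<phi> \<in> J c"
      using poly_ideal_diff_trans[OF Jc \<theta>_res[OF cocycle_times[OF le0 a c\<phi>]]] by (simp add: C_smult)
    then show "J c +>\<^bsub>?N\<^esub> \<theta> (a \<odot>\<^bsub>?M\<^esub> \<phi>) = J c +>\<^bsub>?N\<^esub> (a \<odot>\<^bsub>?N\<^esub> \<theta> \<phi>)"
      unfolding poly_coset_eq_iff[OF Jc] by (simp add: ring_module_def)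
  next
    fix g assume "g \<in> carrier ?N"
    then obtain \<phi> where \<phi>: "cocycle 0 c \<phi>" "\<theta> \<phi> - g \<in> J c"
      using \<theta> by (auto simp: induces_iso_def)
    have "\<theta> (restrict \<phi> (vec V (k c))) - g \<in> J c"
      by (rule poly_ideal_diff_trans[OF Jc \<theta>_res[OF \<phi>(1)] \<phi>(2)])
    then show "\<exists>\<phi>\<in>carrier ?M. J c +>\<^bsub>?N\<^esub> \<theta> \<phi> = J c +>\<^bsub>?N\<^esub> g"
      unfolding poly_coset_eq_iff[OF Jc] using restrict_Z[OF \<phi>(1)] by auto
  qed
qed

theorem hom_cohomology_regular_sequence:
  fixes f :: "nat \<Rightarrow> ('v, 'k::field) mpoly"
  assumes I: "ideal I (poly_ring V)"
    and res: "free_resolution (poly_ring V) (quotient_module (ring_module (poly_ring V)) I) k d e"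
    and f_in: "\<And>i. i < c \<Longrightarrow> f i \<in> I"
    and regular: "\<And>r g. r < c \<Longrightarrow> g \<in> polys V \<Longrightarrow> f r * g \<in> ideal_span V f {..<r} \<Longrightarrow>
      g \<in> ideal_span V f {..<r}"
    and c: "0 < c"
  shows "isomorphic_modules (poly_ring V) (hom_cohomology (poly_ring V) k d (ring_module (poly_ring V)) c)
    (quotient_module ((ring_module (poly_ring V))\<lparr>carrier :=
       {g \<in> polys V. \<forall>a\<in>I. g * a \<in> ideal_span V f {..<c}}\<rparr>) (ideal_span V f {..<c}))"
proof -
  obtain ev u where "poly_resolution V I k d ev u"
    using free_resolution_poly_resolution[OF I res] by blast
  then interpret regular_resolution V I k d ev u f c
    using f_in regular by (intro regular_resolution.intro regular_resolution_axioms.intro) auto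
  have "d i \<in> extensional (vec V (k (Suc i)))" for i
    using res linear_maps_free_iff[of "d i" V] by (auto simp: free_resolution_def Let_def)
  from hom_cohomology_iso[OF this c] show ?thesis by (simp add: colon_def)
qed

subsection \<open>Monomial orders\<close>

definition wdeg :: "('v \<Rightarrow> nat) \<Rightarrow> ('v \<Rightarrow>\<^sub>0 nat) \<Rightarrow> nat" where
  "wdeg w t = (\<Sum>v\<in>keys t. w v * lookup t v)"

lemma wdeg_superset: "finite A \<Longrightarrow> keys t \<subseteq> A \<Longrightarrow> wdeg w t = (\<Sum>v\<in>A. w v * lookup t v)"
  unfolding wdeg_def by (rule sum.mono_neutral_left) (auto simp: in_keys_iff)

lemma wdeg_add: "wdeg w (s + t) = wdeg w s + wdeg w t"
proof -
  have "wdeg w u = (\<Sum>v\<in>keys s \<union> keys t. w v * lookup u v)" if "keys u \<subseteq> keys s \<union> keys t" for u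
    using that by (intro wdeg_superset) auto
  then show ?thesis
    by (simp add: keys_add_nat lookup_add distrib_left sum.distrib)
qed

lemma wdeg_single: "wdeg w (single v n) = w v * n"
  by (cases "n = 0") (simp_all add: wdeg_def)

lemma wdeg_0 [simp]: "wdeg w 0 = 0"
  by (simp add: wdeg_def)

text \<open>Weight first, ties broken by the linear order on exponent vectors, pairs being compared
  lexicographically. For the constant weight 1 this is a degree order, in which a monomial in
  finitely many variables has only finitely many predecessors.\<close>

definition mkey :: "('v \<Rightarrow> nat) \<Rightarrow> ('v::linorder \<Rightarrow>\<^sub>0 nat) \<Rightarrow> nat \<times> ('v \<Rightarrow>\<^sub>0 nat)" where
  "mkey w t = (wdeg w t, t)"

definition lead :: "('v \<Rightarrow> nat) \<Rightarrow> (('v::linorder \<Rightarrow>\<^sub>0 nat) \<Rightarrow>\<^sub>0 'k::zero) \<Rightarrow> ('v \<Rightarrow>\<^sub>0 nat)" where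
  "lead w p = snd (Max (mkey w ` keys p))"

lemma mkey_inj: "mkey w s = mkey w t \<longleftrightarrow> s = t"
  by (auto simp: mkey_def)

lemma mkey_le_iff: "mkey w s \<le> mkey w t \<longleftrightarrow> mkey w s < mkey w t \<or> s = t"
  using mkey_inj[of w s t] by (auto simp: le_less)

lemma mkey_add_less: "mkey w s < mkey w t \<Longrightarrow> mkey w (u + s) < mkey w (u + t)"
  by (auto simp: mkey_def less_prod_simp wdeg_add add_strict_left_mono)

lemma lead_keys:
  assumes "p \<noteq> 0"
  shows "lead w p \<in> keys p"
proof -
  have "Max (mkey w ` keys p) \<in> mkey w ` keys p"
    using assms by (intro Max_in) auto
  then show ?thesis by (auto simp: lead_def mkey_def)
qed

lemma lead_max: "t \<in> keys p \<Longrightarrow> mkey w t \<le> mkey w (lead w p)"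
proof -
  assume t: "t \<in> keys p"
  then have "Max (mkey w ` keys p) \<in> mkey w ` keys p" by (intro Max_in) auto
  then have "mkey w (lead w p) = Max (mkey w ` keys p)" by (auto simp: lead_def mkey_def)
  then show ?thesis using t by simp
qed

lemma lookup_lead: "p \<noteq> 0 \<Longrightarrow> lookup p (lead w p) \<noteq> 0"
  using lead_keys by (simp add: in_keys_iff)

text \<open>The position of a monomial in the degree order, which turns the descent of leading
  monomials into induction over the natural numbers.\<close>

definition mrank :: "'v set \<Rightarrow> ('v::linorder \<Rightarrow>\<^sub>0 nat) \<Rightarrow> nat" where
  "mrank V t = card {s. keys s \<subseteq> V \<and> mkey (\<lambda>_. 1) s < mkey (\<lambda>_. 1) t}"

lemma finite_bounded_monomials:
  assumes "finite V"
  shows "finite {s :: 'v \<Rightarrow>\<^sub>0 nat. keys s \<subseteq> V \<and> (\<forall>v\<in>V. lookup s v \<le> N)}"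
proof (rule finite_imageD)
  have "lookup ` {s. keys s \<subseteq> V \<and> (\<forall>v\<in>V. lookup s v \<le> N)}
      \<subseteq> {f. \<forall>v. (v \<in> V \<longrightarrow> f v \<in> {..N}) \<and> (v \<notin> V \<longrightarrow> f v = 0)}"
    by (auto simp: in_keys_iff)
  then show "finite (lookup ` {s. keys s \<subseteq> V \<and> (\<forall>v\<in>V. lookup s v \<le> N)})"
    using finite_set_of_finite_funs[OF assms finite_atMost] by (rule finite_subset)
  show "inj_on lookup {s :: 'v \<Rightarrow>\<^sub>0 nat. keys s \<subseteq> V \<and> (\<forall>v\<in>V. lookup s v \<le> N)}"
    by (rule inj_onI, rule poly_mapping_eqI) simp
qed

lemma lookup_le_tdeg: "lookup t v \<le> wdeg (\<lambda>_. 1) t"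
proof (cases "v \<in> keys t")
  case True
  then show ?thesis unfolding wdeg_def by (simp add: member_le_sum)
qed (simp add: in_keys_iff)

lemma mrank_less:
  assumes "finite V" "keys s \<subseteq> V" and st: "mkey (\<lambda>_. 1) s < mkey (\<lambda>_. 1) t"
  shows "mrank V s < mrank V t"
  unfolding mrank_def
proof (rule psubset_card_mono)
  have "{s. keys s \<subseteq> V \<and> mkey (\<lambda>_. 1) s < mkey (\<lambda>_. 1) t}
      \<subseteq> {s. keys s \<subseteq> V \<and> (\<forall>v\<in>V. lookup s v \<le> wdeg (\<lambda>_. 1) t)}"
    by (auto simp: mkey_def less_prod_simp intro!: order_trans[OF lookup_le_tdeg])
  then show "finite {s. keys s \<subseteq> V \<and> mkey (\<lambda>_. 1) s < mkey (\<lambda>_. 1) t}"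
    using finite_bounded_monomials[OF assms(1)] finite_subset by blast
  have "s \<notin> {r. keys r \<subseteq> V \<and> mkey (\<lambda>_. 1) r < mkey (\<lambda>_. 1) s}" by simp
  moreover have "s \<in> {r. keys r \<subseteq> V \<and> mkey (\<lambda>_. 1) r < mkey (\<lambda>_. 1) t}" using assms by simp
  ultimately show "{r. keys r \<subseteq> V \<and> mkey (\<lambda>_. 1) r < mkey (\<lambda>_. 1) s}
      \<subset> {r. keys r \<subseteq> V \<and> mkey (\<lambda>_. 1) r < mkey (\<lambda>_. 1) t}"
    using order.strict_trans[OF _ st] by blast
qed


subsection \<open>Existence of free resolutions\<close>

text \<open>Stated for an arbitrary exponent function \<open>c\<close>, since it will be applied to
  leading monomials of components of vectors. Induction on the variables: elements with a large
  exponent at \<open>v\<close> are covered by the family that ignores \<open>v\<close>, and each of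
  the finitely many small exponents has its own family.\<close>

lemma dickson:
  fixes c :: "'a \<Rightarrow> 'v \<Rightarrow> nat"
  assumes "finite V"
  shows "\<exists>F. finite F \<and> F \<subseteq> M \<and> (\<forall>t\<in>M. \<exists>s\<in>F. \<forall>v\<in>V. c s v \<le> c t v)"
  using assms
proof (induction V arbitrary: M rule: finite_induct)
  case empty
  show ?case
  proof (cases "M = {}")
    case False
    then obtain s where "s \<in> M" by blast
    then show ?thesis by (intro exI[of _ "{s}"]) auto
  qed auto
next
  case (insert v V)
  obtain F0 where F0: "finite F0" "F0 \<subseteq> M" "\<forall>t\<in>M. \<exists>s\<in>F0. \<forall>v\<in>V. c s v \<le> c t v"
    using insert.IH[of M] by blast
  have "\<forall>n. \<exists>F. finite F \<and> F \<subseteq> {t \<in> M. c t v = n} \<and>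
      (\<forall>t\<in>{t \<in> M. c t v = n}. \<exists>s\<in>F. \<forall>v\<in>V. c s v \<le> c t v)"
    by (intro allI insert.IH)
  from choice[OF this] obtain F where "\<forall>n. finite (F n) \<and> F n \<subseteq> {t \<in> M. c t v = n} \<and>
      (\<forall>t\<in>{t \<in> M. c t v = n}. \<exists>s\<in>F n. \<forall>v\<in>V. c s v \<le> c t v)" ..
  then have F: "\<And>n. finite (F n)" "\<And>n. F n \<subseteq> {t \<in> M. c t v = n}"
    "\<And>n. \<forall>t\<in>{t \<in> M. c t v = n}. \<exists>s\<in>F n. \<forall>v\<in>V. c s v \<le> c t v"
    by simp_all
  \<comment> \<open>Any common bound for the exponents at \<open>v\<close> within \<open>F0\<close>
    would do.\<close>
  define N where "N = (\<Sum>s\<in>F0. c s v)"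
  let ?F = "F0 \<union> (\<Union>n<N. F n)"
  have "\<exists>s\<in>?F. \<forall>x\<in>insert v V. c s x \<le> c t x" if t: "t \<in> M" for t
  proof (cases "c t v < N")
    case True
    then obtain s where "s \<in> F (c t v)" "\<forall>x\<in>V. c s x \<le> c t x" using F(3) t by blast
    then show ?thesis using True F(2)[of "c t v"] by (intro bexI[of _ s]) auto
  next
    case False
    obtain s where s: "s \<in> F0" "\<forall>x\<in>V. c s x \<le> c t x" using F0(3) t by blast
    have "c s v \<le> N" unfolding N_def using member_le_sum[OF s(1), of "\<lambda>s. c s v"] F0(1) by simp
    then show ?thesis using s False by (intro bexI[of _ s]) auto
  qed
  moreover have "?F \<subseteq> M" using F0(2) F(2) by blast
  moreover have "finite ?F" using F0(1) F(1) by simp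
  ultimately show ?case by blast
qed

lemma lookup_xpow_mult:
  "lookup (single s c * p) (s + t) = c * lookup p (t :: 'v \<Rightarrow>\<^sub>0 nat)" for p :: "('v, 'k::comm_ring_1) mpoly"
proof (rule poly_lin_induct[of p UNIV])
  fix r :: "'v \<Rightarrow>\<^sub>0 nat" and d :: 'k
  show "lookup (single s c * single r d) (s + t) = c * lookup (single r d) t"
    by (simp add: mult_single lookup_single when_def)
qed (simp_all add: distrib_left lookup_add)

lemma keys_single_mult:
  "keys (single s c * p) \<subseteq> (\<lambda>t. s + t) ` keys (p :: ('v, 'k::comm_ring_1) mpoly)"
proof
  fix u assume "u \<in> keys (single s c * p)"
  then obtain a b where "u = a + b" "a \<in> keys (single s c)" "b \<in> keys p"
    using subsetD[OF keys_mult] by blast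
  then show "u \<in> (\<lambda>t. s + t) ` keys p" by (auto split: if_splits)
qed

lemma monomial_minus_add:
  "(\<And>v. lookup s v \<le> lookup t v) \<Longrightarrow> s + (t - s) = (t :: 'v \<Rightarrow>\<^sub>0 nat)"
  by (rule poly_mapping_eqI) (simp add: lookup_add lookup_minus)

lemma lead_cancel:
  fixes p q :: "('v::linorder, 'k::field) mpoly"
  assumes p: "p \<noteq> 0" and q: "q \<noteq> 0" and le: "\<And>v. lookup (lead w q) v \<le> lookup (lead w p) v"
  defines "r \<equiv> p - single (lead w p - lead w q) (lookup p (lead w p) / lookup q (lead w q)) * q"
  assumes r: "r \<noteq> 0"
  shows "mkey w (lead w r) < mkey w (lead w p)"
proof -
  let ?s = "lead w p - lead w q"
  let ?c = "lookup p (lead w p) / lookup q (lead w q)"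
  have s: "?s + lead w q = lead w p"
    using monomial_minus_add[OF le] by (simp add: add.commute)
  have "lookup (single ?s ?c * q) (?s + lead w q) = ?c * lookup q (lead w q)"
    by (rule lookup_xpow_mult)
  then have "lookup r (lead w p) = 0"
    using lookup_lead[OF q, of w] unfolding s r_def by (simp add: lookup_minus)
  then have ne: "lead w r \<noteq> lead w p" using lookup_lead[OF r, of w] by auto
  have "lead w r \<in> keys p \<union> keys (single ?s ?c * q)"
    using lead_keys[OF r, of w] unfolding r_def by (auto simp: in_keys_iff lookup_minus)
  then have "mkey w (lead w r) \<le> mkey w (lead w p)"
  proof
    assume "lead w r \<in> keys p"
    then show ?thesis by (rule lead_max)
  next
    assume "lead w r \<in> keys (single ?s ?c * q)"
    then obtain t where t: "t \<in> keys q" "lead w r = ?s + t" using keys_single_mult by blast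
    have "mkey w t \<le> mkey w (lead w q)" by (rule lead_max[OF t(1)])
    then have "mkey w (?s + t) \<le> mkey w (?s + lead w q)"
      using mkey_add_less[of w t "lead w q" ?s] by (auto simp: mkey_le_iff)
    then show ?thesis unfolding t(2) s .
  qed
  with ne show ?thesis by (simp add: mkey_le_iff)
qed

section \<open>Hilbert's basis theorem for submodules of free modules\<close>

definition spanned :: "'v set \<Rightarrow> nat \<Rightarrow> (nat \<Rightarrow> ('v, 'k::comm_ring_1) mpoly) set \<Rightarrow> (nat \<Rightarrow> ('v, 'k) mpoly) \<Rightarrow> bool" where
  "spanned V k F x \<longleftrightarrow> (\<exists>a. (\<forall>g\<in>F. a g \<in> polys V) \<and> (\<forall>j<k. x j = (\<Sum>g\<in>F. a g * g j)))"

lemma spanned_comb: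
  assumes "spanned V k F x" "finite F" "g \<in> F" "c \<in> polys V" "\<And>j. j < k \<Longrightarrow> y j = x j + c * g j"
  shows "spanned V k F y"
proof -
  obtain a where a: "\<forall>g\<in>F. a g \<in> polys V" "\<forall>j<k. x j = (\<Sum>g\<in>F. a g * g j)"
    using assms(1) by (auto simp: spanned_def)
  have "y j = (\<Sum>h\<in>F. (a h + (if h = g then c else 0)) * h j)" if "j < k" for j
  proof -
    have "(\<Sum>h\<in>F. (if h = g then c else 0) * h j) = (\<Sum>h\<in>F. if h = g then c * h j else 0)"
      by (rule sum.cong) auto
    then show ?thesis
      using assms a(2) that by (simp add: distrib_right sum.distrib)
  qed
  then show ?thesis
    unfolding spanned_def using a(1) assms(4)
    by (intro exI[of _ "\<lambda>h. a h + (if h = g then c else 0)"]) (auto simp: polys_closed)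
qed

definition submod :: "'v set \<Rightarrow> nat \<Rightarrow> (nat \<Rightarrow> ('v, 'k::comm_ring_1) mpoly) set \<Rightarrow> bool" where
  "submod V k U \<longleftrightarrow> U \<subseteq> vec V k \<and> vzero k \<in> U \<and> (\<forall>x\<in>U. \<forall>y\<in>U. vadd k x y \<in> U) \<and>
     (\<forall>a\<in>polys V. \<forall>x\<in>U. vscale k a x \<in> U)"

text \<open>A Groebner basis argument in which the position counts before the monomial.
  \<open>M j\<close> collects the elements whose last nonzero component is \<open>j\<close>; by
  Dickson's lemma finitely many of them have leading monomials dividing all others. Division by
  these lowers the rank of the last component until it vanishes.\<close>

lemma hilbert_basis:
  fixes V :: "'v::linorder set" and U :: "(nat \<Rightarrow> ('v, 'k::field) mpoly) set"
  assumes V: "finite V" and U: "submod V k U"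
  obtains F where "finite F" "F \<subseteq> U" "\<And>x. x \<in> U \<Longrightarrow> spanned V k F x"
proof -
  let ?w = "\<lambda>_. 1"
  have Uv: "x \<in> vec V k" if "x \<in> U" for x using U that by (auto simp: submod_def)
  define M where "M j = {x \<in> U. x j \<noteq> 0 \<and> (\<forall>i. j < i \<longrightarrow> i < k \<longrightarrow> x i = 0)}" for j
  have "\<exists>F. finite F \<and> F \<subseteq> M j \<and>
      (\<forall>t\<in>M j. \<exists>s\<in>F. \<forall>v\<in>V. lookup (lead ?w (s j)) v \<le> lookup (lead ?w (t j)) v)" for j
    by (rule dickson[OF V])
  then obtain F where F: "\<And>j. finite (F j)" "\<And>j. F j \<subseteq> M j"
    "\<And>j. \<forall>t\<in>M j. \<exists>s\<in>F j. \<forall>v\<in>V. lookup (lead ?w (s j)) v \<le> lookup (lead ?w (t j)) v"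
    by metis
  let ?G = "\<Union>j<k. F j"
  have fin: "finite ?G" using F(1) by simp
  have GU: "?G \<subseteq> U" using F(2) by (auto simp: M_def)
  have lead_V: "keys (lead ?w p) \<subseteq> V" if "p \<in> polys V" "p \<noteq> 0" for p :: "('v, 'k) mpoly"
    using that lead_keys[OF that(2)] by (auto simp: polys_iff)
  have main: "spanned V k ?G x" if "x \<in> U" "\<And>i. n \<le> i \<Longrightarrow> i < k \<Longrightarrow> x i = 0" "n \<le> k" for n x
    using that
  proof (induction n arbitrary: x)
    case 0
    then show ?case by (auto simp: spanned_def intro!: exI[of _ "\<lambda>_. 0"])
  next
    case (Suc n)
    note IHn = Suc.IH
    have n: "n < k" using Suc.prems by simp
    \<comment> \<open>The value 0 is reserved for a vanishing component, hence the
      \<open>Suc\<close>.\<close>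
    define \<mu> where "\<mu> x = (if x n = 0 then 0 else Suc (mrank V (lead ?w (x n))))"
      for x :: "nat \<Rightarrow> ('v, 'k) mpoly"
    show ?case
      using Suc.prems(1,2)
    proof (induction "\<mu> x" arbitrary: x rule: less_induct)
      case less
      show ?case
      proof (cases "x n = 0")
        case True
        then have "x i = 0" if "n \<le> i" "i < k" for i
          using less.prems(2)[of i] that by (cases "i = n") auto
        then show ?thesis using IHn[of x] less.prems(1) n by simp
      next
        case False
        then have "x \<in> M n" using less.prems by (simp add: M_def)
        then obtain s where s: "s \<in> F n" "\<forall>v\<in>V. lookup (lead ?w (s n)) v \<le> lookup (lead ?w (x n)) v"
          using F(3) by blast
        have sM: "s \<in> M n" using s(1) F(2) by blast
        then have s0: "s n \<noteq> 0" and sU: "s \<in> U" by (auto simp: M_def)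
        note sv = Uv[OF sU] and xv = Uv[OF less.prems(1)]
        have le: "lookup (lead ?w (s n)) v \<le> lookup (lead ?w (x n)) v" for v
        proof (cases "v \<in> V")
          case False
          then have "v \<notin> keys (lead ?w (s n))" using lead_V[OF vec_mem[OF sv n] s0] by blast
          then show ?thesis by (simp add: in_keys_iff)
        qed (use s(2) in simp)
        define c where "c = single (lead ?w (x n) - lead ?w (s n))
          (lookup (x n) (lead ?w (x n)) / lookup (s n) (lead ?w (s n)))"
        have "keys (lead ?w (x n) - lead ?w (s n)) \<subseteq> keys (lead ?w (x n))"
          by (auto simp: in_keys_iff lookup_minus)
        then have c: "c \<in> polys V"
          unfolding c_def using lead_V[OF vec_mem[OF xv n] False] by (intro single_in_polys) auto
        define y where "y = vadd k x (vscale k (- c) s)"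
        have y: "y j = x j - c * s j" if "j < k" for j using that by (simp add: y_def)
        have yU: "y \<in> U"
          using U less.prems(1) sU polys_uminus[OF c] by (auto simp: submod_def y_def)
        have y0: "y i = 0" if "Suc n \<le> i" "i < k" for i
          using that y[of i] less.prems(2)[of i] sM by (simp add: M_def)
        have "\<mu> y < \<mu> x"
        proof (cases "y n = 0")
          case True
          then show ?thesis using False by (simp add: \<mu>_def)
        next
          case yn: False
          have "mkey ?w (lead ?w (y n)) < mkey ?w (lead ?w (x n))"
            using lead_cancel[OF False s0, of ?w] le yn unfolding y[OF n] c_def by blast
          then have "mrank V (lead ?w (y n)) < mrank V (lead ?w (x n))"
            by (rule mrank_less[OF V lead_V[OF vec_mem[OF Uv[OF yU] n] yn]])
          then show ?thesis using False yn by (simp add: \<mu>_def)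
        qed
        then have "spanned V k ?G y" by (rule less.hyps[OF _ yU y0])
        then show ?thesis
          by (rule spanned_comb[OF _ fin _ c]) (use s(1) n y in auto)
      qed
    qed
  qed
  show thesis
    by (rule that[OF fin GU]) (rule main[of _ k], auto)
qed

section \<open>Construction of resolutions by covering kernels\<close>

lemma submod_image:
  fixes V :: "'v::linorder set" and U :: "(nat \<Rightarrow> ('v, 'k::field) mpoly) set"
  assumes V: "finite V" and U: "submod V k U"
  shows "\<exists>l h. h \<in> linear_maps (poly_ring V) (free_module (poly_ring V) l) (free_module (poly_ring V) k) \<and>
    h ` vec V l = U"
proof -
  obtain F where F: "finite F" "F \<subseteq> U" "\<And>x. x \<in> U \<Longrightarrow> spanned V k F x"
    using hilbert_basis[OF V U] by blast
  obtain w where w: "bij_betw w {..<card F} F"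
    using ex_bij_betw_nat_finite[OF F(1)] by (auto simp: atLeast0LessThan)
  let ?l = "card F"
  have wU: "w i \<in> U" if "i < ?l" for i using that w F(2) by (auto simp: bij_betw_def)
  have Uv: "U \<subseteq> vec V k" using U by (auto simp: submod_def)
  obtain h where h: "lin_map V ?l k h" "\<And>i. i < ?l \<Longrightarrow> h (vunit ?l i) = w i"
    using lin_map_of_units[of ?l w V k] wU Uv by blast
  have im: "h x \<in> U" if x: "x \<in> vec V ?l" for x
  proof (rule vec_induct[OF x, where P = "\<lambda>n y. h y \<in> U"])
    show "h (vzero ?l) \<in> U" using U by (simp add: lin_map_zero[OF h(1)] submod_def)
    fix n y assume "n < ?l" "y \<in> vec V ?l" "h y \<in> U"
    then show "h (vadd ?l y (vscale ?l (x n) (vunit ?l n))) \<in> U"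
      using U x wU h(2) by (auto simp: lin_map_add[OF h(1)] lin_map_scale[OF h(1)] vec_mem submod_def)
  qed
  have "x \<in> h ` vec V ?l" if x: "x \<in> U" for x
  proof -
    obtain a where a: "\<forall>g\<in>F. a g \<in> polys V" "\<forall>j<k. x j = (\<Sum>g\<in>F. a g * g j)"
      using F(3)[OF x] by (auto simp: spanned_def)
    let ?y = "\<lambda>i\<in>{..<?l}. a (w i)"
    have y: "?y \<in> vec V ?l" by (rule vecI) (use a(1) w in \<open>auto simp: bij_betw_def\<close>)
    have "h ?y = x"
    proof (rule vec_eqI[OF lin_map_vec[OF h(1) y] subsetD[OF Uv x]])
      fix j assume j: "j < k"
      have "h ?y j = (\<Sum>i<?l. a (w i) * w i j)"
        by (subst lin_fun_expand[OF lin_map_coord[OF h(1) j] y]) (simp add: h(2))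
      also have "\<dots> = (\<Sum>g\<in>F. a g * g j)"
        by (rule sum.reindex_bij_betw[OF w])
      finally show "h ?y j = x j" using a(2) j by simp
    qed
    with y show ?thesis by blast
  qed
  with im have "h ` vec V ?l = U" by blast
  moreover have "restrict h (vec V ?l) \<in> linear_maps (poly_ring V) (free_module (poly_ring V) ?l) (free_module (poly_ring V) k)"
    unfolding linear_maps_free_iff using h(1) by (auto simp: lin_map_def lin_fun_def)
  ultimately show ?thesis
    by (intro exI[of _ ?l] exI[of _ "restrict h (vec V ?l)"]) simp
qed

lemma submod_kernel:
  assumes "lin_map V l k h"
  shows "submod V l {x \<in> vec V l. h x = vzero k}"
  using assms by (auto simp: submod_def lin_map_add lin_map_scale lin_map_zero)
    (auto simp: vadd_def vscale_def vzero_def)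

text \<open>The kernel of each map is finitely generated and thus the image of another free module;
  dependent choice strings these maps together, starting from S -> S/I.\<close>

lemma free_resolution_exists:
  fixes V :: "'v::linorder set" and I :: "('v, 'k::field) mpoly set"
  assumes V: "finite V" and I: "ideal I (poly_ring V)"
  shows "\<exists>k d e. free_resolution (poly_ring V) (quotient_module (ring_module (poly_ring V)) I) k d e"
proof -
  let ?S = "poly_ring V :: ('v, 'k) mpoly ring"
  let ?R = "ring_module ?S"
  let ?Q = "quotient_module ?R I"
  let ?F = "\<lambda>k. free_module ?S k"
  interpret Q: scalar_quotient ?S ?R I
    using scalar_quotient_poly_ideal[OF polys_ideal I] poly_ideal_carrier[OF I]
    by (auto simp: ring_module_carrier_self)
  have Rc: "carrier ?R = polys V" by (simp add: ring_module_def)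
  define e where "e = (\<lambda>x\<in>vec V 1. I +>\<^bsub>?R\<^esub> x 0)"
  have e_lin: "e \<in> linear_maps ?S (?F 1) ?Q"
    unfolding linear_maps_def
  proof (intro CollectI conjI ballI)
    show "e \<in> carrier (?F 1) \<rightarrow>\<^sub>E carrier ?Q"
      by (auto simp: e_def vec_carrier Q.quotient_carrier Rc vec_mem)
    fix x :: "nat \<Rightarrow> ('v, 'k) mpoly" assume "x \<in> carrier (?F 1)"
    then have x: "x \<in> vec V 1" by (simp add: vec_carrier)
    have x0: "x 0 \<in> carrier ?R" by (simp add: Rc vec_mem[OF x])
    {
      fix y assume "y \<in> carrier (?F 1)"
      then have y: "y \<in> vec V 1" by (simp add: vec_carrier)
      have eq: "x \<oplus>\<^bsub>?F 1\<^esub> y = vadd 1 x y" by (simp add: free_module_def vadd_def)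
      have y0: "y 0 \<in> carrier ?R" by (simp add: Rc vec_mem[OF y])
      show "e (x \<oplus>\<^bsub>?F 1\<^esub> y) = e x \<oplus>\<^bsub>?Q\<^esub> e y"
        unfolding eq e_def using x y Q.add_coset[OF x0 y0] by (simp add: ring_module_def)
    }
    fix r assume r: "r \<in> carrier ?S"
    have eq: "r \<odot>\<^bsub>?F 1\<^esub> x = vscale 1 r x" by (simp add: free_module_def vscale_def)
    show "e (r \<odot>\<^bsub>?F 1\<^esub> x) = r \<odot>\<^bsub>?Q\<^esub> e x"
      unfolding eq e_def using x r Q.smult_coset[OF r x0] by (simp add: ring_module_def)
  qed
  have e_surj: "e ` carrier (?F 1) = carrier ?Q"
  proof
    show "e ` carrier (?F 1) \<subseteq> carrier ?Q" using e_lin by (auto simp: linear_maps_def)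
    show "carrier ?Q \<subseteq> e ` carrier (?F 1)"
    proof
      fix X assume "X \<in> carrier ?Q"
      then obtain p where p: "p \<in> polys V" "X = I +>\<^bsub>?R\<^esub> p" by (auto simp: Q.quotient_carrier Rc)
      have v: "(\<lambda>i\<in>{..<1}. p) \<in> vec V 1" by (rule vecI) (rule p(1))
      then have "e (\<lambda>i\<in>{..<1}. p) = X" by (simp add: e_def p(2))
      with v show "X \<in> e ` carrier (?F 1)" by (auto simp: vec_carrier)
    qed
  qed
  have zero: "I +>\<^bsub>?R\<^esub> b = I \<longleftrightarrow> b \<in> I" for b
  proof -
    have "I +>\<^bsub>?R\<^esub> 0 = I" by (auto simp: a_r_coset_def' ring_module_def)
    then show ?thesis
      using poly_coset_eq_iff[OF I, of "polys V" b 0] by (simp add: ring_module_carrier_self)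
  qed
  have ker_e: "linear_kernel (?F 1) ?Q e = {x \<in> vec V 1. x 0 \<in> I}"
    by (auto simp: linear_kernel_def vec_carrier e_def zero quotient_module_def)
  have sub: "submod V 1 {x \<in> vec V 1. x 0 \<in> I}"
    by (auto simp: submod_def poly_ideal_closed[OF I])
  obtain l0 d0 where d0: "d0 \<in> linear_maps ?S (?F l0) (?F 1)" "d0 ` vec V l0 = linear_kernel (?F 1) ?Q e"
    using submod_image[OF V sub] unfolding ker_e by (elim exE conjE)
  have next_map: "\<exists>l' d'. d' \<in> linear_maps ?S (?F l') (?F l) \<and> d' ` vec V l' = linear_kernel (?F l) (?F k) d"
    if d: "d \<in> linear_maps ?S (?F l) (?F k)" for k l d
  proof -
    have ker: "linear_kernel (?F l) (?F k) d = {x \<in> vec V l. d x = vzero k}"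
      by (auto simp: linear_kernel_def vec_carrier free_module_def vec_def vzero_def)
    have "submod V l {x \<in> vec V l. d x = vzero k}"
      using d by (intro submod_kernel) (simp add: linear_maps_free_iff)
    from submod_image[OF V this] show ?thesis unfolding ker .
  qed
  \<comment> \<open>A stage is a triple: rank of the target, rank of the source, map.
    \<open>T\<close> makes the next map start over the present source and cover the present kernel;
    stage 0 is pinned to the kernel of \<open>e\<close>.\<close>
  define P where "P n s \<longleftrightarrow> (case s of (k, l, d) \<Rightarrow> d \<in> linear_maps ?S (?F l) (?F k) \<and>
      (n = 0 \<longrightarrow> k = 1 \<and> d ` vec V l = linear_kernel (?F 1) ?Q e))"
    for n :: nat and s :: "nat \<times> nat \<times> ((nat \<Rightarrow> ('v, 'k) mpoly) \<Rightarrow> nat \<Rightarrow> ('v, 'k) mpoly)"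
  define T where "T n s s' \<longleftrightarrow> (case s of (k, l, d) \<Rightarrow> case s' of (k', l', d') \<Rightarrow>
      k' = l \<and> d' ` vec V l' = linear_kernel (?F l) (?F k) d)"
    for n :: nat and s s' :: "nat \<times> nat \<times> ((nat \<Rightarrow> ('v, 'k) mpoly) \<Rightarrow> nat \<Rightarrow> ('v, 'k) mpoly)"
  have "\<exists>f. \<forall>n. P n (f n) \<and> T n (f n) (f (Suc n))"
  proof (rule dependent_nat_choice)
    show "\<exists>x. P 0 x" using d0 by (intro exI[of _ "(1, l0, d0)"]) (simp add: P_def)
  next
    fix s n assume "P n s"
    then obtain k l d where s: "s = (k, l, d)" "d \<in> linear_maps ?S (?F l) (?F k)"
      by (cases s) (auto simp: P_def)
    then show "\<exists>s'. P (Suc n) s' \<and> T n s s'"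
      using next_map[OF s(2)] by (auto simp: P_def T_def)
  qed
  then obtain f where f: "\<And>n. P n (f n)" "\<And>n. T n (f n) (f (Suc n))" by blast
  define k where "k n = fst (f n)" for n
  define d where "d n = snd (snd (f n))" for n
  have f_eq: "f n = (k n, k (Suc n), d n)" for n
    using f(2)[of n] by (cases "f n"; cases "f (Suc n)") (auto simp: T_def k_def d_def)
  have k0: "k 0 = 1" and im0: "d 0 ` vec V (k (Suc 0)) = linear_kernel (?F 1) ?Q e"
    using f(1)[of 0] unfolding f_eq P_def by auto
  have dl: "d n \<in> linear_maps ?S (?F (k (Suc n))) (?F (k n))" for n
    using f(1)[of n] unfolding f_eq P_def by auto
  have im: "d (Suc n) ` vec V (k (Suc (Suc n))) = linear_kernel (?F (k (Suc n))) (?F (k n)) (d n)" for n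
    using f(2)[of n] unfolding f_eq T_def by auto
  have "free_resolution ?S ?Q k d e"
    unfolding free_resolution_def Let_def k0
    using e_lin e_surj dl im im0 by (simp add: vec_carrier)
  then show ?thesis by blast
qed

text \<open>Since resolutions exist, the one chosen in \<open>Ext\<close> is a resolution, and the
  isomorphism holds for every resolution.\<close>

theorem Ext_regular_sequence:
  fixes f :: "nat \<Rightarrow> ('v::linorder, 'k::field) mpoly"
  assumes V: "finite V" and I: "ideal I (poly_ring V)"
    and f_in: "\<And>i. i < c \<Longrightarrow> f i \<in> I"
    and regular: "\<And>r g. r < c \<Longrightarrow> g \<in> polys V \<Longrightarrow> f r * g \<in> ideal_span V f {..<r} \<Longrightarrow>
      g \<in> ideal_span V f {..<r}"
    and c: "0 < c"
  shows "isomorphic_modules (poly_ring V)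
    (Ext (poly_ring V) c (quotient_module (ring_module (poly_ring V)) I) (ring_module (poly_ring V)))
    (quotient_module ((ring_module (poly_ring V))\<lparr>carrier :=
       {g \<in> polys V. \<forall>a\<in>I. g * a \<in> ideal_span V f {..<c}}\<rparr>) (ideal_span V f {..<c}))"
proof -
  define Res where "Res = (\<lambda>(k, d). \<exists>e. free_resolution (poly_ring V)
      (quotient_module (ring_module (poly_ring V)) I) k d e)"
  obtain k d where kd: "(SOME s. Res s) = (k, d)" by (cases "SOME s. Res s") auto
  have "\<exists>s. Res s"
    using free_resolution_exists[OF V I] by (auto simp: Res_def)
  then have "Res (SOME s. Res s)" by (rule someI_ex)
  then obtain e where "free_resolution (poly_ring V) (quotient_module (ring_module (poly_ring V)) I) k d e"
    unfolding kd by (auto simp: Res_def)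
  from hom_cohomology_regular_sequence[OF I this f_in regular c] show ?thesis
    unfolding Ext_def Res_def[symmetric] kd by simp
qed

subsection \<open>Monomial maps and toric ideals\<close>

definition pscale :: "nat \<Rightarrow> ('p \<Rightarrow>\<^sub>0 nat) \<Rightarrow> ('p \<Rightarrow>\<^sub>0 nat)" where
  "pscale n m = Poly_Mapping.map ((*) n) m"

lemma lookup_pscale [simp]: "lookup (pscale n m) x = n * lookup m x"
  by (simp add: pscale_def map.rep_eq when_def)

definition dmap :: "('v \<Rightarrow> ('p \<Rightarrow>\<^sub>0 nat)) \<Rightarrow> ('v \<Rightarrow>\<^sub>0 nat) \<Rightarrow> ('p \<Rightarrow>\<^sub>0 nat)" where
  "dmap A t = (\<Sum>v\<in>keys t. pscale (lookup t v) (A v))"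

lemma lookup_dmap: "lookup (dmap A t) x = wdeg (\<lambda>v. lookup (A v) x) t"
  by (simp add: dmap_def wdeg_def lookup_sum mult.commute)

lemma dmap_add: "dmap A (s + t) = dmap A s + dmap A t"
  by (rule poly_mapping_eqI) (simp add: lookup_dmap lookup_add wdeg_add)

lemma dmap_0 [simp]: "dmap A 0 = 0"
  by (simp add: dmap_def)

lemma dmap_single: "dmap A (single v 1) = A v"
  by (rule poly_mapping_eqI) (simp add: lookup_dmap wdeg_single)

lemma keys_dmap: "keys (dmap A t) = (\<Union>v\<in>keys t. keys (A v))"
  by (auto simp: in_keys_iff lookup_dmap wdeg_def) (metis in_keys_iff neq0_conv)

text \<open>The ring homomorphism that sends the variables in \<open>Z\<close> to 0 and every other
  variable \<open>v\<close> to the monomial with exponent \<open>A v\<close>; thus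
  \<open>dmap A t\<close> is the multidegree of the monomial \<open>t\<close>.\<close>

definition mhom :: "'v set \<Rightarrow> ('v \<Rightarrow> ('p \<Rightarrow>\<^sub>0 nat)) \<Rightarrow> ('v, 'k::comm_ring_1) mpoly \<Rightarrow> ('p, 'k) mpoly" where
  "mhom Z A = lin_ext (\<lambda>t. if keys t \<inter> Z = {} then xpow (dmap A t) else 0)"

lemma mhom_add: "mhom Z A (p + q) = mhom Z A p + mhom Z A q"
  and mhom_diff: "mhom Z A (p - q) = mhom Z A p - mhom Z A q"
  and mhom_0 [simp]: "mhom Z A 0 = 0"
  and mhom_sum: "mhom Z A (sum f S) = (\<Sum>i\<in>S. mhom Z A (f i))"
  by (simp_all add: mhom_def lin_ext_add lin_ext_diff lin_ext_sum)

lemma mhom_mult: "mhom Z A (p * q) = mhom Z A p * mhom Z A q"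
  unfolding mhom_def
  by (rule lin_ext_mult) (auto simp: keys_add_nat dmap_add xpow_add)

lemma mhom_xpow: "mhom Z A (xpow t) = (if keys t \<inter> Z = {} then xpow (dmap A t) else 0)"
  unfolding mhom_def by (rule lin_ext_xpow)

lemma mhom_const: "mhom Z A (const c) = const c"
  by (simp add: mhom_def lin_ext_single xpow_0)

lemma mhom_1 [simp]: "mhom Z A 1 = 1"
  using mhom_const[of Z A 1] by simp

lemma mhom_power: "mhom Z A (p ^ n) = mhom Z A p ^ n"
  by (induction n) (simp_all add: mhom_mult)

lemma mhom_prod: "mhom Z A (prod f S) = (\<Prod>i\<in>S. mhom Z A (f i))"
  by (induction S rule: infinite_finite_induct) (simp_all add: mhom_mult)

lemma lookup_mhom: "lookup (mhom Z A p) u = (\<Sum>t | t \<in> keys p \<and> keys t \<inter> Z = {} \<and> dmap A t = u. lookup p t)"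
proof -
  have "lookup (mhom Z A p) u
      = (\<Sum>t\<in>keys p. if keys t \<inter> Z = {} \<and> dmap A t = u then lookup p t else 0)"
    unfolding mhom_def lookup_lin_ext by (rule sum.cong) (auto simp: lookup_xpow)
  also have "\<dots> = (\<Sum>t | t \<in> keys p \<and> keys t \<inter> Z = {} \<and> dmap A t = u. lookup p t)"
    by (simp add: sum.inter_filter)
  finally show ?thesis .
qed

text \<open>The linear order on the parameters orders the exponents of the target ring, which
  therefore has no zero divisors; so these kernels are prime.\<close>

definition toric :: "'v set \<Rightarrow> 'v set \<Rightarrow> ('v \<Rightarrow> ('p::linorder \<Rightarrow>\<^sub>0 nat)) \<Rightarrow> ('v, 'k::field) mpoly set" where
  "toric V Z A = {p \<in> polys V. mhom Z A p = 0}"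

lemma toric_ideal: "ideal (toric V Z A) (poly_ring V)"
  by (rule poly_idealI) (auto simp: toric_def polys_closed mhom_add mhom_mult)

lemma toric_prime:
  assumes "a \<in> polys V" "b \<in> polys V" "a * b \<in> toric V Z A"
  shows "a \<in> toric V Z A \<or> b \<in> toric V Z A"
  using assms by (simp add: toric_def mhom_mult)

lemma one_not_in_toric: "1 \<notin> toric V Z A"
  by (simp add: toric_def)

subsection \<open>The Krull dimension of a toric ring\<close>

text \<open>The lexicographically smallest exponent of an algebraic relation among the \<open>y i\<close> yields
  \<open>y\<^sub>0\<^bsup>a\<^sub>0\<^esup> (y\<^sub>1\<^bsup>a\<^sub>1\<^esup> (\<dots> (1 + y\<^sub>n b\<^sub>n) \<dots>) + y\<^sub>0 b\<^sub>0) = 0\<close>, which is incompatible with a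
  chain of primes separating the \<open>y i\<close> (Coquand and Lombardi).\<close>

lemma no_relation_along_chain:
  fixes P :: "nat \<Rightarrow> ('v, 'k::field) mpoly set"
  assumes "\<And>i. i \<le> n \<Longrightarrow> ideal (P i) (poly_ring V)"
    and "\<And>i a b. i \<le> n \<Longrightarrow> a \<in> polys V \<Longrightarrow> b \<in> polys V \<Longrightarrow> a * b \<in> P i \<Longrightarrow> a \<in> P i \<or> b \<in> P i"
    and "\<And>i. i \<le> n \<Longrightarrow> 1 \<notin> P i"
    and "\<And>i. i < n \<Longrightarrow> P i \<subseteq> P (Suc i)"
    and "\<And>i. i < n \<Longrightarrow> y i \<in> P (Suc i) \<and> y i \<notin> P i"
    and "finite E" "E \<noteq> {}" "\<And>e. e \<in> E \<Longrightarrow> length e = n" "\<And>e. e \<in> E \<Longrightarrow> c e \<noteq> 0"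
    and "(\<Sum>e\<in>E. const (c e) * (\<Prod>i<n. y i ^ (e ! i))) \<in> P 0"
  shows False
  using assms
proof (induction n arbitrary: P y E c)
  case 0
  then have "E = {[]}" by auto
  with 0 have c: "const (c []) \<in> P 0" and c0: "c [] \<noteq> 0" by auto
  have "const (1 / c []) * const (c []) \<in> P 0"
    by (rule poly_ideal_mult[OF 0(1) const_in_polys c]) simp
  also have "const (1 / c []) * const (c []) = 1"
    using c0 by (simp flip: const_mult_const)
  finally show False using 0(3)[of 0] by simp
next
  case (Suc n)
  note id = Suc.prems(1) and prime = Suc.prems(2) and ne1 = Suc.prems(3) and mono = Suc.prems(4)
    and y = Suc.prems(5) and E = Suc.prems(6-9) and rel = Suc.prems(10)
  have id0: "ideal (P 0) (poly_ring V)" and id1: "ideal (P (Suc 0)) (poly_ring V)"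
    using id[of 0] id[of "Suc 0"] by simp_all
  have yp: "y i \<in> polys V" if "i < Suc n" for i
    using y[OF that] poly_ideal_carrier[OF id[of "Suc i"]] that by auto
  define a where "a = Min (hd ` E)"
  have a_le: "a \<le> hd e" if "e \<in> E" for e using that E(1) by (simp add: a_def)
  have "a \<in> hd ` E" unfolding a_def using E by (intro Min_in) auto
  then obtain e0 where e0: "e0 \<in> E" "hd e0 = a" by blast
  define T where "T e = const (c e) * (\<Prod>i<n. y (Suc i) ^ (tl e ! i))" for e
  have Tp: "T e \<in> polys V" for e
    unfolding T_def by (intro polys_closed const_in_polys yp) simp
  have split: "const (c e) * (\<Prod>i<Suc n. y i ^ (e ! i)) = y 0 ^ a * (y 0 ^ (hd e - a) * T e)"
    if e: "e \<in> E" for e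
  proof -
    have "e \<noteq> []" using E(3)[OF e] by auto
    then obtain h t where ht: "e = h # t" by (cases e) auto
    have "y 0 ^ h = y 0 ^ a * y 0 ^ (h - a)"
      using a_le[OF e] ht by (simp flip: power_add)
    then show ?thesis
      unfolding T_def ht by (simp add: prod.lessThan_Suc_shift mult_ac del: prod.lessThan_Suc)
  qed
  define r where "r = (\<Sum>e\<in>E. y 0 ^ (hd e - a) * T e)"
  have rp: "r \<in> polys V" unfolding r_def by (intro polys_closed Tp yp) simp
  have "(\<Sum>e\<in>E. const (c e) * (\<Prod>i<Suc n. y i ^ (e ! i))) = y 0 ^ a * r"
    unfolding r_def sum_distrib_left by (rule sum.cong) (simp_all only: split)
  with rel have yr: "y 0 ^ a * r \<in> P 0" by simp
  \<comment> \<open>The element \<open>y 0\<close> lies outside the prime \<open>P 0\<close> and can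
    be cancelled.\<close>
  have "r \<in> P 0" if "y 0 ^ b * r \<in> P 0" for b
    using that
  proof (induction b)
    case (Suc b)
    have "y 0 * (y 0 ^ b * r) \<in> P 0" using Suc.prems by (simp add: mult_ac)
    then have "y 0 ^ b * r \<in> P 0"
      using prime[of 0 "y 0" "y 0 ^ b * r"] y[of 0] yp rp by (auto intro!: polys_closed)
    then show ?case by (rule Suc.IH)
  qed simp
  from this[OF yr] have r1: "r \<in> P (Suc 0)" using mono[of 0] by blast
  let ?E = "{e \<in> E. hd e = a}"
  have r_eq: "r = (\<Sum>e\<in>?E. T e) + (\<Sum>e\<in>{e \<in> E. hd e \<noteq> a}. y 0 ^ (hd e - a) * T e)"
  proof -
    have "E = ?E \<union> {e \<in> E. hd e \<noteq> a}" by auto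
    then have "r = (\<Sum>e\<in>?E \<union> {e \<in> E. hd e \<noteq> a}. y 0 ^ (hd e - a) * T e)" unfolding r_def by simp
    also have "\<dots> = (\<Sum>e\<in>?E. y 0 ^ (hd e - a) * T e) + (\<Sum>e\<in>{e \<in> E. hd e \<noteq> a}. y 0 ^ (hd e - a) * T e)"
      by (rule sum.union_disjoint) (use E(1) in auto)
    finally show ?thesis by simp
  qed
  \<comment> \<open>The terms whose exponent exceeds \<open>a\<close> still contain
    \<open>y 0\<close>, which belongs to the second prime; modulo it, a relation among the remaining
    \<open>y i\<close> is left.\<close>
  have high: "(\<Sum>e\<in>{e \<in> E. hd e \<noteq> a}. y 0 ^ (hd e - a) * T e) \<in> P (Suc 0)"
  proof (rule poly_ideal_sum[OF id1])
    fix e assume e: "e \<in> {e \<in> E. hd e \<noteq> a}"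
    then obtain b where b: "hd e - a = Suc b" using a_le[of e] by (cases "hd e - a") auto
    have "(y 0 ^ b * T e) * y 0 \<in> P (Suc 0)"
      by (rule poly_ideal_mult[OF id1]) (use y[of 0] yp Tp in \<open>auto intro!: polys_closed\<close>)
    then show "y 0 ^ (hd e - a) * T e \<in> P (Suc 0)" by (simp add: b mult_ac)
  qed
  have "(\<Sum>e\<in>?E. T e) = r - (\<Sum>e\<in>{e \<in> E. hd e \<noteq> a}. y 0 ^ (hd e - a) * T e)"
    using r_eq by simp
  then have "(\<Sum>e\<in>?E. T e) \<in> P (Suc 0)"
    using poly_ideal_diff[OF id1 r1 high] by simp
  also have "(\<Sum>e\<in>?E. T e) = (\<Sum>e\<in>tl ` ?E. const (c (a # e)) * (\<Prod>i<n. y (Suc i) ^ (e ! i)))"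
  proof (subst sum.reindex)
    have ne: "e \<noteq> []" if "e \<in> E" for e using E(3)[OF that] by auto
    show "inj_on tl ?E" by (rule inj_onI) (metis (mono_tags, lifting) list.expand mem_Collect_eq ne)
    show "sum T ?E = sum ((\<lambda>e. const (c (a # e)) * (\<Prod>i<n. y (Suc i) ^ (e ! i))) \<circ> tl) ?E"
    proof (rule sum.cong)
      fix e assume e: "e \<in> ?E"
      then have "a # tl e = e" using ne[of e] by (auto simp: list.collapse)
      then show "T e = ((\<lambda>e. const (c (a # e)) * (\<Prod>i<n. y (Suc i) ^ (e ! i))) \<circ> tl) e"
        by (simp add: T_def)
    qed simp
  qed
  finally have rel': "(\<Sum>e\<in>tl ` ?E. const (c (a # e)) * (\<Prod>i<n. y (Suc i) ^ (e ! i))) \<in> P (Suc 0)" .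
  show False
  proof (rule Suc.IH[of "\<lambda>i. P (Suc i)" "\<lambda>i. y (Suc i)" "tl ` ?E" "\<lambda>e. c (a # e)"])
    show "tl ` ?E \<noteq> {}" using e0 by auto
    fix e assume "e \<in> tl ` ?E"
    then obtain e' where e': "e' \<in> E" "hd e' = a" "e = tl e'" by auto
    then have "e' \<noteq> []" "length e' = Suc n" using E(3)[of e'] by auto
    then show "length e = n" "c (a # e) \<noteq> 0"
      using E(4)[OF e'(1)] e' by (auto simp: list.collapse)
  qed (use id prime ne1 mono y E(1) rel' in auto)
qed

section \<open>Algebraic dependence by counting monomials\<close>

definition bounded_exps :: "'p set \<Rightarrow> nat \<Rightarrow> ('p, 'k::zero) mpoly \<Rightarrow> bool" where
  "bounded_exps Q b p \<longleftrightarrow> (\<forall>u\<in>keys p. keys u \<subseteq> Q \<and> (\<forall>x\<in>Q. lookup u x \<le> b))"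

lemma bounded_exps_mult:
  "bounded_exps Q a p \<Longrightarrow> bounded_exps Q b q \<Longrightarrow> bounded_exps Q (a + b) (p * q)"
proof -
  assume p: "bounded_exps Q a p" and q: "bounded_exps Q b q"
  show ?thesis
    unfolding bounded_exps_def
  proof
    fix u assume "u \<in> keys (p * q)"
    then obtain s t where "u = s + t" "s \<in> keys p" "t \<in> keys q"
      using subsetD[OF keys_mult] by blast
    then show "keys u \<subseteq> Q \<and> (\<forall>x\<in>Q. lookup u x \<le> a + b)"
      using p q by (auto simp: bounded_exps_def keys_add_nat lookup_add intro!: add_mono)
  qed
qed

lemma bounded_exps_1: "bounded_exps Q 0 1"
  by (simp add: bounded_exps_def)

lemma bounded_exps_power: "bounded_exps Q b p \<Longrightarrow> bounded_exps Q (n * b) (p ^ n)"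
  by (induction n) (auto simp: bounded_exps_1 bounded_exps_mult)

lemma bounded_exps_mono: "bounded_exps Q a p \<Longrightarrow> a \<le> b \<Longrightarrow> bounded_exps Q b p"
  unfolding bounded_exps_def by (meson order_trans)

lemma bounded_exps_prod:
  assumes "\<And>i. i < n \<Longrightarrow> bounded_exps Q b (f i)"
  shows "bounded_exps Q (n * b) (\<Prod>i<n. f i)"
  using assms
proof (induction n)
  case (Suc n)
  then show ?case
    using bounded_exps_mult[of Q "n * b" "\<Prod>i<n. f i" b "f n"] by (simp add: add.commute)
qed (simp add: bounded_exps_1)

lemma bounded_exps_exists:
  assumes "\<forall>u\<in>keys p. keys u \<subseteq> Q"
  shows "\<exists>b. bounded_exps Q b p"
proof -
  have "lookup u x \<le> (\<Sum>u\<in>keys p. wdeg (\<lambda>_. 1) u)" if "u \<in> keys p" for u x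
    using lookup_le_tdeg[of u x] member_le_sum[OF that, of "wdeg (\<lambda>_. 1)"] by simp
  then show ?thesis using assms unfolding bounded_exps_def by blast
qed

lemma card_bounded_monomials:
  assumes "finite Q"
  shows "card {u :: 'p \<Rightarrow>\<^sub>0 nat. keys u \<subseteq> Q \<and> (\<forall>x\<in>Q. lookup u x \<le> b)} \<le> Suc b ^ card Q"
proof -
  let ?U = "{u :: 'p \<Rightarrow>\<^sub>0 nat. keys u \<subseteq> Q \<and> (\<forall>x\<in>Q. lookup u x \<le> b)}"
  have "card ?U \<le> card (Q \<rightarrow>\<^sub>E {..b})"
  proof (rule card_inj_on_le)
    show "inj_on (\<lambda>u. restrict (lookup u) Q) ?U"
    proof (rule inj_onI, rule poly_mapping_eqI)
      fix u v x assume u: "u \<in> ?U" and v: "v \<in> ?U" and eq: "restrict (lookup u) Q = restrict (lookup v) Q"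
      show "lookup u x = lookup v x"
      proof (cases "x \<in> Q")
        case True
        then show ?thesis using fun_cong[OF eq, of x] by simp
      next
        case False
        then have "x \<notin> keys u" "x \<notin> keys v" using u v by auto
        then show ?thesis by (simp add: in_keys_iff)
      qed
    qed
  qed (use assms in \<open>auto intro: finite_PiE\<close>)
  also have "\<dots> = Suc b ^ card Q" by (simp add: card_PiE assms)
  finally show ?thesis .
qed

text \<open>There are \<open>N ^ n\<close> products of the \<open>y i\<close> with exponents below
  \<open>N\<close>, but their images lie in the span of a number of monomials that grows only like
  \<open>N ^ card Q\<close>. For large \<open>N\<close> they must be linearly dependent.\<close>

lemma algebraic_relation:
  fixes y :: "nat \<Rightarrow> ('v, 'k::field) mpoly" and A :: "'v \<Rightarrow> ('p::linorder \<Rightarrow>\<^sub>0 nat)"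
  assumes Q: "finite Q" and A: "\<And>v. v \<in> V \<Longrightarrow> keys (A v) \<subseteq> Q"
    and y: "\<And>i. i < n \<Longrightarrow> y i \<in> polys V" and n: "card Q < n"
  obtains E c where "finite E" "E \<noteq> {}" "\<And>e. e \<in> E \<Longrightarrow> length e = n" "\<And>e. e \<in> E \<Longrightarrow> c e \<noteq> 0"
    "(\<Sum>e\<in>E. const (c e) * (\<Prod>i<n. y i ^ (e ! i))) \<in> toric V {} A"
proof -
  interpret vector_space "\<lambda>a (p :: ('p, 'k) mpoly). const a * p"
    by unfold_locales (simp_all add: distrib_left distrib_right single_add const_mult_const mult.assoc)
  let ?d = "card Q"
  have "\<forall>i. \<exists>b. i < n \<longrightarrow> bounded_exps Q b (mhom {} A (y i) :: ('p, 'k) mpoly)"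
  proof (intro allI)
    fix i
    show "\<exists>b. i < n \<longrightarrow> bounded_exps Q b (mhom {} A (y i) :: ('p, 'k) mpoly)"
    proof (cases "i < n")
      case True
      have "\<forall>u\<in>keys (mhom {} A (y i) :: ('p, 'k) mpoly). keys u \<subseteq> Q"
      proof
        fix u assume "u \<in> keys (mhom {} A (y i) :: ('p, 'k) mpoly)"
        then have "(\<Sum>t | t \<in> keys (y i) \<and> keys t \<inter> {} = {} \<and> dmap A t = u. lookup (y i) t) \<noteq> 0"
          by (simp add: in_keys_iff lookup_mhom)
        then obtain t where "t \<in> keys (y i)" "dmap A t = u"
          by (metis (mono_tags, lifting) mem_Collect_eq sum.not_neutral_contains_not_neutral)
        then show "keys u \<subseteq> Q" using y[OF True] A by (fastforce simp: polys_iff keys_dmap)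
      qed
      then show ?thesis using bounded_exps_exists by blast
    qed simp
  qed
  then obtain b where b: "\<And>i. i < n \<Longrightarrow> bounded_exps Q (b i) (mhom {} A (y i) :: ('p, 'k) mpoly)"
    by metis
  define D where "D = (\<Sum>i<n. b i)"
  have bD: "bounded_exps Q D (mhom {} A (y i) :: ('p, 'k) mpoly)" if i: "i < n" for i
    by (rule bounded_exps_mono[OF b[OF i]]) (use i in \<open>simp add: D_def member_le_sum\<close>)
  \<comment> \<open>With \<open>D\<close> bounding all exponents in the images of the
    \<open>y i\<close>, an exponent in an image of a product is at most \<open>n * (N * D)\<close>,
    and \<open>Suc (n * (N * D)) \<le> C * N\<close>. Then \<open>C ^ ?d < N\<close> makes the count
    of monomials smaller than \<open>N ^ Suc ?d\<close>.\<close>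
  define C where "C = Suc (n * D)"
  define N where "N = Suc (C ^ ?d)"
  define W where "W = {e :: nat list. set e \<subseteq> {..<N} \<and> length e = n}"
  define Y where "Y e = (\<Prod>i<n. y i ^ (e ! i))" for e
  define X where "X e = (mhom {} A (Y e) :: ('p, 'k) mpoly)" for e
  have Yp: "Y e \<in> polys V" for e unfolding Y_def by (intro polys_closed y) simp
  have finW: "finite W" and cardW: "card W = N ^ n"
    unfolding W_def by (simp_all add: finite_lists_length_eq card_lists_length_eq)
  let ?U = "{u :: 'p \<Rightarrow>\<^sub>0 nat. keys u \<subseteq> Q \<and> (\<forall>x\<in>Q. lookup u x \<le> n * (N * D))}"
  let ?T = "xpow ` ?U :: ('p, 'k) mpoly set"
  have finT: "finite ?T" using finite_bounded_monomials[OF Q] by simp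
  have "card ?T \<le> Suc (n * (N * D)) ^ ?d"
    using card_image_le[OF finite_bounded_monomials[OF Q]] card_bounded_monomials[OF Q] by (rule order_trans)
  also have "\<dots> \<le> (C * N) ^ ?d"
    by (rule power_mono) (simp_all add: C_def N_def algebra_simps)
  also have "\<dots> = C ^ ?d * N ^ ?d" by (simp add: power_mult_distrib)
  also have "\<dots> < N * N ^ ?d" by (simp add: N_def)
  also have "\<dots> \<le> N ^ n"
    using n power_increasing[of "Suc ?d" n N] by (simp add: N_def)
  finally have cardT: "card ?T < card W" by (simp add: cardW)
  have X_span: "X e \<in> span ?T" if e: "e \<in> W" for e
  proof -
    have "bounded_exps Q (N * D) (mhom {} A (y i) ^ (e ! i) :: ('p, 'k) mpoly)" if "i < n" for i
    proof (rule bounded_exps_mono[OF bounded_exps_power[OF bD[OF that]]])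
      have "e ! i \<in> {..<N}" using e that nth_mem[of i e] unfolding W_def by blast
      then show "e ! i * D \<le> N * D" by simp
    qed
    then have bX: "bounded_exps Q (n * (N * D)) (X e)"
      unfolding X_def Y_def mhom_prod mhom_power by (rule bounded_exps_prod)
    have "X e = (\<Sum>u\<in>keys (X e). const (lookup (X e) u) * xpow u)"
      using poly_as_sum[of "keys (X e)" "X e"] by (simp add: const_mult_xpow)
    also have "\<dots> \<in> span ?T"
      using bX by (intro span_sum span_scale span_base) (auto simp: bounded_exps_def)
    finally show ?thesis .
  qed
  have in_toric: "(\<Sum>e\<in>E. const (c e) * Y e) \<in> toric V {} A"
    if "(\<Sum>e\<in>E. const (c e) * X e) = 0" for E c
    using that Yp unfolding toric_def X_def
    by (auto simp: mhom_sum mhom_mult mhom_const intro!: polys_closed)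
  show thesis
  proof (cases "inj_on X W")
    case True
    then have "card (X ` W) = card W" by (rule card_image)
    then have "dependent (X ` W)"
      using independent_span_bound[OF finT, of "X ` W"] X_span cardT by auto
    then obtain c where c: "\<exists>x\<in>X ` W. c x \<noteq> 0" "(\<Sum>x\<in>X ` W. const (c x) * x) = 0"
      using dependent_finite[of "X ` W"] finW by auto
    let ?E = "{e \<in> W. c (X e) \<noteq> 0}"
    have "(\<Sum>e\<in>?E. const (c (X e)) * X e) = (\<Sum>e\<in>W. const (c (X e)) * X e)"
      by (rule sum.mono_neutral_left) (use finW in auto)
    also have "\<dots> = 0" using c(2) by (simp add: sum.reindex[OF True])
    finally have "(\<Sum>e\<in>?E. const (c (X e)) * Y e) \<in> toric V {} A" by (rule in_toric)
    moreover have "finite ?E" using finW by simp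
    ultimately show thesis
      by (intro that[of ?E "\<lambda>e. c (X e)"]) (use c(1) in \<open>auto simp: W_def Y_def\<close>)
  next
    case False
    then obtain e e' where e: "e \<in> W" "e' \<in> W" "e \<noteq> e'" "X e = X e'" by (auto simp: inj_on_def)
    \<comment> \<open>Two different products with the same image give the relation directly; the
      dependence of a set of images would not notice them.\<close>
    let ?c = "\<lambda>x. if x = e then 1 else - 1 :: 'k"
    have "(\<Sum>x\<in>{e, e'}. const (?c x) * X x) = 0" using e by (simp add: single_uminus)
    then have "(\<Sum>x\<in>{e, e'}. const (?c x) * Y x) \<in> toric V {} A" by (rule in_toric)
    then show thesis
      by (intro that[of "{e, e'}" ?c]) (use e in \<open>auto simp: W_def Y_def\<close>)
  qed
qed

section \<open>Primes of the quotient ring and primes above the ideal\<close>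

lemma coset_image_iff:
  assumes "ideal I (poly_ring V :: ('v, 'k::comm_ring_1) mpoly ring)" and q: "ideal q (poly_ring V)"
    and "I \<subseteq> q" "a \<in> polys V"
  shows "I +>\<^bsub>poly_ring V\<^esub> a \<in> (+>\<^bsub>poly_ring V\<^esub>) I ` q \<longleftrightarrow> a \<in> q"
proof
  interpret ideal I "poly_ring V" by (rule assms(1))
  assume "I +>\<^bsub>poly_ring V\<^esub> a \<in> (+>\<^bsub>poly_ring V\<^esub>) I ` q"
  then obtain b where b: "b \<in> q" "I +>\<^bsub>poly_ring V\<^esub> a = I +>\<^bsub>poly_ring V\<^esub> b" by blast
  have "a \<in> I +>\<^bsub>poly_ring V\<^esub> b" using a_rcos_self[OF assms(4)] b(2) by simp
  then obtain h where "h \<in> I" "a = h + b" by (auto simp: a_r_coset_def')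
  then show "a \<in> q" using poly_ideal_add[OF q] assms(3) b(1) by blast
qed blast

lemma primeideal_coset_image:
  assumes I: "ideal I (poly_ring V :: ('v, 'k::comm_ring_1) mpoly ring)" and q: "ideal q (poly_ring V)"
    and sub: "I \<subseteq> q" and one: "1 \<notin> q"
    and prime: "\<And>a b. a \<in> polys V \<Longrightarrow> b \<in> polys V \<Longrightarrow> a * b \<in> q \<Longrightarrow> a \<in> q \<or> b \<in> q"
  shows "primeideal ((+>\<^bsub>poly_ring V\<^esub>) I ` q) (poly_ring V Quot I)"
proof (rule primeidealI)
  interpret S: cring "poly_ring V" by (rule cring_poly_ring)
  interpret ideal I "poly_ring V" by (rule I)
  show "ideal ((+>\<^bsub>poly_ring V\<^esub>) I ` q) (poly_ring V Quot I)"
    by (rule S.ring_ideal_imp_quot_ideal[OF I q])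
  show "cring (poly_ring V Quot I)"
    by (rule quotient_is_cring[OF S.is_cring])
  have carr: "carrier (poly_ring V Quot I) = (+>\<^bsub>poly_ring V\<^esub>) I ` polys V"
    by (auto simp: FactRing_def A_RCOSETS_def')
  have "I +>\<^bsub>poly_ring V\<^esub> 1 \<notin> (+>\<^bsub>poly_ring V\<^esub>) I ` q"
    using coset_image_iff[OF I q sub, of 1] one by simp
  then show "carrier (poly_ring V Quot I) \<noteq> (+>\<^bsub>poly_ring V\<^esub>) I ` q"
    unfolding carr by (metis imageI poly_ring_simps(6))
  fix X Y assume "X \<in> carrier (poly_ring V Quot I)" "Y \<in> carrier (poly_ring V Quot I)"
    and XY: "X \<otimes>\<^bsub>poly_ring V Quot I\<^esub> Y \<in> (+>\<^bsub>poly_ring V\<^esub>) I ` q"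
  then obtain a b where ab: "a \<in> polys V" "b \<in> polys V" "X = I +>\<^bsub>poly_ring V\<^esub> a" "Y = I +>\<^bsub>poly_ring V\<^esub> b"
    unfolding carr by blast
  have "X \<otimes>\<^bsub>poly_ring V Quot I\<^esub> Y = I +>\<^bsub>poly_ring V\<^esub> (a * b)"
    using rcoset_mult_add[OF ab(1,2)] by (simp add: FactRing_def ab)
  then have "a * b \<in> q"
    using XY coset_image_iff[OF I q sub poly_ring_closed(2)[OF ab(1,2)]] by simp
  then show "X \<in> (+>\<^bsub>poly_ring V\<^esub>) I ` q \<or> Y \<in> (+>\<^bsub>poly_ring V\<^esub>) I ` q"
    using prime ab by auto
qed

lemma primeideal_coset_preimage:
  assumes I: "ideal I (poly_ring V :: ('v, 'k::comm_ring_1) mpoly ring)"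
    and p: "primeideal p (poly_ring V Quot I)"
  defines "q \<equiv> {a \<in> polys V. I +>\<^bsub>poly_ring V\<^esub> a \<in> p}"
  shows "ideal q (poly_ring V)" "1 \<notin> q"
    and "\<And>a b. a \<in> polys V \<Longrightarrow> b \<in> polys V \<Longrightarrow> a * b \<in> q \<Longrightarrow> a \<in> q \<or> b \<in> q" "I \<subseteq> q"
proof -
  interpret S: cring "poly_ring V" by (rule cring_poly_ring)
  interpret I: ideal I "poly_ring V" by (rule I)
  interpret p: primeideal p "poly_ring V Quot I" by (rule p)
  interpret h: ring_hom_ring "poly_ring V" "poly_ring V Quot I" "(+>\<^bsub>poly_ring V\<^esub>) I"
    by (rule I.rcos_ring_hom_ring)
  show q: "ideal q (poly_ring V)"
    using h.ideal_vimage[OF p.is_ideal] by (simp add: q_def)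
  have carr: "carrier (poly_ring V Quot I) = (+>\<^bsub>poly_ring V\<^esub>) I ` polys V"
    by (auto simp: FactRing_def A_RCOSETS_def')
  show "1 \<notin> q"
  proof
    assume "1 \<in> q"
    then have "\<one>\<^bsub>poly_ring V Quot I\<^esub> \<in> p" using h.hom_one by (simp add: q_def)
    then show False using p.one_imp_carrier p.I_notcarr by simp
  qed
  show "a \<in> q \<or> b \<in> q" if "a \<in> polys V" "b \<in> polys V" "a * b \<in> q" for a b
    using that p.I_prime[of "I +>\<^bsub>poly_ring V\<^esub> a" "I +>\<^bsub>poly_ring V\<^esub> b"] h.hom_mult[of a b]
    by (auto simp: q_def carr)
  show "I \<subseteq> q"
  proof
    fix a assume a: "a \<in> I"
    have "\<zero>\<^bsub>poly_ring V Quot I\<^esub> \<in> p"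
      using additive_subgroup.zero_closed[OF p.is_additive_subgroup] .
    moreover have "I +>\<^bsub>poly_ring V\<^esub> a = \<zero>\<^bsub>poly_ring V Quot I\<^esub>"
      using S.a_coset_join2[OF I.Icarr[OF a] I.a_subgroup a] by (simp add: FactRing_def)
    ultimately show "a \<in> q" using I.Icarr[OF a] by (simp add: q_def)
  qed
qed

text \<open>Lower bound: killing all variables that involve one of the first \<open>i\<close>
  parameters gives a prime \<open>q i\<close>, and the triangular assumption supplies a variable
  that lies in \<open>q (Suc i)\<close> but not in \<open>q i\<close>. Upper bound: a longer chain
  would separate \<open>d + 1\<close> elements, which satisfy an algebraic relation because there
  are only \<open>d\<close> parameters.\<close>

theorem krull_dim_toric:
  fixes V :: "'v set" and A :: "'v \<Rightarrow> ('p::linorder \<Rightarrow>\<^sub>0 nat)" and \<pi> :: "nat \<Rightarrow> 'p"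
  defines "I \<equiv> toric V {} A :: ('v, 'k::field) mpoly set"
  assumes A: "\<And>v. v \<in> V \<Longrightarrow> keys (A v) \<subseteq> \<pi> ` {..<d}" and inj: "inj_on \<pi> {..<d}"
    and tri: "\<And>i. i < d \<Longrightarrow> \<exists>v\<in>V. \<pi> i \<in> keys (A v) \<and> keys (A v) \<subseteq> \<pi> ` {i..<d}"
  shows "krull_dim (poly_ring V Quot I) = enat d"
proof -
  let ?S = "poly_ring V :: ('v, 'k) mpoly ring"
  let ?L = "{enat l | l. \<exists>p :: nat \<Rightarrow> ('v, 'k) mpoly set set.
     (\<forall>i\<le>l. primeideal (p i) (?S Quot I)) \<and> (\<forall>i<l. p i \<subset> p (Suc i))}"
  have I: "ideal I ?S" unfolding I_def by (rule toric_ideal)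
  define Z where "Z i = {v. keys (A v) \<inter> \<pi> ` {..<i} \<noteq> {}}" for i
  define q where "q i = (toric V (Z i) A :: ('v, 'k) mpoly set)" for i
  have q: "ideal (q i) ?S" for i unfolding q_def by (rule toric_ideal)
  have kill: "keys t \<inter> Z i = {} \<longleftrightarrow> keys (dmap A t) \<inter> \<pi> ` {..<i} = {}" for t i
    by (auto simp: keys_dmap Z_def)
  \<comment> \<open>Membership becomes a family of conditions indexed by the degrees free of the
    first \<open>i\<close> parameters. Increasing \<open>i\<close> only drops conditions, so the
    chain is increasing.\<close>
  have q_iff: "p \<in> q i \<longleftrightarrow> p \<in> polys V \<and> (\<forall>u. keys u \<inter> \<pi> ` {..<i} = {} \<longrightarrow>
      (\<Sum>t | t \<in> keys p \<and> dmap A t = u. lookup p t) = 0)" for p i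
  proof -
    have "mhom (Z i) A p = 0 \<longleftrightarrow> (\<forall>u. lookup (mhom (Z i) A p) u = 0)"
      by (auto intro: poly_mapping_eqI)
    also have "\<dots> \<longleftrightarrow> (\<forall>u. keys u \<inter> \<pi> ` {..<i} = {} \<longrightarrow>
      (\<Sum>t | t \<in> keys p \<and> dmap A t = u. lookup p t) = 0)"
    proof (intro iff_allI)
      fix u
      have "{t \<in> keys p. keys t \<inter> Z i = {} \<and> dmap A t = u} =
          (if keys u \<inter> \<pi> ` {..<i} = {} then {t \<in> keys p. dmap A t = u} else {})"
        using kill by auto
      then show "lookup (mhom (Z i) A p) u = 0 \<longleftrightarrow> (keys u \<inter> \<pi> ` {..<i} = {} \<longrightarrow>
          (\<Sum>t | t \<in> keys p \<and> dmap A t = u. lookup p t) = 0)"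
        unfolding lookup_mhom by simp
    qed
    finally show ?thesis by (simp add: q_def toric_def)
  qed
  have q_mono: "q i \<subseteq> q j" if "i \<le> j" for i j
  proof -
    have "keys u \<inter> \<pi> ` {..<j} = {} \<Longrightarrow> keys u \<inter> \<pi> ` {..<i} = {}" for u :: "'p \<Rightarrow>\<^sub>0 nat"
      using image_mono[of "{..<i}" "{..<j}" \<pi>] that by auto
    then have "p \<in> q j" if "p \<in> q i" for p using that q_iff[of p i] q_iff[of p j] by simp
    then show ?thesis by (rule subsetI)
  qed
  have "I = q 0" by (simp add: I_def q_def Z_def)
  then have Iq: "I \<subseteq> q i" for i using q_mono[of 0 i] by simp
  have strict: "\<exists>a\<in>polys V. a \<in> q (Suc i) \<and> a \<notin> q i" if i: "i < d" for i
  proof -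
    obtain v where v: "v \<in> V" "\<pi> i \<in> keys (A v)" "keys (A v) \<subseteq> \<pi> ` {i..<d}" using tri[OF i] by blast
    let ?x = "xpow (single v 1) :: ('v, 'k) mpoly"
    have "keys (A v) \<inter> \<pi> ` {..<i} = {}"
    proof -
      have "\<pi> ` {i..<d} \<inter> \<pi> ` {..<i} = \<pi> ` ({i..<d} \<inter> {..<i})"
        by (rule inj_on_image_Int[OF inj, symmetric]) (use i in auto)
      then show ?thesis using v(3) by auto
    qed
    then have "v \<notin> Z i" by (simp add: Z_def)
    moreover have "v \<in> Z (Suc i)" using v(2) by (auto simp: Z_def)
    moreover have "?x \<in> polys V" using v(1) by simp
    ultimately show ?thesis
      by (intro bexI[of _ ?x]) (auto simp: q_def toric_def mhom_xpow)
  qed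
  have "enat d \<in> ?L"
  proof -
    let ?p = "\<lambda>i. (+>\<^bsub>?S\<^esub>) I ` q i"
    have "primeideal (?p i) (?S Quot I)" for i
      by (rule primeideal_coset_image[OF I q Iq])
        (unfold q_def, rule one_not_in_toric, rule toric_prime)
    moreover have "?p i \<subset> ?p (Suc i)" if i: "i < d" for i
    proof
      show "?p i \<subseteq> ?p (Suc i)" using q_mono[of i "Suc i"] by (intro image_mono) simp
      obtain a where "a \<in> polys V" "a \<in> q (Suc i)" "a \<notin> q i" using strict[OF i] by blast
      then show "?p i \<noteq> ?p (Suc i)"
        using coset_image_iff[OF I q Iq, of a i] by (metis imageI)
    qed
    ultimately show ?thesis by (intro CollectI exI[of _ d] conjI refl exI[of _ ?p]) simp_all
  qed
  moreover have "x \<le> enat d" if x: "x \<in> ?L" for x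
  proof (rule ccontr)
    assume gt: "\<not> x \<le> enat d"
    from x have "\<exists>l. x = enat l \<and> (\<exists>p :: nat \<Rightarrow> ('v, 'k) mpoly set set.
        (\<forall>i\<le>l. primeideal (p i) (?S Quot I)) \<and> (\<forall>i<l. p i \<subset> p (Suc i)))"
      unfolding mem_Collect_eq .
    then obtain l where xl: "x = enat l \<and> (\<exists>p :: nat \<Rightarrow> ('v, 'k) mpoly set set.
        (\<forall>i\<le>l. primeideal (p i) (?S Quot I)) \<and> (\<forall>i<l. p i \<subset> p (Suc i)))" ..
    from conjunct2[OF xl] obtain p :: "nat \<Rightarrow> ('v, 'k) mpoly set set" where
      p': "(\<forall>i\<le>l. primeideal (p i) (?S Quot I)) \<and> (\<forall>i<l. p i \<subset> p (Suc i))" ..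
    have p: "\<And>i. i \<le> l \<Longrightarrow> primeideal (p i) (?S Quot I)" "\<And>i. i < l \<Longrightarrow> p i \<subset> p (Suc i)"
      using p' by simp_all
    have l: "d < l" using gt xl by simp
    define P where "P i = {a \<in> polys V. I +>\<^bsub>?S\<^esub> a \<in> p i}" for i
    note Pp = primeideal_coset_preimage[OF I p(1), folded P_def]
    have Ps: "P i \<subseteq> P (Suc i)" if "i < l" for i using p(2)[OF that] by (auto simp: P_def)
    have "\<forall>i. \<exists>a. i < l \<longrightarrow> a \<in> P (Suc i) \<and> a \<notin> P i"
    proof (intro allI)
      fix i
      show "\<exists>a. i < l \<longrightarrow> a \<in> P (Suc i) \<and> a \<notin> P i"
      proof (cases "i < l")
        case True
        obtain X where X: "X \<in> p (Suc i)" "X \<notin> p i" using p(2)[OF True] by blast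
        have "X \<in> carrier (?S Quot I)"
          using ideal.Icarr[OF primeideal.axioms(1)[OF p(1)] X(1)] True by simp
        then obtain a where "a \<in> polys V" "X = I +>\<^bsub>?S\<^esub> a"
          by (auto simp: FactRing_def A_RCOSETS_def')
        with X show ?thesis by (auto simp: P_def)
      qed simp
    qed
    then obtain y where y: "\<And>i. i < l \<Longrightarrow> y i \<in> P (Suc i) \<and> y i \<notin> P i" by metis
    have yp: "y i \<in> polys V" if "i < l" for i using y[OF that] by (auto simp: P_def)
    let ?n = "Suc d"
    have cd: "card (\<pi> ` {..<d}) < ?n" using card_image[OF inj] by simp
    obtain E c where E: "finite E" "E \<noteq> {}" "\<And>e. e \<in> E \<Longrightarrow> length e = ?n" "\<And>e. e \<in> E \<Longrightarrow> c e \<noteq> 0"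
      "(\<Sum>e\<in>E. const (c e) * (\<Prod>i<?n. y i ^ (e ! i))) \<in> toric V {} A"
      by (rule algebraic_relation[of "\<pi> ` {..<d}" V A ?n y]) (use A yp l cd in auto)
    then have rel: "(\<Sum>e\<in>E. const (c e) * (\<Prod>i<?n. y i ^ (e ! i))) \<in> P 0"
      using Pp(4)[of 0] by (auto simp: I_def)
    show False
      by (rule no_relation_along_chain[of ?n P V y E c]) (use Pp Ps y E rel l in auto)
  qed
  ultimately show ?thesis
    unfolding krull_dim_def by (intro antisym Sup_least Sup_upper) auto
qed

subsection \<open>Binomials with coprime leading monomials\<close>

definition mdvd :: "('v \<Rightarrow>\<^sub>0 nat) \<Rightarrow> ('v \<Rightarrow>\<^sub>0 nat) \<Rightarrow> bool" where
  "mdvd s t \<longleftrightarrow> (\<forall>v. lookup s v \<le> lookup t v)"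

text \<open>Binomials with pairwise coprime leading monomials form a Groebner basis by Buchberger's
  product criterion. For binomials this is a statement on rewriting monomials by
  \<open>m i \<mapsto> r i\<close>, which terminates because the weight drops.\<close>

locale coprime_binomials =
  fixes V :: "'v::linorder set" and A :: "'i set" and m r :: "'i \<Rightarrow> ('v \<Rightarrow>\<^sub>0 nat)" and w :: "'v \<Rightarrow> nat"
  assumes finA: "finite A"
    and m_V: "\<And>i. i \<in> A \<Longrightarrow> keys (m i) \<subseteq> V" and r_V: "\<And>i. i \<in> A \<Longrightarrow> keys (r i) \<subseteq> V"
    and coprime: "\<And>i j. i \<in> A \<Longrightarrow> j \<in> A \<Longrightarrow> i \<noteq> j \<Longrightarrow> keys (m i) \<inter> keys (m j) = {}"
    and squarefree: "\<And>i v. i \<in> A \<Longrightarrow> lookup (m i) v \<le> 1"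
    and weight: "\<And>i. i \<in> A \<Longrightarrow> wdeg w (r i) < wdeg w (m i)"
begin

definition irreducible where
  "irreducible t \<longleftrightarrow> (\<forall>i\<in>A. \<not> mdvd (m i) t)"

definition pick where
  "pick t = (SOME i. i \<in> A \<and> mdvd (m i) t)"

lemma pick: "\<not> irreducible t \<Longrightarrow> pick t \<in> A \<and> mdvd (m (pick t)) t"
  unfolding pick_def by (rule someI_ex) (auto simp: irreducible_def)

lemma mdvd_diff: "mdvd s t \<Longrightarrow> t - s + s = t"
  using monomial_minus_add[of s t] by (simp add: mdvd_def add.commute)

lemma rewrite_weight:
  assumes "i \<in> A" "mdvd (m i) t"
  shows "wdeg w (t - m i + r i) < wdeg w t"
proof -
  have "wdeg w t = wdeg w (t - m i) + wdeg w (m i)"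
    using mdvd_diff[OF assms(2)] by (metis wdeg_add)
  then show ?thesis using weight[OF assms(1)] by (simp add: wdeg_add)
qed

function nf :: "('v \<Rightarrow>\<^sub>0 nat) \<Rightarrow> ('v \<Rightarrow>\<^sub>0 nat)" where
  "nf t = (if irreducible t then t else nf (t - m (pick t) + r (pick t)))"
  by auto
termination
  by (relation "Wellfounded.measure (wdeg w)") (auto dest: pick intro: rewrite_weight)

declare nf.simps [simp del]

lemma nf_id: "irreducible t \<Longrightarrow> nf t = t"
  by (subst nf.simps) simp

text \<open>Confluence: two rules whose left sides have disjoint supports do not disturb each other,
  and applying both gives the same monomial in either order. The induction on the weight applies to
  the two intermediate monomials.\<close>

lemma nf_step: "i \<in> A \<Longrightarrow> mdvd (m i) t \<Longrightarrow> nf t = nf (t - m i + r i)"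
proof (induction "wdeg w t" arbitrary: t i rule: less_induct)
  case less
  define j where "j = pick t"
  have red: "\<not> irreducible t" using less.prems by (auto simp: irreducible_def)
  then have j: "j \<in> A" "mdvd (m j) t" using pick by (simp_all add: j_def)
  have nf_t: "nf t = nf (t - m j + r j)" using red by (subst nf.simps) (simp add: j_def)
  show ?case
  proof (cases "i = j")
    case False
    have dis: "lookup (m i) v = 0 \<or> lookup (m j) v = 0" for v
      using coprime[OF less.prems(1) j(1) False] by (auto simp: in_keys_iff)
    have le: "lookup (m i) v \<le> lookup t v" "lookup (m j) v \<le> lookup t v" for v
      using less.prems(2) j(2) by (simp_all add: mdvd_def)
    have "lookup (m i) v \<le> lookup (t - m j + r j) v \<and> lookup (m j) v \<le> lookup (t - m i + r i) v" for v
      using dis[of v] le[of v] by (auto simp: lookup_add lookup_minus)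
    then have "mdvd (m i) (t - m j + r j)" "mdvd (m j) (t - m i + r i)"
      by (simp_all add: mdvd_def)
    then have "nf (t - m j + r j) = nf (t - m j + r j - m i + r i)"
      "nf (t - m i + r i) = nf (t - m i + r i - m j + r j)"
      using less.hyps rewrite_weight less.prems j by blast+
    moreover have "t - m j + r j - m i + r i = t - m i + r i - m j + r j"
    proof (rule poly_mapping_eqI)
      fix v
      show "lookup (t - m j + r j - m i + r i) v = lookup (t - m i + r i - m j + r j) v"
        using dis[of v] le[of v] by (auto simp: lookup_add lookup_minus)
    qed
    ultimately show ?thesis using nf_t by simp
  qed (use nf_t in simp)
qed

lemma nf_irreducible: "irreducible (nf t)"
proof (induction t rule: nf.induct)
  case (1 t)
  then show ?case by (cases "irreducible t") (simp_all add: nf.simps[of t])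
qed

lemma nf_weight: "wdeg w (nf t) \<le> wdeg w t"
  and nf_weight_less: "\<not> irreducible t \<Longrightarrow> wdeg w (nf t) < wdeg w t"
proof -
  have "wdeg w (nf t) \<le> wdeg w t \<and> (\<not> irreducible t \<longrightarrow> wdeg w (nf t) < wdeg w t)"
  proof (induction t rule: nf.induct)
    case (1 t)
    show ?case
    proof (cases "irreducible t")
      case False
      then have "wdeg w (t - m (pick t) + r (pick t)) < wdeg w t"
        using pick rewrite_weight by blast
      moreover have "nf t = nf (t - m (pick t) + r (pick t))" using False by (subst nf.simps) simp
      ultimately show ?thesis using 1[OF False] by simp
    qed (simp add: nf_id)
  qed
  then show "wdeg w (nf t) \<le> wdeg w t" "\<not> irreducible t \<Longrightarrow> wdeg w (nf t) < wdeg w t" by auto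
qed

lemma rewrite_V: "i \<in> A \<Longrightarrow> keys t \<subseteq> V \<Longrightarrow> keys (t - m i + r i) \<subseteq> V"
  using r_V[of i] by (auto simp: keys_add_nat in_keys_iff lookup_minus)

lemma nf_V: "keys t \<subseteq> V \<Longrightarrow> keys (nf t) \<subseteq> V"
proof (induction t rule: nf.induct)
  case (1 t)
  show ?case
  proof (cases "irreducible t")
    case False
    have "nf t = nf (t - m (pick t) + r (pick t))" using False by (subst nf.simps) simp
    then show ?thesis using 1(1)[OF False rewrite_V[OF conjunct1[OF pick[OF False]] 1(2)]] by simp
  qed (simp add: nf_id 1(2))
qed

definition binom :: "'i \<Rightarrow> ('v, 'k::field) mpoly" where
  "binom i = xpow (m i) - xpow (r i)"

abbreviation BI :: "('v, 'k::field) mpoly set" where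
  "BI \<equiv> ideal_span V binom A"

lemma binom_polys: "i \<in> A \<Longrightarrow> (binom i :: ('v, 'k::field) mpoly) \<in> polys V"
  by (simp add: binom_def polys_diff m_V r_V)

lemma BI_ideal: "ideal (BI :: ('v, 'k::field) mpoly set) (poly_ring V)"
  by (rule ideal_span_ideal) (rule binom_polys)

lemma nf_cong: "keys t \<subseteq> V \<Longrightarrow> (xpow t - xpow (nf t) :: ('v, 'k::field) mpoly) \<in> BI"
proof (induction t rule: nf.induct)
  case (1 t)
  show ?case
  proof (cases "irreducible t")
    case True
    then show ?thesis using poly_ideal_0[OF BI_ideal] by (simp add: nf_id)
  next
    case False
    define i where "i = pick t"
    have i: "i \<in> A" "mdvd (m i) t" using pick[OF False] by (simp_all add: i_def)
    have nf_t: "nf t = nf (t - m i + r i)" by (rule nf_step[OF i])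
    have V': "keys (t - m i) \<subseteq> V" using 1(2) by (auto simp: in_keys_iff lookup_minus)
    have "(xpow t :: ('v, 'k) mpoly) - xpow (t - m i + r i) = xpow (t - m i) * binom i"
    proof -
      have "(xpow t :: ('v, 'k) mpoly) = xpow (t - m i) * xpow (m i)"
        using mdvd_diff[OF i(2)] by (simp flip: xpow_add)
      then show ?thesis by (simp add: binom_def xpow_add right_diff_distrib)
    qed
    also have "\<dots> \<in> BI"
      by (rule poly_ideal_mult[OF BI_ideal _ ideal_span_mem[OF finA i(1)]]) (simp add: V')
    finally have "(xpow t - xpow (t - m i + r i) :: ('v, 'k) mpoly) \<in> BI" .
    moreover have "(xpow (t - m i + r i) - xpow (nf (t - m i + r i)) :: ('v, 'k) mpoly) \<in> BI"
      using 1(1)[OF False] rewrite_V[OF i(1) 1(2)] by (simp add: i_def)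
    ultimately show ?thesis unfolding nf_t by (rule poly_ideal_diff_trans[OF BI_ideal])
  qed
qed

definition red :: "('v, 'k::field) mpoly \<Rightarrow> ('v, 'k) mpoly" where
  "red = lin_ext (\<lambda>t. xpow (nf t))"

lemma red_add: "red (p + q) = red p + red q"
  and red_0 [simp]: "red 0 = 0"
  and red_sum: "red (sum f S) = (\<Sum>i\<in>S. red (f i))"
  and red_diff: "red (p - q) = red p - red q"
  by (simp_all add: red_def lin_ext_add lin_ext_sum lin_ext_diff)

lemma red_keys: "keys (red p) \<subseteq> nf ` keys p"
proof
  fix u assume "u \<in> keys (red p)"
  then have "(\<Sum>t\<in>keys p. lookup p t * lookup (xpow (nf t)) u) \<noteq> 0"
    by (simp add: in_keys_iff red_def lookup_lin_ext)
  then obtain t where "t \<in> keys p" "lookup p t * lookup (xpow (nf t)) u \<noteq> 0"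
    by (rule sum.not_neutral_contains_not_neutral)
  then show "u \<in> nf ` keys p" by (auto simp: lookup_xpow split: if_splits)
qed

lemma red_polys: "p \<in> polys V \<Longrightarrow> red p \<in> polys V"
  using red_keys nf_V by (fastforce simp: polys_iff)

lemma red_irreducible: "t \<in> keys (red p) \<Longrightarrow> irreducible t"
  using red_keys nf_irreducible by blast

lemma red_cong:
  assumes p: "p \<in> polys V"
  shows "p - red p \<in> BI"
proof -
  have "p - red p = (\<Sum>t\<in>keys p. const (lookup p t) * (xpow t - xpow (nf t)))"
    using poly_as_sum[of "keys p" p]
    by (simp add: red_def lin_ext_def right_diff_distrib sum_subtractf const_mult_xpow)
  also have "\<dots> \<in> BI"
    by (rule poly_ideal_sum[OF BI_ideal], rule poly_ideal_mult[OF BI_ideal const_in_polys nf_cong])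
      (use p in \<open>simp add: polys_iff\<close>)
  finally show ?thesis .
qed

lemma red_binom:
  assumes i: "i \<in> A"
  shows "red (a * binom i) = 0"
proof (rule poly_lin_induct[of a UNIV])
  fix s c
  have "nf (s + m i) = nf (s + r i)"
    using nf_step[OF i, of "s + m i"] by (simp add: mdvd_def lookup_add)
  then show "red (single s c * binom i) = 0"
    by (simp add: binom_def right_diff_distrib xpow_def mult_single red_diff)
      (simp add: red_def lin_ext_single)
qed (simp_all add: distrib_right red_add)

lemma BI_iff:
  assumes p: "p \<in> polys V"
  shows "p \<in> BI \<longleftrightarrow> red p = 0"
proof
  assume "p \<in> BI"
  then obtain a where "p = (\<Sum>i\<in>A. a i * binom i)" by (auto simp: ideal_span_def)
  then show "red p = 0" by (simp add: red_sum red_binom)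
next
  assume "red p = 0"
  then show "p \<in> BI" using red_cong[OF p] by simp
qed

lemma irreducible_add:
  assumes "irreducible t" "\<And>i. i \<in> A \<Longrightarrow> keys (m i) \<inter> keys s = {}"
  shows "irreducible (t + s)"
  unfolding irreducible_def
proof (intro ballI notI)
  fix i assume i: "i \<in> A" and dvd: "mdvd (m i) (t + s)"
  have "lookup (m i) v \<le> lookup t v" for v
  proof (cases "v \<in> keys (m i)")
    case True
    then have "lookup s v = 0" using assms(2)[OF i] by (auto simp: in_keys_iff)
    then show ?thesis using dvd[unfolded mdvd_def, rule_format, of v] by (simp add: lookup_add)
  qed (simp add: in_keys_iff)
  then show False using assms(1) i by (auto simp: irreducible_def mdvd_def)
qed

text \<open>The normal form is linear over the field but not multiplicative, so products are
  expanded along one factor in order to read off a single coefficient.\<close>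

lemma lookup_red_mult:
  fixes h g :: "('v, 'k::field) mpoly"
  assumes "finite S" "keys h \<subseteq> S"
  shows "lookup (red (h * g)) u = (\<Sum>t\<in>S. lookup h t * lookup (red (xpow t * g)) u)"
proof -
  have hg: "h * g = (\<Sum>t\<in>S. const (lookup h t) * (xpow t * g))"
    using arg_cong[OF poly_as_sum[OF assms], of "\<lambda>p. p * g"]
    by (simp add: const_mult_xpow sum_distrib_right mult.assoc[symmetric])
  have "red (const c * p) = const c * red p" for c and p :: "('v, 'k) mpoly"
    unfolding red_def
  proof (rule poly_lin_induct[of p UNIV])
    fix t d
    show "lin_ext (\<lambda>t. xpow (nf t)) (const c * single t d) = const c * lin_ext (\<lambda>t. xpow (nf t)) (single t d)"
      by (simp add: mult_single lin_ext_single xpow_def)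
  qed (simp_all add: distrib_left lin_ext_add)
  then show ?thesis unfolding hg by (simp add: red_sum lookup_sum lookup_const_mult)
qed

lemma red_xpow: "red (xpow t) = xpow (nf t)"
  by (simp add: red_def lin_ext_xpow)

lemma mkey_weight_le: "mkey w s \<le> mkey w t \<Longrightarrow> wdeg w s \<le> wdeg w t"
  by (auto simp: mkey_def less_eq_prod_simp)

text \<open>Multiplying by \<open>s\<close>, which is coprime to all \<open>m i\<close>, keeps
  irreducible monomials irreducible. So the leading term of the normal form of \<open>g\<close>,
  shifted by \<open>s\<close>, survives in the product: the terms from \<open>s'\<close> have
  smaller weight even after reduction.\<close>

lemma nonzerodivisor:
  fixes g :: "('v, 'k::field) mpoly"
  assumes s: "keys s \<subseteq> V" "keys s' \<subseteq> V" "\<And>i. i \<in> A \<Longrightarrow> keys (m i) \<inter> keys s = {}" "wdeg w s' < wdeg w s"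
    and g: "g \<in> polys V" "(xpow s - xpow s') * g \<in> BI"
  shows "g \<in> BI"
proof -
  let ?f = "xpow s - xpow s' :: ('v, 'k) mpoly"
  have f: "?f \<in> polys V" using s by (simp add: polys_diff)
  define h where "h = red g"
  have hp: "h \<in> polys V" unfolding h_def by (rule red_polys[OF g(1)])
  have "g - h \<in> BI" unfolding h_def by (rule red_cong[OF g(1)])
  then have "?f * g - ?f * (g - h) \<in> BI"
    by (intro poly_ideal_diff[OF BI_ideal g(2)] poly_ideal_mult[OF BI_ideal f])
  then have "h * ?f \<in> BI" by (simp add: algebra_simps)
  then have zero: "red (h * ?f) = 0" using BI_iff[OF poly_ring_closed(2)[OF hp f]] by simp
  have "h = 0"
  proof (rule ccontr)
    assume h0: "h \<noteq> 0"
    let ?t = "lead w h"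
    have t: "?t \<in> keys h" by (rule lead_keys[OF h0])
    have "lookup (red (xpow u * ?f)) (?t + s) = (if u = ?t then 1 else 0)" if u: "u \<in> keys h" for u
    proof -
      have "irreducible (u + s)"
        by (rule irreducible_add[OF _ s(3)]) (use red_irreducible u in \<open>auto simp: h_def\<close>)
      then have 1: "nf (u + s) = u + s" by (rule nf_id)
      have "wdeg w (nf (u + s')) \<le> wdeg w u + wdeg w s'" using nf_weight[of "u + s'"] by (simp add: wdeg_add)
      also have "\<dots> < wdeg w (?t + s)"
        using mkey_weight_le[OF lead_max[OF u, of w]] s(4) by (simp add: wdeg_add)
      finally have 2: "nf (u + s') \<noteq> ?t + s" by auto
      have "red (xpow u * ?f) = xpow (u + s) - xpow (nf (u + s'))"
        by (simp add: right_diff_distrib red_diff red_xpow 1 flip: xpow_add)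
      then show ?thesis using 2 by (auto simp: lookup_minus lookup_xpow)
    qed
    then have "(\<Sum>u\<in>keys h. lookup h u * lookup (red (xpow u * ?f)) (?t + s))
        = (\<Sum>u\<in>keys h. if u = ?t then lookup h u else 0)"
      by (intro sum.cong) simp_all
    then have "lookup (red (h * ?f)) (?t + s) = (\<Sum>u\<in>keys h. if u = ?t then lookup h u else 0)"
      using lookup_red_mult[of "keys h" h ?f "?t + s"] by simp
    also have "\<dots> = lookup h ?t" using t by simp
    finally show False using zero lookup_lead[OF h0, of w] by simp
  qed
  then show ?thesis using \<open>g - h \<in> BI\<close> by simp
qed

text \<open>A squarefree monomial that divides the square of a monomial divides the monomial itself.
  So the square of the leading monomial of a normal form is irreducible, and its coefficient in the
  reduced square is the square of the leading coefficient.\<close>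

lemma radical:
  fixes g :: "('v, 'k::field) mpoly"
  assumes g: "g \<in> polys V" "g * g \<in> BI"
  shows "g \<in> BI"
proof -
  define h where "h = red g"
  have hp: "h \<in> polys V" unfolding h_def by (rule red_polys[OF g(1)])
  have gh: "g - h \<in> BI" unfolding h_def by (rule red_cong[OF g(1)])
  then have "(g + h) * (g - h) \<in> BI"
    by (intro poly_ideal_mult[OF BI_ideal] poly_ring_closed(1) g(1) hp)
  from poly_ideal_diff[OF BI_ideal g(2) this] have "h * h \<in> BI" by (simp add: algebra_simps)
  then have zero: "red (h * h) = 0" using BI_iff[OF poly_ring_closed(2)[OF hp hp]] by simp
  have "h = 0"
  proof (rule ccontr)
    assume h0: "h \<noteq> 0"
    let ?t = "lead w h"
    have t: "?t \<in> keys h" by (rule lead_keys[OF h0])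
    have irr: "irreducible u" if "u \<in> keys h" for u using that red_irreducible by (auto simp: h_def)
    have irr2: "irreducible (?t + ?t)"
      unfolding irreducible_def
    proof (intro ballI notI)
      fix i assume i: "i \<in> A" and dvd: "mdvd (m i) (?t + ?t)"
      have "lookup (m i) v \<le> lookup ?t v" for v
        using dvd[unfolded mdvd_def, rule_format, of v] squarefree[OF i, of v] by (simp add: lookup_add)
      then show False using irr[OF t] i by (auto simp: irreducible_def mdvd_def)
    qed
    have nf_iff: "nf (a + b) = ?t + ?t \<longleftrightarrow> a = ?t \<and> b = ?t" if a: "a \<in> keys h" and b: "b \<in> keys h" for a b
    proof
      assume eq: "nf (a + b) = ?t + ?t"
      note ab = lead_max[OF a, of w] lead_max[OF b, of w]
      have "wdeg w (a + b) \<le> wdeg w (?t + ?t)"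
        using ab[THEN mkey_weight_le] by (simp add: wdeg_add)
      \<comment> \<open>A reducible product would end up with a weight strictly below that of
        \<open>?t + ?t\<close>.\<close>
      then have "irreducible (a + b)" using nf_weight_less[of "a + b"] eq by (metis not_le)
      then have sum: "a + b = ?t + ?t" using eq nf_id by simp
      show "a = ?t \<and> b = ?t"
      proof (rule ccontr)
        assume "\<not> (a = ?t \<and> b = ?t)"
        then have "mkey w (a + b) < mkey w (?t + ?t)"
        proof (cases "a = ?t")
          case True
          then have "mkey w b < mkey w ?t" using ab(2) \<open>\<not> (a = ?t \<and> b = ?t)\<close> by (auto simp: mkey_le_iff)
          then show ?thesis using True mkey_add_less[of w b ?t ?t] by simp
        next
          case False
          then have "mkey w a < mkey w ?t" using ab(1) by (auto simp: mkey_le_iff)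
          then have 1: "mkey w (a + b) < mkey w (?t + b)"
            using mkey_add_less[of w a ?t b] by (simp add: add.commute)
          have "mkey w (?t + b) \<le> mkey w (?t + ?t)"
            using ab(2) mkey_add_less[of w b ?t ?t] by (auto simp: mkey_le_iff)
          with 1 show ?thesis by (rule less_le_trans)
        qed
        then show False unfolding sum by simp
      qed
    qed (use nf_id[OF irr2] in simp)
    have inner: "lookup (red (xpow a * h)) (?t + ?t) = (if a = ?t then lookup h ?t else 0)"
      if a: "a \<in> keys h" for a
    proof -
      have *: "lookup (red (xpow b * xpow a :: ('v, 'k) mpoly)) (?t + ?t) = (if a = ?t \<and> b = ?t then 1 else 0)"
        if b: "b \<in> keys h" for b
      proof -
        have "red (xpow b * xpow a :: ('v, 'k) mpoly) = xpow (nf (b + a))" by (simp only: xpow_add[symmetric] red_xpow)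
        moreover have "?t + ?t = nf (b + a) \<longleftrightarrow> a = ?t \<and> b = ?t"
          by (subst eq_commute) (simp only: nf_iff[OF b a] conj_commute)
        ultimately show ?thesis by (simp only: lookup_xpow)
      qed
      have "lookup (red (h * xpow a)) (?t + ?t) = (\<Sum>b\<in>keys h. lookup h b * lookup (red (xpow b * xpow a)) (?t + ?t))"
        by (rule lookup_red_mult) simp_all
      also have "\<dots> = (\<Sum>b\<in>keys h. if a = ?t \<and> b = ?t then lookup h b else 0)"
        by (rule sum.cong) (simp_all add: *)
      also have "\<dots> = (if a = ?t then lookup h ?t else 0)"
        using t by (cases "a = ?t") simp_all
      finally show ?thesis by (simp add: mult.commute)
    qed
    have "lookup (red (h * h)) (?t + ?t) = (\<Sum>a\<in>keys h. lookup h a * lookup (red (xpow a * h)) (?t + ?t))"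
      by (rule lookup_red_mult) simp_all
    also have "\<dots> = (\<Sum>a\<in>keys h. if a = ?t then lookup h ?t * lookup h ?t else 0)"
      by (rule sum.cong) (simp_all add: inner)
    also have "\<dots> = lookup h ?t * lookup h ?t" using t by simp
    finally show False using zero lookup_lead[OF h0, of w] by simp
  qed
  then show ?thesis using gh by simp
qed

end

subsection \<open>Generators and faces of toric ideals\<close>

text \<open>Modulo I all monomials of one multidegree may be replaced by a common representative;
  the coefficients collected at it add up to a coefficient of the image of \<open>p\<close>, which
  is zero.\<close>

lemma toric_subset_ideal:
  fixes V :: "'v set" and A :: "'v \<Rightarrow> ('p::linorder \<Rightarrow>\<^sub>0 nat)" and I :: "('v, 'k::field) mpoly set"
  assumes I: "ideal I (poly_ring V)"
    and cong: "\<And>s t. keys s \<subseteq> V \<Longrightarrow> keys t \<subseteq> V \<Longrightarrow> dmap A s = dmap A t \<Longrightarrow> xpow s - xpow t \<in> I"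
  shows "toric V {} A \<subseteq> I"
proof
  fix p :: "('v, 'k) mpoly" assume p: "p \<in> toric V {} A"
  then have pV: "keys t \<subseteq> V" if "t \<in> keys p" for t using that by (auto simp: toric_def polys_iff)
  define \<rho> where "\<rho> u = (SOME t. t \<in> keys p \<and> dmap A t = u)" for u
  have \<rho>: "\<rho> (dmap A t) \<in> keys p \<and> dmap A (\<rho> (dmap A t)) = dmap A t" if "t \<in> keys p" for t
    unfolding \<rho>_def by (rule someI[of _ t]) (use that in simp)
  let ?c = "\<lambda>t. const (lookup p t) :: ('v, 'k) mpoly"
  have "(\<Sum>t\<in>keys p. ?c t * xpow (\<rho> (dmap A t)))
      = (\<Sum>u\<in>dmap A ` keys p. \<Sum>t\<in>{t \<in> keys p. dmap A t = u}. ?c t * xpow (\<rho> (dmap A t)))"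
    by (rule sum.image_gen) simp
  also have "\<dots> = (\<Sum>u\<in>dmap A ` keys p. const (lookup (mhom {} A p) u) * xpow (\<rho> u))"
  proof (rule sum.cong)
    fix u
    have "(\<Sum>t\<in>{t \<in> keys p. dmap A t = u}. ?c t * xpow (\<rho> (dmap A t)))
        = (\<Sum>t\<in>{t \<in> keys p. dmap A t = u}. ?c t) * xpow (\<rho> u)"
      unfolding sum_distrib_right by (rule sum.cong) auto
    also have "(\<Sum>t\<in>{t \<in> keys p. dmap A t = u}. ?c t) = const (lookup (mhom {} A p) u)"
      unfolding lookup_mhom by (rule poly_mapping_eqI) (simp add: lookup_sum lookup_single when_def)
    finally show "(\<Sum>t\<in>{t \<in> keys p. dmap A t = u}. ?c t * xpow (\<rho> (dmap A t)))
        = const (lookup (mhom {} A p) u) * xpow (\<rho> u)" .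
  qed simp
  also have "\<dots> = 0" using p by (simp add: toric_def)
  finally have zero: "(\<Sum>t\<in>keys p. ?c t * xpow (\<rho> (dmap A t))) = 0" .
  have "p = (\<Sum>t\<in>keys p. ?c t * xpow t)"
    using poly_as_sum[of "keys p" p] by (simp add: const_mult_xpow)
  also have "\<dots> = (\<Sum>t\<in>keys p. ?c t * (xpow t - xpow (\<rho> (dmap A t))))"
    using zero by (simp add: right_diff_distrib sum_subtractf)
  also have "\<dots> \<in> I"
  proof (rule poly_ideal_sum[OF I], rule poly_ideal_mult[OF I const_in_polys])
    fix t assume t: "t \<in> keys p"
    show "xpow t - xpow (\<rho> (dmap A t)) \<in> I"
      by (rule cong) (use \<rho>[OF t] pV t in auto)
  qed
  finally show "p \<in> I" .
qed

lemma wdeg_sum: "wdeg w (sum f S) = (\<Sum>i\<in>S. wdeg w (f i))"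
  by (induction S rule: infinite_finite_induct) (simp_all add: wdeg_add)

lemma wdeg_pscale: "wdeg w (pscale n t) = n * wdeg w t"
proof -
  have "wdeg w (pscale n t) = (\<Sum>v\<in>keys t. w v * lookup (pscale n t) v)"
    by (rule wdeg_superset) (auto simp: in_keys_iff)
  then show ?thesis by (simp add: wdeg_def sum_distrib_left mult_ac)
qed

lemma dmap_sum: "dmap B (sum f S) = (\<Sum>i\<in>S. dmap B (f i))"
  by (rule poly_mapping_eqI) (simp add: lookup_dmap lookup_sum wdeg_sum)

lemma dmap_pscale: "dmap B (pscale n t) = pscale n (dmap B t)"
  by (rule poly_mapping_eqI) (simp add: lookup_dmap wdeg_pscale)

lemma dmap_dmap:
  assumes "\<And>v. v \<in> keys t \<Longrightarrow> A v = dmap B (A' v)"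
  shows "dmap A t = dmap B (dmap A' t)"
  unfolding dmap_def[of A] dmap_def[of A'] dmap_sum dmap_pscale
  using assms by (intro sum.cong) simp_all

text \<open>Away from \<open>Z\<close> the multidegree for \<open>A'\<close> is finer than that for
  \<open>A\<close>. If all terms of \<open>g\<close> of degree \<open>u\<close> avoid
  \<open>Z\<close>, this fibre of \<open>A\<close> splits into full fibres of \<open>A'\<close>,
  over each of which the coefficients of \<open>g\<close> add up to zero.\<close>

lemma lookup_mhom_on_face:
  assumes ker: "mhom Z A' g = 0" and g: "g \<in> polys V"
    and face: "\<And>t. t \<in> keys g \<Longrightarrow> dmap A t = u \<Longrightarrow> keys t \<inter> Z = {}"
    and factor: "\<And>v. v \<in> V \<Longrightarrow> v \<notin> Z \<Longrightarrow> A v = dmap B (A' v)"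
  shows "lookup (mhom {} A g) u = 0"
proof -
  let ?T = "{t \<in> keys g. dmap A t = u}"
  have AB: "dmap A t = dmap B (dmap A' t)" if "t \<in> keys g" "keys t \<inter> Z = {}" for t
    by (rule dmap_dmap) (use that g factor in \<open>auto simp: polys_iff\<close>)
  have "lookup (mhom {} A g) u = sum (lookup g) ?T"
    by (simp add: lookup_mhom)
  also have "\<dots> = (\<Sum>u'\<in>dmap A' ` ?T. sum (lookup g) {t \<in> ?T. dmap A' t = u'})"
    by (rule sum.image_gen) simp
  also have "\<dots> = (\<Sum>u'\<in>dmap A' ` ?T. lookup (mhom Z A' g) u')"
  proof (rule sum.cong)
    fix u' assume "u' \<in> dmap A' ` ?T"
    then obtain t0 where t0: "t0 \<in> keys g" "dmap A t0 = u" "dmap A' t0 = u'" by blast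
    have "{t \<in> ?T. dmap A' t = u'} = {t \<in> keys g. keys t \<inter> Z = {} \<and> dmap A' t = u'}"
    proof (intro equalityI subsetI)
      fix t assume "t \<in> {t \<in> keys g. keys t \<inter> Z = {} \<and> dmap A' t = u'}"
      then have t: "t \<in> keys g" "keys t \<inter> Z = {}" "dmap A' t = u'" by simp_all
      have "dmap A t = dmap A t0"
        using AB[OF t(1,2)] AB[OF t0(1) face[OF t0(1,2)]] t(3) t0(3) by simp
      then show "t \<in> {t \<in> ?T. dmap A' t = u'}" using t t0(2) by simp
    next
      fix t assume "t \<in> {t \<in> ?T. dmap A' t = u'}"
      then show "t \<in> {t \<in> keys g. keys t \<inter> Z = {} \<and> dmap A' t = u'}" using face by simp
    qed
    then show "sum (lookup g) {t \<in> ?T. dmap A' t = u'} = lookup (mhom Z A' g) u'"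
      by (simp add: lookup_mhom)
  qed simp
  finally show ?thesis by (simp add: ker)
qed

lemma mhom_binomial:
  "mhom Z A (xpow s - xpow t :: ('v, 'k::comm_ring_1) mpoly) = 0 \<longleftrightarrow>
    (keys s \<inter> Z \<noteq> {} \<and> keys t \<inter> Z \<noteq> {}) \<or>
    (keys s \<inter> Z = {} \<and> keys t \<inter> Z = {} \<and> dmap A s = dmap A t)"
proof -
  have inj: "xpow a = (xpow b :: ('p, 'k) mpoly) \<longleftrightarrow> a = b" for a b :: "'p \<Rightarrow>\<^sub>0 nat"
    by (metis keys_xpow singleton_inject)
  show ?thesis
    by (auto simp: mhom_diff mhom_xpow inj)
qed

lemma var_eq_xpow: "var v = xpow (single v 1)"
  by (simp add: var_def xpow_def)

subsection \<open>The four strips of the circle\<close>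

datatype side = South | East | North | West

fun nxt :: "side \<Rightarrow> side" where
  "nxt South = East" | "nxt East = North" | "nxt North = West" | "nxt West = South"

fun prv :: "side \<Rightarrow> side" where
  "prv South = West" | "prv East = South" | "prv North = East" | "prv West = North"

fun side_no :: "side \<Rightarrow> int" where
  "side_no South = 0" | "side_no East = 1" | "side_no North = 2" | "side_no West = 3"

lemma side_no_inj [simp]: "side_no \<sigma> = side_no \<tau> \<longleftrightarrow> \<sigma> = \<tau>"
  by (cases \<sigma>; cases \<tau>) simp_all

instance side :: finite
proof
  have "(UNIV :: side set) = {South, East, North, West}"
    using side.exhaust by blast
  then show "finite (UNIV :: side set)" by (rule ssubst) simp
qed

lemma sum_sides: "(\<Sum>\<sigma>\<in>UNIV. f \<sigma>) = f South + f East + f North + (f West :: 'a::comm_monoid_add)"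
proof -
  have "(UNIV :: side set) = {South, East, North, West}"
    using side.exhaust by blast
  then have "(\<Sum>\<sigma>\<in>UNIV. f \<sigma>) = (\<Sum>\<sigma>\<in>{South, East, North, West}. f \<sigma>)" by (rule arg_cong)
  then show ?thesis by (simp add: add_ac)
qed

text \<open>The strip along a side consists of the vertices of depth 1 (outer) and 2 (inner) with respect
  to this side. Its columns are numbered counterclockwise; the chain order \<open>2, 1, 3, 4, \<dots>\<close> of the columns
  is the one for which \<open>J\<close> is generated by the minors of consecutive columns.\<close>

definition chain :: "int \<Rightarrow> int" where
  "chain i = (if i = 1 then 2 else if i = 2 then 1 else i)"

locale circle_path =
  fixes m n :: int
  assumes m4: "4 \<le> m" and n4: "4 \<le> n"
begin

fun len :: "side \<Rightarrow> int" where
  "len South = m" | "len East = n" | "len North = m" | "len West = n"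

fun depth :: "side \<Rightarrow> point \<Rightarrow> int" where
  "depth South v = snd v" | "depth East v = m + 1 - fst v"
| "depth North v = n + 1 - snd v" | "depth West v = fst v"

text \<open>Counting columns counterclockwise means measuring depth from the preceding side, so that
  facts about a corner are facts about two depths.\<close>

definition pos :: "side \<Rightarrow> point \<Rightarrow> int" where
  "pos \<sigma> v = depth (prv \<sigma>) v"

fun pt :: "side \<Rightarrow> int \<Rightarrow> int \<Rightarrow> point" where
  "pt South k l = (k, l)" | "pt East k l = (m + 1 - l, k)"
| "pt North k l = (m + 1 - k, n + 1 - l)" | "pt West k l = (l, n + 1 - k)"

definition VV :: "point set" where
  "VV = {v. (\<forall>\<sigma>. 1 \<le> depth \<sigma> v) \<and> (\<exists>\<sigma>. depth \<sigma> v \<le> 2)}"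

lemma VV_iff: "v \<in> VV \<longleftrightarrow> 1 \<le> fst v \<and> fst v \<le> m \<and> 1 \<le> snd v \<and> snd v \<le> n \<and>
    (fst v \<le> 2 \<or> m - 1 \<le> fst v \<or> snd v \<le> 2 \<or> n - 1 \<le> snd v)"
proof -
  have "(\<forall>\<sigma>. 1 \<le> depth \<sigma> v) \<longleftrightarrow> 1 \<le> depth South v \<and> 1 \<le> depth East v \<and> 1 \<le> depth North v \<and> 1 \<le> depth West v"
    by (metis side.exhaust)
  moreover have "(\<exists>\<sigma>. depth \<sigma> v \<le> 2) \<longleftrightarrow> depth South v \<le> 2 \<or> depth East v \<le> 2 \<or> depth North v \<le> 2 \<or> depth West v \<le> 2"
    by (metis side.exhaust)
  ultimately show ?thesis unfolding VV_def by auto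
qed

lemma finite_VV: "finite VV"
proof (rule finite_subset)
  show "VV \<subseteq> {1..m} \<times> {1..n}" by (auto simp: VV_iff)
qed simp

lemma pt_VV: "1 \<le> k \<Longrightarrow> k \<le> len \<sigma> \<Longrightarrow> 1 \<le> l \<Longrightarrow> l \<le> 2 \<Longrightarrow> pt \<sigma> k l \<in> VV"
  using m4 n4 by (cases \<sigma>) (auto simp: VV_iff)

lemma depth_pt [simp]: "depth \<sigma> (pt \<sigma> k l) = l" "pos \<sigma> (pt \<sigma> k l) = k"
  by (cases \<sigma>; simp add: pos_def)+

lemma pt_eq_iff [simp]: "pt \<sigma> k l = pt \<sigma> k' l' \<longleftrightarrow> k = k' \<and> l = l'"
  by (cases \<sigma>) auto

lemma pt_pos_depth: "pt \<sigma> (pos \<sigma> v) (depth \<sigma> v) = v"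
  by (cases \<sigma>) (simp_all add: pos_def)

lemma len_ge_4: "4 \<le> len \<sigma>"
  using m4 n4 by (cases \<sigma>) auto

lemma pos_le_len: "v \<in> VV \<Longrightarrow> 1 \<le> pos \<sigma> v \<and> pos \<sigma> v \<le> len \<sigma>"
  by (cases \<sigma>) (auto simp: pos_def VV_iff)

lemma depth_ge_1: "v \<in> VV \<Longrightarrow> 1 \<le> depth \<sigma> v"
  by (simp add: VV_def)

text \<open>There are \<open>len \<sigma> - 1\<close> pairs of consecutive columns, but the last
  pair of a strip spans the corner cell that the next strip lists first.\<close>

definition J_index :: "(side \<times> int) set" where
  "J_index = (SIGMA \<sigma>:UNIV. {1..len \<sigma> - 2})"

definition col_minor :: "side \<Rightarrow> int \<Rightarrow> int \<Rightarrow> (point, 'k::field) mpoly" where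
  "col_minor \<sigma> i j = var (pt \<sigma> i 1) * var (pt \<sigma> j 2) - var (pt \<sigma> i 2) * var (pt \<sigma> j 1)"

definition lead_mon :: "side \<times> int \<Rightarrow> (point \<Rightarrow>\<^sub>0 nat)" where
  "lead_mon = (\<lambda>(\<sigma>, i). single (pt \<sigma> (chain i) 1) 1 + single (pt \<sigma> (chain (i + 1)) 2) 1)"

definition tail_mon :: "side \<times> int \<Rightarrow> (point \<Rightarrow>\<^sub>0 nat)" where
  "tail_mon = (\<lambda>(\<sigma>, i). single (pt \<sigma> (chain i) 2) 1 + single (pt \<sigma> (chain (i + 1)) 1) 1)"

fun corner_weight :: "side \<Rightarrow> point \<Rightarrow> int" where
  "corner_weight \<sigma> v = (if depth \<sigma> v = 1 then m + n + 1 else if pos \<sigma> v = 1 then 1 else 0)"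

text \<open>In each strip, the difference between the weights of the outer and of the inner vertex of a
  column decreases along the chain order. At a corner this has to hold in two strips at once.\<close>

definition weight :: "point \<Rightarrow> nat" where
  "weight v = nat (
     if fst v \<le> 2 \<and> snd v \<le> 2 then corner_weight South v
     else if m - 1 \<le> fst v \<and> snd v \<le> 2 then corner_weight East v
     else if m - 1 \<le> fst v \<and> n - 1 \<le> snd v then corner_weight North v
     else if fst v \<le> 2 \<and> n - 1 \<le> snd v then corner_weight West v
     else if snd v = 1 then m - fst v
     else if fst v = m then n - snd v
     else if snd v = n then fst v - 1
     else if fst v = 1 then snd v - 1 else 0)"

lemma J_index_iff: "(\<sigma>, i) \<in> J_index \<longleftrightarrow> 1 \<le> i \<and> i \<le> len \<sigma> - 2"
  by (auto simp: J_index_def)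

lemma finite_J_index: "finite J_index"
  by (simp add: J_index_def)

lemma card_J_index: "int (card J_index) = 2 * (m + n) - 8"
  using m4 n4 by (simp add: J_index_def card_SigmaI sum_sides)

text \<open>This is where the exchange of columns 1 and 2 in \<open>chain\<close> pays off: in the
  natural order \<open>pt \<sigma> 2 2\<close>, which is also the inner vertex of column
  \<open>len - 1\<close> of the preceding strip, would occur twice.\<close>

lemma lead_vertices_disjoint:
  assumes "1 \<le> i" "i \<le> len \<sigma> - 2" "1 \<le> j" "j \<le> len \<tau> - 2" "(\<sigma>, i) \<noteq> (\<tau>, j)"
  shows "{pt \<sigma> (chain i) 1, pt \<sigma> (chain (i + 1)) 2} \<inter> {pt \<tau> (chain j) 1, pt \<tau> (chain (j + 1)) 2} = {}"
  using assms m4 n4 by (cases \<sigma>; cases \<tau>) (auto simp: chain_def split: if_splits)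

lemma chain_bounds: "1 \<le> i \<Longrightarrow> i \<le> len \<sigma> \<Longrightarrow> 1 \<le> chain i \<and> chain i \<le> len \<sigma>"
  using len_ge_4[of \<sigma>] by (auto simp: chain_def)

lemma weight_outer:
  assumes "1 \<le> k" "k \<le> len \<sigma>"
  shows "int (weight (pt \<sigma> k 1)) = (if k \<le> 2 \<or> k = len \<sigma> then m + n + 1 else len \<sigma> - k)"
  using assms m4 n4 by (cases \<sigma>) (simp_all add: weight_def pos_def)

lemma weight_inner:
  assumes "1 \<le> k" "k \<le> len \<sigma>"
  shows "int (weight (pt \<sigma> k 2)) = (if k = 1 then 1 else if k = len \<sigma> then m + n + 1 else 0)"
  using assms m4 n4 by (cases \<sigma>) (simp_all add: weight_def pos_def)

text \<open>Along the chain the outer weight exceeds the inner one by \<open>m + n + 1\<close>,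
  \<open>m + n\<close>, \<open>len \<sigma> - 3\<close>, \<open>len \<sigma> - 4\<close> and so on.
  The constant \<open>m + n + 1\<close> is large enough for either kind of side.\<close>

lemma weight_lead:
  assumes "1 \<le> i" "i \<le> len \<sigma> - 2"
  shows "weight (pt \<sigma> (chain i) 2) + weight (pt \<sigma> (chain (i + 1)) 1)
    < weight (pt \<sigma> (chain i) 1) + weight (pt \<sigma> (chain (i + 1)) 2)"
proof -
  have len: "len \<sigma> \<le> m + n" using m4 n4 by (cases \<sigma>) auto
  have b: "1 \<le> chain i" "chain i \<le> len \<sigma>" "1 \<le> chain (i + 1)" "chain (i + 1) \<le> len \<sigma>"
    using chain_bounds[of i \<sigma>] chain_bounds[of "i + 1" \<sigma>] assms by auto
  have "int (weight (pt \<sigma> (chain i) 2)) + int (weight (pt \<sigma> (chain (i + 1)) 1))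
    < int (weight (pt \<sigma> (chain i) 1)) + int (weight (pt \<sigma> (chain (i + 1)) 2))"
    unfolding weight_outer[OF b(1,2)] weight_outer[OF b(3,4)] weight_inner[OF b(1,2)] weight_inner[OF b(3,4)]
    using assms len_ge_4[of \<sigma>] len by (auto simp: chain_def)
  then show ?thesis by linarith
qed

end

subsection \<open>The ideal of consecutive column minors\<close>

lemma xpow_split:
  assumes "v \<in> keys t"
  shows "xpow t = var v * xpow (t - single v 1)"
    and "keys t - {v} \<subseteq> keys (t - single v 1)" and "keys (t - single v 1) \<subseteq> keys t"
proof -
  have "t = single v 1 + (t - single v 1)"
    using assms by (intro poly_mapping_eqI) (auto simp: lookup_add lookup_minus lookup_single when_def in_keys_iff)
  then show "xpow t = var v * xpow (t - single v 1)"
    unfolding var_eq_xpow by (metis xpow_add)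
qed (auto simp: in_keys_iff lookup_minus lookup_single when_def split: if_splits)

context circle_path
begin

sublocale rw: coprime_binomials VV J_index lead_mon tail_mon weight
proof
  show "finite J_index" by (rule finite_J_index)
next
  fix x assume x: "x \<in> J_index"
  then obtain \<sigma> i where xi: "x = (\<sigma>, i)" "1 \<le> i" "i \<le> len \<sigma> - 2" by (cases x) (auto simp: J_index_iff)
  have b: "1 \<le> chain i" "chain i \<le> len \<sigma>" "1 \<le> chain (i + 1)" "chain (i + 1) \<le> len \<sigma>"
    using chain_bounds[of i \<sigma>] chain_bounds[of "i + 1" \<sigma>] xi by auto
  then show "keys (lead_mon x) \<subseteq> VV" "keys (tail_mon x) \<subseteq> VV"
    by (simp_all add: xi lead_mon_def tail_mon_def keys_add_nat pt_VV)
  show "lookup (lead_mon x) v \<le> 1" for v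
    by (auto simp: xi lead_mon_def lookup_add lookup_single when_def)
  show "wdeg weight (tail_mon x) < wdeg weight (lead_mon x)"
    using weight_lead[OF xi(2,3)] by (simp add: xi lead_mon_def tail_mon_def wdeg_add wdeg_single)
next
  fix x y assume "x \<in> J_index" "y \<in> J_index" "x \<noteq> y"
  then show "keys (lead_mon x) \<inter> keys (lead_mon y) = {}"
    using lead_vertices_disjoint by (cases x; cases y) (simp add: lead_mon_def keys_add_nat J_index_iff insert_commute)
qed

abbreviation JJ :: "(point, 'k::field) mpoly set" where
  "JJ \<equiv> rw.BI"

lemma rw_binom: "rw.binom (\<sigma>, i) = col_minor \<sigma> (chain i) (chain (i + 1))"
  unfolding rw.binom_def by (simp add: lead_mon_def tail_mon_def col_minor_def var_eq_xpow xpow_add)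

text \<open>In the square shared by two consecutive sides, depth along one side is position along
  the other.\<close>

lemma pt_corner: "pt \<sigma> (len \<sigma> + 1 - l) k = pt (nxt \<sigma>) k l"
  by (cases \<sigma>) simp_all

abbreviation cm :: "side \<Rightarrow> int \<Rightarrow> int \<Rightarrow> (point, 'k::field) mpoly" where
  "cm \<sigma> a b \<equiv> col_minor \<sigma> (chain a) (chain b)"

text \<open>The last pair of columns has no index of its own in \<open>J_index\<close>; it is the
  first pair of the next strip, with rows and columns transposed.\<close>

lemma cm_consecutive: "1 \<le> a \<Longrightarrow> a < len \<sigma> \<Longrightarrow> (cm \<sigma> a (a + 1) :: (point, 'k::field) mpoly) \<in> JJ"
proof (cases "a \<le> len \<sigma> - 2")
  case True
  assume "1 \<le> a"
  with True have "(\<sigma>, a) \<in> J_index" by (simp add: J_index_iff)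
  from ideal_span_mem[OF finite_J_index this] show ?thesis by (metis rw_binom)
next
  case False
  assume "1 \<le> a" "a < len \<sigma>"
  with False have a: "a = len \<sigma> - 1" by simp
  have "chain a = len \<sigma> + 1 - 2" "chain (a + 1) = len \<sigma> + 1 - 1"
    using len_ge_4[of \<sigma>] by (simp_all add: chain_def a)
  then have "(cm \<sigma> a (a + 1) :: (point, 'k) mpoly) = cm (nxt \<sigma>) 1 (1 + 1)"
    unfolding col_minor_def by (simp only: pt_corner) (simp add: chain_def mult.commute)
  also have "\<dots> = rw.binom (nxt \<sigma>, 1)" by (simp only: rw_binom)
  also have "\<dots> \<in> JJ"
    by (rule ideal_span_mem[OF finite_J_index]) (use len_ge_4[of "nxt \<sigma>"] in \<open>simp add: J_index_iff\<close>)
  finally show ?thesis .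
qed

text \<open>The three-rowed determinant of columns \<open>i\<close>, \<open>j\<close>,
  \<open>k\<close> whose rows are the outer row, the inner row and again row \<open>l\<close>
  vanishes; this is its expansion along the repeated row.\<close>

lemma pluecker:
  assumes "l \<in> {1, 2}"
  shows "var (pt \<sigma> k l) * col_minor \<sigma> i j =
    var (pt \<sigma> j l) * col_minor \<sigma> i k + var (pt \<sigma> i l) * col_minor \<sigma> k j"
  using assms by (auto simp: col_minor_def algebra_simps)

text \<open>The Pluecker relation splits the minor at its last intermediate column and spends one
  variable of \<open>t\<close> from that column; the columns further inside remain covered by the
  rest of \<open>t\<close>.\<close>

lemma cover_minor:
  assumes a: "1 \<le> a" and ab: "a < b" and b: "b \<le> len \<sigma>" and t: "keys t \<subseteq> VV"
    and cover: "\<And>k. a < k \<Longrightarrow> k < b \<Longrightarrow> \<exists>l\<in>{1, 2}. pt \<sigma> (chain k) l \<in> keys t"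
  shows "(xpow t * cm \<sigma> a b :: (point, 'k::field) mpoly) \<in> JJ"
  using ab b t cover
proof (induction b arbitrary: t rule: int_gr_induct)
  case base
  then show ?case
    using a by (intro poly_ideal_mult[OF rw.BI_ideal] cm_consecutive) simp_all
next
  case (step b)
  obtain l where l: "l \<in> {1, 2}" "pt \<sigma> (chain b) l \<in> keys t"
    using step.prems(3)[of b] step.hyps by auto
  let ?z = "pt \<sigma> (chain b) l"
  let ?s = "t - single ?z 1"
  note sp = xpow_split[OF l(2)]
  have sV: "keys ?s \<subseteq> VV" using sp(3) step.prems(2) by blast
  have bd: "pt \<sigma> (chain k) l \<in> VV" if "1 \<le> k" "k \<le> len \<sigma>" for k
    using chain_bounds[OF that] l(1) by (auto intro!: pt_VV)
  have vp: "(var (pt \<sigma> (chain k) l) :: (point, 'k) mpoly) \<in> polys VV" if "1 \<le> k" "k \<le> len \<sigma>" for k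
    using bd[OF that] by (simp add: var_eq_xpow)
  have "(xpow t * cm \<sigma> a (b + 1) :: (point, 'k) mpoly) = xpow ?s * (var ?z * cm \<sigma> a (b + 1))"
    unfolding sp(1) by (simp only: mult_ac)
  also have "\<dots> = var (pt \<sigma> (chain (b + 1)) l) * (xpow ?s * cm \<sigma> a b)
      + xpow ?s * var (pt \<sigma> (chain a) l) * cm \<sigma> b (b + 1)"
    unfolding pluecker[OF l(1), of \<sigma> "chain b" "chain a" "chain (b + 1)"] by (simp only: distrib_left mult_ac)
  also have "\<dots> \<in> JJ"
  proof (rule poly_ideal_add[OF rw.BI_ideal])
    have IH: "(xpow ?s * cm \<sigma> a b :: (point, 'k) mpoly) \<in> JJ"
    proof (rule step.IH)
      fix k assume k: "a < k" "k < b"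
      then obtain l' where l': "l' \<in> {1, 2}" "pt \<sigma> (chain k) l' \<in> keys t"
        using step.prems(3)[of k] by auto
      moreover have "chain k \<noteq> chain b" using k(2) a k(1) by (auto simp: chain_def)
      ultimately have "pt \<sigma> (chain k) l' \<in> keys ?s" using sp(2) by auto
      with l'(1) show "\<exists>l\<in>{1, 2}. pt \<sigma> (chain k) l \<in> keys ?s" by blast
    qed (use step.prems sV in auto)
    show "(var (pt \<sigma> (chain (b + 1)) l) * (xpow ?s * cm \<sigma> a b) :: (point, 'k) mpoly) \<in> JJ"
      by (rule poly_ideal_mult[OF rw.BI_ideal _ IH]) (rule vp, use step.prems step.hyps a in simp_all)
    have "(xpow ?s * var (pt \<sigma> (chain a) l) :: (point, 'k) mpoly) \<in> polys VV"
      by (rule poly_ring_closed(2)) (use sV vp step.prems step.hyps a in simp_all)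
    then show "(xpow ?s * var (pt \<sigma> (chain a) l) * cm \<sigma> b (b + 1) :: (point, 'k) mpoly) \<in> JJ"
      by (rule poly_ideal_mult[OF rw.BI_ideal]) (rule cm_consecutive, use step.prems step.hyps a in simp_all)
  qed
  finally show ?case .
qed

lemma cover_flip:
  assumes "1 \<le> a" "a < b" "b \<le> len \<sigma>" "keys t \<subseteq> VV"
    and "\<And>k. a < k \<Longrightarrow> k < b \<Longrightarrow> \<exists>l\<in>{1, 2}. pt \<sigma> (chain k) l \<in> keys t"
  shows "(xpow (single (pt \<sigma> (chain a) 1) 1 + single (pt \<sigma> (chain b) 2) 1 + t)
    - xpow (single (pt \<sigma> (chain a) 2) 1 + single (pt \<sigma> (chain b) 1) 1 + t) :: (point, 'k::field) mpoly) \<in> JJ"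
  using cover_minor[OF assms] by (simp add: xpow_add col_minor_def var_eq_xpow algebra_simps)

lemma chain_chain [simp]: "chain (chain i) = i"
  by (simp add: chain_def)

lemma col_minor_swap: "col_minor \<sigma> j i = - col_minor \<sigma> i j"
  by (simp add: col_minor_def mult.commute)

text \<open>In chain order every strip also needs a variable from its columns 1 and
  \<open>len \<sigma> - 1\<close>. The corner variables in \<open>c\<close> provide these for East
  and West only. One exchange in each of these two strips turns \<open>c\<close> into
  \<open>c2\<close> modulo J, and \<open>c2\<close> provides them for South and North.\<close>

lemma covered_times_minor:
  assumes t: "keys t \<subseteq> VV" and mid: "\<And>\<sigma> k. 3 \<le> k \<Longrightarrow> k \<le> len \<sigma> - 2 \<Longrightarrow> \<exists>l\<in>{1, 2}. pt \<sigma> k l \<in> keys t"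
    and ij: "1 \<le> i" "i \<le> len \<sigma>" "1 \<le> j" "j \<le> len \<sigma>"
  defines "c \<equiv> single (2, 2) 1 + single (1, n) 1 + single (m, 1) 1 + single (m - 1, n - 1) 1"
  shows "(xpow (c + t) * col_minor \<sigma> i j :: (point, 'k::field) mpoly) \<in> JJ"
proof -
  \<comment> \<open>\<open>c1\<close> results from \<open>c\<close> by the exchange in the East
    strip, \<open>c2\<close> from \<open>c1\<close> by that in the West strip.\<close>
  define c1 :: "point \<Rightarrow>\<^sub>0 nat" where "c1 = single (m - 1, 1) 1 + single (m, n - 1) 1 + (single (2, 2) 1 + single (1, n) 1)"
  define c2 :: "point \<Rightarrow>\<^sub>0 nat" where "c2 = single (m - 1, 1) 1 + single (m, n - 1) 1 + (single (2, n) 1 + single (1, 2) 1)"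
  have V: "keys c \<subseteq> VV" "keys c2 \<subseteq> VV" "(1, n) \<in> VV" "(2, 2) \<in> VV" "(m - 1, 1) \<in> VV" "(m, n - 1) \<in> VV"
    using m4 n4 by (auto simp: c_def c2_def keys_add_nat VV_iff)
  have "(xpow (single (pt East (chain 2) 1) 1 + single (pt East (chain (n - 1)) 2) 1 + (single (2, 2) 1 + single (1, n) 1 + t))
      - xpow (single (pt East (chain 2) 2) 1 + single (pt East (chain (n - 1)) 1) 1 + (single (2, 2) 1 + single (1, n) 1 + t)) :: (point, 'k) mpoly) \<in> JJ"
    by (rule cover_flip) (use n4 t V mid[of _ East] in \<open>auto simp: keys_add_nat chain_def\<close>)
  then have f1: "(xpow (c + t) - xpow (c1 + t) :: (point, 'k) mpoly) \<in> JJ"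
    using n4 by (simp add: chain_def c_def c1_def add_ac)
  have "(xpow (single (pt West (chain 2) 1) 1 + single (pt West (chain (n - 1)) 2) 1 + (single (m - 1, 1) 1 + single (m, n - 1) 1 + t))
      - xpow (single (pt West (chain 2) 2) 1 + single (pt West (chain (n - 1)) 1) 1 + (single (m - 1, 1) 1 + single (m, n - 1) 1 + t)) :: (point, 'k) mpoly) \<in> JJ"
    by (rule cover_flip) (use n4 t V mid[of _ West] in \<open>auto simp: keys_add_nat chain_def\<close>)
  then have f2: "(xpow (c1 + t) - xpow (c2 + t) :: (point, 'k) mpoly) \<in> JJ"
    using n4 by (simp add: chain_def c1_def c2_def add_ac)
  have f: "(xpow (c + t) - xpow (c2 + t) :: (point, 'k) mpoly) \<in> JJ"
    by (rule poly_ideal_diff_trans[OF rw.BI_ideal f1 f2])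
  have vertical: "(xpow (c + t) * cm \<sigma> a b :: (point, 'k) mpoly) \<in> JJ"
    if hyp: "\<sigma> = East \<or> \<sigma> = West" "1 \<le> a" "a < b" "b \<le> len \<sigma>" for a b
  proof (rule cover_minor[OF hyp(2-4)])
    show "keys (c + t) \<subseteq> VV" using V t by (simp add: keys_add_nat)
    fix k assume k: "a < k" "k < b"
    consider "k = 2" | "k = len \<sigma> - 1" "k \<noteq> 2" | "3 \<le> k" "k \<le> len \<sigma> - 2" using k hyp by linarith
    then show "\<exists>l\<in>{1, 2}. pt \<sigma> (chain k) l \<in> keys (c + t)"
    proof cases
      case 1
      have "pt \<sigma> 1 1 \<in> keys (c + t)" using hyp(1) by (auto simp: c_def keys_add_nat)
      then show ?thesis by (intro bexI[of _ 1]) (simp_all add: 1 chain_def)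
    next
      case 2
      have "pt \<sigma> (len \<sigma> - 1) 2 \<in> keys (c + t)" using hyp(1) by (auto simp: c_def keys_add_nat)
      then show ?thesis
        using len_ge_4[of \<sigma>] by (intro bexI[of _ 2]) (simp_all add: 2(1) chain_def)
    next
      case 3
      then show ?thesis using mid[of k \<sigma>] by (simp add: chain_def keys_add_nat) blast
    qed
  qed
  have horizontal: "(xpow (c2 + t) * cm \<sigma> a b :: (point, 'k) mpoly) \<in> JJ"
    if hyp: "\<sigma> = South \<or> \<sigma> = North" "1 \<le> a" "a < b" "b \<le> len \<sigma>" for a b
  proof (rule cover_minor[OF hyp(2-4)])
    show "keys (c2 + t) \<subseteq> VV" using V t by (simp add: keys_add_nat)
    fix k assume k: "a < k" "k < b"
    consider "k = 2" | "k = len \<sigma> - 1" "k \<noteq> 2" | "3 \<le> k" "k \<le> len \<sigma> - 2" using k hyp by linarith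
    then show "\<exists>l\<in>{1, 2}. pt \<sigma> (chain k) l \<in> keys (c2 + t)"
    proof cases
      case 1
      have "pt \<sigma> 1 2 \<in> keys (c2 + t)" using hyp(1) by (auto simp: c2_def keys_add_nat)
      then show ?thesis by (intro bexI[of _ 2]) (simp_all add: 1 chain_def)
    next
      case 2
      have "pt \<sigma> (len \<sigma> - 1) 1 \<in> keys (c2 + t)" using hyp(1) by (auto simp: c2_def keys_add_nat)
      then show ?thesis
        using len_ge_4[of \<sigma>] by (intro bexI[of _ 1]) (simp_all add: 2(1) chain_def)
    next
      case 3
      then show ?thesis using mid[of k \<sigma>] by (simp add: chain_def keys_add_nat) blast
    qed
  qed
  have cmp: "(cm \<sigma> a b :: (point, 'k) mpoly) \<in> polys VV" if "1 \<le> a" "a \<le> len \<sigma>" "1 \<le> b" "b \<le> len \<sigma>" for a b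
    using chain_bounds[OF that(1,2)] chain_bounds[OF that(3,4)]
    by (auto simp: col_minor_def var_eq_xpow intro!: polys_closed pt_VV)
  have main: "(xpow (c + t) * cm \<sigma> a b :: (point, 'k) mpoly) \<in> JJ" if ab: "1 \<le> a" "a < b" "b \<le> len \<sigma>" for a b
  proof (cases "\<sigma> = East \<or> \<sigma> = West")
    case True
    then show ?thesis by (rule vertical[OF _ ab])
  next
    case False
    then have "\<sigma> = South \<or> \<sigma> = North" by (cases \<sigma>) auto
    note h = horizontal[OF this ab]
    have "((xpow (c + t) - xpow (c2 + t)) * cm \<sigma> a b :: (point, 'k) mpoly) \<in> JJ"
      by (rule poly_ideal_mult2[OF rw.BI_ideal _ f]) (rule cmp, use ab in auto)
    from poly_ideal_add[OF rw.BI_ideal this h] show ?thesis by (simp add: algebra_simps)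
  qed
  have bds: "1 \<le> chain i" "chain i \<le> len \<sigma>" "1 \<le> chain j" "chain j \<le> len \<sigma>"
    using chain_bounds ij by auto
  consider "chain i < chain j" | "chain j < chain i" | "chain i = chain j" by linarith
  then show ?thesis
  proof cases
    case 1
    then show ?thesis using main[OF bds(1) 1 bds(4)] by simp
  next
    case 2
    then show ?thesis
      using poly_ideal_uminus[OF rw.BI_ideal main[OF bds(3) 2 bds(2)]] by (simp add: col_minor_swap[of \<sigma> j i])
  next
    case 3
    then have "i = j" by (metis chain_chain)
    then have "(col_minor \<sigma> i j :: (point, 'k) mpoly) = 0" by (simp add: col_minor_def mult.commute)
    then show ?thesis using poly_ideal_0[OF rw.BI_ideal] by simp
  qed
qed

end

subsection \<open>The toric ideal of the circle\<close>

lemma ideal_span_subset: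
  assumes "ideal I (poly_ring V)" "\<And>i. i \<in> A \<Longrightarrow> f i \<in> I"
  shows "ideal_span V f A \<subseteq> (I :: ('v, 'k::comm_ring_1) mpoly set)"
proof
  fix x assume "x \<in> ideal_span V f A"
  then obtain a where a: "x = (\<Sum>i\<in>A. a i * f i)" "\<forall>i\<in>A. a i \<in> polys V" by (auto simp: ideal_span_def)
  show "x \<in> I"
    unfolding a(1) by (rule poly_ideal_sum[OF assms(1)], rule poly_ideal_mult[OF assms(1)]) (use a(2) assms(2) in auto)
qed

definition clamp :: "int \<Rightarrow> int \<Rightarrow> int" where
  "clamp N k = (if k \<le> 2 then 1 else if N - 1 \<le> k then N else k)"

context circle_path
begin

text \<open>The vertices in a common column of every strip through them form a block: a corner square or
  a pair of an outer and an inner vertex. It is represented by its outermost vertex.\<close>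

definition rep :: "point \<Rightarrow> point" where
  "rep v = (clamp m (fst v), clamp n (snd v))"

text \<open>The monomial parametrization has one parameter for each block and, for each side, the ratio of
  inner to outer vertices, indexed by \<open>(0, side_no \<sigma>)\<close>. The predicate \<open>\<chi>\<close> singles out vertices for which
  an independent ratio, indexed by \<open>(- 1, side_no \<sigma>)\<close>, is used.\<close>

definition expo :: "(side \<Rightarrow> point \<Rightarrow> bool) \<Rightarrow> point \<Rightarrow> (point \<Rightarrow>\<^sub>0 nat)" where
  "expo \<chi> v = single (rep v) 1 +
     (\<Sum>\<sigma>\<in>UNIV. if depth \<sigma> v = 2 then single (if \<chi> \<sigma> v then - 1 else 0, side_no \<sigma>) 1 else 0)"

abbreviation AA :: "point \<Rightarrow> (point \<Rightarrow>\<^sub>0 nat)" where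
  "AA \<equiv> expo (\<lambda>_ _. False)"

lemma rep_pt: "1 \<le> k \<Longrightarrow> k \<le> len \<sigma> \<Longrightarrow> rep (pt \<sigma> k 1) = rep (pt \<sigma> k 2)"
  using m4 n4 by (cases \<sigma>) (simp_all add: rep_def clamp_def)

lemma depth_cross:
  "\<tau> \<noteq> \<sigma> \<Longrightarrow> depth \<tau> (pt \<sigma> k 1) = 2 \<longleftrightarrow> depth \<tau> (pt \<sigma> k 2) = 2"
  using m4 n4 by (cases \<sigma>; cases \<tau>) simp_all

lemma rep_ge_1: "v \<in> VV \<Longrightarrow> 1 \<le> fst (rep v) \<and> 1 \<le> snd (rep v)"
  using m4 n4 by (auto simp: rep_def clamp_def VV_iff)

text \<open>A column in a corner square also meets a second strip. This is the condition under which
  passing from its outer to its inner vertex still changes the exponent by the ratio of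
  \<open>\<sigma>\<close> alone.\<close>

definition uncrossed where
  "uncrossed \<chi> \<sigma> k \<longleftrightarrow> (\<forall>\<tau>. \<tau> \<noteq> \<sigma> \<longrightarrow> depth \<tau> (pt \<sigma> k 2) = 2 \<longrightarrow> \<chi> \<tau> (pt \<sigma> k 1) = \<chi> \<tau> (pt \<sigma> k 2))"

lemma expo_flip:
  assumes k: "1 \<le> k" "k \<le> len \<sigma>" and u: "uncrossed \<chi> \<sigma> k"
  shows "expo \<chi> (pt \<sigma> k 2) = expo \<chi> (pt \<sigma> k 1) + single (if \<chi> \<sigma> (pt \<sigma> k 2) then - 1 else 0, side_no \<sigma>) 1"
proof -
  let ?F = "\<lambda>l \<tau>. if depth \<tau> (pt \<sigma> k l) = 2 then single (if \<chi> \<tau> (pt \<sigma> k l) then - 1 else 0, side_no \<tau>) 1 else (0 :: point \<Rightarrow>\<^sub>0 nat)"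
  have split: "(\<Sum>\<tau>\<in>UNIV. ?F l \<tau>) = ?F l \<sigma> + (\<Sum>\<tau>\<in>UNIV - {\<sigma>}. ?F l \<tau>)" for l
    by (rule sum.remove) simp_all
  have "(\<Sum>\<tau>\<in>UNIV - {\<sigma>}. ?F 2 \<tau>) = (\<Sum>\<tau>\<in>UNIV - {\<sigma>}. ?F 1 \<tau>)"
    by (rule sum.cong) (use u depth_cross in \<open>auto simp: uncrossed_def\<close>)
  then show ?thesis
    unfolding expo_def split rep_pt[OF k] by (simp add: add_ac)
qed

lemma col_minor_toric:
  "(col_minor \<sigma> i j :: (point, 'k::field) mpoly) \<in> toric VV Z A \<longleftrightarrow> col_minor \<sigma> i j \<in> (polys VV :: (point, 'k) mpoly set) \<and>
    (((pt \<sigma> i 1 \<in> Z \<or> pt \<sigma> j 2 \<in> Z) \<and> (pt \<sigma> i 2 \<in> Z \<or> pt \<sigma> j 1 \<in> Z)) \<or>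
     (pt \<sigma> i 1 \<notin> Z \<and> pt \<sigma> j 2 \<notin> Z \<and> pt \<sigma> i 2 \<notin> Z \<and> pt \<sigma> j 1 \<notin> Z \<and>
      A (pt \<sigma> i 1) + A (pt \<sigma> j 2) = A (pt \<sigma> i 2) + A (pt \<sigma> j 1)))"
proof -
  have "(col_minor \<sigma> i j :: (point, 'k) mpoly) =
      xpow (single (pt \<sigma> i 1) 1 + single (pt \<sigma> j 2) 1) - xpow (single (pt \<sigma> i 2) 1 + single (pt \<sigma> j 1) 1)"
    by (simp add: col_minor_def var_eq_xpow xpow_add)
  then show ?thesis
    unfolding toric_def mem_Collect_eq
    by (simp only: mhom_binomial keys_add_nat dmap_add dmap_single) auto
qed

lemma col_minor_polys:
  "1 \<le> i \<Longrightarrow> i \<le> len \<sigma> \<Longrightarrow> 1 \<le> j \<Longrightarrow> j \<le> len \<sigma> \<Longrightarrow> (col_minor \<sigma> i j :: (point, 'k::field) mpoly) \<in> polys VV"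
  by (auto simp: col_minor_def var_eq_xpow intro!: polys_closed pt_VV)

lemma expo_eq_iff:
  assumes "1 \<le> i" "i \<le> len \<sigma>" "1 \<le> j" "j \<le> len \<sigma>" "uncrossed \<chi> \<sigma> i" "uncrossed \<chi> \<sigma> j"
  shows "expo \<chi> (pt \<sigma> i 1) + expo \<chi> (pt \<sigma> j 2) = expo \<chi> (pt \<sigma> i 2) + expo \<chi> (pt \<sigma> j 1)
    \<longleftrightarrow> \<chi> \<sigma> (pt \<sigma> i 2) = \<chi> \<sigma> (pt \<sigma> j 2)"
proof -
  have inj: "single a (1::nat) = single b 1 \<longleftrightarrow> a = b" for a b :: point
    by (metis keys_single one_neq_zero singleton_inject)
  have eq: "expo \<chi> (pt \<sigma> i 1) + expo \<chi> (pt \<sigma> j 2) = (expo \<chi> (pt \<sigma> i 1) + expo \<chi> (pt \<sigma> j 1))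
      + single (if \<chi> \<sigma> (pt \<sigma> j 2) then - 1 else 0, side_no \<sigma>) 1"
    "expo \<chi> (pt \<sigma> i 2) + expo \<chi> (pt \<sigma> j 1) = (expo \<chi> (pt \<sigma> i 1) + expo \<chi> (pt \<sigma> j 1))
      + single (if \<chi> \<sigma> (pt \<sigma> i 2) then - 1 else 0, side_no \<sigma>) 1"
    using expo_flip assms by (simp_all add: add_ac)
  show ?thesis unfolding eq add_left_cancel inj by auto
qed

section \<open>The polyomino ideal as the ideal of all column minors\<close>

definition I_minors :: "(point, 'k::field) mpoly set" where
  "I_minors = {col_minor \<sigma> i j | \<sigma> i j. 1 \<le> i \<and> i \<le> len \<sigma> \<and> 1 \<le> j \<and> j \<le> len \<sigma>}"

definition II :: "(point, 'k::field) mpoly set" where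
  "II = Idl\<^bsub>poly_ring VV\<^esub> I_minors"

lemma I_minors_polys: "I_minors \<subseteq> (polys VV :: (point, 'k::field) mpoly set)"
  by (auto simp: I_minors_def intro!: col_minor_polys)

lemma II_ideal: "ideal (II :: (point, 'k::field) mpoly set) (poly_ring VV)"
  unfolding II_def by (rule genideal_poly_ideal[OF I_minors_polys])

lemma col_minor_II:
  "1 \<le> i \<Longrightarrow> i \<le> len \<sigma> \<Longrightarrow> 1 \<le> j \<Longrightarrow> j \<le> len \<sigma> \<Longrightarrow> (col_minor \<sigma> i j :: (point, 'k::field) mpoly) \<in> II"
  unfolding II_def by (rule genideal_poly_mem[OF I_minors_polys]) (auto simp: I_minors_def)

lemma II_subset_toric: "(II :: (point, 'k::field) mpoly set) \<subseteq> toric VV {} AA"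
  unfolding II_def
proof (rule genideal_poly_least[OF toric_ideal], rule subsetI)
  fix x :: "(point, 'k) mpoly" assume "x \<in> I_minors"
  then obtain \<sigma> i j where x: "x = col_minor \<sigma> i j" "1 \<le> i" "i \<le> len \<sigma>" "1 \<le> j" "j \<le> len \<sigma>"
    by (auto simp: I_minors_def)
  then show "x \<in> toric VV {} AA"
    using expo_eq_iff[OF x(2-5), of "\<lambda>_ _. False"]
    by (simp add: col_minor_toric col_minor_polys uncrossed_def)
qed

lemma JJ_subset_II: "(JJ :: (point, 'k::field) mpoly set) \<subseteq> II"
proof (rule ideal_span_subset[OF II_ideal])
  fix x assume "x \<in> J_index"
  then obtain \<sigma> i where x: "x = (\<sigma>, i)" "1 \<le> i" "i \<le> len \<sigma> - 2" by (cases x) (auto simp: J_index_iff)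
  show "(rw.binom x :: (point, 'k) mpoly) \<in> II"
    unfolding x(1) rw_binom
    by (rule col_minor_II) (use chain_bounds[of i \<sigma>] chain_bounds[of "i + 1" \<sigma>] x in auto)
qed

definition flip :: "side \<Rightarrow> point \<Rightarrow> point" where
  "flip \<sigma> v = pt \<sigma> (pos \<sigma> v) (3 - depth \<sigma> v)"

text \<open>A column minor exchanges the levels of an outer and an inner factor in the same
  strip.\<close>

lemma swap_levels:
  assumes s: "keys s \<subseteq> VV" and v: "v \<in> keys s" and w: "w \<in> keys s"
    and d: "depth \<sigma> v = 1 \<and> depth \<sigma> w = 2 \<or> depth \<sigma> v = 2 \<and> depth \<sigma> w = 1"
  obtains s' where "keys s' \<subseteq> VV" "flip \<sigma> v \<in> keys s'" "(xpow s - xpow s' :: (point, 'k::field) mpoly) \<in> II"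
proof -
  let ?i = "pos \<sigma> v" and ?j = "pos \<sigma> w"
  have vw: "v \<noteq> w" using d by auto
  define t where "t = s - single v 1 - single w 1"
  have wk: "w \<in> keys (s - single v 1)" using xpow_split(2)[OF v] w vw by blast
  have t: "keys t \<subseteq> VV"
    unfolding t_def using xpow_split(3)[OF v] xpow_split(3)[OF wk] s by blast
  have xs: "(xpow s :: (point, 'k) mpoly) = var v * (var w * xpow t)"
    unfolding t_def using xpow_split(1)[OF v] xpow_split(1)[OF wk] by metis
  have b: "1 \<le> ?i" "?i \<le> len \<sigma>" "1 \<le> ?j" "?j \<le> len \<sigma>"
    using pos_le_len s v w by blast+
  let ?v = "flip \<sigma> v" and ?w = "flip \<sigma> w"
  have fV: "?v \<in> VV" "?w \<in> VV" unfolding flip_def using b d by (auto intro!: pt_VV)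
  have vp: "v = pt \<sigma> ?i (depth \<sigma> v)" "w = pt \<sigma> ?j (depth \<sigma> w)" by (simp_all add: pt_pos_depth)
  define s' where "s' = single ?v 1 + single ?w 1 + t"
  have "(xpow s - xpow s' :: (point, 'k) mpoly) = xpow t * (var v * var w - var ?v * var ?w)"
    unfolding xs s'_def by (simp add: xpow_add var_eq_xpow algebra_simps)
  moreover have "(var v * var w - var ?v * var ?w :: (point, 'k) mpoly) \<in> II"
  proof (cases "depth \<sigma> v = 1")
    case True
    then have "(var v * var w - var ?v * var ?w :: (point, 'k) mpoly) = col_minor \<sigma> ?i ?j"
      using d vp by (simp add: col_minor_def flip_def; metis)
    then show ?thesis using col_minor_II[OF b] by simp
  next
    case False
    then have "(var v * var w - var ?v * var ?w :: (point, 'k) mpoly) = col_minor \<sigma> ?j ?i"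
      using d vp by (simp add: col_minor_def flip_def mult.commute; metis mult.commute)
    then show ?thesis using col_minor_II[OF b(3,4,1,2)] by simp
  qed
  ultimately have "(xpow s - xpow s' :: (point, 'k) mpoly) \<in> II"
    using poly_ideal_mult[OF II_ideal, of "xpow t"] t by simp
  moreover have "keys s' \<subseteq> VV" "?v \<in> keys s'"
    using fV t by (auto simp: s'_def keys_add_nat)
  ultimately show thesis by (intro that[of s'])
qed

end

lemma wdeg_pos_iff: "0 < wdeg w t \<longleftrightarrow> (\<exists>v\<in>keys t. 0 < w v)"
proof -
  have "wdeg w t = 0 \<longleftrightarrow> (\<forall>v\<in>keys t. w v = 0)"
    by (simp add: wdeg_def in_keys_iff)
  then show ?thesis by auto
qed

context circle_path
begin

section \<open>What the degree of a monomial tells about its factors\<close>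

lemma rep_VV: "v \<in> VV \<Longrightarrow> rep v \<in> VV" and rep_rep: "rep (rep v) = rep v"
  using m4 n4 by (auto simp: rep_def clamp_def VV_iff)

lemma depth_rep: "v \<in> VV \<Longrightarrow> depth \<sigma> (rep v) = 1 \<longleftrightarrow> depth \<sigma> v \<le> 2"
  and depth_rep_2: "depth \<sigma> (rep v) \<noteq> 2"
  using m4 n4 by (cases \<sigma>; auto simp: rep_def clamp_def VV_iff)+

lemma lookup_AA_ratio: "v \<in> VV \<Longrightarrow> lookup (AA v) (0, side_no \<sigma>) = (if depth \<sigma> v = 2 then 1 else 0)"
  using rep_ge_1[of v]
  by (cases \<sigma>) (auto simp: expo_def lookup_add sum_sides lookup_single when_def)

lemma lookup_AA_block: "1 \<le> fst x \<Longrightarrow> lookup (AA v) x = (if rep v = x then 1 else 0)"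
  by (auto simp: expo_def lookup_add sum_sides lookup_single when_def)

definition Reps :: "point set" where
  "Reps = rep ` VV"

lemma finite_Reps: "finite Reps"
  by (simp add: Reps_def finite_VV)

lemma Reps_iff: "x \<in> Reps \<longleftrightarrow> x \<in> VV \<and> rep x = x"
  using rep_VV rep_rep by (auto simp: Reps_def) (metis image_eqI)

lemma Reps_ge_1: "x \<in> Reps \<Longrightarrow> 1 \<le> fst x"
  by (simp add: Reps_iff VV_iff)

text \<open>The number of factors in the strip along \<open>\<sigma>\<close>, read off from the
  degree: the blocks that meet this strip are those whose representative has depth 1.\<close>

definition tot :: "side \<Rightarrow> (point \<Rightarrow>\<^sub>0 nat) \<Rightarrow> nat" where
  "tot \<sigma> u = (\<Sum>x\<in>Reps. (if depth \<sigma> x = 1 then 1 else 0) * lookup u x)"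

lemma tot_dmap:
  assumes t: "keys t \<subseteq> VV"
  shows "tot \<sigma> (dmap AA t) = wdeg (\<lambda>v. if depth \<sigma> v \<le> 2 then 1 else 0) t"
proof -
  let ?g = "\<lambda>x. if depth \<sigma> x = 1 then 1 else 0 :: nat"
  have "tot \<sigma> (dmap AA t) = (\<Sum>x\<in>Reps. \<Sum>v\<in>keys t. ?g x * (lookup (AA v) x * lookup t v))"
    by (simp add: tot_def lookup_dmap wdeg_def sum_distrib_left)
  also have "\<dots> = (\<Sum>v\<in>keys t. \<Sum>x\<in>Reps. ?g x * (lookup (AA v) x * lookup t v))"
    by (rule sum.swap)
  also have "\<dots> = (\<Sum>v\<in>keys t. (if depth \<sigma> v \<le> 2 then 1 else 0) * lookup t v)"
  proof (rule sum.cong)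
    fix v assume "v \<in> keys t"
    then have v: "v \<in> VV" using t by blast
    have "(\<Sum>x\<in>Reps. ?g x * (lookup (AA v) x * lookup t v)) = (\<Sum>x\<in>Reps. if x = rep v then ?g x * lookup t v else 0)"
      by (rule sum.cong) (auto simp: lookup_AA_block Reps_ge_1)
    also have "\<dots> = ?g (rep v) * lookup t v"
      using v finite_Reps by (simp add: Reps_def)
    finally show "(\<Sum>x\<in>Reps. ?g x * (lookup (AA v) x * lookup t v)) = (if depth \<sigma> v \<le> 2 then 1 else 0) * lookup t v"
      using depth_rep[OF v] by simp
  qed simp
  finally show ?thesis by (simp add: wdeg_def)
qed

lemma ratio_dmap: 
  assumes t: "keys t \<subseteq> VV"
  shows "lookup (dmap AA t) (0, side_no \<sigma>) = wdeg (\<lambda>v. if depth \<sigma> v = 2 then 1 else 0) t"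
  unfolding lookup_dmap wdeg_def
  by (rule sum.cong) (use t lookup_AA_ratio in auto)

text \<open>Every factor in a strip is outer or inner, so the degree determines both
  numbers.\<close>

lemma tot_levels:
  assumes t: "keys t \<subseteq> VV"
  shows "tot \<sigma> (dmap AA t) = wdeg (\<lambda>v. if depth \<sigma> v = 1 then 1 else 0) t + lookup (dmap AA t) (0, side_no \<sigma>)"
proof -
  have "wdeg (\<lambda>v. if depth \<sigma> v \<le> 2 then 1 else 0) t
      = (\<Sum>v\<in>keys t. (if depth \<sigma> v = 1 then 1 else 0) * lookup t v + (if depth \<sigma> v = 2 then 1 else 0) * lookup t v)"
    unfolding wdeg_def
  proof (rule sum.cong)
    fix v assume "v \<in> keys t"
    then have "1 \<le> depth \<sigma> v" using t depth_ge_1 by blast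
    then show "(if depth \<sigma> v \<le> 2 then 1 else 0) * lookup t v =
      (if depth \<sigma> v = 1 then 1 else 0) * lookup t v + (if depth \<sigma> v = 2 then 1 else 0) * lookup t v"
      by auto
  qed simp
  then show ?thesis
    unfolding tot_dmap[OF t] ratio_dmap[OF t] by (simp add: wdeg_def sum.distrib)
qed

lemma level_transfer:
  assumes s: "keys s \<subseteq> VV" and t: "keys t \<subseteq> VV" and eq: "dmap AA s = dmap AA t"
    and v: "v \<in> keys t" and d: "depth \<sigma> v = l" "l \<in> {1, 2}"
  shows "\<exists>z\<in>keys s. depth \<sigma> z = l"
proof -
  have "wdeg (\<lambda>v. if depth \<sigma> v = l then 1 else 0) s = wdeg (\<lambda>v. if depth \<sigma> v = l then 1 else 0) t"
    using d(2) tot_levels[OF s, of \<sigma>] tot_levels[OF t, of \<sigma>] ratio_dmap[OF s, of \<sigma>] ratio_dmap[OF t, of \<sigma>] eq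
    by auto
  moreover have "0 < wdeg (\<lambda>v. if depth \<sigma> v = l then 1 else 0) t"
    using v d(1) by (auto simp: wdeg_pos_iff)
  ultimately have "0 < wdeg (\<lambda>v. if depth \<sigma> v = l then 1 else 0) s" by simp
  then obtain z where "z \<in> keys s" "0 < (if depth \<sigma> z = l then 1 else 0 :: nat)"
    unfolding wdeg_pos_iff by blast
  then show ?thesis by (intro bexI[of _ z]) (simp_all split: if_splits)
qed

lemma block_transfer:
  assumes t: "keys t \<subseteq> VV" and eq: "dmap AA s = dmap AA t" and v: "v \<in> keys t"
  shows "\<exists>w\<in>keys s. rep w = rep v"
proof -
  have x: "1 \<le> fst (rep v)" using t v rep_ge_1 by blast
  have "0 < lookup (dmap AA t) (rep v)"
    using v x by (auto simp: lookup_dmap wdeg_pos_iff lookup_AA_block)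
  then have "0 < wdeg (\<lambda>w. lookup (AA w) (rep v)) s" by (simp add: lookup_dmap flip: eq)
  then show ?thesis using x by (auto simp: wdeg_pos_iff lookup_AA_block split: if_splits)
qed

lemma II_dmap: "(xpow s - xpow t :: (point, 'k::field) mpoly) \<in> II \<Longrightarrow> dmap AA s = dmap AA t"
  using II_subset_toric mhom_binomial[of "{}" AA s t] by (auto simp: toric_def)

text \<open>If \<open>w\<close> is on the wrong level, equality of degrees provides a factor of
  \<open>s\<close> in the same strip that is on the wanted level, and the two exchange
  levels.\<close>

lemma adjust_level:
  assumes s: "keys s \<subseteq> VV" and t: "keys t \<subseteq> VV" and eq: "dmap AA s = dmap AA t"
    and v: "v \<in> keys t" and w: "w \<in> keys s" and d: "depth \<sigma> v \<le> 2" "depth \<sigma> w \<le> 2"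
  obtains s' where "keys s' \<subseteq> VV" "pt \<sigma> (pos \<sigma> w) (depth \<sigma> v) \<in> keys s'"
    "(xpow s - xpow s' :: (point, 'k::field) mpoly) \<in> II"
proof (cases "depth \<sigma> w = depth \<sigma> v")
  case True
  then have "pt \<sigma> (pos \<sigma> w) (depth \<sigma> v) = w" by (metis pt_pos_depth)
  then show thesis using that[of s] s w poly_ideal_0[OF II_ideal] by simp
next
  case False
  have d': "depth \<sigma> v \<in> {1, 2}" "depth \<sigma> w \<in> {1, 2}"
    using d depth_ge_1[of v \<sigma>] depth_ge_1[of w \<sigma>] s t v w by force+
  obtain z where z: "z \<in> keys s" "depth \<sigma> z = depth \<sigma> v"
    using level_transfer[OF s t eq v refl d'(1)] by blast
  have "depth \<sigma> w = 1 \<and> depth \<sigma> z = 2 \<or> depth \<sigma> w = 2 \<and> depth \<sigma> z = 1"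
    using d' z(2) False by auto
  then obtain s' where s': "keys s' \<subseteq> VV" "flip \<sigma> w \<in> keys s'" "(xpow s - xpow s' :: (point, 'k) mpoly) \<in> II"
    using swap_levels[OF s w z(1)] by metis
  have "flip \<sigma> w = pt \<sigma> (pos \<sigma> w) (depth \<sigma> v)" using d' False by (auto simp: flip_def)
  with s' show thesis using that by metis
qed

text \<open>Some factor \<open>w\<close> of \<open>s\<close> lies in the block of \<open>v\<close>.
  Within a block, the first coordinate can only differ by the level in West or East and the second
  by the level in South or North, so the coordinates are corrected one after the other.\<close>

lemma reach_vertex:
  assumes s: "keys s \<subseteq> VV" and t: "keys t \<subseteq> VV" and eq: "dmap AA s = dmap AA t" and v: "v \<in> keys t"
  obtains s' where "keys s' \<subseteq> VV" "v \<in> keys s'" "(xpow s - xpow s' :: (point, 'k::field) mpoly) \<in> II"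
proof -
  obtain w where w: "w \<in> keys s" "rep w = rep v" using block_transfer[OF t eq v] by blast
  have vV: "v \<in> VV" and wV: "w \<in> VV" using s t v w(1) by blast+
  have "\<exists>s'. keys s' \<subseteq> VV \<and> (fst v, snd w) \<in> keys s' \<and> (xpow s - xpow s' :: (point, 'k) mpoly) \<in> II"
  proof (cases "fst w = fst v")
    case True
    then have "(fst v, snd w) = w" by (metis prod.collapse)
    then show ?thesis using s w(1) poly_ideal_0[OF II_ideal] by (intro exI[of _ s]) auto
  next
    case False
    then consider "fst w \<le> 2" "fst v \<le> 2" | "m - 1 \<le> fst w" "m - 1 \<le> fst v"
      using w(2) vV wV m4 n4 by (auto simp: VV_iff rep_def clamp_def split: if_splits)
    then show ?thesis
    proof cases
      case 1
      obtain s' where "keys s' \<subseteq> VV" "pt West (pos West w) (depth West v) \<in> keys s'"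
        "(xpow s - xpow s' :: (point, 'k) mpoly) \<in> II"
        by (rule adjust_level[OF s t eq v w(1), of West]) (use 1 in auto)
      then show ?thesis by (auto simp: pos_def)
    next
      case 2
      obtain s' where "keys s' \<subseteq> VV" "pt East (pos East w) (depth East v) \<in> keys s'"
        "(xpow s - xpow s' :: (point, 'k) mpoly) \<in> II"
        by (rule adjust_level[OF s t eq v w(1), of East]) (use 2 in auto)
      then show ?thesis by (auto simp: pos_def)
    qed
  qed
  then obtain s1 where s1: "keys s1 \<subseteq> VV" "(fst v, snd w) \<in> keys s1" "(xpow s - xpow s1 :: (point, 'k) mpoly) \<in> II"
    by blast
  have eq1: "dmap AA s1 = dmap AA t" using II_dmap[OF s1(3)] eq by simp
  have "\<exists>s'. keys s' \<subseteq> VV \<and> v \<in> keys s' \<and> (xpow s1 - xpow s' :: (point, 'k) mpoly) \<in> II"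
  proof (cases "snd w = snd v")
    case True
    then show ?thesis using s1 poly_ideal_0[OF II_ideal] by (intro exI[of _ s1]) auto
  next
    case False
    then consider "snd w \<le> 2" "snd v \<le> 2" | "n - 1 \<le> snd w" "n - 1 \<le> snd v"
      using w(2) vV wV m4 n4 by (auto simp: VV_iff rep_def clamp_def split: if_splits)
    then show ?thesis
    proof cases
      case 1
      obtain s' where "keys s' \<subseteq> VV" "pt South (pos South (fst v, snd w)) (depth South v) \<in> keys s'"
        "(xpow s1 - xpow s' :: (point, 'k) mpoly) \<in> II"
        by (rule adjust_level[OF s1(1) t eq1 v s1(2), of South]) (use 1 in auto)
      then show ?thesis by (auto simp: pos_def)
    next
      case 2
      obtain s' where "keys s' \<subseteq> VV" "pt North (pos North (fst v, snd w)) (depth North v) \<in> keys s'"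
        "(xpow s1 - xpow s' :: (point, 'k) mpoly) \<in> II"
        by (rule adjust_level[OF s1(1) t eq1 v s1(2), of North]) (use 2 in auto)
      then show ?thesis by (auto simp: pos_def)
    qed
  qed
  then obtain s' where "keys s' \<subseteq> VV" "v \<in> keys s'" "(xpow s1 - xpow s' :: (point, 'k) mpoly) \<in> II" by blast
  with poly_ideal_diff_trans[OF II_ideal s1(3)] show thesis using that by blast
qed

text \<open>Once a factor of \<open>t\<close> has been brought into \<open>s\<close>, it is
  cancelled on both sides, and induction on the number of factors applies.\<close>

lemma dmap_cong_II:
  "keys s \<subseteq> VV \<Longrightarrow> keys t \<subseteq> VV \<Longrightarrow> dmap AA s = dmap AA t \<Longrightarrow> (xpow s - xpow t :: (point, 'k::field) mpoly) \<in> II"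
proof (induction "wdeg (\<lambda>_. 1) t" arbitrary: s t rule: less_induct)
  case less
  show ?case
  proof (cases "t = 0")
    case True
    have "v \<notin> keys s" for v
      using block_transfer[OF less.prems(1) less.prems(3)[symmetric], of v] True by auto
    then have "keys s = {}" by blast
    then have "s = 0" by simp
    then show ?thesis using True poly_ideal_0[OF II_ideal] by simp
  next
    case False
    then have "keys t \<noteq> {}" by simp
    then obtain v where v: "v \<in> keys t" by blast
    obtain s' where s': "keys s' \<subseteq> VV" "v \<in> keys s'" "(xpow s - xpow s' :: (point, 'k) mpoly) \<in> II"
      using reach_vertex[OF less.prems v] by blast
    have eq: "dmap AA s' = dmap AA t" using II_dmap[OF s'(3)] less.prems(3) by simp
    define s1 t1 where "s1 = s' - single v 1" and "t1 = t - single v 1"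
    have sp: "s' = single v 1 + s1" and tp: "t = single v 1 + t1"
      unfolding s1_def t1_def using s'(2) v
      by (intro poly_mapping_eqI; auto simp: lookup_add lookup_minus lookup_single when_def in_keys_iff)+
    have "(xpow s1 - xpow t1 :: (point, 'k) mpoly) \<in> II"
    proof (rule less.hyps)
      show "wdeg (\<lambda>_. 1) t1 < wdeg (\<lambda>_. 1) t" unfolding tp wdeg_add wdeg_single by simp
      show "keys s1 \<subseteq> VV" "keys t1 \<subseteq> VV"
        using xpow_split(3)[OF s'(2)] xpow_split(3)[OF v] s'(1) less.prems(2) by (auto simp: s1_def t1_def)
      show "dmap AA s1 = dmap AA t1" using eq unfolding sp tp dmap_add by simp
    qed
    then have "xpow (single v 1) * (xpow s1 - xpow t1 :: (point, 'k) mpoly) \<in> II"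
      by (intro poly_ideal_mult[OF II_ideal]) (use v less.prems(2) in auto)
    then have "(xpow s' - xpow t :: (point, 'k) mpoly) \<in> II"
      unfolding sp tp by (simp add: xpow_add right_diff_distrib)
    with poly_ideal_diff_trans[OF II_ideal s'(3)] show ?thesis by blast
  qed
qed

theorem II_eq_toric: "(II :: (point, 'k::field) mpoly set) = toric VV {} AA"
  using II_subset_toric toric_subset_ideal[OF II_ideal dmap_cong_II] by blast

section \<open>The degrees that occur\<close>

definition inner_choice :: "(point \<Rightarrow>\<^sub>0 nat) \<Rightarrow> point \<Rightarrow> point" where
  "inner_choice u x =
    (if fst x = 1 \<and> 0 < lookup u (0, side_no West) then 2
     else if fst x = m \<and> 0 < lookup u (0, side_no East) then m - 1 else fst x,
     if snd x = 1 \<and> 0 < lookup u (0, side_no South) then 2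
     else if snd x = n \<and> 0 < lookup u (0, side_no North) then n - 1 else snd x)"

lemma inner_choice:
  assumes "x \<in> Reps"
  shows "inner_choice u x \<in> VV" "rep (inner_choice u x) = x"
    and "depth \<sigma> (inner_choice u x) = 2 \<longleftrightarrow> depth \<sigma> x = 1 \<and> 0 < lookup u (0, side_no \<sigma>)"
  using assms m4 n4
  by (cases \<sigma>; cases x; auto simp: inner_choice_def Reps_iff VV_iff rep_def clamp_def split: if_splits)+

text \<open>Greedy choice: in any block still present, take the vertex that is inner for every side
  whose ratio is not yet used up. A ratio then drops together with the total of its side or is
  already zero, so the inequalities persist.\<close>

lemma realize:
  assumes "keys u \<subseteq> Reps \<union> range (\<lambda>\<sigma>. (0, side_no \<sigma>))" "\<And>\<sigma>. lookup u (0, side_no \<sigma>) \<le> tot \<sigma> u"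
  shows "\<exists>\<gamma>. keys \<gamma> \<subseteq> VV \<and> dmap AA \<gamma> = u"
  using assms
proof (induction "\<Sum>x\<in>Reps. lookup u x" arbitrary: u rule: less_induct)
  case less
  show ?case
  proof (cases "\<exists>x\<in>Reps. 0 < lookup u x")
    case False
    then have "tot \<sigma> u = 0" for \<sigma> by (auto simp: tot_def)
    then have "lookup u (0, side_no \<sigma>) = 0" for \<sigma> using less.prems(2)[of \<sigma>] by simp
    with False less.prems(1) have "x \<notin> keys u" for x by (auto simp: in_keys_iff subset_eq)
    then have "keys u = {}" by blast
    then show ?thesis by (intro exI[of _ 0]) simp
  next
    case True
    then obtain x where x: "x \<in> Reps" "0 < lookup u x" by blast
    define c where "c = inner_choice u x"
    note v = inner_choice[OF x(1), where u = u, folded c_def]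
    have r: "lookup (AA c) (0, side_no \<sigma>) = (if depth \<sigma> x = 1 \<and> 0 < lookup u (0, side_no \<sigma>) then 1 else 0)" for \<sigma>
      using lookup_AA_ratio[OF v(1)] v(3) by simp
    have b: "lookup (AA c) y = (if x = y then 1 else 0)" if "y \<in> Reps" for y
      using lookup_AA_block[OF Reps_ge_1[OF that]] v(2) by simp
    define u' where "u' = u - AA c"
    have "mdvd (AA c) u"
      unfolding mdvd_def
    proof
      fix y
      show "lookup (AA c) y \<le> lookup u y"
      proof (cases "y \<in> Reps \<or> y \<in> range (\<lambda>\<sigma>. (0, side_no \<sigma>))")
        case True
        then consider "y \<in> Reps" | \<sigma> where "y = (0, side_no \<sigma>)" by blast
        then show ?thesis
        proof cases
          case 1
          then show ?thesis using b[OF 1] x(2) by (cases "x = y") simp_all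
        next
          case 2
          then show ?thesis using r[of \<sigma>] by (simp split: if_splits)
        qed
      next
        case False
        then have y: "y \<noteq> rep c" "\<And>\<sigma>. y \<noteq> (0, side_no \<sigma>)" using x(1) v(2) by auto
        then have "lookup (AA c) y = 0"
          using y(2)[of South] y(2)[of East] y(2)[of North] y(2)[of West]
          by (auto simp: expo_def lookup_add lookup_single when_def sum_sides)
        then show ?thesis by simp
      qed
    qed
    then have uu: "u = AA c + u'" unfolding u'_def by (metis monomial_minus_add mdvd_def)
    have tot: "tot \<sigma> u = (if depth \<sigma> x = 1 then 1 else 0) + tot \<sigma> u'" for \<sigma>
    proof -
      have "tot \<sigma> u = (\<Sum>y\<in>Reps. (if y = x then (if depth \<sigma> x = 1 then 1 else 0) else 0)
          + (if depth \<sigma> y = 1 then 1 else 0) * lookup u' y)"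
        unfolding tot_def by (rule sum.cong) (auto simp: uu lookup_add b)
      then show ?thesis using x(1) finite_Reps by (simp add: sum.distrib tot_def)
    qed
    have "\<exists>\<gamma>. keys \<gamma> \<subseteq> VV \<and> dmap AA \<gamma> = u'"
    proof (rule less.hyps)
      have "(\<Sum>y\<in>Reps. lookup u y) = (\<Sum>y\<in>Reps. (if y = x then 1 else 0) + lookup u' y)"
        by (rule sum.cong) (auto simp: uu lookup_add b)
      then show "(\<Sum>y\<in>Reps. lookup u' y) < (\<Sum>y\<in>Reps. lookup u y)"
        using x(1) finite_Reps by (simp add: sum.distrib)
      show "keys u' \<subseteq> Reps \<union> range (\<lambda>\<sigma>. (0, side_no \<sigma>))"
        using less.prems(1) by (auto simp: uu keys_add_nat)
      fix \<sigma>
      have "lookup u (0, side_no \<sigma>) = lookup (AA c) (0, side_no \<sigma>) + lookup u' (0, side_no \<sigma>)"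
        by (simp add: uu lookup_add)
      then show "lookup u' (0, side_no \<sigma>) \<le> tot \<sigma> u'"
        using less.prems(2)[of \<sigma>] tot[of \<sigma>] r[of \<sigma>] by (auto split: if_splits)
    qed
    then obtain \<gamma> where "keys \<gamma> \<subseteq> VV" "dmap AA \<gamma> = u'" by blast
    then show ?thesis
      using v(1) by (intro exI[of _ "single c 1 + \<gamma>"]) (simp add: keys_add_nat dmap_add dmap_single[simplified] flip: uu)
  qed
qed

end

subsection \<open>Degrees of elements of the colon ideal\<close>

context circle_path
begin

lemma J_toricI:
  assumes "\<And>\<sigma> i. 1 \<le> i \<Longrightarrow> i \<le> len \<sigma> - 2 \<Longrightarrow>
    ((pt \<sigma> (chain i) 1 \<in> Z \<or> pt \<sigma> (chain (i + 1)) 2 \<in> Z) \<and> (pt \<sigma> (chain i) 2 \<in> Z \<or> pt \<sigma> (chain (i + 1)) 1 \<in> Z)) \<or>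
    (pt \<sigma> (chain i) 1 \<notin> Z \<and> pt \<sigma> (chain (i + 1)) 2 \<notin> Z \<and> pt \<sigma> (chain i) 2 \<notin> Z \<and> pt \<sigma> (chain (i + 1)) 1 \<notin> Z \<and>
     uncrossed \<chi> \<sigma> (chain i) \<and> uncrossed \<chi> \<sigma> (chain (i + 1)) \<and>
     \<chi> \<sigma> (pt \<sigma> (chain i) 2) = \<chi> \<sigma> (pt \<sigma> (chain (i + 1)) 2))"
  shows "(JJ :: (point, 'k::field) mpoly set) \<subseteq> toric VV Z (expo \<chi>)"
proof (rule ideal_span_subset[OF toric_ideal])
  fix x assume "x \<in> J_index"
  then obtain \<sigma> i where x: "x = (\<sigma>, i)" "1 \<le> i" "i \<le> len \<sigma> - 2" by (cases x) (auto simp: J_index_iff)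
  have b: "1 \<le> chain i" "chain i \<le> len \<sigma>" "1 \<le> chain (i + 1)" "chain (i + 1) \<le> len \<sigma>"
    using chain_bounds[of i \<sigma>] chain_bounds[of "i + 1" \<sigma>] x by auto
  show "(rw.binom x :: (point, 'k) mpoly) \<in> toric VV Z (expo \<chi>)"
    unfolding x(1) rw_binom col_minor_toric
    using assms[OF x(2,3)] expo_eq_iff[OF b, of \<chi>] col_minor_polys[OF b] by blast
qed

text \<open>Identifying each extra ratio with the ordinary one recovers \<open>AA\<close>, so
  \<open>expo \<chi>\<close> is a refinement of \<open>AA\<close> in the sense of
  \<open>lookup_mhom_on_face\<close>.\<close>

lemma AA_merge:
  assumes "v \<in> VV"
  shows "AA v = dmap (\<lambda>x. single (if fst x = - 1 then (0, snd x) else x) 1) (expo \<chi> v)"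
proof -
  let ?B = "\<lambda>x :: point. single (if fst x = - 1 then (0, snd x) else x) (1::nat)"
  have "dmap ?B (expo \<chi> v) = ?B (rep v) + (\<Sum>\<sigma>\<in>UNIV. dmap ?B
      (if depth \<sigma> v = 2 then single (if \<chi> \<sigma> v then - 1 else 0, side_no \<sigma>) 1 else 0))"
    unfolding expo_def by (simp only: dmap_add dmap_sum dmap_single)
  also have "?B (rep v) = single (rep v) 1" using rep_ge_1[OF assms] by simp
  also have "(\<Sum>\<sigma>\<in>UNIV. dmap ?B (if depth \<sigma> v = 2 then single (if \<chi> \<sigma> v then - 1 else 0, side_no \<sigma>) 1 else 0))
      = (\<Sum>\<sigma>\<in>UNIV. if depth \<sigma> v = 2 then single (0, side_no \<sigma>) 1 else 0)"
  proof (rule sum.cong)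
    fix \<sigma> :: side
    show "dmap ?B (if depth \<sigma> v = 2 then single (if \<chi> \<sigma> v then - 1 else 0, side_no \<sigma>) 1 else 0)
        = (if depth \<sigma> v = 2 then single (0, side_no \<sigma>) 1 else 0)"
      by (simp only: dmap_single dmap_0 split: if_split) simp
  qed simp
  finally show ?thesis by (simp add: expo_def)
qed

text \<open>The product of \<open>g\<close> with a minor of I lies in J, hence in a prime that
  contains J but not this minor. So \<open>g\<close> lies in that prime, and its part on the
  corresponding face vanishes.\<close>

lemma colon_facet:
  fixes g :: "(point, 'k::field) mpoly"
  assumes J: "(JJ :: (point, 'k) mpoly set) \<subseteq> toric VV Z (expo \<chi>)"
    and f: "1 \<le> i" "i \<le> len \<sigma>" "1 \<le> j" "j \<le> len \<sigma>"
      "(col_minor \<sigma> i j :: (point, 'k) mpoly) \<notin> toric VV Z (expo \<chi>)"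
    and g: "g \<in> polys VV" "\<And>a. a \<in> II \<Longrightarrow> g * a \<in> JJ"
    and face: "\<And>t. keys t \<subseteq> VV \<Longrightarrow> dmap AA t = u \<Longrightarrow> keys t \<inter> Z = {}"
  shows "lookup (mhom {} AA g) u = 0"
proof -
  have "g * col_minor \<sigma> i j \<in> toric VV Z (expo \<chi>)"
    using J g(2)[OF col_minor_II[OF f(1-4)]] by blast
  then have "g \<in> toric VV Z (expo \<chi>)"
    using toric_prime[OF g(1) col_minor_polys[OF f(1-4)]] f(5) by blast
  then have ker: "mhom Z (expo \<chi>) g = 0" by (simp add: toric_def)
  show ?thesis
  proof (rule lookup_mhom_on_face[OF ker g(1)])
    fix t assume "t \<in> keys g" "dmap AA t = u"
    then show "keys t \<inter> Z = {}" using face g(1) by (auto simp: polys_iff)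
  qed (rule AA_merge)
qed

lemma Reps_cases:
  assumes "x \<in> Reps"
  obtains (corner) \<sigma> where "x = pt \<sigma> 1 1" | (mid) \<sigma> k where "x = pt \<sigma> k 1" "3 \<le> k" "k \<le> len \<sigma> - 2"
proof -
  obtain p q where pq: "x = (p, q)" by (cases x)
  have "(\<exists>\<sigma>. x = pt \<sigma> 1 1) \<or> (\<exists>\<sigma> k. x = pt \<sigma> k 1 \<and> 3 \<le> k \<and> k \<le> len \<sigma> - 2)"
  proof -
    consider "x = pt South 1 1" | "x = pt East 1 1" | "x = pt North 1 1" | "x = pt West 1 1"
      | "x = pt South p 1" "3 \<le> p" "p \<le> m - 2" | "x = pt North (m + 1 - p) 1" "3 \<le> p" "p \<le> m - 2"
      | "x = pt East q 1" "3 \<le> q" "q \<le> n - 2" | "x = pt West (n + 1 - q) 1" "3 \<le> q" "q \<le> n - 2"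
      using assms m4 n4 unfolding Reps_iff VV_iff rep_def clamp_def pq by (auto split: if_splits)
    then show ?thesis
    proof cases
      case 5 then show ?thesis by (intro disjI2 exI[of _ South] exI[of _ p]) simp
    next
      case 6 then show ?thesis by (intro disjI2 exI[of _ North] exI[of _ "m + 1 - p"]) simp
    next
      case 7 then show ?thesis by (intro disjI2 exI[of _ East] exI[of _ q]) simp
    next
      case 8 then show ?thesis by (intro disjI2 exI[of _ West] exI[of _ "n + 1 - q"]) simp
    qed blast+
  qed
  with that show thesis by blast
qed

text \<open>The facet of a single column: without column \<open>k\<close> no generator of J connects
  the two parts of the strip, so the columns beyond \<open>k\<close> may have a ratio of their
  own.\<close>

lemma J_toric_mid:
  assumes k: "3 \<le> k" "k \<le> len \<sigma> - 2"
  shows "(JJ :: (point, 'k::field) mpoly set) \<subseteq>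
    toric VV {pt \<sigma> k 1, pt \<sigma> k 2} (expo (\<lambda>\<tau> v. \<tau> = \<sigma> \<and> k < pos \<sigma> v))"
proof (rule J_toricI, goal_cases)
  case (1 \<tau> i)
  show ?case
  proof (cases "\<tau> = \<sigma>")
    case True
    have u: "uncrossed (\<lambda>\<tau> v. \<tau> = \<sigma> \<and> k < pos \<sigma> v) \<sigma> j" for j by (simp add: uncrossed_def)
    show ?thesis
      unfolding True using k u 1 by (auto simp: chain_def)
  next
    case False
    have far: "pt \<tau> j l \<notin> {pt \<sigma> k 1, pt \<sigma> k 2}" if "l = 1 \<or> l = 2" for j l
      using that False k m4 n4 by (cases \<sigma>; cases \<tau>) auto
    have u: "uncrossed (\<lambda>\<tau> v. \<tau> = \<sigma> \<and> k < pos \<sigma> v) \<tau> j" for j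
      unfolding uncrossed_def pos_def
      using False k m4 n4 by (cases \<sigma>; cases \<tau>) auto
    show ?thesis using far u False by auto
  qed
qed

text \<open>The facet of a corner square. One of its vertices, \<open>pt \<sigma> 2 1\<close>, may
  survive: column 2 is joined by J to column 1 only, and all terms of the generators through the
  square contain a killed vertex.\<close>

lemma J_toric_corner:
  "(JJ :: (point, 'k::field) mpoly set) \<subseteq> toric VV {pt \<sigma> 1 1, pt \<sigma> 1 2, pt \<sigma> 2 2} AA"
proof (rule J_toricI, goal_cases)
  case (1 \<tau> i)
  have u: "uncrossed (\<lambda>_ _. False) \<tau> j" for j by (simp add: uncrossed_def)
  show ?case
    using 1 m4 n4 u by (cases \<sigma>; cases \<tau>) (auto simp: chain_def)
qed

text \<open>The facet without inner vertices along \<open>\<sigma>\<close>. Killing them removes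
  column \<open>len - 1\<close> of the preceding strip, so its last column is cut off and may have a
  ratio of its own.\<close>

lemma J_toric_outer:
  "(JJ :: (point, 'k::field) mpoly set) \<subseteq>
    toric VV {v. depth \<sigma> v = 2} (expo (\<lambda>\<tau> v. \<tau> = prv \<sigma> \<and> depth \<sigma> v = 1))"
proof (rule J_toricI, goal_cases)
  case (1 \<tau> i)
  show ?case
    using 1 m4 n4 unfolding uncrossed_def by (cases \<sigma>; cases \<tau>) (auto simp: chain_def)
qed

text \<open>The facet without outer vertices along \<open>\<sigma>\<close>. Killing them removes
  column 1 of the next strip, and with it the only neighbour of column 2 in the chain order.\<close>

lemma J_toric_inner:
  "(JJ :: (point, 'k::field) mpoly set) \<subseteq>
    toric VV {v. depth \<sigma> v = 1} (expo (\<lambda>\<tau> v. \<tau> = nxt \<sigma> \<and> depth \<sigma> v = 2))"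
proof (rule J_toricI, goal_cases)
  case (1 \<tau> i)
  show ?case
    using 1 m4 n4 unfolding uncrossed_def by (cases \<sigma>; cases \<tau>) (auto simp: chain_def)
qed

end

context circle_path
begin

section \<open>Degrees of the colon ideal are interior\<close>

lemma depth_nxt: "depth \<sigma> (pt (nxt \<sigma>) k l) = k" and depth_prv: "depth \<sigma> (pt (prv \<sigma>) k l) = len (prv \<sigma>) + 1 - k"
  by (cases \<sigma>; simp)+

lemma rep_pt_1: "3 \<le> k \<and> k \<le> len \<sigma> - 2 \<or> k = 1 \<Longrightarrow> rep (pt \<sigma> k 1) = pt \<sigma> k 1"
  using m4 n4 by (cases \<sigma>) (auto simp: rep_def clamp_def)

lemma rep_corner: "rep (pt \<sigma> 2 2) = pt \<sigma> 1 1"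
  using m4 n4 by (cases \<sigma>) (auto simp: rep_def clamp_def)

lemma rep_not_zero:
  assumes t: "keys t \<subseteq> VV" and v: "v \<in> keys t"
  shows "0 < lookup (dmap AA t) (rep v)"
proof -
  have "1 \<le> fst (rep v)" using t v rep_ge_1 by blast
  then show ?thesis using v by (auto simp: lookup_dmap wdeg_pos_iff lookup_AA_block)
qed

text \<open>If one of the inequalities failed, every monomial of degree \<open>u\<close> would avoid
  the vertices killed on the facet in question, and \<open>colon_facet\<close> would remove
  \<open>u\<close> from the image of \<open>g\<close>.\<close>

lemma colon_interior:
  fixes g :: "(point, 'k::field) mpoly"
  assumes g: "g \<in> polys VV" "\<And>a. a \<in> II \<Longrightarrow> g * a \<in> JJ" and u: "lookup (mhom {} AA g) u \<noteq> 0"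
  shows "x \<in> Reps \<Longrightarrow> 0 < lookup u x"
    and "0 < lookup u (0, side_no \<sigma>)" and "lookup u (0, side_no \<sigma>) < tot \<sigma> u"
proof -
  note facet = colon_facet[OF _ _ _ _ _ _ g, where u = u]
  {
    assume x: "x \<in> Reps"
    show "0 < lookup u x"
    proof (rule ccontr)
      assume "\<not> 0 < lookup u x"
      then have no_rep: "rep v \<noteq> x" if "keys t \<subseteq> VV" "dmap AA t = u" "v \<in> keys t" for t v
        using rep_not_zero[OF that(1,3)] that(2) by auto
      have "lookup (mhom {} AA g) u = 0"
        using x
      proof (cases rule: Reps_cases)
        case (corner \<tau>)
        have r: "rep (pt \<tau> 1 1) = x" "rep (pt \<tau> 1 2) = x" "rep (pt \<tau> 2 2) = x"
          using rep_pt_1[of 1 \<tau>] rep_pt[of 1 \<tau>] rep_corner[of \<tau>] len_ge_4[of \<tau>] corner by auto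
        have face: "keys t \<inter> {pt \<tau> 1 1, pt \<tau> 1 2, pt \<tau> 2 2} = {}" if "keys t \<subseteq> VV" "dmap AA t = u" for t
          using no_rep[OF that] r by blast
        have b: "(1::int) \<le> 2" "2 \<le> len \<tau>" "(1::int) \<le> 3" "3 \<le> len \<tau>" using len_ge_4[of \<tau>] by auto
        have "(col_minor \<tau> 2 3 :: (point, 'k) mpoly) \<notin> toric VV {pt \<tau> 1 1, pt \<tau> 1 2, pt \<tau> 2 2} AA"
          unfolding col_minor_toric by auto
        then show ?thesis by (rule facet[OF J_toric_corner b]) (assumption, rule face)
      next
        case (mid \<tau> k)
        have r: "rep (pt \<tau> k 1) = x" "rep (pt \<tau> k 2) = x"
          using rep_pt_1[of k \<tau>] rep_pt[of k \<tau>] mid by auto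
        \<comment> \<open>The predecessor of column \<open>k\<close> in the chain order; it and
          column \<open>k + 1\<close> lie on different sides of the cut.\<close>
        define i where "i = chain (k - 1)"
        have i: "1 \<le> i" "i < k" using mid by (auto simp: i_def chain_def)
        have b: "1 \<le> i" "i \<le> len \<tau>" "1 \<le> k + 1" "k + 1 \<le> len \<tau>" using i mid by auto
        let ?\<chi> = "\<lambda>\<sigma>' v. \<sigma>' = \<tau> \<and> k < pos \<tau> v"
        have uc: "uncrossed ?\<chi> \<tau> j" for j by (simp add: uncrossed_def)
        have "(col_minor \<tau> i (k + 1) :: (point, 'k) mpoly) \<notin> toric VV {pt \<tau> k 1, pt \<tau> k 2} (expo ?\<chi>)"
          unfolding col_minor_toric expo_eq_iff[OF b uc uc] using i by auto
        moreover have face: "keys t \<inter> {pt \<tau> k 1, pt \<tau> k 2} = {}" if "keys t \<subseteq> VV" "dmap AA t = u" for t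
          using no_rep[OF that] r by blast
        ultimately show ?thesis
          by (intro facet[OF J_toric_mid[OF mid(2,3)] b])
      qed
      with u show False by simp
    qed
  }
  show "0 < lookup u (0, side_no \<sigma>)"
  proof (rule ccontr)
    assume "\<not> 0 < lookup u (0, side_no \<sigma>)"
    then have no: "keys t \<inter> {v. depth \<sigma> v = 2} = {}" if "keys t \<subseteq> VV" "dmap AA t = u" for t
      using ratio_dmap[OF that(1), of \<sigma>] that(2) wdeg_pos_iff[of "\<lambda>v. if depth \<sigma> v = 2 then 1 else 0" t] by auto
    let ?\<tau> = "prv \<sigma>" and ?\<chi> = "\<lambda>\<tau> v. \<tau> = prv \<sigma> \<and> depth \<sigma> v = 1"
    have b: "1 \<le> len ?\<tau>" "len ?\<tau> \<le> len ?\<tau>" "(1::int) \<le> 1" "1 \<le> len ?\<tau>" using len_ge_4[of ?\<tau>] by auto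
    have uc: "uncrossed ?\<chi> ?\<tau> j" for j by (simp add: uncrossed_def)
    have "(col_minor ?\<tau> (len ?\<tau>) 1 :: (point, 'k) mpoly) \<notin> toric VV {v. depth \<sigma> v = 2} (expo ?\<chi>)"
      unfolding col_minor_toric expo_eq_iff[OF b uc uc] using len_ge_4[of ?\<tau>] by (auto simp: depth_prv)
    then have "lookup (mhom {} AA g) u = 0"
      by (rule facet[OF J_toric_outer b]) (assumption, rule no)
    with u show False by simp
  qed
  show "lookup u (0, side_no \<sigma>) < tot \<sigma> u"
  proof (rule ccontr)
    assume "\<not> lookup u (0, side_no \<sigma>) < tot \<sigma> u"
    then have no: "keys t \<inter> {v. depth \<sigma> v = 1} = {}" if "keys t \<subseteq> VV" "dmap AA t = u" for t
      using tot_levels[OF that(1), of \<sigma>] that(2) wdeg_pos_iff[of "\<lambda>v. if depth \<sigma> v = 1 then 1 else 0" t] by auto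
    let ?\<tau> = "nxt \<sigma>" and ?\<chi> = "\<lambda>\<tau> v. \<tau> = nxt \<sigma> \<and> depth \<sigma> v = 2"
    have b: "(1::int) \<le> 2" "2 \<le> len ?\<tau>" "(1::int) \<le> 3" "3 \<le> len ?\<tau>" using len_ge_4[of ?\<tau>] by auto
    have uc: "uncrossed ?\<chi> ?\<tau> j" for j by (simp add: uncrossed_def)
    have "(col_minor ?\<tau> 2 3 :: (point, 'k) mpoly) \<notin> toric VV {v. depth \<sigma> v = 1} (expo ?\<chi>)"
      unfolding col_minor_toric expo_eq_iff[OF b uc uc] by (auto simp: depth_nxt)
    then have "lookup (mhom {} AA g) u = 0"
      by (rule facet[OF J_toric_inner b]) (assumption, rule no)
    with u show False by simp
  qed
qed

text \<open>Every interior degree is that of a multiple of one of the monomials in which the inner vertices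
  of each strip are the first or the last ones, depending on the side.\<close>

definition corner_mon :: "point \<Rightarrow>\<^sub>0 nat" where
  "corner_mon = single (2, 2) 1 + single (1, n) 1 + single (m, 1) 1 + single (m - 1, n - 1) 1"

text \<open>Here \<open>z \<sigma>\<close> is the number of inner vertices in the middle part of the
  strip. Admissibility dictates their place: an outer vertex to the left of an inner one spans an
  inner interval in the South strip, but an inner one to the left of an outer one does so in the
  North strip, and similarly for West and East.\<close>

definition sorted_choice :: "(side \<Rightarrow> int) \<Rightarrow> point \<Rightarrow> point" where
  "sorted_choice z x = (case x of (p, q) \<Rightarrow>
     if x = (1, 1) then (2, 2) else if x = (m, n) then (m - 1, n - 1)
     else if x = (1, n) \<or> x = (m, 1) then x
     else if q = 1 then (p, if p < 3 + z South then 2 else 1)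
     else if q = n then (p, if m - 2 - z North < p then n - 1 else n)
     else if p = 1 then (if q < 3 + z West then 2 else 1, q)
     else (if n - 2 - z East < q then m - 1 else m, q))"

definition corners_set :: "point set" where
  "corners_set = {(1, 1), (1, n), (m, 1), (m, n)}"

definition mids :: "point set" where
  "mids = {3..m - 2} \<times> {1, n} \<union> {1, m} \<times> {3..n - 2}"

lemma clamp_eq_iff: "4 \<le> N \<Longrightarrow> clamp N k = k \<longleftrightarrow> k = 1 \<or> k = N \<or> 3 \<le> k \<and> k \<le> N - 2"
  by (auto simp: clamp_def)

lemma Reps_eq: "Reps = corners_set \<union> mids"
proof (rule Set.set_eqI)
  fix x :: point
  obtain p q where x: "x = (p, q)" by (cases x)
  have "x \<in> Reps \<longleftrightarrow> x \<in> VV \<and> clamp m p = p \<and> clamp n q = q" by (simp add: x Reps_iff rep_def)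
  also have "\<dots> \<longleftrightarrow> x \<in> corners_set \<union> mids"
    unfolding clamp_eq_iff[OF m4] clamp_eq_iff[OF n4] x VV_iff corners_set_def mids_def
    using m4 n4 by simp presburger
  finally show "x \<in> Reps \<longleftrightarrow> x \<in> corners_set \<union> mids" .
qed

lemma corners_mids_disjoint: "corners_set \<inter> mids = {}"
  using m4 n4 by (auto simp: corners_set_def mids_def)

lemma mids_cases:
  assumes "x \<in> mids"
  obtains (South) p where "x = (p, 1)" "3 \<le> p" "p \<le> m - 2" | (North) p where "x = (p, n)" "3 \<le> p" "p \<le> m - 2"
    | (West) q where "x = (1, q)" "3 \<le> q" "q \<le> n - 2" | (East) q where "x = (m, q)" "3 \<le> q" "q \<le> n - 2"
  using assms by (auto simp: mids_def)

lemma sorted_choice_simps: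
  "sorted_choice z (1, 1) = (2, 2)" "sorted_choice z (m, n) = (m - 1, n - 1)"
  "sorted_choice z (1, n) = (1, n)" "sorted_choice z (m, 1) = (m, 1)"
  "3 \<le> p \<Longrightarrow> p \<le> m - 2 \<Longrightarrow> sorted_choice z (p, 1) = (p, if p < 3 + z South then 2 else 1)"
  "3 \<le> p \<Longrightarrow> p \<le> m - 2 \<Longrightarrow> sorted_choice z (p, n) = (p, if m - 2 - z North < p then n - 1 else n)"
  "3 \<le> q \<Longrightarrow> q \<le> n - 2 \<Longrightarrow> sorted_choice z (1, q) = (if q < 3 + z West then 2 else 1, q)"
  "3 \<le> q \<Longrightarrow> q \<le> n - 2 \<Longrightarrow> sorted_choice z (m, q) = (if n - 2 - z East < q then m - 1 else m, q)"
  using m4 n4 by (simp_all add: sorted_choice_def)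

lemma sorted_choice:
  assumes "x \<in> Reps"
  shows "sorted_choice z x \<in> VV" "rep (sorted_choice z x) = x"
proof -
  have "sorted_choice z x \<in> VV \<and> rep (sorted_choice z x) = x"
  proof (cases "x \<in> mids")
    case True
    then show ?thesis
      by (cases rule: mids_cases) (use m4 n4 in \<open>simp_all add: sorted_choice_simps VV_iff rep_def clamp_def\<close>)
  next
    case False
    then consider "x = (1, 1)" | "x = (1, n)" | "x = (m, 1)" | "x = (m, n)"
      using assms unfolding Reps_eq corners_set_def by blast
    then show ?thesis
      by cases (use m4 n4 in \<open>simp_all add: sorted_choice_simps VV_iff rep_def clamp_def\<close>)
  qed
  then show "sorted_choice z x \<in> VV" "rep (sorted_choice z x) = x" by simp_all
qed

definition sorted_mon :: "(side \<Rightarrow> int) \<Rightarrow> (point \<Rightarrow>\<^sub>0 nat)" where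
  "sorted_mon z = (\<Sum>x\<in>mids. single (sorted_choice z x) 1)"

lemma corner_mon_eq: "corner_mon = (\<Sum>x\<in>corners_set. single (sorted_choice z x) 1)"
  using m4 n4 by (simp add: corner_mon_def corners_set_def sorted_choice_simps add_ac)

lemma sorted_sum: "corner_mon + sorted_mon z = (\<Sum>x\<in>Reps. single (sorted_choice z x) 1)"
proof -
  have "finite corners_set" "finite mids" using finite_Reps unfolding Reps_eq by simp_all
  then show ?thesis
    unfolding Reps_eq corner_mon_eq[of z] sorted_mon_def
    by (rule sum.union_disjoint[symmetric]) (rule corners_mids_disjoint)
qed

lemma sorted_block:
  assumes x: "x \<in> Reps"
  shows "lookup (dmap AA (corner_mon + sorted_mon z)) x = 1"
proof -
  have "lookup (dmap AA (corner_mon + sorted_mon z)) x = (\<Sum>y\<in>Reps. lookup (AA (sorted_choice z y)) x)"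
    by (simp add: sorted_sum lookup_dmap wdeg_sum wdeg_single)
  also have "\<dots> = (\<Sum>y\<in>Reps. if y = x then 1 else 0)"
    by (rule sum.cong) (simp_all add: lookup_AA_block[OF Reps_ge_1[OF x]] sorted_choice(2))
  also have "\<dots> = 1" using x finite_Reps by simp
  finally show ?thesis .
qed

lemma sorted_inner:
  assumes z: "\<And>\<sigma>. 0 \<le> z \<sigma> \<and> z \<sigma> \<le> len \<sigma> - 4"
  shows "{x \<in> Reps. depth \<sigma> (sorted_choice z x) = 2} = (case \<sigma> of
      South \<Rightarrow> insert (1, 1) ((\<lambda>p. (p, 1)) ` {3..<3 + z South})
    | East \<Rightarrow> insert (m, n) ((\<lambda>q. (m, q)) ` {n - 2 - z East<..n - 2})
    | North \<Rightarrow> insert (m, n) ((\<lambda>p. (p, n)) ` {m - 2 - z North<..m - 2})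
    | West \<Rightarrow> insert (1, 1) ((\<lambda>q. (1, q)) ` {3..<3 + z West}))"
proof -
  have depth: "depth \<sigma> (sorted_choice z x) = 2 \<longleftrightarrow> x \<in> (case \<sigma> of
      South \<Rightarrow> insert (1, 1) ((\<lambda>p. (p, 1)) ` {3..<3 + z South})
    | East \<Rightarrow> insert (m, n) ((\<lambda>q. (m, q)) ` {n - 2 - z East<..n - 2})
    | North \<Rightarrow> insert (m, n) ((\<lambda>p. (p, n)) ` {m - 2 - z North<..m - 2})
    | West \<Rightarrow> insert (1, 1) ((\<lambda>q. (1, q)) ` {3..<3 + z West}))" if x: "x \<in> Reps" for x
  proof (cases "x \<in> mids")
    case True
    then show ?thesis
      by (cases rule: mids_cases; cases \<sigma>) (use m4 n4 in \<open>simp_all add: sorted_choice_simps image_iff\<close>)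
  next
    case False
    then consider "x = (1, 1)" | "x = (1, n)" | "x = (m, 1)" | "x = (m, n)"
      using x unfolding Reps_eq corners_set_def by blast
    then show ?thesis
      by (cases; cases \<sigma> rule: side.exhaust)
        (use m4 n4 z[of South] z[of East] z[of North] z[of West] in \<open>simp_all add: sorted_choice_simps image_iff\<close>)
  qed
  have sub: "(case \<sigma> of
      South \<Rightarrow> insert (1, 1) ((\<lambda>p. (p, 1)) ` {3..<3 + z South})
    | East \<Rightarrow> insert (m, n) ((\<lambda>q. (m, q)) ` {n - 2 - z East<..n - 2})
    | North \<Rightarrow> insert (m, n) ((\<lambda>p. (p, n)) ` {m - 2 - z North<..m - 2})
    | West \<Rightarrow> insert (1, 1) ((\<lambda>q. (1, q)) ` {3..<3 + z West})) \<subseteq> Reps"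
    using z[of \<sigma>] unfolding Reps_eq corners_set_def mids_def by (cases \<sigma>) auto
  show ?thesis using depth sub by blast
qed

text \<open>The extra 1 comes from the corners: \<open>(2, 2)\<close> is inner for South and West,
  \<open>(m - 1, n - 1)\<close> for North and East.\<close>

lemma sorted_ratio:
  assumes z: "\<And>\<sigma>. 0 \<le> z \<sigma> \<and> z \<sigma> \<le> len \<sigma> - 4"
  shows "int (lookup (dmap AA (corner_mon + sorted_mon z)) (0, side_no \<sigma>)) = z \<sigma> + 1"
proof -
  have "lookup (dmap AA (corner_mon + sorted_mon z)) (0, side_no \<sigma>)
      = (\<Sum>y\<in>Reps. lookup (AA (sorted_choice z y)) (0, side_no \<sigma>))"
    by (simp add: sorted_sum lookup_dmap wdeg_sum wdeg_single)
  also have "\<dots> = (\<Sum>y\<in>Reps. if depth \<sigma> (sorted_choice z y) = 2 then 1 else 0)"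
    by (rule sum.cong) (simp_all add: lookup_AA_ratio sorted_choice(1))
  also have "\<dots> = card {x \<in> Reps. depth \<sigma> (sorted_choice z x) = 2}"
    using finite_Reps by (simp add: sum.If_cases Int_def)
  finally have eq: "lookup (dmap AA (corner_mon + sorted_mon z)) (0, side_no \<sigma>)
      = card {x \<in> Reps. depth \<sigma> (sorted_choice z x) = 2}" .
  show ?thesis
    unfolding eq sorted_inner[OF z]
    using z[of \<sigma>] m4 n4
    by (cases \<sigma>) (auto simp: card_insert_if card_image inj_on_def image_iff)
qed

text \<open>The first two and the last two columns of a strip belong to one block each.\<close>

lemma tot_blocks: "int (\<Sum>x\<in>Reps. if depth \<sigma> x = 1 then 1 else 0) = len \<sigma> - 2"
proof -
  have "(\<Sum>x\<in>Reps. if depth \<sigma> x = 1 then 1 else 0 :: nat) = card {x \<in> Reps. depth \<sigma> x = 1}"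
    using finite_Reps by (simp add: sum.If_cases Int_def)
  also have "{x \<in> Reps. depth \<sigma> x = 1} = (\<lambda>k. pt \<sigma> k 1) ` insert 1 (insert (len \<sigma>) {3..len \<sigma> - 2})"
  proof -
    have iff: "pt \<sigma> k 1 \<in> Reps \<longleftrightarrow> k \<in> insert 1 (insert (len \<sigma>) {3..len \<sigma> - 2})" for k
      unfolding Reps_eq corners_set_def mids_def using m4 n4 by (cases \<sigma>) auto
    show ?thesis
    proof (intro equalityI subsetI)
      fix x assume x: "x \<in> {x \<in> Reps. depth \<sigma> x = 1}"
      then have eq: "x = pt \<sigma> (pos \<sigma> x) 1" using pt_pos_depth[of \<sigma> x] by simp
      then have "pos \<sigma> x \<in> insert 1 (insert (len \<sigma>) {3..len \<sigma> - 2})" using x iff[of "pos \<sigma> x"] by simp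
      with eq show "x \<in> (\<lambda>k. pt \<sigma> k 1) ` insert 1 (insert (len \<sigma>) {3..len \<sigma> - 2})" by (rule image_eqI)
    next
      fix x assume "x \<in> (\<lambda>k. pt \<sigma> k 1) ` insert 1 (insert (len \<sigma>) {3..len \<sigma> - 2})"
      then obtain k where "k \<in> insert 1 (insert (len \<sigma>) {3..len \<sigma> - 2})" "x = pt \<sigma> k 1" ..
      then show "x \<in> {x \<in> Reps. depth \<sigma> x = 1}" using iff[of k] by simp
    qed
  qed
  also have "card \<dots> = card (insert 1 (insert (len \<sigma>) {3..len \<sigma> - 2}))"
    by (rule card_image) (simp add: inj_on_def)
  also have "int \<dots> = len \<sigma> - 2" using len_ge_4[of \<sigma>] by (simp add: card_insert_if)
  finally show ?thesis .
qed

text \<open>Removing one factor from every block, with suitably many of them inner, leaves a degree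
  that still satisfies the inequalities of \<open>realize\<close>.\<close>

lemma interior_multiple:
  assumes keys: "keys u \<subseteq> Reps \<union> range (\<lambda>\<sigma>. (0, side_no \<sigma>))"
    and block: "\<And>x. x \<in> Reps \<Longrightarrow> 0 < lookup u x"
    and ratio: "\<And>\<sigma>. 0 < lookup u (0, side_no \<sigma>)" "\<And>\<sigma>. lookup u (0, side_no \<sigma>) < tot \<sigma> u"
  obtains z \<gamma> where "\<And>\<sigma>. 0 \<le> z \<sigma> \<and> z \<sigma> \<le> len \<sigma> - 4" "keys \<gamma> \<subseteq> VV"
    "dmap AA (corner_mon + sorted_mon z + \<gamma>) = u"
proof -
  \<comment> \<open>As many inner vertices as the ratio permits, one being taken by a corner. If
    this exhausts the ratio nothing remains to be realized; otherwise
    \<open>len \<sigma> - 3\<close> of \<open>len \<sigma> - 2\<close> factors were inner, and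
    strictness of the upper bound makes up for the missing one.\<close>
  define z where "z \<sigma> = min (int (lookup u (0, side_no \<sigma>)) - 1) (len \<sigma> - 4)" for \<sigma>
  have z: "0 \<le> z \<sigma> \<and> z \<sigma> \<le> len \<sigma> - 4" for \<sigma>
    using ratio(1)[of \<sigma>] len_ge_4[of \<sigma>] by (simp add: z_def)
  let ?c = "dmap AA (corner_mon + sorted_mon z)"
  define u' where "u' = u - ?c"
  have c_keys: "lookup ?c y = 0" if y: "y \<notin> Reps \<union> range (\<lambda>\<sigma>. (0, side_no \<sigma>))" for y
  proof -
    have "lookup (AA (sorted_choice z x)) y = 0" if x: "x \<in> Reps" for x
    proof -
      have "y \<noteq> rep (sorted_choice z x)" using sorted_choice(2)[OF x] x y by auto
      moreover have "y \<noteq> (0, side_no \<sigma>)" for \<sigma> using y by auto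
      ultimately show ?thesis
        by (auto simp: expo_def lookup_add lookup_single when_def sum_sides)
          (metis side_no.simps)+
    qed
    then show ?thesis by (simp add: sorted_sum lookup_dmap wdeg_sum wdeg_single)
  qed
  have ratio_c: "int (lookup ?c (0, side_no \<sigma>)) = z \<sigma> + 1" for \<sigma> by (rule sorted_ratio[OF z])
  have "mdvd ?c u"
    unfolding mdvd_def
  proof
    fix y
    consider "y \<in> Reps" | \<sigma> where "y = (0, side_no \<sigma>)" | "y \<notin> Reps \<union> range (\<lambda>\<sigma>. (0, side_no \<sigma>))" by blast
    then show "lookup ?c y \<le> lookup u y"
    proof cases
      case 1
      then show ?thesis using sorted_block[OF 1, of z] block[OF 1] by simp
    next
      case 2
      then show ?thesis using ratio_c[of \<sigma>] z_def[of \<sigma>] by simp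
    qed (simp add: c_keys)
  qed
  then have uu: "u = ?c + u'" unfolding u'_def by (metis monomial_minus_add mdvd_def)
  have luu: "lookup u y = lookup ?c y + lookup u' y" for y by (subst uu) (rule lookup_add)
  have "\<exists>\<gamma>. keys \<gamma> \<subseteq> VV \<and> dmap AA \<gamma> = u'"
  proof (rule realize)
    show "keys u' \<subseteq> Reps \<union> range (\<lambda>\<sigma>. (0, side_no \<sigma>))"
    proof
      fix y assume "y \<in> keys u'"
      then have "y \<in> keys u" using luu[of y] unfolding in_keys_iff by linarith
      then show "y \<in> Reps \<union> range (\<lambda>\<sigma>. (0, side_no \<sigma>))" using keys by (rule subsetD[rotated])
    qed
    fix \<sigma>
    have "tot \<sigma> u = (\<Sum>x\<in>Reps. (if depth \<sigma> x = 1 then 1 else 0) + (if depth \<sigma> x = 1 then 1 else 0) * lookup u' x)"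
      unfolding tot_def by (rule sum.cong) (auto simp: luu sorted_block)
    then have "int (tot \<sigma> u) = len \<sigma> - 2 + int (tot \<sigma> u')"
      using tot_blocks[of \<sigma>] by (simp add: sum.distrib tot_def)
    then show "lookup u' (0, side_no \<sigma>) \<le> tot \<sigma> u'"
      using ratio_c[of \<sigma>] luu[of "(0, side_no \<sigma>)"] ratio(2)[of \<sigma>] unfolding z_def by linarith
  qed
  then obtain \<gamma> where "keys \<gamma> \<subseteq> VV" "dmap AA \<gamma> = u'" by blast
  then show thesis by (intro that[OF z, of \<gamma>]) (simp_all add: dmap_add[of AA "corner_mon + sorted_mon z"] flip: uu)
qed

end

subsection \<open>Cells, intervals and minors of the circle\<close>

lemma cell_subset_interval:
  "cell x \<subseteq> interval a b \<longleftrightarrow> fst a \<le> fst x \<and> fst x + 1 \<le> fst b \<and> snd a \<le> snd x \<and> snd x + 1 \<le> snd b"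
  by (auto simp: cell_def interval_def up_def times_subset_iff)

lemma cell_in_cells_in: "cell x \<in> cells_in I \<longleftrightarrow> cell x \<subseteq> I"
  unfolding cells_in_def by blast

lemma sum_list_singles: "keys (sum_list (map (\<lambda>x. single x 1) v) :: 'v \<Rightarrow>\<^sub>0 nat) = set v"
  by (induction v) (simp_all add: keys_add_nat)

lemma prod_list_var: "prod_list (map var v) = xpow (sum_list (map (\<lambda>x. single x 1) v))"
  by (induction v) (simp_all add: xpow_0 xpow_add var_eq_xpow)

lemma listset_iff: "v \<in> listset As \<longleftrightarrow> list_all2 (\<in>) v As"
proof (induction As arbitrary: v)
  case (Cons A As)
  then show ?case by (cases v) (auto simp: set_Cons_def)
qed simp

lemma poly_ideal_up_to_sign:
  "ideal I (poly_ring V) \<Longrightarrow> y \<in> I \<Longrightarrow> y = x \<or> y = - x \<Longrightarrow> (x :: ('v, 'k::comm_ring_1) mpoly) \<in> I"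
  using poly_ideal_uminus[of I V y] by auto

context circle_path
begin

lemma col_minor_swap_mem:
  "ideal I (poly_ring V) \<Longrightarrow> col_minor \<sigma> i j \<in> I \<Longrightarrow> (col_minor \<sigma> j i :: (point, 'k::field) mpoly) \<in> I"
  by (subst col_minor_swap) (rule poly_ideal_uminus)

lemma cell_circle: "cell x \<in> circle m n \<longleftrightarrow> 1 \<le> fst x \<and> fst x \<le> m - 1 \<and> 1 \<le> snd x \<and> snd x \<le> n - 1 \<and>
    \<not> (2 \<le> fst x \<and> fst x \<le> m - 2 \<and> 2 \<le> snd x \<and> snd x \<le> n - 2)"
  by (auto simp: circle_def cell_in_cells_in cell_subset_interval)

lemma vertices_circle: "vertices (circle m n) = VV"
proof
  show "vertices (circle m n) \<subseteq> VV"
    using m4 n4 by (auto simp: vertices_def cell_circle corners_def up_def VV_iff)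
  show "VV \<subseteq> vertices (circle m n)"
  proof
    fix v assume v: "v \<in> VV"
    obtain p q where pq: "v = (p, q)" by (cases v)
    define y where "y = (if p = m then p - 1 else p, if q = n then q - 1 else q)"
    define y' where "y' = (if p = 1 then p else p - 1, if q = 1 then q else q - 1)"
    have "cell y \<in> circle m n \<or> cell y' \<in> circle m n"
      using v m4 n4 unfolding pq y_def y'_def cell_circle VV_iff by auto
    moreover have "v \<in> corners y (up y)" "v \<in> corners y' (up y')"
      by (auto simp: pq y_def y'_def corners_def up_def)
    ultimately show "v \<in> vertices (circle m n)" unfolding vertices_def by blast
  qed
qed

lemma inner_interval_circle: "inner_interval (circle m n) a b \<longleftrightarrow> proper a b \<and>
    1 \<le> fst a \<and> fst b \<le> m \<and> 1 \<le> snd a \<and> snd b \<le> n \<and>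
    (snd b \<le> 2 \<or> n - 1 \<le> snd a \<or> fst b \<le> 2 \<or> m - 1 \<le> fst a)"
proof
  assume "inner_interval (circle m n) a b"
  then have p: "proper a b" and c: "\<And>x. cell x \<subseteq> interval a b \<Longrightarrow> cell x \<in> circle m n"
    by (auto simp: inner_interval_def cells_in_def)
  obtain i j k l where ab: "a = (i, j)" "b = (k, l)" by (cases a; cases b)
  have 1: "cell (i, j) \<in> circle m n" and 2: "cell (k - 1, l - 1) \<in> circle m n"
    by (rule c; use p in \<open>simp add: cell_subset_interval ab proper_def\<close>)+
  \<comment> \<open>The lowest leftmost cell of the interval with both coordinates at least 2. It
    falls into the hole unless the interval stays inside a strip.\<close>
  have 3: "2 < k \<longrightarrow> 2 < l \<longrightarrow> cell (max i 2, max j 2) \<in> circle m n"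
    by (intro impI, rule c) (use p in \<open>auto simp: cell_subset_interval ab proper_def\<close>)
  show "proper a b \<and> 1 \<le> fst a \<and> fst b \<le> m \<and> 1 \<le> snd a \<and> snd b \<le> n \<and>
    (snd b \<le> 2 \<or> n - 1 \<le> snd a \<or> fst b \<le> 2 \<or> m - 1 \<le> fst a)"
    using p 1 2 3 m4 n4 unfolding cell_circle ab proper_def by auto
next
  assume h: "proper a b \<and> 1 \<le> fst a \<and> fst b \<le> m \<and> 1 \<le> snd a \<and> snd b \<le> n \<and>
    (snd b \<le> 2 \<or> n - 1 \<le> snd a \<or> fst b \<le> 2 \<or> m - 1 \<le> fst a)"
  have "cell x \<in> circle m n" if "cell x \<subseteq> interval a b" for x
    using h that unfolding cell_circle cell_subset_interval by auto
  then show "inner_interval (circle m n) a b"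
    using h by (auto simp: inner_interval_def cells_in_def)
qed

lemma minor_col_minor:
  "minor (i, 1) (j, 2) = (col_minor South i j :: (point, 'k::field) mpoly)"
  "minor (p, n - 1) (p', n) = (col_minor North (m + 1 - p') (m + 1 - p) :: (point, 'k) mpoly)"
  "minor (1, q) (2, q') = (col_minor West (n + 1 - q) (n + 1 - q') :: (point, 'k) mpoly)"
  "minor (m - 1, q) (m, q') = (col_minor East q' q :: (point, 'k) mpoly)"
  by (simp_all add: minor_def col_minor_def mult.commute)

lemma inner_minor:
  assumes "inner_interval (circle m n) a b"
  shows "\<exists>\<sigma> i j. 1 \<le> i \<and> i \<le> len \<sigma> \<and> 1 \<le> j \<and> j \<le> len \<sigma> \<and> minor a b = (col_minor \<sigma> i j :: (point, 'k::field) mpoly)"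
proof -
  obtain i j k l where ab: "a = (i, j)" "b = (k, l)" by (cases a; cases b)
  have bd: "i < k" "j < l" "1 \<le> i" "k \<le> m" "1 \<le> j" "l \<le> n"
    using assms unfolding inner_interval_circle by (auto simp: proper_def ab)
  consider "j = 1" "l = 2" | "j = n - 1" "l = n" | "i = 1" "k = 2" | "i = m - 1" "k = m"
    using assms unfolding inner_interval_circle by (auto simp: proper_def ab)
  then show ?thesis
  proof cases
    case 1
    show ?thesis
      unfolding ab 1 minor_col_minor(1) by (intro exI[of _ South] exI conjI) (use bd in auto)
  next
    case 2
    show ?thesis
      unfolding ab 2 minor_col_minor(2) by (intro exI[of _ North] exI conjI) (use bd in auto)
  next
    case 3
    show ?thesis
      unfolding ab 3 minor_col_minor(3) by (intro exI[of _ West] exI conjI) (use bd in auto)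
  next
    case 4
    show ?thesis
      unfolding ab 4 minor_col_minor(4) by (intro exI[of _ East] exI conjI) (use bd in auto)
  qed
qed

lemma col_minor_inner:
  assumes "1 \<le> i" "i < j" "j \<le> len \<sigma>"
  shows "\<exists>a b. inner_interval (circle m n) a b \<and>
    (minor a b = (col_minor \<sigma> i j :: (point, 'k::field) mpoly) \<or> minor a b = (col_minor \<sigma> j i :: (point, 'k) mpoly))"
proof (cases \<sigma>)
  case South
  have "inner_interval (circle m n) (i, 1) (j, 2)"
    using assms South m4 n4 by (simp add: inner_interval_circle proper_def)
  then show ?thesis using minor_col_minor(1) South by blast
next
  case East
  have "inner_interval (circle m n) (m - 1, i) (m, j)"
    using assms East m4 n4 by (simp add: inner_interval_circle proper_def)
  then show ?thesis using minor_col_minor(4) East by blast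
next
  case North
  have "inner_interval (circle m n) (m + 1 - j, n - 1) (m + 1 - i, n)"
    using assms North m4 n4 by (simp add: inner_interval_circle proper_def)
  moreover have "minor (m + 1 - j, n - 1) (m + 1 - i, n) = (col_minor \<sigma> i j :: (point, 'k) mpoly)"
    unfolding minor_col_minor(2) North by simp
  ultimately show ?thesis by blast
next
  case West
  have "inner_interval (circle m n) (1, n + 1 - j) (2, n + 1 - i)"
    using assms West m4 n4 by (simp add: inner_interval_circle proper_def)
  moreover have "minor (1, n + 1 - j) (2, n + 1 - i) = (col_minor \<sigma> j i :: (point, 'k) mpoly)"
    unfolding minor_col_minor(3) West by simp
  ultimately show ?thesis by blast
qed

lemma polyomino_ideal_circle: "polyomino_ideal (circle m n) = (II :: (point, 'k::field) mpoly set)"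
proof -
  let ?G = "{minor a b | a b. inner_interval (circle m n) a b} :: (point, 'k) mpoly set"
  have GI: "?G \<subseteq> I_minors" using inner_minor by (fastforce simp: I_minors_def)
  then have G: "?G \<subseteq> polys VV" using I_minors_polys by blast
  note id = genideal_poly_ideal[OF G]
  have "x \<in> Idl\<^bsub>poly_ring VV\<^esub> ?G" if xI: "x \<in> I_minors" for x
  proof -
    obtain \<sigma> i j where x: "x = col_minor \<sigma> i j" "1 \<le> i" "i \<le> len \<sigma>" "1 \<le> j" "j \<le> len \<sigma>"
      using xI by (auto simp: I_minors_def)
    have lt: "col_minor \<sigma> i j \<in> Idl\<^bsub>poly_ring VV\<^esub> ?G \<and> col_minor \<sigma> j i \<in> Idl\<^bsub>poly_ring VV\<^esub> ?G"
      if ij: "1 \<le> i" "i < j" "j \<le> len \<sigma>" for i j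
    proof -
      obtain a b where ab: "inner_interval (circle m n) a b"
        "minor a b = (col_minor \<sigma> i j :: (point, 'k) mpoly) \<or> minor a b = (col_minor \<sigma> j i :: (point, 'k) mpoly)"
        using col_minor_inner[OF ij] by blast
      then have "(minor a b :: (point, 'k) mpoly) \<in> Idl\<^bsub>poly_ring VV\<^esub> ?G"
        by (intro genideal_poly_mem[OF G]) blast
      with ab(2) have "(col_minor \<sigma> i j :: (point, 'k) mpoly) \<in> Idl\<^bsub>poly_ring VV\<^esub> ?G
          \<or> (col_minor \<sigma> j i :: (point, 'k) mpoly) \<in> Idl\<^bsub>poly_ring VV\<^esub> ?G" by auto
      then show ?thesis using col_minor_swap_mem[OF id] by blast
    qed
    consider "i < j" | "j < i" | "i = j" by linarith
    then show ?thesis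
    proof cases
      case 3
      then have "x = 0" by (simp add: x(1) col_minor_def mult.commute)
      then show ?thesis using poly_ideal_0[OF id] by simp
    qed (use lt x in blast)+
  qed
  then have "I_minors \<subseteq> Idl\<^bsub>poly_ring VV\<^esub> ?G" by blast
  then have "II \<subseteq> Idl\<^bsub>poly_ring VV\<^esub> ?G"
    unfolding II_def by (rule genideal_poly_least[OF id])
  moreover have "Idl\<^bsub>poly_ring VV\<^esub> ?G \<subseteq> II"
  proof (rule genideal_poly_least[OF II_ideal])
    have "(I_minors :: (point, 'k) mpoly set) \<subseteq> II"
      unfolding II_def by (rule subsetI) (rule genideal_poly_mem[OF I_minors_polys])
    with GI show "?G \<subseteq> II" by (rule subset_trans)
  qed
  ultimately show ?thesis unfolding polyomino_ideal_def vertices_circle by blast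
qed

text \<open>In terms of columns, the four excluded cells are the pairs of columns 2 and 3, and the
  four intervals of two cells are the pairs of columns 1 and 3.\<close>

lemma col_minor_JJ:
  assumes "1 \<le> i" "i < len \<sigma>" "i \<noteq> 2"
  shows "(col_minor \<sigma> i (i + 1) :: (point, 'k::field) mpoly) \<in> JJ" "(col_minor \<sigma> (i + 1) i :: (point, 'k) mpoly) \<in> JJ"
    and "(col_minor \<sigma> 1 3 :: (point, 'k) mpoly) \<in> JJ" "(col_minor \<sigma> 3 1 :: (point, 'k) mpoly) \<in> JJ"
proof -
  have "(col_minor \<sigma> i (i + 1) :: (point, 'k) mpoly) \<in> JJ \<and> (col_minor \<sigma> (i + 1) i :: (point, 'k) mpoly) \<in> JJ"
  proof (cases "i = 1")
    case True
    have "(cm \<sigma> 1 (1 + 1) :: (point, 'k) mpoly) \<in> JJ" by (rule cm_consecutive) (use len_ge_4[of \<sigma>] in auto)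
    then have "(col_minor \<sigma> 2 1 :: (point, 'k) mpoly) \<in> JJ" by (simp add: chain_def)
    then show ?thesis
      using True col_minor_swap_mem[OF rw.BI_ideal] by auto
  next
    case False
    have "(cm \<sigma> i (i + 1) :: (point, 'k) mpoly) \<in> JJ" by (rule cm_consecutive) (use assms in auto)
    then have "(col_minor \<sigma> i (i + 1) :: (point, 'k) mpoly) \<in> JJ" using False assms by (simp add: chain_def)
    then show ?thesis
      using col_minor_swap_mem[OF rw.BI_ideal] by blast
  qed
  then show "(col_minor \<sigma> i (i + 1) :: (point, 'k) mpoly) \<in> JJ" "(col_minor \<sigma> (i + 1) i :: (point, 'k) mpoly) \<in> JJ"
    by simp_all
  have "(cm \<sigma> 2 (2 + 1) :: (point, 'k) mpoly) \<in> JJ" by (rule cm_consecutive) (use len_ge_4[of \<sigma>] in auto)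
  then show "(col_minor \<sigma> 1 3 :: (point, 'k) mpoly) \<in> JJ" by (simp add: chain_def)
  then show "(col_minor \<sigma> 3 1 :: (point, 'k) mpoly) \<in> JJ"
    by (rule col_minor_swap_mem[OF rw.BI_ideal])
qed

lemma J_interval_minor:
  assumes "(a, b) \<in> J_intervals m n"
  shows "(minor a b :: (point, 'k::field) mpoly) \<in> JJ"
proof -
  have c1: "(col_minor \<sigma> 1 3 :: (point, 'k) mpoly) \<in> JJ" "(col_minor \<sigma> 3 1 :: (point, 'k) mpoly) \<in> JJ" for \<sigma>
    using col_minor_JJ(3,4)[of 1 \<sigma>] len_ge_4[of \<sigma>] by auto
  consider (cell) "b = up a" "cell a \<in> circle m n" "a \<notin> {(2, 1), (m - 1, 2), (m - 2, n - 1), (1, n - 2)}"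
    | "a = (1, 1)" "b = (3, 2)" | "a = (m - 1, 1)" "b = (m, 3)" | "a = (m - 2, n - 1)" "b = (m, n)"
    | "a = (1, n - 2)" "b = (2, n)"
    using assms by (auto simp: J_intervals_def)
  then show ?thesis
  proof cases
    case cell
    obtain p q where a: "a = (p, q)" by (cases a)
    have b: "b = (p + 1, q + 1)" by (simp add: cell(1) a up_def)
    have bd: "1 \<le> p" "p \<le> m - 1" "1 \<le> q" "q \<le> n - 1" using cell(2) unfolding cell_circle a by auto
    consider "q = 1" "p \<noteq> 2" | "q = n - 1" "p \<noteq> m - 2" | "p = 1" "q \<noteq> n - 2" | "p = m - 1" "q \<noteq> 2"
    proof -
      have "q = 1 \<or> q = n - 1 \<or> p = 1 \<or> p = m - 1" using cell(2) unfolding cell_circle a by auto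
      moreover have "\<not> (p = 2 \<and> q = 1)" "\<not> (p = m - 1 \<and> q = 2)" "\<not> (p = m - 2 \<and> q = n - 1)" "\<not> (p = 1 \<and> q = n - 2)"
        using cell(3) unfolding a by auto
      ultimately show thesis using that by blast
    qed
    then show ?thesis
    proof cases
      case 1
      have "minor a b = (col_minor South p (p + 1) :: (point, 'k) mpoly)"
        by (simp add: a b 1 minor_def col_minor_def)
      then show ?thesis using col_minor_JJ(1)[of p South] 1 bd by simp
    next
      case 2
      have "minor a b = (col_minor North (m - p) (m - p + 1) :: (point, 'k) mpoly)"
      proof -
        have b': "b = (p + 1, n)" by (simp add: b 2)
        show ?thesis
          unfolding a b' 2 minor_col_minor(2) by (rule arg_cong2[where f = "col_minor North"]) simp_all
      qed
      then show ?thesis using col_minor_JJ(1)[of "m - p" North] 2 bd by simp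
    next
      case 3
      have "minor a b = (col_minor West (n - q + 1) (n - q) :: (point, 'k) mpoly)"
      proof -
        have b': "b = (2, q + 1)" by (simp add: b 3)
        show ?thesis
          unfolding a b' 3 minor_col_minor(3) by (rule arg_cong2[where f = "col_minor West"]) simp_all
      qed
      then show ?thesis using col_minor_JJ(2)[of "n - q" West] 3 bd by simp
    next
      case 4
      have "minor a b = (col_minor East (q + 1) q :: (point, 'k) mpoly)"
        by (simp add: a b 4 minor_def col_minor_def mult.commute)
      then show ?thesis using col_minor_JJ(2)[of q East] 4 bd by simp
    qed
  next
    case 2
    show ?thesis unfolding 2 minor_col_minor(1) by (rule c1(1))
  next
    case 3
    show ?thesis unfolding 3 minor_col_minor(4) by (rule c1(2))
  next
    case 4
    show ?thesis unfolding 4 minor_col_minor(2) using c1(1)[of North] by simp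
  next
    case 5
    show ?thesis unfolding 5 minor_col_minor(3) using c1(2)[of West] by simp
  qed
qed

text \<open>Signs arise because in the East and West strips the minor of an interval lists the
  column of larger number first, and because the chain starts with columns 2, 1.\<close>

lemma J_index_minor:
  assumes i: "1 \<le> i" "i \<le> len \<sigma> - 2"
  shows "\<exists>a b. (a, b) \<in> J_intervals m n \<and>
    (minor a b = (cm \<sigma> i (i + 1) :: (point, 'k::field) mpoly) \<or> minor a b = - (cm \<sigma> i (i + 1) :: (point, 'k) mpoly))"
proof (cases "i = 2")
  case True
  have c: "(cm \<sigma> i (i + 1) :: (point, 'k) mpoly) = col_minor \<sigma> 1 3" by (simp add: True chain_def)
  have J: "((1, 1), (3, 2)) \<in> J_intervals m n" "((m - 1, 1), (m, 3)) \<in> J_intervals m n"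
    "((m - 2, n - 1), (m, n)) \<in> J_intervals m n" "((1, n - 2), (2, n)) \<in> J_intervals m n"
    by (auto simp: J_intervals_def)
  show ?thesis
  proof (cases \<sigma>)
    case South
    show ?thesis using J(1) minor_col_minor(1)[of 1 3] unfolding c unfolding South by blast
  next
    case East
    show ?thesis
      using J(2) minor_col_minor(4)[of 1 3] unfolding c unfolding East col_minor_swap[of East 1 3] minus_minus by blast
  next
    case North
    have "minor (m - 2, n - 1) (m, n) = (col_minor North 1 3 :: (point, 'k) mpoly)"
      unfolding minor_col_minor(2) by simp
    then show ?thesis using J(3) unfolding c unfolding North by blast
  next
    case West
    have "minor (1, n - 2) (2, n) = (col_minor West 3 1 :: (point, 'k) mpoly)"
      unfolding minor_col_minor(3) by simp
    then show ?thesis using J(4) unfolding c unfolding West col_minor_swap[of West 1 3] minus_minus by blast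
  qed
next
  case False
  have c: "(cm \<sigma> i (i + 1) :: (point, 'k) mpoly) = col_minor \<sigma> i (i + 1)
      \<or> (cm \<sigma> i (i + 1) :: (point, 'k) mpoly) = - col_minor \<sigma> i (i + 1)"
    using False i col_minor_swap[of \<sigma> 2 1] by (auto simp: chain_def)
  have "\<exists>a b. (a, b) \<in> J_intervals m n \<and>
    (minor a b = (col_minor \<sigma> i (i + 1) :: (point, 'k) mpoly) \<or> minor a b = - (col_minor \<sigma> i (i + 1) :: (point, 'k) mpoly))"
  proof (cases \<sigma>)
    case South
    have "((i, 1), (i + 1, 2)) \<in> J_intervals m n"
      using i False South m4 n4 cell_circle[of "(i, 1)"] by (simp add: J_intervals_def up_def)
    then show ?thesis using minor_col_minor(1)[of i "i + 1"] South by blast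
  next
    case East
    have "((m - 1, i), (m, i + 1)) \<in> J_intervals m n"
      using i False East m4 n4 cell_circle[of "(m - 1, i)"] by (simp add: J_intervals_def up_def)
    then show ?thesis
      using minor_col_minor(4)[of i "i + 1"] unfolding East col_minor_swap[of East "i + 1" i] by blast
  next
    case North
    have "((m - i, n - 1), (m - i + 1, n)) \<in> J_intervals m n"
      using i False North m4 n4 cell_circle[of "(m - i, n - 1)"] by (simp add: J_intervals_def up_def)
    moreover have "minor (m - i, n - 1) (m - i + 1, n) = (col_minor North i (i + 1) :: (point, 'k) mpoly)"
      unfolding minor_col_minor(2) by (simp add: add.commute)
    ultimately show ?thesis using North by blast
  next
    case West
    have "((1, n - i), (2, n - i + 1)) \<in> J_intervals m n"
      using i False West m4 n4 cell_circle[of "(1, n - i)"] by (simp add: J_intervals_def up_def)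
    moreover have "minor (1, n - i) (2, n - i + 1) = (col_minor West (i + 1) i :: (point, 'k) mpoly)"
      unfolding minor_col_minor(3) by (simp add: add.commute)
    ultimately show ?thesis unfolding West col_minor_swap[of West "i + 1" i] by blast
  qed
  with c show ?thesis by force
qed

lemma J_ideal_circle: "J_ideal m n = (JJ :: (point, 'k::field) mpoly set)"
proof -
  let ?G = "{minor a b | a b. (a, b) \<in> J_intervals m n} :: (point, 'k) mpoly set"
  have GJ: "?G \<subseteq> JJ" using J_interval_minor by blast
  then have G: "?G \<subseteq> polys VV" using poly_ideal_carrier[OF rw.BI_ideal] by blast
  note id = genideal_poly_ideal[OF G]
  have "(JJ :: (point, 'k) mpoly set) \<subseteq> Idl\<^bsub>poly_ring VV\<^esub> ?G"
  proof (rule ideal_span_subset[OF id])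
    fix x assume "x \<in> J_index"
    then obtain \<sigma> i where x: "x = (\<sigma>, i)" "1 \<le> i" "i \<le> len \<sigma> - 2" by (cases x) (auto simp: J_index_iff)
    obtain a b where ab: "(a, b) \<in> J_intervals m n"
      "minor a b = (cm \<sigma> i (i + 1) :: (point, 'k) mpoly) \<or> minor a b = - (cm \<sigma> i (i + 1) :: (point, 'k) mpoly)"
      using J_index_minor[OF x(2,3)] by blast
    have "(minor a b :: (point, 'k) mpoly) \<in> Idl\<^bsub>poly_ring VV\<^esub> ?G"
      by (rule genideal_poly_mem[OF G]) (use ab(1) in blast)
    from poly_ideal_up_to_sign[OF id this ab(2)] show "rw.binom x \<in> Idl\<^bsub>poly_ring VV\<^esub> ?G"
      unfolding x(1) rw_binom .
  qed
  moreover have "Idl\<^bsub>poly_ring VV\<^esub> ?G \<subseteq> JJ" by (rule genideal_poly_least[OF rw.BI_ideal GJ])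
  ultimately show ?thesis unfolding J_ideal_def vertices_circle by blast
qed

end

subsection \<open>The monomials generating \<open>K\<close>\<close>

context circle_path
begin

lemma x_monomial_eq:
  "x_monomial m n v = (xpow (corner_mon + sum_list (map (\<lambda>x. single x 1) v)) :: (point, 'k::field) mpoly)"
  by (simp add: x_monomial_def prod_list_var corner_mon_def xpow_add var_eq_xpow mult_ac)

lemma factors_VV: "F \<in> set (factors m n) \<Longrightarrow> F \<subseteq> VV"
  using m4 n4 by (auto simp: factors_def VV_iff)

lemma factors_cover:
  assumes "3 \<le> k" "k \<le> len \<sigma> - 2"
  shows "{pt \<sigma> k 1, pt \<sigma> k 2} \<in> set (factors m n)"
proof (cases \<sigma>)
  case South
  then show ?thesis using assms by (auto simp: factors_def)
next
  case East
  then show ?thesis using assms by (auto simp: factors_def insert_commute)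
next
  case North
  then have "m + 1 - k \<in> {3..m - 2}" using assms by auto
  then show ?thesis using North by (auto simp: factors_def)
next
  case West
  then have "n + 1 - k \<in> {3..n - 2}" using assms by auto
  then show ?thesis using West by (auto simp: factors_def)
qed

lemma listset_factors:
  assumes "v \<in> listset (factors m n)"
  shows "set v \<subseteq> VV" and "\<And>\<sigma> k. 3 \<le> k \<Longrightarrow> k \<le> len \<sigma> - 2 \<Longrightarrow> \<exists>l\<in>{1, 2}. pt \<sigma> k l \<in> set v"
proof -
  have all: "list_all2 (\<in>) v (factors m n)" using assms by (simp add: listset_iff)
  then have len: "length v = length (factors m n)" by (rule list_all2_lengthD)
  have nth: "v ! i \<in> factors m n ! i" if "i < length v" for i
    by (rule list_all2_nthD[OF all that])
  show "set v \<subseteq> VV"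
  proof
    fix x assume "x \<in> set v"
    then obtain i where "i < length v" "x = v ! i" by (auto simp: in_set_conv_nth)
    then show "x \<in> VV" using nth[of i] factors_VV[OF nth_mem, of i] len by auto
  qed
  fix \<sigma> k assume "3 \<le> k" "k \<le> len \<sigma> - 2"
  then obtain i where i: "i < length v" "factors m n ! i = {pt \<sigma> k 1, pt \<sigma> k 2}"
    using factors_cover len by (metis in_set_conv_nth)
  have "v ! i \<in> set v" using i(1) by simp
  then show "\<exists>l\<in>{1, 2}. pt \<sigma> k l \<in> set v"
    using nth[OF i(1)] unfolding i(2) by auto
qed

text \<open>The elements that a fixed monomial multiplies into J form an ideal, so it suffices to
  test column minors. The tuple covers the middle columns and the corner variables do the
  rest.\<close>

lemma x_monomial_times_II:
  assumes v: "v \<in> listset (factors m n)" and a: "a \<in> (II :: (point, 'k::field) mpoly set)"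
  shows "x_monomial m n v * a \<in> JJ"
proof -
  let ?x = "x_monomial m n v :: (point, 'k) mpoly"
  let ?t = "sum_list (map (\<lambda>x. single x 1) v) :: point \<Rightarrow>\<^sub>0 nat"
  have "ideal {a \<in> polys VV. ?x * a \<in> JJ} (poly_ring VV)"
    by (rule poly_idealI)
      (auto simp: polys_closed distrib_left mult.left_commute[of ?x] poly_ideal_closed[OF rw.BI_ideal])
  moreover have "I_minors \<subseteq> {a \<in> polys VV. ?x * a \<in> JJ}"
  proof
    fix y :: "(point, 'k) mpoly" assume "y \<in> I_minors"
    then obtain \<sigma> i j where y: "y = col_minor \<sigma> i j" "1 \<le> i" "i \<le> len \<sigma>" "1 \<le> j" "j \<le> len \<sigma>"
      by (auto simp: I_minors_def)
    have "xpow (corner_mon + ?t) * (col_minor \<sigma> i j :: (point, 'k) mpoly) \<in> JJ"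
      unfolding corner_mon_def
      by (rule covered_times_minor[OF _ _ y(2-5)])
        (use listset_factors[OF v] in \<open>auto simp only: sum_list_singles\<close>)
    then show "y \<in> {a \<in> polys VV. ?x * a \<in> JJ}"
      using col_minor_polys[OF y(2-5)] by (simp add: y(1) x_monomial_eq)
  qed
  ultimately have "II \<subseteq> {a \<in> polys VV. ?x * a \<in> JJ}"
    unfolding II_def by (rule genideal_poly_least)
  with a show ?thesis by blast
qed

text \<open>The tuple behind \<open>sorted_mon z\<close>, in the order of
  \<open>factors\<close>.\<close>

definition sorted_list :: "(side \<Rightarrow> int) \<Rightarrow> point list" where
  "sorted_list z =
     map (\<lambda>j. sorted_choice z (1, j)) [3..n - 2] @ map (\<lambda>j. sorted_choice z (m, j)) [3..n - 2] @
     map (\<lambda>k. sorted_choice z (k, n)) [3..m - 2] @ map (\<lambda>k. sorted_choice z (k, 1)) [3..m - 2]"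

lemma set_sorted_list: "set (sorted_list z) = sorted_choice z ` mids"
  by (auto simp: sorted_list_def mids_def)

lemma sum_sorted_list: "sum_list (map (\<lambda>x. single x 1) (sorted_list z)) = sorted_mon z"
proof -
  let ?F = "\<lambda>x. single (sorted_choice z x) 1 :: point \<Rightarrow>\<^sub>0 nat"
  have "sorted_mon z = sum ?F ({3..m - 2} \<times> {1, n}) + sum ?F ({1, m} \<times> {3..n - 2})"
    unfolding sorted_mon_def mids_def
    by (rule sum.union_disjoint) (use m4 n4 in auto)
  also have "sum ?F ({3..m - 2} \<times> {1, n}) = (\<Sum>k\<in>{3..m - 2}. ?F (k, 1) + ?F (k, n))"
    unfolding sum.cartesian_product' using n4 by simp
  also have "sum ?F ({1, m} \<times> {3..n - 2}) = (\<Sum>k\<in>{3..n - 2}. ?F (1, k)) + (\<Sum>k\<in>{3..n - 2}. ?F (m, k))"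
    unfolding sum.cartesian_product' using m4 by simp
  finally show ?thesis
    by (simp add: sorted_list_def comp_def interv_sum_list_conv_sum_set_int sum.distrib add_ac)
qed

lemma sorted_list_admissible:
  assumes z: "\<And>\<sigma>. 0 \<le> z \<sigma> \<and> z \<sigma> \<le> len \<sigma> - 4"
  shows "sorted_list z \<in> admissible m n"
proof -
  have "sorted_list z \<in> listset (factors m n)"
    unfolding listset_iff sorted_list_def factors_def
    by (intro list_all2_appendI)
      (auto simp: list.rel_map sorted_choice_simps intro!: list.rel_refl_strong split: if_splits)
  moreover have "\<not> inner_interval (circle m n) x y" if xy: "x \<in> set (sorted_list z)" "y \<in> set (sorted_list z)" for x y
  proof
    assume inner: "inner_interval (circle m n) x y"
    obtain a b where ab: "a \<in> mids" "x = sorted_choice z a" "b \<in> mids" "y = sorted_choice z b"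
      using xy unfolding set_sorted_list by blast
    show False
      using ab(1)
    proof (cases rule: mids_cases)
      case a: (South p)
      show ?thesis
        using ab(3) by (cases rule: mids_cases)
          (use a inner m4 n4 in \<open>auto simp: ab(2,4) sorted_choice_simps inner_interval_circle proper_def split: if_splits\<close>)
    next
      case a: (North p)
      show ?thesis
        using ab(3) by (cases rule: mids_cases)
          (use a inner m4 n4 in \<open>auto simp: ab(2,4) sorted_choice_simps inner_interval_circle proper_def split: if_splits\<close>)
    next
      case a: (West p)
      show ?thesis
        using ab(3) by (cases rule: mids_cases)
          (use a inner m4 n4 in \<open>auto simp: ab(2,4) sorted_choice_simps inner_interval_circle proper_def split: if_splits\<close>)
    next
      case a: (East p)
      show ?thesis
        using ab(3) by (cases rule: mids_cases)
          (use a inner m4 n4 in \<open>auto simp: ab(2,4) sorted_choice_simps inner_interval_circle proper_def split: if_splits\<close>)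
    qed
  qed
  ultimately show ?thesis by (simp add: admissible_def)
qed

lemma keys_AA: "v \<in> VV \<Longrightarrow> keys (AA v) \<subseteq> insert (rep v) {(0, side_no \<sigma>) | \<sigma>. depth \<sigma> v = 2}"
proof -
  let ?F = "\<lambda>\<sigma>. if depth \<sigma> v = 2 then single (0, side_no \<sigma>) 1 else 0 :: point \<Rightarrow>\<^sub>0 nat"
  have "keys (\<Sum>\<sigma>\<in>UNIV. ?F \<sigma>) \<subseteq> (\<Union>\<sigma>\<in>UNIV. keys (?F \<sigma>))" by (rule Poly_Mapping.keys_sum)
  also have "\<dots> \<subseteq> {(0, side_no \<sigma>) | \<sigma>. depth \<sigma> v = 2}" by (auto split: if_splits)
  finally show ?thesis by (auto simp: expo_def keys_add_nat)
qed

lemma K_ideal_circle: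
  "(K_ideal m n :: (point, 'k::field) mpoly set) = Idl\<^bsub>poly_ring VV\<^esub> (x_monomial m n ` admissible m n)"
  by (simp add: K_ideal_def vertices_circle)

lemma x_monomials_polys: "x_monomial m n ` admissible m n \<subseteq> (polys VV :: (point, 'k::field) mpoly set)"
proof (rule image_subsetI)
  fix v assume "v \<in> admissible m n"
  then have "set v \<subseteq> VV" using listset_factors(1) by (simp add: admissible_def)
  moreover have "keys corner_mon \<subseteq> VV" using m4 n4 by (auto simp: corner_mon_def keys_add_nat VV_iff)
  ultimately show "(x_monomial m n v :: (point, 'k) mpoly) \<in> polys VV"
    unfolding x_monomial_eq xpow_in_polys keys_add_nat sum_list_singles by simp
qed

theorem colon_circle:
  "{g \<in> polys VV. \<forall>a\<in>II. g * a \<in> JJ} = (JJ <+>\<^bsub>poly_ring VV\<^esub> K_ideal m n :: (point, 'k::field) mpoly set)"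
    (is "?Q = _")
proof
  note K = genideal_poly_ideal[OF x_monomials_polys, folded K_ideal_circle]
  have Q: "ideal ?Q (poly_ring VV)"
    by (rule poly_idealI)
      (auto simp: polys_closed distrib_right mult.assoc poly_ideal_closed[OF rw.BI_ideal])
  have JQ: "JJ \<subseteq> ?Q"
    using poly_ideal_carrier[OF rw.BI_ideal] poly_ideal_mult2[OF rw.BI_ideal poly_ideal_carrier[OF II_ideal]] by blast
  have KQ: "K_ideal m n \<subseteq> ?Q"
    unfolding K_ideal_circle
  proof (rule genideal_poly_least[OF Q], rule image_subsetI)
    fix v assume v: "v \<in> admissible m n"
    then show "(x_monomial m n v :: (point, 'k) mpoly) \<in> ?Q"
      using x_monomial_times_II x_monomials_polys by (auto simp: admissible_def)
  qed
  show "(JJ <+>\<^bsub>poly_ring VV\<^esub> K_ideal m n :: (point, 'k) mpoly set) \<subseteq> ?Q"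
  proof
    fix x :: "(point, 'k) mpoly" assume "x \<in> JJ <+>\<^bsub>poly_ring VV\<^esub> K_ideal m n"
    then obtain a b where "a \<in> JJ" "b \<in> K_ideal m n" "x = a + b" by (auto simp: set_add_def')
    then show "x \<in> ?Q" using poly_ideal_add[OF Q] JQ KQ by blast
  qed
  show "?Q \<subseteq> JJ <+>\<^bsub>poly_ring VV\<^esub> K_ideal m n"
  proof
    fix g assume "g \<in> ?Q"
    then have g: "g \<in> polys VV" "\<And>a. a \<in> II \<Longrightarrow> g * a \<in> JJ" by auto
    let ?U = "keys (mhom {} AA g :: (point, 'k) mpoly)"
    \<comment> \<open>Every degree in the image of \<open>g\<close> is interior, hence the degree of
      a multiple of the monomial of some sorted tuple.\<close>
    have "\<exists>t. (xpow t :: (point, 'k) mpoly) \<in> K_ideal m n \<and> keys t \<subseteq> VV \<and> dmap AA t = u" if u: "u \<in> ?U" for u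
    proof -
      have nz: "lookup (mhom {} AA g) u \<noteq> 0" using u by (simp add: in_keys_iff)
      then obtain s where s: "s \<in> keys g" "dmap AA s = u"
        unfolding lookup_mhom by (auto elim: sum.not_neutral_contains_not_neutral)
      then have sV: "keys s \<subseteq> VV" using g(1) by (auto simp: polys_iff)
      have "keys u \<subseteq> Reps \<union> range (\<lambda>\<sigma>. (0, side_no \<sigma>))"
      proof
        fix x assume "x \<in> keys u"
        then have "x \<in> (\<Union>v\<in>keys s. keys (AA v))" using s(2) keys_dmap[of AA s] by simp
        then obtain v where "v \<in> VV" "x \<in> keys (AA v)" using sV by blast
        then show "x \<in> Reps \<union> range (\<lambda>\<sigma>. (0, side_no \<sigma>))" using keys_AA[of v] by (auto simp: Reps_def)
      qed
      then obtain z \<gamma> where z: "\<And>\<sigma>. 0 \<le> z \<sigma> \<and> z \<sigma> \<le> len \<sigma> - 4" and \<gamma>: "keys \<gamma> \<subseteq> VV"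
        "dmap AA (corner_mon + sorted_mon z + \<gamma>) = u"
        using interior_multiple colon_interior[OF g nz] by metis
      have adm: "sorted_list z \<in> admissible m n" by (rule sorted_list_admissible[OF z])
      have x: "x_monomial m n (sorted_list z) = (xpow (corner_mon + sorted_mon z) :: (point, 'k) mpoly)"
        unfolding x_monomial_eq sum_sorted_list ..
      have xK: "(xpow (corner_mon + sorted_mon z) :: (point, 'k) mpoly) \<in> K_ideal m n"
        unfolding x[symmetric] K_ideal_circle by (rule genideal_poly_mem[OF x_monomials_polys]) (use adm in blast)
      then have "(xpow (corner_mon + sorted_mon z) :: (point, 'k) mpoly) \<in> polys VV" by (rule poly_ideal_carrier[OF K])
      then have "keys (corner_mon + sorted_mon z + \<gamma>) \<subseteq> VV" using \<gamma>(1) by (simp add: keys_add_nat)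
      moreover have "(xpow (corner_mon + sorted_mon z + \<gamma>) :: (point, 'k) mpoly) \<in> K_ideal m n"
        unfolding xpow_add[of "corner_mon + sorted_mon z" \<gamma>]
        by (rule poly_ideal_mult2[OF K _ xK]) (simp add: \<gamma>(1))
      ultimately show ?thesis using \<gamma>(2) by blast
    qed
    then obtain T where T: "\<And>u. u \<in> ?U \<Longrightarrow> (xpow (T u) :: (point, 'k) mpoly) \<in> K_ideal m n"
      "\<And>u. u \<in> ?U \<Longrightarrow> keys (T u) \<subseteq> VV" "\<And>u. u \<in> ?U \<Longrightarrow> dmap AA (T u) = u" by metis
    \<comment> \<open>An element of K with the same image as \<open>g\<close> in the toric ring,
      assembled degree by degree.\<close>
    define h where "h = (\<Sum>u\<in>?U. const (lookup (mhom {} AA g) u) * xpow (T u))"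
    have hK: "h \<in> K_ideal m n"
      unfolding h_def by (rule poly_ideal_sum[OF K], rule poly_ideal_mult[OF K const_in_polys T(1)])
    have "mhom {} AA h = (\<Sum>u\<in>?U. const (lookup (mhom {} AA g) u) * xpow u)"
      unfolding h_def mhom_sum mhom_mult mhom_const mhom_xpow by (rule sum.cong) (simp_all add: T(3))
    also have "\<dots> = mhom {} AA g"
      using poly_as_sum[of ?U "mhom {} AA g"] by (simp add: const_mult_xpow)
    finally have "mhom {} AA (g - h) = (0 :: (point, 'k) mpoly)" by (simp add: mhom_diff)
    moreover have hp: "h \<in> polys VV" by (rule poly_ideal_carrier[OF K hK])
    ultimately have II: "g - h \<in> II"
      unfolding II_eq_toric toric_def using polys_diff[OF g(1) hp] by simp
    have "h \<in> ?Q" using hK KQ by blast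
    \<comment> \<open>The difference lies in I and in the colon ideal at once, so these two
      memberships can be played against each other.\<close>
    then have "(g - h) * (g - h) \<in> JJ"
      using II g(2)[OF II] poly_ideal_diff[OF rw.BI_ideal, of "g * (g - h)" "h * (g - h)"]
      by (simp add: left_diff_distrib)
    then have "g - h \<in> JJ"
      by (rule rw.radical[OF polys_diff[OF g(1) hp]])
    then have "g \<in> (\<Union>a\<in>JJ. \<Union>b\<in>K_ideal m n. {a + b})"
      by (rule UN_I) (rule UN_I[OF hK], simp)
    then show "g \<in> JJ <+>\<^bsub>poly_ring VV\<^esub> K_ideal m n" by (simp add: set_add_def')
  qed
qed

end

subsection \<open>Dimension and conclusion\<close>

text \<open>Applied to initial segments of the generators: \<open>nonzerodivisor\<close> for each
  segment is what makes the sequence regular.\<close>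

lemma (in coprime_binomials) subset_coprime_binomials:
  "B \<subseteq> A \<Longrightarrow> coprime_binomials V B m r w"
  by (intro coprime_binomials.intro finite_subset[OF _ finA] m_V r_V coprime squarefree weight) (erule (1) subsetD | assumption)+

lemma ideal_span_cong_image:
  assumes "finite A" "finite B" "f ` A = g ` B"
    and "\<And>i. i \<in> A \<Longrightarrow> f i \<in> polys V" "\<And>i. i \<in> B \<Longrightarrow> g i \<in> polys V"
  shows "ideal_span V f A = (ideal_span V g B :: ('v, 'k::comm_ring_1) mpoly set)"
  using genideal_eq_ideal_span[of A f V] genideal_eq_ideal_span[of B g V] assms by simp

context circle_path
begin

lemma card_Reps: "int (card Reps) = 2 * (m + n) - 12"
proof -
  have "finite corners_set" "finite mids" using finite_Reps unfolding Reps_eq by simp_all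
  then have "card Reps = card corners_set + card mids"
    unfolding Reps_eq by (rule card_Un_disjoint) (rule corners_mids_disjoint)
  also have "card mids = card ({3..m - 2} \<times> {1, n}) + card ({1, m} \<times> {3..n - 2})"
    unfolding mids_def by (rule card_Un_disjoint) (use m4 n4 in auto)
  finally show ?thesis
    using m4 n4 by (simp add: corners_set_def card_cartesian_product card_insert_if)
qed

text \<open>The dimension of K[P] will be \<open>card J_index\<close>, so its codimension is the
  same number, which is the length of the regular sequence.\<close>

lemma card_VV: "card VV = 2 * card J_index"
proof -
  have VV: "VV = {1..m} \<times> {1..n} - {3..m - 2} \<times> {3..n - 2}"
    by (auto simp: VV_iff)
  have outer: "int (card ({1..m} \<times> {1..n})) = m * n"
    and inner: "int (card ({3..m - 2} \<times> {3..n - 2})) = (m - 4) * (n - 4)"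
    using m4 n4 by (simp_all add: card_cartesian_product)
  have "int (card VV) = int (card ({1..m} \<times> {1..n})) - int (card ({3..m - 2} \<times> {3..n - 2}))"
  proof -
    have sub: "{3..m - 2} \<times> {3..n - 2} \<subseteq> {1..m} \<times> {1..n}" by auto
    have "card VV = card ({1..m} \<times> {1..n}) - card ({3..m - 2} \<times> {3..n - 2})"
      unfolding VV by (rule card_Diff_subset) (use sub in simp_all)
    then show ?thesis using card_mono[OF _ sub] by (simp only: of_nat_diff finite_cartesian_product finite_atLeastAtMost_int)
  qed
  also have "\<dots> = m * n - (m - 4) * (n - 4)" unfolding outer inner ..
  also have "\<dots> = 2 * int (card J_index)" unfolding card_J_index by (simp add: algebra_simps)
  finally show ?thesis by simp
qed

lemma krull_dim_circle:
  "krull_dim (poly_ring VV Quot (II :: (point, 'k::field) mpoly set)) = enat (card J_index)"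
proof -
  obtain h where h: "bij_betw h {..<card Reps} Reps"
    using ex_bij_betw_nat_finite[OF finite_Reps] by (auto simp: atLeast0LessThan)
  \<comment> \<open>The four ratios come first, then the blocks. This order is triangular: an
    outermost vertex involves its block only, while a ratio always comes together with a
    block.\<close>
  define \<pi> :: "nat \<Rightarrow> point" where "\<pi> i = (if i < 4 then (0, int i) else h (i - 4))" for i
  have d: "card J_index = 4 + card Reps" using card_J_index card_Reps by simp
  have hR: "h i \<in> Reps" if "i < card Reps" for i using h that by (auto simp: bij_betw_def)
  have \<pi>_block: "x \<in> \<pi> ` {4..<card J_index}" if x: "x \<in> Reps" for x
  proof -
    obtain i where "i < card Reps" "x = h i" using h x by (auto simp: bij_betw_def)
    then show ?thesis by (intro image_eqI[of _ _ "i + 4"]) (simp_all add: \<pi>_def d)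
  qed
  have \<pi>_ratio: "(0, side_no \<sigma>) = \<pi> (nat (side_no \<sigma>)) \<and> nat (side_no \<sigma>) < 4" for \<sigma>
    by (cases \<sigma>) (simp_all add: \<pi>_def)
  have "krull_dim (poly_ring VV Quot (toric VV {} AA :: (point, 'k) mpoly set)) = enat (card J_index)"
  proof (rule krull_dim_toric)
    fix v assume v: "v \<in> VV"
    then have "rep v \<in> \<pi> ` {..<card J_index}" using \<pi>_block[of "rep v"] by (auto simp: Reps_def)
    moreover have "(0, side_no \<sigma>) \<in> \<pi> ` {..<card J_index}" for \<sigma>
      using \<pi>_ratio[of \<sigma>] d by (intro image_eqI[of _ _ "nat (side_no \<sigma>)"]) auto
    ultimately show "keys (AA v) \<subseteq> \<pi> ` {..<card J_index}" using keys_AA[OF v] by blast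
  next
    show "inj_on \<pi> {..<card J_index}"
    proof (rule inj_onI)
      fix i j assume ij: "i \<in> {..<card J_index}" "j \<in> {..<card J_index}" "\<pi> i = \<pi> j"
      have ge: "1 \<le> fst (h k)" if "k < card Reps" for k using hR[OF that] by (rule Reps_ge_1)
      consider "i < 4" "j < 4" | "4 \<le> i" "4 \<le> j" | "i < 4" "4 \<le> j" | "4 \<le> i" "j < 4" by linarith
      then show "i = j"
      proof cases
        case 2
        then have "h (i - 4) = h (j - 4)" "i - 4 < card Reps" "j - 4 < card Reps"
          using ij d by (auto simp: \<pi>_def)
        then have "i - 4 = j - 4" using h by (auto simp: bij_betw_def inj_on_def)
        with 2 show ?thesis by simp
      next
        case 3
        then have "fst (h (j - 4)) = 0" using arg_cong[OF ij(3), of fst] by (simp add: \<pi>_def)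
        moreover have "j - 4 < card Reps" using ij(2) d 3 by auto
        ultimately show ?thesis using ge[of "j - 4"] by simp
      next
        case 4
        then have "fst (h (i - 4)) = 0" using arg_cong[OF ij(3), of fst] by (simp add: \<pi>_def)
        moreover have "i - 4 < card Reps" using ij(1) d 4 by auto
        ultimately show ?thesis using ge[of "i - 4"] by simp
      qed (use ij in \<open>simp add: \<pi>_def\<close>)
    qed
  next
    fix i assume i: "i < card J_index"
    show "\<exists>v\<in>VV. \<pi> i \<in> keys (AA v) \<and> keys (AA v) \<subseteq> \<pi> ` {i..<card J_index}"
    proof (cases "i < 4")
      case True
      have "\<exists>\<sigma>. nat (side_no \<sigma>) = i"
      proof -
        from True consider "i = 0" | "i = 1" | "i = 2" | "i = 3" by linarith
        then show ?thesis
        proof cases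
          case 1 then show ?thesis by (intro exI[of _ South]) simp
        next
          case 2 then show ?thesis by (intro exI[of _ East]) simp
        next
          case 3 then show ?thesis by (intro exI[of _ North]) simp
        next
          case 4 then show ?thesis by (intro exI[of _ West]) simp
        qed
      qed
      then obtain \<sigma> where \<sigma>: "nat (side_no \<sigma>) = i" by blast
      \<comment> \<open>This vertex is inner for \<open>\<sigma>\<close> but outer for the preceding
        side, so no second ratio enters.\<close>
      let ?v = "pt \<sigma> 1 2"
      have v: "?v \<in> VV" using len_ge_4[of \<sigma>] by (intro pt_VV) auto
      have only: "depth \<tau> ?v = 2 \<Longrightarrow> \<tau> = \<sigma>" for \<tau>
        using m4 n4 by (cases \<sigma>; cases \<tau>) auto
      have "\<pi> i \<in> keys (AA ?v)"
        using lookup_AA_ratio[OF v, of \<sigma>] \<pi>_ratio[of \<sigma>] \<sigma> by (simp add: in_keys_iff)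
      moreover have "keys (AA ?v) \<subseteq> \<pi> ` {i..<card J_index}"
      proof
        fix x assume "x \<in> keys (AA ?v)"
        then have "x = rep ?v \<or> x = (0, side_no \<sigma>)" using keys_AA[OF v] only by blast
        then show "x \<in> \<pi> ` {i..<card J_index}"
        proof
          assume "x = rep ?v"
          then have "x \<in> \<pi> ` {4..<card J_index}" using \<pi>_block v by (simp add: Reps_def)
          then show ?thesis using True by auto
        next
          assume "x = (0, side_no \<sigma>)"
          then have "x = \<pi> i" using \<pi>_ratio[of \<sigma>] \<sigma> by simp
          then show ?thesis using i by auto
        qed
      qed
      ultimately show ?thesis using v by blast
    next
      case False
      then have x: "\<pi> i \<in> Reps" using hR[of "i - 4"] i d by (simp add: \<pi>_def)
      then have v: "\<pi> i \<in> VV" "rep (\<pi> i) = \<pi> i" by (simp_all add: Reps_iff)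
      have "depth \<sigma> (\<pi> i) \<noteq> 2" for \<sigma> using depth_rep_2[of \<sigma> "\<pi> i"] v(2) by simp
      then have "keys (AA (\<pi> i)) \<subseteq> {\<pi> i}" using keys_AA[OF v(1)] v(2) by auto
      moreover have "\<pi> i \<in> keys (AA (\<pi> i))"
        using lookup_AA_block[OF Reps_ge_1[OF x], of "\<pi> i"] v(2) by (simp add: in_keys_iff)
      ultimately show ?thesis using v(1) i by (intro bexI[of _ "\<pi> i"]) auto
    qed
  qed
  then show ?thesis by (simp only: II_eq_toric)
qed

lemma canonical_module_circle:
  "isomorphic_modules (poly_ring VV) (canonical_module VV (II :: (point, 'k::field) mpoly set))
    (quotient_module ((ring_module (poly_ring VV))\<lparr>carrier := JJ <+>\<^bsub>poly_ring VV\<^esub> K_ideal m n\<rparr>) JJ)"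
proof -
  let ?d = "card J_index"
  \<comment> \<open>Any enumeration gives a regular sequence, since coprimality does not depend on
    the order.\<close>
  obtain h where h: "bij_betw h {..<?d} J_index"
    using ex_bij_betw_nat_finite[OF finite_J_index] by (auto simp: atLeast0LessThan)
  define f :: "nat \<Rightarrow> (point, 'k) mpoly" where "f i = rw.binom (h i)" for i
  have hJ: "h i \<in> J_index" if "i < ?d" for i using h that by (auto simp: bij_betw_def)
  have fp: "f i \<in> polys VV" if "i < ?d" for i unfolding f_def by (rule rw.binom_polys[OF hJ[OF that]])
  have span: "ideal_span VV f {..<r} = ideal_span VV rw.binom (h ` {..<r})" if "r \<le> ?d" for r
    by (rule ideal_span_cong_image) (use that hJ fp rw.binom_polys in \<open>auto simp: f_def image_image\<close>)
  have all: "ideal_span VV f {..<?d} = JJ"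
    using span[of ?d] h by (simp add: bij_betw_def)
  have f_in: "f i \<in> II" if "i < ?d" for i
    using JJ_subset_II ideal_span_mem[OF finite_J_index hJ[OF that]] unfolding f_def by blast
  have regular: "g \<in> ideal_span VV f {..<r}"
    if r: "r < ?d" and g: "g \<in> polys VV" "f r * g \<in> ideal_span VV f {..<r}" for r g
  proof -
    have sub: "h ` {..<r} \<subseteq> J_index" using hJ r by auto
    interpret B: coprime_binomials VV "h ` {..<r}" lead_mon tail_mon weight
      by (rule rw.subset_coprime_binomials[OF sub])
    have new: "h i \<noteq> h r" if "i < r" for i
      using h that r by (auto simp: bij_betw_def inj_on_def)
    have "g \<in> B.BI"
    proof (rule B.nonzerodivisor)
      show "keys (lead_mon (h r)) \<subseteq> VV" "keys (tail_mon (h r)) \<subseteq> VV"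
        using rw.m_V[OF hJ[OF r]] rw.r_V[OF hJ[OF r]] .
      show "wdeg weight (tail_mon (h r)) < wdeg weight (lead_mon (h r))" by (rule rw.weight[OF hJ[OF r]])
      show "keys (lead_mon i) \<inter> keys (lead_mon (h r)) = {}" if "i \<in> h ` {..<r}" for i
        by (rule rw.coprime) (use that new sub hJ[OF r] in auto)
      show "(xpow (lead_mon (h r)) - xpow (tail_mon (h r))) * g \<in> B.BI"
        using g(2) span[of r] r by (simp add: f_def rw.binom_def)
    qed (rule g(1))
    then show ?thesis using span[of r] r by simp
  qed
  have pos: "0 < ?d" using card_J_index m4 n4 by simp
  have codim: "card VV - the_enat (krull_dim (poly_ring VV Quot (II :: (point, 'k) mpoly set))) = ?d"
    by (simp add: krull_dim_circle card_VV)
  have "isomorphic_modules (poly_ring VV)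
    (Ext (poly_ring VV) ?d (quotient_module (ring_module (poly_ring VV)) II) (ring_module (poly_ring VV)))
    (quotient_module ((ring_module (poly_ring VV))\<lparr>carrier :=
       {g \<in> polys VV. \<forall>a\<in>II. g * a \<in> ideal_span VV f {..<?d}}\<rparr>) (ideal_span VV f {..<?d}))"
    by (rule Ext_regular_sequence[OF finite_VV II_ideal f_in regular pos])
  then show ?thesis
    unfolding all colon_circle canonical_module_def codim Let_def .
qed

end

theorem theorem5p4:
  fixes m n :: int
  assumes "4 \<le> m" and "4 \<le> n" and "(m, n) \<noteq> (4, 4)"
  shows "let P = circle m n;
             S = (poly_ring (vertices P) :: (point, 'k::field) mpoly ring);
             J = J_ideal m n;
             K = K_ideal m n
         in isomorphic_modules S
              (canonical_module (vertices P) (polyomino_ideal P))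
              (quotient_module ((ring_module S)\<lparr>carrier := J <+>\<^bsub>S\<^esub> K\<rparr>) J)"
proof -
  interpret circle_path m n
    using assms by unfold_locales
  show ?thesis
    unfolding Let_def vertices_circle polyomino_ideal_circle J_ideal_circle
    by (rule canonical_module_circle)
qed

end
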